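(* Let $\gamma\in\mathfrak{gl}_3(\mathfrak{o})$ with $\chi_\gamma(x)=x^3+c_1x^2+c_2x+c_3$ irreducible and separable over $F$ and $\overline{\chi}_\gamma(x)=x^3$. Let $L=\mathfrak{o}^3$ and let $k_1,k_2$ be integers with $1\le k_1\le k_2$ and $k_1+k_2=d:=\mathrm{ord}(c_3)$. Put $t=\lceil d/3\rceil$, $s=\lfloor d/3\rfloor$. Then: - (Case 1) if $k_1<k_2$ and $k_1<t$: $c_{(k_1,k_2)}\cdot\mathcal{SO}_{\gamma,(k_1,k_2)}=(q^{3}-1)(q^{2}-1)q^{k_{2}}\cdot \frac{(k_1+1)q-(k_1-1)}{q^{6+d}}$; - (Case 2) if $k_1<k_2$ and $k_1>s$: $c_{(k_1,k_2)}\cdot\mathcal{SO}_{\gamma,(k_1,k_2)}=(q^{3}-1)(q^{2}-1)q^{k_{2}}\cdot \frac{(k_2-k_1+1)q-(k_2-k_1-1)}{q^{6+d}}$; - (Case 3) if $k_1=k_2$: $c_{(k_1,k_2)}\cdot\mathcal{SO}_{\gamma,(k_1,k_2)}=\frac{(q^{3}-1)(q^{2}-1)}{q^{5+d}}\cdot q^{k_{1}}$; - (Case 4) if $k_1=t$, $d=3t$ and the reduction mod $\pi$ of $\chi_\gamma(\pi^tx)/\pi^{3t}$ is irreducible over $\kappa$: $c_{(k_1,k_2)}\cdot\mathcal{SO}_{\gamma,(k_1,k_2)}=(q^{3}-1)(q^{2}-1)q^{k_{2}}\cdot \frac{(t+1)q-(t-1)}{q^{6+d}}$.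
   Context: $F$ non-Archimedean local field, $\mathfrak{o}$ its ring of integers, $\pi$ a uniformizer, $\kappa$ the residue field, $q=\#\kappa$, $\mathrm{ord}$ the valuation; bars denote reduction mod $\pi$. For $X\in\mathfrak{gl}_n(\mathfrak{o})$, $\chi_X$ is its characteristic polynomial. Let $\varphi_n:\mathfrak{gl}_{n,\mathfrak{o}}\to\mathbb{A}^n_{\mathfrak{o}}$ send a matrix to the coefficients of its characteristic polynomial, $\rho_n$ its generic fiber; $\omega_{\mathfrak{gl}},\omega_{\mathbb{A}}$ translation-invariant top forms on $\mathfrak{gl}_{n,F}$, $\mathbb{A}^n_F$ giving $\mathfrak{gl}_n(\mathfrak{o})$, $\mathbb{A}^n(\mathfrak{o})$ volume 1; $\omega^{\mathrm{ld}}_{\chi_\gamma}=\omega_{\mathfrak{gl}}/\rho_n^*\omega_{\mathbb{A}}$ the quotient form on the smooth fiber $\rho_n^{-1}(\chi_\gamma)$. A sublattice $M\subset L=\mathfrak{o}^n$ of rank $n$ has type $(k_1,\dots,k_{n-m})$ ($1\le k_1\le\dots\le k_{n-m}$) if $L/M\cong\bigoplus_i\mathfrak{o}/\pi^{k_i}\mathfrak{o}$. For such $M$ let $O_{\gamma,M}=\{X\in\mathfrak{gl}_n(\mathfrak{o})=\mathrm{End}_{\mathfrak{o}}(L):\chi_X=\chi_\gamma,\ X(L)=M\}$; its volume $\int_{O_{\gamma,M}}|\omega^{\mathrm{ld}}_{\chi_\gamma}|$ depends only on the type of $M$ and is denoted $\mathcal{SO}_{\gamma,(k_1,\dots,k_{n-m})}$.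 $c_{(k_1,\dots,k_{n-m})}$ denotes the number of sublattices of $L$ of that type. *)

theory Defs
  imports "HOL-Analysis.Analysis" "HOL-Computational_Algebra.Computational_Algebra"
begin

section \<open>Non-Archimedean local fields\<close>

text \<open>The value \<open>ord 0\<close> is unspecified; it stands for infinity and is never used.\<close>

class discrete_valued_field = field +
  fixes ord :: "'a \<Rightarrow> int"
  assumes ord_mult: "x \<noteq> 0 \<Longrightarrow> y \<noteq> 0 \<Longrightarrow> ord (x * y) = ord x + ord y"
    and ord_add: "x \<noteq> 0 \<Longrightarrow> y \<noteq> 0 \<Longrightarrow> x + y \<noteq> 0 \<Longrightarrow> min (ord x) (ord y) \<le> ord (x + y)"
    and ord_surj: "\<exists>x. x \<noteq> 0 \<and> ord x = 1"

definition uniformizer :: "'a::discrete_valued_field \<Rightarrow> bool" where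
  "uniformizer p \<longleftrightarrow> p \<noteq> 0 \<and> ord p = 1"

text \<open>The ideal \<open>\<pi>\<^sup>k \<oo>\<close>; in particular \<open>ideal_pow 0\<close> is the ring of integers \<open>\<oo>\<close>.\<close>

definition ideal_pow :: "nat \<Rightarrow> 'a::discrete_valued_field set" where
  "ideal_pow k = {x. x = 0 \<or> int k \<le> ord x}"

abbreviation integers :: "'a::discrete_valued_field set" where
  "integers \<equiv> ideal_pow 0"

lemma ord_one [simp]: "ord (1 :: 'a::discrete_valued_field) = 0"
  using ord_mult[of "1::'a" 1] by simp

lemma ord_uminus [simp]: "ord (- x) = ord (x :: 'a::discrete_valued_field)"
proof (cases "x = 0")
  case False
  have "ord (-1::'a) + ord (-1::'a) = 0"
    using ord_mult[of "-1::'a" "-1"] by simp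
  then have "ord (-1::'a) = 0" by simp
  then show ?thesis
    using ord_mult[of "-1::'a" x] False by simp
qed simp

lemma ord_inverse: "x \<noteq> 0 \<Longrightarrow> ord (inverse x) = - ord (x :: 'a::discrete_valued_field)"
  using ord_mult[of x "inverse x"] by simp

lemma zero_in_ideal_pow [simp]: "0 \<in> ideal_pow k"
  by (simp add: ideal_pow_def)

lemma one_in_integers [simp]: "1 \<in> integers"
  by (simp add: ideal_pow_def)

lemma one_notin_ideal_pow_1 [simp]: "1 \<notin> ideal_pow (Suc 0)"
  by (simp add: ideal_pow_def)

lemma ideal_pow_add: "x \<in> ideal_pow k \<Longrightarrow> y \<in> ideal_pow k \<Longrightarrow> x + y \<in> ideal_pow k"
  using ord_add[of x y] by (cases "x = 0"; cases "y = 0"; cases "x + y = 0") (auto simp: ideal_pow_def)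

lemma ideal_pow_uminus [simp]: "- x \<in> ideal_pow k \<longleftrightarrow> x \<in> ideal_pow k"
  by (simp add: ideal_pow_def)

lemma ideal_pow_diff: "x \<in> ideal_pow k \<Longrightarrow> y \<in> ideal_pow k \<Longrightarrow> x - y \<in> ideal_pow k"
  using ideal_pow_add[of x k "- y"] by simp

lemma ideal_pow_mult: "x \<in> ideal_pow j \<Longrightarrow> y \<in> ideal_pow k \<Longrightarrow> x * y \<in> ideal_pow (j + k)"
  by (cases "x = 0 \<or> y = 0") (auto simp: ideal_pow_def ord_mult)

lemmas integers_mult = ideal_pow_mult[of _ 0 _ 0, simplified]

text \<open>The residue field \<open>\<kappa> = \<oo>/\<pi>\<oo>\<close>.\<close>

definition residue_eq :: "'a::discrete_valued_field \<Rightarrow> 'a \<Rightarrow> bool" where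
  "residue_eq x y \<longleftrightarrow> x \<in> integers \<and> y \<in> integers \<and> x - y \<in> ideal_pow 1"

quotient_type (overloaded) 'a residue = "'a::discrete_valued_field" / partial: residue_eq
proof (rule part_equivpI)
  show "\<exists>x::'a. residue_eq x x" by (rule exI[of _ 0]) (simp add: residue_eq_def)
  show "symp (residue_eq :: 'a \<Rightarrow> 'a \<Rightarrow> bool)"
    by (rule sympI) (metis residue_eq_def ideal_pow_uminus minus_diff_eq)
  show "transp (residue_eq :: 'a \<Rightarrow> 'a \<Rightarrow> bool)"
  proof (rule transpI)
    fix x y z :: 'a
    assume "residue_eq x y" "residue_eq y z"
    then show "residue_eq x z"
      using ideal_pow_add[of "x - y" 1 "y - z"] by (simp add: residue_eq_def)
  qed
qed

lemma integers_inverse: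
  assumes "x \<in> integers" "x \<notin> ideal_pow 1"
  shows "x \<noteq> 0" "ord x = 0" "inverse x \<in> integers" "inverse x \<notin> ideal_pow 1"
proof -
  show x: "x \<noteq> 0" "ord x = 0" using assms by (auto simp: ideal_pow_def)
  then show "inverse x \<in> integers" "inverse x \<notin> ideal_pow 1"
    by (auto simp: ideal_pow_def ord_inverse)
qed

instantiation residue :: (discrete_valued_field) field
begin

lift_definition zero_residue :: "'a residue" is 0 by (simp add: residue_eq_def)
lift_definition one_residue :: "'a residue" is 1 by (simp add: residue_eq_def)

lift_definition plus_residue :: "'a residue \<Rightarrow> 'a residue \<Rightarrow> 'a residue" is "(+)"
proof -
  fix x x' y y' :: 'a
  assume a: "residue_eq x x'" "residue_eq y y'"
  have "x + y - (x' + y') = (x - x') + (y - y')" by (rule add_diff_add)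
  then show "residue_eq (x + y) (x' + y')"
    using a by (metis residue_eq_def ideal_pow_add)
qed

lift_definition minus_residue :: "'a residue \<Rightarrow> 'a residue \<Rightarrow> 'a residue" is "(-)"
proof -
  fix x x' y y' :: 'a
  assume a: "residue_eq x x'" "residue_eq y y'"
  have "x - y - (x' - y') = (x - x') - (y - y')" by (simp add: algebra_simps)
  then show "residue_eq (x - y) (x' - y')"
    using a by (metis residue_eq_def ideal_pow_diff)
qed

lift_definition uminus_residue :: "'a residue \<Rightarrow> 'a residue" is uminus
proof -
  fix x x' :: 'a
  assume a: "residue_eq x x'"
  have "- x - - x' = - (x - x')" by simp
  then show "residue_eq (- x) (- x')"
    using a by (simp only: residue_eq_def ideal_pow_uminus)
qed

lift_definition times_residue :: "'a residue \<Rightarrow> 'a residue \<Rightarrow> 'a residue" is "(*)"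
proof -
  fix x x' y y' :: 'a
  assume a: "residue_eq x x'" "residue_eq y y'"
  have "x * y - x' * y' = x * (y - y') + y' * (x - x')" by (simp add: algebra_simps)
  moreover have "x * (y - y') \<in> ideal_pow 1" "y' * (x - x') \<in> ideal_pow 1"
    using a ideal_pow_mult[of _ 0 _ 1] by (auto simp: residue_eq_def)
  ultimately show "residue_eq (x * y) (x' * y')"
    using a by (simp add: residue_eq_def integers_mult ideal_pow_add)
qed

lift_definition inverse_residue :: "'a residue \<Rightarrow> 'a residue" is
  "\<lambda>x. if x \<in> ideal_pow 1 then 0 else inverse x"
proof -
  fix x y :: 'a
  assume a: "residue_eq x y"
  have iff: "x \<in> ideal_pow 1 \<longleftrightarrow> y \<in> ideal_pow 1"
    using a ideal_pow_add[of "x - y" 1 y] ideal_pow_diff[of x 1 "x - y"]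
    by (auto simp: residue_eq_def)
  show "residue_eq (if x \<in> ideal_pow 1 then 0 else inverse x)
          (if y \<in> ideal_pow 1 then 0 else inverse y)"
  proof (cases "x \<in> ideal_pow 1")
    case False
    then have nx: "x \<in> integers" "x \<notin> ideal_pow 1" and ny: "y \<in> integers" "y \<notin> ideal_pow 1"
      using a iff by (auto simp: residue_eq_def)
    note ix = integers_inverse[OF nx] and iy = integers_inverse[OF ny]
    have "inverse x - inverse y = - ((inverse x * inverse y) * (x - y))"
      using ix(1) iy(1) by (simp add: field_simps)
    moreover have "(inverse x * inverse y) * (x - y) \<in> ideal_pow (0 + 1)"
      using a ix iy by (intro ideal_pow_mult integers_mult) (auto simp: residue_eq_def)
    ultimately have "inverse x - inverse y \<in> ideal_pow 1" by simp
    then show ?thesis using False iff ix iy by (simp add: residue_eq_def)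
  next
    case True
    then show ?thesis using iff by (simp add: residue_eq_def)
  qed
qed

definition divide_residue :: "'a residue \<Rightarrow> 'a residue \<Rightarrow> 'a residue" where
  "divide_residue x y = x * inverse y"

instance
proof
  fix a b c :: "'a residue"
  show "a * b * c = a * (b * c)"
    by transfer (simp add: residue_eq_def integers_mult mult.assoc)
  show "a * b = b * a"
    by transfer (simp add: residue_eq_def integers_mult mult.commute)
  show "1 * a = a" by transfer (simp add: residue_eq_def)
  show "a + b + c = a + (b + c)"
    by transfer (simp add: residue_eq_def ideal_pow_add add.assoc)
  show "a + b = b + a" by transfer (simp add: residue_eq_def ideal_pow_add add.commute)
  show "0 + a = a" by transfer (simp add: residue_eq_def)
  show "- a + a = 0" by transfer (simp add: residue_eq_def)
  show "a - b = a + - b" by transfer (simp add: residue_eq_def ideal_pow_diff)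
  show "(a + b) * c = a * c + b * c"
    by transfer (simp add: residue_eq_def ideal_pow_add integers_mult distrib_right)
  show "(0::'a residue) \<noteq> 1" by transfer (simp add: residue_eq_def)
  show "a \<noteq> 0 \<Longrightarrow> inverse a * a = 1"
    by transfer (auto simp: residue_eq_def integers_inverse)
  show "a div b = a * inverse b" by (simp add: divide_residue_def)
  show "inverse (0::'a residue) = 0" by transfer (simp add: residue_eq_def)
qed

end

text \<open>Reduction modulo \<open>\<pi>\<close>; meaningful on integers only.\<close>

definition reduce :: "'a::discrete_valued_field \<Rightarrow> 'a residue" where
  "reduce x = abs_residue x"

definition reduce_poly :: "'a::discrete_valued_field poly \<Rightarrow> 'a residue poly" where
  "reduce_poly = map_poly reduce"

text \<open>The metric is the one given by the absolute value \<open>q\<close> to the power \<open>- ord x\<close>. There is no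
  restriction on the characteristic.\<close>

class nonarch_local_field = discrete_valued_field + complete_space +
  assumes finite_residue: "finite (UNIV :: 'a residue set)"
    and dist_ord: "dist x y = (if x = y then 0 else real CARD('a residue) powi (- ord (x - y)))"

definition absval :: "'a::nonarch_local_field \<Rightarrow> real" where
  "absval x = dist x 0"


section \<open>Lattices and their types\<close>

definition std_lattice :: "('a::discrete_valued_field ^ 'n) set" where
  "std_lattice = {x. \<forall>i. x $ i \<in> integers}"

definition o_submodule :: "('a::discrete_valued_field ^ 'n) set \<Rightarrow> bool" where
  "o_submodule M \<longleftrightarrow> 0 \<in> M \<and> (\<forall>x\<in>M. \<forall>y\<in>M. x + y \<in> M) \<and> (\<forall>a\<in>integers. \<forall>x\<in>M. a *s x \<in> M)"

definition full_sublattice :: "('a::discrete_valued_field ^ 'n) set \<Rightarrow> bool" where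
  "full_sublattice M \<longleftrightarrow> o_submodule M \<and> M \<subseteq> std_lattice \<and> vec.span M = UNIV"

definition coset :: "'b::plus \<Rightarrow> 'b set \<Rightarrow> 'b set" where
  "coset x M = (\<lambda>m. x + m) ` M"

text \<open>\<open>M\<close> has type \<open>ks\<close> if \<open>ks\<close> is an increasing list of positive integers and \<open>L/M\<close> is isomorphic
  as an \<open>\<oo>\<close>-module to the direct sum of the \<open>\<oo>/\<pi>\<^sup>k\<oo>\<close> for \<open>k\<close> in \<open>ks\<close>. The elements of both modules
  are cosets, resp. tuples of cosets: addition is addition of sets, and the product
  of \<open>a\<close> with the coset \<open>C\<close> of \<open>\<pi>\<^sup>k\<oo>\<close> is \<open>a C + \<pi>\<^sup>k\<oo>\<close>.\<close>

definition quotient_iso ::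
  "nat list \<Rightarrow> ('a::discrete_valued_field ^ 'n) set \<Rightarrow> (('a ^ 'n) set \<Rightarrow> nat \<Rightarrow> 'a set) \<Rightarrow> bool" where
  "quotient_iso ks M \<Phi> \<longleftrightarrow>
     bij_betw \<Phi> ((\<lambda>x. coset x M) ` std_lattice)
       (\<Pi>\<^sub>E i\<in>{..<length ks}. (\<lambda>a. coset a (ideal_pow (ks ! i))) ` integers) \<and>
     (\<forall>x\<in>std_lattice. \<forall>y\<in>std_lattice. \<forall>i<length ks.
        \<Phi> (coset (x + y) M) i = {u + v | u v. u \<in> \<Phi> (coset x M) i \<and> v \<in> \<Phi> (coset y M) i}) \<and>
     (\<forall>a\<in>integers. \<forall>x\<in>std_lattice. \<forall>i<length ks.
        \<Phi> (coset (a *s x) M) i =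
          {a * u + z | u z. u \<in> \<Phi> (coset x M) i \<and> z \<in> ideal_pow (ks ! i)})"

definition has_type :: "('a::discrete_valued_field ^ 'n) set \<Rightarrow> nat list \<Rightarrow> bool" where
  "has_type M ks \<longleftrightarrow>
     full_sublattice M \<and> sorted ks \<and> (\<forall>k\<in>set ks. 1 \<le> k) \<and> (\<exists>\<Phi>. quotient_iso ks M \<Phi>)"

definition num_sublattices :: "'a::discrete_valued_field itself \<Rightarrow> 'n::finite itself \<Rightarrow> nat list \<Rightarrow> nat" where
  "num_sublattices TYPE('a) TYPE('n) ks = card {M :: ('a ^ 'n) set. has_type M ks}"


section \<open>Characteristic polynomials\<close>

definition charpoly :: "'a::comm_ring_1 ^ 'n ^ 'n \<Rightarrow> 'a poly" where
  "charpoly A = det (\<chi> i j. (if i = j then [:0, 1:] else 0) - [:A $ i $ j:])"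

definition separable :: "'a::field poly \<Rightarrow> bool" where
  "separable p \<longleftrightarrow> coprime p (pderiv p)"

definition integral_matrices :: "('a::discrete_valued_field ^ 'n ^ 'm) set" where
  "integral_matrices = {X. \<forall>i j. X $ i $ j \<in> integers}"

text \<open>The morphism from \<open>3 \<times> 3\<close> matrices to affine space given by the coefficients
  \<open>(c\<^sub>1, c\<^sub>2, c\<^sub>3)\<close> of the characteristic polynomial.\<close>

definition rho :: "'a::comm_ring_1 ^ 3 ^ 3 \<Rightarrow> 'a ^ 3" where
  "rho X = vector [coeff (charpoly X) 2, coeff (charpoly X) 1, coeff (charpoly X) 0]"

text \<open>The differential of \<open>rho\<close> at \<open>X\<close> in the direction \<open>Y\<close>: the coefficient of \<open>\<epsilon>\<close> in
  \<open>rho (X + \<epsilon> Y)\<close>, computed over the polynomial ring in \<open>\<epsilon>\<close>.\<close>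

definition drho :: "'a::comm_ring_1 ^ 3 ^ 3 \<Rightarrow> 'a ^ 3 ^ 3 \<Rightarrow> 'a ^ 3" where
  "drho X Y = (\<chi> i. coeff (rho (\<chi> j k. [:X $ j $ k, Y $ j $ k:]) $ i) 1)"

definition fiber :: "'a::comm_ring_1 ^ 3 ^ 3 \<Rightarrow> ('a ^ 3 ^ 3) set" where
  "fiber \<gamma> = {X. rho X = rho \<gamma>}"

definition tangent :: "'a::comm_ring_1 ^ 3 ^ 3 \<Rightarrow> ('a ^ 3 ^ 3) set" where
  "tangent X = {Y. drho X Y = 0}"


section \<open>The measure of the quotient form on the fiber\<close>

definition mat_scale :: "'a::times \<Rightarrow> 'a ^ 'n ^ 'm \<Rightarrow> 'a ^ 'n ^ 'm" where
  "mat_scale a X = (\<chi> i j. a * X $ i $ j)"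

text \<open>A translation-invariant differential form on a vector space is an alternating multilinear
  form on it.\<close>

definition alternating_form ::
  "('a::field \<Rightarrow> 'v::ab_group_add \<Rightarrow> 'v) \<Rightarrow> (('i \<Rightarrow> 'v) \<Rightarrow> 'a) \<Rightarrow> bool" where
  "alternating_form sm \<omega> \<longleftrightarrow>
     (\<forall>w i x y. \<omega> (w(i := x + y)) = \<omega> (w(i := x)) + \<omega> (w(i := y))) \<and>
     (\<forall>w i a x. \<omega> (w(i := sm a x)) = a * \<omega> (w(i := x))) \<and>
     (\<forall>w i j. i \<noteq> j \<and> w i = w j \<longrightarrow> \<omega> w = 0)"

definition elem_matrix :: "'n \<times> 'n \<Rightarrow> 'a::zero_neq_one ^ 'n ^ 'n" where
  "elem_matrix p = (\<chi> i j. if (i, j) = p then 1 else 0)"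

text \<open>A translation-invariant top form \<open>\<omega>\<close> gives the lattice spanned by a basis \<open>b\<close> the volume
  \<open>|\<omega> b|\<close>. So the lattice has volume 1 iff \<open>|\<omega> b| = 1\<close>. The nine tangent vectors of matrix space are
  indexed by the sum type \<open>6 + 3\<close>: six along the fiber, three transversal.\<close>

definition normalized_gl_form :: "((6 + 3 \<Rightarrow> 'a::nonarch_local_field ^ 3 ^ 3) \<Rightarrow> 'a) \<Rightarrow> bool" where
  "normalized_gl_form \<omega> \<longleftrightarrow> alternating_form mat_scale \<omega> \<and>
     (\<forall>b. bij b \<longrightarrow> absval (\<omega> (\<lambda>i. elem_matrix (b i))) = 1)"

definition normalized_affine_form :: "((3 \<Rightarrow> 'a::nonarch_local_field ^ 3) \<Rightarrow> 'a) \<Rightarrow> bool" where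
  "normalized_affine_form \<omega> \<longleftrightarrow> alternating_form (*s) \<omega> \<and> absval (\<omega> (\<lambda>i. axis i 1)) = 1"

text \<open>\<open>\<omega> X\<close> is a 6-form on the tangent space at each point \<open>X\<close> of the fiber, and
  \<open>\<omega>_gl = \<omega> \<and> rho\<^sup>* \<omega>_A\<close> holds there, so \<open>\<omega> = \<omega>_gl / rho\<^sup>* \<omega>_A\<close>. The values of \<open>\<omega> X\<close> on
  non-tangent vectors are irrelevant.\<close>

definition quotient_form ::
  "'a::nonarch_local_field ^ 3 ^ 3 \<Rightarrow> ((6 + 3 \<Rightarrow> 'a ^ 3 ^ 3) \<Rightarrow> 'a) \<Rightarrow> ((3 \<Rightarrow> 'a ^ 3) \<Rightarrow> 'a) \<Rightarrow>
   ('a ^ 3 ^ 3 \<Rightarrow> (6 \<Rightarrow> 'a ^ 3 ^ 3) \<Rightarrow> 'a) \<Rightarrow> bool" where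
  "quotient_form \<gamma> \<omega>_gl \<omega>_A \<omega> \<longleftrightarrow>
     (\<forall>X\<in>fiber \<gamma>. \<forall>w v. range w \<subseteq> tangent X \<longrightarrow>
        \<omega>_gl (case_sum w v) = \<omega> X w * \<omega>_A (\<lambda>i. drho X (v i)))"

definition normalized_haar :: "('a::nonarch_local_field ^ 'n) measure \<Rightarrow> bool" where
  "normalized_haar \<nu> \<longleftrightarrow> sets \<nu> = sets borel \<and>
     (\<forall>x. \<forall>A\<in>sets borel. emeasure \<nu> ((\<lambda>y. x + y) ` A) = emeasure \<nu> A) \<and>
     emeasure \<nu> std_lattice = 1"

text \<open>Six matrix entries, selected by \<open>e\<close>, are local coordinates on the fiber wherever their
  differentials are independent on the tangent space. By the implicit function theorem such
  charts cover the smooth fiber.\<close>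

definition entries :: "(6 \<Rightarrow> 3 \<times> 3) \<Rightarrow> 'a ^ 3 ^ 3 \<Rightarrow> 'a ^ 6" where
  "entries e X = (\<chi> i. X $ fst (e i) $ snd (e i))"

definition coord_chart ::
  "'a::nonarch_local_field ^ 3 ^ 3 \<Rightarrow> (6 \<Rightarrow> 3 \<times> 3) \<Rightarrow> ('a ^ 3 ^ 3) set \<Rightarrow> bool" where
  "coord_chart \<gamma> e U \<longleftrightarrow> openin (top_of_set (fiber \<gamma>)) U \<and> inj_on (entries e) U \<and>
     (\<forall>X\<in>U. bij_betw (entries e) (tangent X) UNIV)"

text \<open>The coordinate vector fields of such a chart.\<close>

definition coord_frame ::
  "(6 \<Rightarrow> 3 \<times> 3) \<Rightarrow> 'a::nonarch_local_field ^ 3 ^ 3 \<Rightarrow> 6 \<Rightarrow> 'a ^ 3 ^ 3" where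
  "coord_frame e X i = inv_into (tangent X) (entries e) (axis i 1)"

text \<open>\<open>\<mu>\<close> is the Borel measure \<open>|\<omega>|\<close> on the fiber: in local coordinates \<open>\<omega> = f dx\<^sub>1 \<dots> dx\<^sub>6\<close> and
  the volume of an open subset \<open>U\<close> of a chart domain, itself a chart domain, is the integral of
  \<open>|f|\<close> over its image. This determines \<open>\<mu>\<close> as the charts cover the fiber.\<close>

definition form_measure ::
  "'a::nonarch_local_field ^ 3 ^ 3 \<Rightarrow> ('a ^ 3 ^ 3 \<Rightarrow> (6 \<Rightarrow> 'a ^ 3 ^ 3) \<Rightarrow> 'a) \<Rightarrow> ('a ^ 6) measure \<Rightarrow>
   ('a ^ 3 ^ 3) measure \<Rightarrow> bool" where
  "form_measure \<gamma> \<omega> \<nu> \<mu> \<longleftrightarrow> sets \<mu> = sets (restrict_space borel (fiber \<gamma>)) \<and>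
     (\<forall>e U. coord_chart \<gamma> e U \<longrightarrow>
        emeasure \<mu> U =
          (\<integral>\<^sup>+ y \<in> entries e ` U.
             (let X = inv_into U (entries e) y in ennreal (absval (\<omega> X (coord_frame e X)))) \<partial>\<nu>))"

text \<open>\<open>ld_measure \<gamma> \<mu>\<close>: \<open>\<mu>\<close> is the measure of the quotient form on the fiber through \<open>\<gamma>\<close>.
  It does not depend on the choice of normalized \<open>\<omega>_gl\<close>, \<open>\<omega>_A\<close>, which are unique up to units.\<close>

definition ld_measure :: "'a::nonarch_local_field ^ 3 ^ 3 \<Rightarrow> ('a ^ 3 ^ 3) measure \<Rightarrow> bool" where
  "ld_measure \<gamma> \<mu> \<longleftrightarrow>
     (\<exists>\<omega>_gl \<omega>_A \<omega> \<nu>. normalized_gl_form \<omega>_gl \<and> normalized_affine_form \<omega>_A \<and>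
        quotient_form \<gamma> \<omega>_gl \<omega>_A \<omega> \<and> normalized_haar \<nu> \<and> form_measure \<gamma> \<omega> \<nu> \<mu>)"

definition image_orbit :: "'a::nonarch_local_field ^ 3 ^ 3 \<Rightarrow> ('a ^ 3) set \<Rightarrow> ('a ^ 3 ^ 3) set" where
  "image_orbit \<gamma> M =
     {X \<in> integral_matrices. charpoly X = charpoly \<gamma> \<and> (\<lambda>x. X *v x) ` std_lattice = M}"

text \<open>The common volume of the sets \<open>image_orbit \<gamma> M\<close> for \<open>M\<close> of type \<open>ks\<close>.\<close>

definition orbital_integral ::
  "('a::nonarch_local_field ^ 3 ^ 3) measure \<Rightarrow> 'a ^ 3 ^ 3 \<Rightarrow> nat list \<Rightarrow> real" where
  "orbital_integral \<mu> \<gamma> ks = (THE r. \<forall>M. has_type M ks \<longrightarrow> measure \<mu> (image_orbit \<gamma> M) = r)"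

end

theory Submission
  imports Defs
begin

text \<open>
  All lattices of type \<open>(k\<^sub>1, k\<^sub>2)\<close> are conjugate under \<open>GL\<^sub>3(\<oo>)\<close>, and conjugation preserves the measure of the
  quotient form: a small ball of the fiber around \<open>X\<close> has a volume that depends only on its radius and
  on the least valuation of the \<open>3\<close>-minors of the differential of \<open>rho\<close> at \<open>X\<close>. So it is enough to take
  for \<open>M\<close> the image of \<open>D = diag(1, \<pi>^k\<^sub>1, \<pi>^k\<^sub>2)\<close>. The matrices \<open>X\<close> with image \<open>M\<close> are the products \<open>D Y\<close> with
  \<open>Y\<close> in \<open>GL\<^sub>3(\<oo>)\<close>, and the characteristic polynomial becomes three equations for the entries of \<open>Y\<close>. As
  \<open>\<chi>\<close> is irreducible, its Newton polygon is a segment, which controls the valuations of the right-hand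
  sides. According to the valuations of \<open>y\<^sub>1\<^sub>2\<close> and \<open>y\<^sub>2\<^sub>1\<close> the orbit is cut into pieces on which three of
  the entries are functions of the six others, and these six range over a product of balls and shells.
  For \<open>k\<^sub>1 < k\<^sub>2\<close> the product \<open>y\<^sub>1\<^sub>2 y\<^sub>2\<^sub>1\<close>, when both factors are nonunits, has a constant valuation \<open>K\<close>, which is
  \<open>k\<^sub>1\<close>, \<open>k\<^sub>2 - k\<^sub>1\<close> and \<open>t\<close> in Cases 1, 2 and 4; each of its \<open>K - 1\<close> decompositions contributes the same
  volume. Sublattices are counted as pairs of linear forms \<open>f\<^sub>1\<close> mod \<open>\<pi>^k\<^sub>1\<close>, \<open>f\<^sub>2\<close> mod \<open>\<pi>^k\<^sub>2\<close>, independent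
  mod \<open>\<pi>\<close>, up to a change of basis.
\<close>

text \<open>The measure is known only through charts whose coordinates are six matrix entries, and
  conjugation does not respect such charts. So invariance is read off from balls: if the least
  valuation of the minors is \<open>m < n\<close>, the ball of radius \<open>n\<close> is a graph
  over a coordinate ball and has volume \<open>q^m / q^(6 n)\<close>. For the same reason every
  piece of the orbit has to be a chart domain outright, on which one minor has constant valuation,
  so that the density is constant.

  The constant \<open>K\<close> is decided by the second coefficient, which writes
  \<open>y12 y21\<close> as a sum with two main terms: \<open>y11 y22\<close>, containing
  \<open>- \<pi>^k1 y22^2\<close>, and \<open>- \<pi>^(k2 - k1) y13 y31\<close>. The chord of the
  Newton polygon has slope \<open>d / 3\<close>, and \<open>t\<close> and \<open>s\<close> only say
  on which side of it \<open>k1\<close> lies. In Case 1 the former term dominates, in Case 2 the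
  latter. In Case 4 both have order \<open>k1\<close>, as may the contributions of the first two
  coefficients, and cancellation has to be excluded: up to a unit the sum is the reduced cubic
  evaluated at \<open>y22\<close>, and an irreducible cubic has no zero.\<close>

no_notation fps_nth (infixl \<open>$\<close> 75)

section \<open>Valuations\<close>

lemma ideal_pow_mono: "x \<in> ideal_pow j \<Longrightarrow> k \<le> j \<Longrightarrow> x \<in> ideal_pow k"
  by (auto simp: ideal_pow_def)

lemma ideal_pow_integers: "x \<in> ideal_pow j \<Longrightarrow> x \<in> integers"
  by (rule ideal_pow_mono) auto

lemma ideal_pow_mult_integer: "a \<in> integers \<Longrightarrow> x \<in> ideal_pow k \<Longrightarrow> a * x \<in> ideal_pow k"
  "a \<in> integers \<Longrightarrow> x \<in> ideal_pow k \<Longrightarrow> x * a \<in> ideal_pow k"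
  using ideal_pow_mult[of a 0 x k] ideal_pow_mult[of x k a 0] by auto

lemma ideal_pow_diff_commute: "x - y \<in> ideal_pow k \<longleftrightarrow> y - x \<in> ideal_pow k"
  using ideal_pow_uminus[of "x - y" k] by simp

lemma ideal_pow_trans: "x - y \<in> ideal_pow k \<Longrightarrow> y - z \<in> ideal_pow k \<Longrightarrow> x - z \<in> ideal_pow k"
  using ideal_pow_add[of "x - y" k "y - z"] by simp

lemma ideal_pow_add_cancel: "x \<in> ideal_pow k \<Longrightarrow> x + y \<in> ideal_pow k \<longleftrightarrow> y \<in> ideal_pow k"
  using ideal_pow_add[of x k y] ideal_pow_diff[of "x + y" k x] by auto

lemma ideal_pow_congruent: "x - y \<in> ideal_pow k \<Longrightarrow> x \<in> ideal_pow k \<longleftrightarrow> y \<in> ideal_pow k"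
  using ideal_pow_add_cancel[of "x - y" k y] by simp

lemma ideal_pow_sum: "(\<And>i. i \<in> A \<Longrightarrow> f i \<in> ideal_pow k) \<Longrightarrow> sum f A \<in> ideal_pow k"
  by (induction A rule: infinite_finite_induct) (auto intro: ideal_pow_add)

lemma ideal_pow_zero_iff: "x = 0 \<longleftrightarrow> (\<forall>k. x \<in> ideal_pow k)"
proof
  assume *: "\<forall>k. x \<in> ideal_pow k"
  have "x \<in> ideal_pow (Suc (nat (ord x)))" using * by blast
  then show "x = 0" by (auto simp: ideal_pow_def split: if_splits)
qed auto

definition ounit :: "'a::discrete_valued_field \<Rightarrow> bool" where
  "ounit x \<longleftrightarrow> x \<in> integers \<and> x \<notin> ideal_pow 1"

lemma ounit_iff: "ounit x \<longleftrightarrow> x \<noteq> 0 \<and> ord x = 0"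
  by (auto simp: ounit_def ideal_pow_def)

lemma ounit_integer: "ounit x \<Longrightarrow> x \<in> integers"
  by (simp add: ounit_def)

lemma ounit_nonzero: "ounit x \<Longrightarrow> x \<noteq> 0"
  by (simp add: ounit_iff)

lemma ounit_mult: "ounit x \<Longrightarrow> ounit y \<Longrightarrow> ounit (x * y)"
  by (simp add: ounit_iff ord_mult)

lemma ounit_one [simp]: "ounit 1"
  by (simp add: ounit_iff)

lemma ounit_uminus [simp]: "ounit (- x) \<longleftrightarrow> ounit x"
  by (simp add: ounit_iff)

lemma ounit_inverse: "ounit x \<Longrightarrow> ounit (inverse x)"
  by (simp add: ounit_iff ord_inverse)

lemma ounit_divide: "ounit y \<Longrightarrow> x \<in> ideal_pow k \<Longrightarrow> x / y \<in> ideal_pow k"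
  using ideal_pow_mult_integer(2)[of "inverse y" x k] by (simp add: divide_inverse ounit_inverse ounit_integer)

lemma ounit_add: "ounit x \<Longrightarrow> y \<in> ideal_pow 1 \<Longrightarrow> ounit (x + y)"
  unfolding ounit_def using ideal_pow_add[of x 0 y] ideal_pow_integers[of y 1]
    ideal_pow_add_cancel[of y 1 x] by (auto simp: add.commute)

lemma ounit_congruent: "x - y \<in> ideal_pow 1 \<Longrightarrow> ounit x \<longleftrightarrow> ounit y"
  using ounit_add[of y "x - y"] ounit_add[of x "y - x"] ideal_pow_diff_commute[of x y] by auto

lemma ounit_mult_ideal_pow: "ounit u \<Longrightarrow> u * x \<in> ideal_pow k \<longleftrightarrow> x \<in> ideal_pow k"
  by (cases "x = 0") (auto simp: ounit_iff ideal_pow_def ord_mult)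

lemma ounit_mult_iff:
  assumes "x \<in> integers" "y \<in> integers"
  shows "ounit (x * y) \<longleftrightarrow> ounit x \<and> ounit y"
  using assms by (cases "x = 0 \<or> y = 0") (auto simp: ounit_iff ord_mult ideal_pow_def)

lemma integer_cases: "x \<in> integers \<Longrightarrow> ounit x \<or> x \<in> ideal_pow 1"
  by (auto simp: ounit_def)

lemma uniformizer_nonzero: "uniformizer p \<Longrightarrow> p \<noteq> 0"
  by (simp add: uniformizer_def)

lemma ord_power: "x \<noteq> 0 \<Longrightarrow> ord (x ^ n) = int n * ord x"
  by (induction n) (auto simp: ord_mult algebra_simps)

lemma ord_uniformizer_power: "uniformizer p \<Longrightarrow> ord (p ^ n) = int n"
  by (simp add: uniformizer_def ord_power)

lemma uniformizer_power_mem: "uniformizer p \<Longrightarrow> p ^ n \<in> ideal_pow n"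
  by (simp add: ideal_pow_def ord_uniformizer_power)

lemma uniformizer_power_mem': "uniformizer p \<Longrightarrow> k \<le> n \<Longrightarrow> p ^ n \<in> ideal_pow k"
  using uniformizer_power_mem ideal_pow_mono by blast

lemma uniformizer_power_mult:
  "uniformizer p \<Longrightarrow> p ^ n * x \<in> ideal_pow (n + k) \<longleftrightarrow> x \<in> ideal_pow k"
  by (cases "x = 0") (auto simp: ideal_pow_def ord_mult ord_uniformizer_power uniformizer_def ord_power)

lemma uniformizer_power_mult':
  "uniformizer p \<Longrightarrow> n \<le> m \<Longrightarrow> p ^ n * x \<in> ideal_pow m \<longleftrightarrow> x \<in> ideal_pow (m - n)"
  using uniformizer_power_mult[of p n x "m - n"] by simp

lemma ideal_pow_divide_power:
  "uniformizer p \<Longrightarrow> x \<in> ideal_pow (n + k) \<Longrightarrow> x / p ^ n \<in> ideal_pow k"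
  using uniformizer_power_mult[of p n "x / p ^ n" k] by (simp add: uniformizer_def)

lemma ideal_pow_obtain:
  assumes "uniformizer p" "x \<in> ideal_pow n"
  obtains y where "y \<in> integers" "x = p ^ n * y"
  using ideal_pow_divide_power[of p x n 0] assms that[of "x / p ^ n"] by (simp add: uniformizer_def)

lemma exists_uniformizer: "\<exists>p::'a::discrete_valued_field. uniformizer p"
  using ord_surj by (auto simp: uniformizer_def)

text \<open>Phrased by membership rather than by \<open>ord\<close>, so that it is false at zero
  whatever the unspecified value of \<open>ord 0\<close>; \<open>ounit\<close>, the case of
  valuation zero, is written in the same way.\<close>

definition same_ord :: "nat \<Rightarrow> 'a::discrete_valued_field \<Rightarrow> bool" where
  "same_ord n x \<longleftrightarrow> x \<in> ideal_pow n \<and> x \<notin> ideal_pow (Suc n)"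

lemma same_ord_iff: "same_ord n x \<longleftrightarrow> x \<noteq> 0 \<and> ord x = int n"
  by (auto simp: same_ord_def ideal_pow_def)

lemma same_ord_0: "same_ord 0 x \<longleftrightarrow> ounit x"
  by (simp add: same_ord_iff ounit_iff)

lemma same_ord_uniformizer_power: "uniformizer p \<Longrightarrow> same_ord n (p ^ n)"
  by (simp add: same_ord_iff ord_uniformizer_power uniformizer_def ord_power)

lemma same_ord_mult_ideal_pow: "same_ord n u \<Longrightarrow> u * x \<in> ideal_pow (n + k) \<longleftrightarrow> x \<in> ideal_pow k"
  by (cases "x = 0") (auto simp: same_ord_iff ideal_pow_def ord_mult)

lemma same_ord_divide: "same_ord n u \<Longrightarrow> x \<in> ideal_pow (n + k) \<Longrightarrow> x / u \<in> ideal_pow k"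
  using same_ord_mult_ideal_pow[of n u "x / u" k] by (simp add: same_ord_iff)

lemma same_ord_mult: "same_ord m x \<Longrightarrow> same_ord n y \<Longrightarrow> same_ord (m + n) (x * y)"
  by (auto simp: same_ord_iff ord_mult)

lemma same_ord_add: "same_ord n x \<Longrightarrow> y \<in> ideal_pow (Suc n) \<Longrightarrow> same_ord n (x + y)"
  unfolding same_ord_def using ideal_pow_add[of x n y] ideal_pow_mono[of y "Suc n" n]
    ideal_pow_add_cancel[of y "Suc n" x] by (auto simp: add.commute)

lemma same_ord_uminus [simp]: "same_ord n (- x) \<longleftrightarrow> same_ord n x"
  by (simp add: same_ord_iff)

section \<open>Representatives modulo powers of the maximal ideal\<close>

definition representatives :: "nat \<Rightarrow> 'a::discrete_valued_field set \<Rightarrow> bool" where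
  "representatives n T \<longleftrightarrow> finite T \<and> T \<subseteq> integers \<and> (\<forall>x\<in>integers. \<exists>!t. t \<in> T \<and> x - t \<in> ideal_pow n)"

lemma representativesD:
  assumes "representatives n T"
  shows "finite T" "T \<subseteq> integers" "x \<in> integers \<Longrightarrow> \<exists>t\<in>T. x - t \<in> ideal_pow n"
    "t \<in> T \<Longrightarrow> t' \<in> T \<Longrightarrow> t - t' \<in> ideal_pow n \<Longrightarrow> t = t'"
proof -
  show "finite T" "T \<subseteq> integers" "x \<in> integers \<Longrightarrow> \<exists>t\<in>T. x - t \<in> ideal_pow n"
    using assms by (auto simp: representatives_def)
  assume t: "t \<in> T" "t' \<in> T" "t - t' \<in> ideal_pow n"
  then have "t \<in> integers" "t - t \<in> ideal_pow n"
    using assms by (auto simp: representatives_def)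
  then show "t = t'" using t assms unfolding representatives_def by blast
qed

lemma residue_eq_iff:
  assumes "x \<in> integers" "y \<in> integers"
  shows "reduce x = reduce y \<longleftrightarrow> x - y \<in> ideal_pow 1"
  using Quotient3_rel[OF Quotient3_residue, of x y] assms
  by (auto simp: reduce_def residue_eq_def)

lemma reduce_surj:
  obtains x where "x \<in> integers" "reduce x = (r :: 'a::discrete_valued_field residue)"
proof -
  have "residue_eq (rep_residue r) (rep_residue r)" "abs_residue (rep_residue r) = r"
    using Quotient3_residue by (auto simp: Quotient3_def)
  then show thesis using that by (auto simp: residue_eq_def reduce_def)
qed

lemma representatives_1:
  "\<exists>T. representatives 1 (T :: 'a::nonarch_local_field set) \<and> card T = CARD('a residue)"
proof -
  define f :: "'a residue \<Rightarrow> 'a" where "f r = (SOME x. x \<in> integers \<and> reduce x = r)" for r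
  have f: "f r \<in> integers" "reduce (f r) = r" for r
    using someI_ex[of "\<lambda>x. x \<in> integers \<and> reduce x = r"] reduce_surj[of r] unfolding f_def by blast+
  have inj: "inj f" by (rule inj_on_inverseI[of _ reduce]) (rule f)
  have "representatives 1 (range f)"
    unfolding representatives_def
  proof (intro conjI ballI)
    show "finite (range f)" by (rule finite_imageI) (rule finite_residue)
    show "range f \<subseteq> integers" using f by auto
    fix x :: 'a assume x: "x \<in> integers"
    have "x - f r \<in> ideal_pow 1 \<longleftrightarrow> r = reduce x" for r
      using residue_eq_iff[OF x f(1), of r] f(2)[of r] by auto
    then show "\<exists>!t. t \<in> range f \<and> x - t \<in> ideal_pow 1" by auto
  qed
  moreover have "card (range f) = CARD('a residue)" by (rule card_image[OF inj])
  ultimately show ?thesis by blast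
qed

text \<open>Digit expansion: \<open>S\<close> supplies the part of a number below
  \<open>p ^ n\<close> and \<open>T\<close> the next \<open>m\<close> digits. With
  \<open>m = 1\<close> this gives sets of \<open>q ^ n\<close> representatives by induction.\<close>

lemma bij_betw_representatives_Suc:
  assumes p: "uniformizer p" and S: "representatives n S" and T: "representatives m T"
  shows "inj_on (\<lambda>(s, t). s + p ^ n * t) (S \<times> T)"
    "representatives (n + m) ((\<lambda>(s, t). s + p ^ n * t) ` (S \<times> T))"
proof -
  note S' = representativesD[OF S] and T' = representativesD[OF T]
  \<comment> \<open>Reduction modulo \<open>p ^ n\<close> removes the terms with \<open>t\<close>
    and \<open>t'\<close> and gives \<open>s = s'\<close>; after that \<open>p ^ n\<close> can be
    divided out.\<close>
  have uniq: "s = s' \<and> t = t'" if st: "s \<in> S" "t \<in> T" "s' \<in> S" "t' \<in> T"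
    and d: "s + p ^ n * t - (s' + p ^ n * t') \<in> ideal_pow (n + m)" for s t s' t'
  proof -
    have e: "s + p ^ n * t - (s' + p ^ n * t') = p ^ n * (t - t') + (s - s')"
      by (simp add: algebra_simps)
    have "t - t' \<in> integers" using st T'(2) by (auto intro: ideal_pow_diff)
    then have "p ^ n * (t - t') \<in> ideal_pow n"
      using uniformizer_power_mult[OF p, of n "t - t'" 0] by simp
    moreover have "p ^ n * (t - t') + (s - s') \<in> ideal_pow n"
      using d e ideal_pow_mono[of _ "n + m" n] by simp
    ultimately have "s - s' \<in> ideal_pow n" using ideal_pow_add_cancel by blast
    then have s: "s = s'" using S'(4) st by blast
    then have "p ^ n * (t - t') \<in> ideal_pow (n + m)" using d e by simp
    then have "t - t' \<in> ideal_pow m" using uniformizer_power_mult[OF p] by blast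
    then show ?thesis using s T'(4) st by blast
  qed
  show "inj_on (\<lambda>(s, t). s + p ^ n * t) (S \<times> T)"
    by (rule inj_onI) (use uniq in force)
  show "representatives (n + m) ((\<lambda>(s, t). s + p ^ n * t) ` (S \<times> T))"
    unfolding representatives_def
  proof (intro conjI ballI)
    show "finite ((\<lambda>(s, t). s + p ^ n * t) ` (S \<times> T))" using S'(1) T'(1) by simp
    show "(\<lambda>(s, t). s + p ^ n * t) ` (S \<times> T) \<subseteq> integers"
      using S'(2) T'(2) uniformizer_power_mem'[OF p, of 0 n]
      by (auto intro!: ideal_pow_add integers_mult)
    fix x :: 'a assume "x \<in> integers"
    then obtain s where s: "s \<in> S" "x - s \<in> ideal_pow n" using S'(3) by blast
    obtain y where y: "y \<in> integers" "x - s = p ^ n * y" using ideal_pow_obtain[OF p s(2)] .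
    obtain t where t: "t \<in> T" "y - t \<in> ideal_pow m" using T'(3) y by blast
    have e: "x - (s + p ^ n * t) = p ^ n * (y - t)" using y by (simp add: algebra_simps)
    have m: "x - (s + p ^ n * t) \<in> ideal_pow (n + m)"
      unfolding e using t uniformizer_power_mult[OF p] by blast
    show "\<exists>!t. t \<in> (\<lambda>(s, t). s + p ^ n * t) ` (S \<times> T) \<and> x - t \<in> ideal_pow (n + m)"
    proof (rule ex1I[of _ "s + p ^ n * t"])
      show "s + p ^ n * t \<in> (\<lambda>(s, t). s + p ^ n * t) ` (S \<times> T) \<and>
          x - (s + p ^ n * t) \<in> ideal_pow (n + m)" using s t m by auto
      fix z assume z: "z \<in> (\<lambda>(s, t). s + p ^ n * t) ` (S \<times> T) \<and> x - z \<in> ideal_pow (n + m)"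
      then obtain s' t' where z': "s' \<in> S" "t' \<in> T" "z = s' + p ^ n * t'" by auto
      have "s' + p ^ n * t' - (s + p ^ n * t) \<in> ideal_pow (n + m)"
        using ideal_pow_trans[of "s' + p ^ n * t'" x "n + m"] m z z'(3) ideal_pow_diff_commute[of x] by simp
      then show "z = s + p ^ n * t" using uniq[of s' t' s t] s t z' by auto
    qed
  qed
qed

lemma representatives_exist:
  "\<exists>T. representatives n (T :: 'a::nonarch_local_field set) \<and> card T = CARD('a residue) ^ n"
proof (induction n)
  case 0
  have "representatives 0 {0 :: 'a}" by (auto simp: representatives_def)
  then show ?case by force
next
  case (Suc n)
  then obtain S :: "'a set" where S: "representatives n S" "card S = CARD('a residue) ^ n" by blast
  obtain T :: "'a set" where T: "representatives 1 T" "card T = CARD('a residue)" using representatives_1 by blast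
  obtain p :: 'a where p: "uniformizer p" using exists_uniformizer by blast
  note b = bij_betw_representatives_Suc[OF p S(1) T(1)]
  have "card ((\<lambda>(s, t). s + p ^ n * t) ` (S \<times> T)) = CARD('a residue) ^ Suc n"
    using card_image[OF b(1)] S T by (simp add: card_cartesian_product)
  then show ?case using b(2) by auto
qed

lemma residue_card_ge_2: "2 \<le> CARD('a::nonarch_local_field residue)"
proof -
  have "card {0, 1 :: 'a residue} \<le> CARD('a residue)"
    by (rule card_mono) (use finite_residue in auto)
  then show ?thesis by simp
qed

section \<open>Topology\<close>

abbreviation res_card :: "'a::nonarch_local_field itself \<Rightarrow> real" where
  "res_card _ \<equiv> real CARD('a residue)"

lemma res_card_gt_1: "1 < res_card TYPE('a::nonarch_local_field)"
  using residue_card_ge_2[where 'a='a] by simp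

text \<open>Cosets of \<open>ideal_pow n\<close> are the closed balls of radius
  \<open>q ^ (- n)\<close>, so that openness and convergence can be handled by congruences.\<close>

lemma ideal_pow_dist:
  "x - y \<in> ideal_pow n \<longleftrightarrow> dist x y \<le> res_card TYPE('a) powi (- int n)"
  for x y :: "'a::nonarch_local_field"
  using power_int_strict_increasing[of "- ord (x - y)" "- int n" "res_card TYPE('a)"]
    power_int_strict_increasing[of "- int n" "- ord (x - y)" "res_card TYPE('a)"]
    res_card_gt_1[where 'a='a]
  by (cases "int n" "ord (x - y)" rule: linorder_cases) (auto simp: ideal_pow_def dist_ord)

lemma res_card_powi_tendsto: 
  assumes "e > 0"
  shows "\<exists>n. res_card TYPE('a::nonarch_local_field) powi (- int n) < e"
proof -
  have q: "1 < res_card TYPE('a)" by (rule res_card_gt_1)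
  obtain n where "(1 / res_card TYPE('a)) ^ n < e"
    using real_arch_pow_inv[of e "1 / res_card TYPE('a)"] assms q by auto
  then show ?thesis by (auto simp: power_int_minus field_simps power_int_def intro!: exI[of _ n])
qed

lemma open_congruent:
  fixes U :: "'a::nonarch_local_field set"
  shows "open U \<longleftrightarrow> (\<forall>a\<in>U. \<exists>n. \<forall>x. x - a \<in> ideal_pow n \<longrightarrow> x \<in> U)"
proof
  assume U: "open U"
  show "\<forall>a\<in>U. \<exists>n. \<forall>x. x - a \<in> ideal_pow n \<longrightarrow> x \<in> U"
  proof
    fix a assume "a \<in> U"
    then obtain e where e: "e > 0" "\<forall>y. dist y a < e \<longrightarrow> y \<in> U" using U open_dist by blast
    obtain n where "res_card TYPE('a) powi (- int n) < e" using res_card_powi_tendsto e(1) by blast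
    then have "\<forall>x. x - a \<in> ideal_pow n \<longrightarrow> x \<in> U"
      using e(2) by (auto simp: ideal_pow_dist)
    then show "\<exists>n. \<forall>x. x - a \<in> ideal_pow n \<longrightarrow> x \<in> U" by blast
  qed
next
  assume *: "\<forall>a\<in>U. \<exists>n. \<forall>x. x - a \<in> ideal_pow n \<longrightarrow> x \<in> U"
  show "open U" unfolding open_dist
  proof
    fix a assume "a \<in> U"
    then obtain n where n: "\<forall>x. x - a \<in> ideal_pow n \<longrightarrow> x \<in> U" using * by blast
    have "0 < res_card TYPE('a) powi (- int n)"
      by (rule zero_less_power_int) (use res_card_gt_1[where 'a='a] in simp)
    then show "\<exists>e>0. \<forall>y. dist y a < e \<longrightarrow> y \<in> U"
      using n by (auto simp: ideal_pow_dist intro!: exI[of _ "res_card TYPE('a) powi (- int n)"])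
  qed
qed

lemma open_coset_ideal_pow: "open {x. x - a \<in> ideal_pow n}" for a :: "'a::nonarch_local_field"
  unfolding open_congruent by (auto intro: ideal_pow_trans)

lemma open_ideal_pow: "open (ideal_pow n :: 'a::nonarch_local_field set)"
  using open_coset_ideal_pow[of 0 n] by simp

lemma closed_ideal_pow: "closed (ideal_pow n :: 'a::nonarch_local_field set)"
  unfolding closed_def open_congruent using ideal_pow_congruent[of _ _ n] by auto

lemma open_vec_congruent:
  fixes U :: "('a::nonarch_local_field ^ 'n::finite) set"
  shows "open U \<longleftrightarrow> (\<forall>a\<in>U. \<exists>n. \<forall>x. (\<forall>i. x $ i - a $ i \<in> ideal_pow n) \<longrightarrow> x \<in> U)"
proof
  assume U: "open U"
  show "\<forall>a\<in>U. \<exists>n. \<forall>x. (\<forall>i. x $ i - a $ i \<in> ideal_pow n) \<longrightarrow> x \<in> U"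
  proof
    fix a assume "a \<in> U"
    then obtain A where A: "\<And>i. open (A i) \<and> a $ i \<in> A i" "\<And>y. (\<forall>i. y $ i \<in> A i) \<Longrightarrow> y \<in> U"
      using U unfolding open_vec_def by metis
    have "\<exists>n. \<forall>x. x - a $ i \<in> ideal_pow n \<longrightarrow> x \<in> A i" for i
      using A(1)[of i] open_congruent[of "A i"] by blast
    then obtain n where n: "\<And>i x. x - a $ i \<in> ideal_pow (n i) \<Longrightarrow> x \<in> A i" by metis
    have "x \<in> U" if "\<forall>i. x $ i - a $ i \<in> ideal_pow (Max (range n))" for x
    proof (rule A(2), rule allI)
      fix i
      have "n i \<le> Max (range n)" by simp
      then show "x $ i \<in> A i" using n[of "x $ i" i] that ideal_pow_mono by blast
    qed
    then show "\<exists>n. \<forall>x. (\<forall>i. x $ i - a $ i \<in> ideal_pow n) \<longrightarrow> x \<in> U" by blast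
  qed
next
  assume *: "\<forall>a\<in>U. \<exists>n. \<forall>x. (\<forall>i. x $ i - a $ i \<in> ideal_pow n) \<longrightarrow> x \<in> U"
  show "open U" unfolding open_vec_def
  proof
    fix a assume "a \<in> U"
    then obtain n where "\<forall>x. (\<forall>i. x $ i - a $ i \<in> ideal_pow n) \<longrightarrow> x \<in> U" using * by blast
    then show "\<exists>A. (\<forall>i. open (A i) \<and> a $ i \<in> A i) \<and> (\<forall>y. (\<forall>i. y $ i \<in> A i) \<longrightarrow> y \<in> U)"
      by (intro exI[of _ "\<lambda>i. {x. x - a $ i \<in> ideal_pow n}"]) (auto intro: open_coset_ideal_pow)
  qed
qed

lemma open_matrix_congruent:
  fixes U :: "('a::nonarch_local_field ^ 'n::finite ^ 'm::finite) set"
  assumes "\<And>A. A \<in> U \<Longrightarrow> \<exists>n. \<forall>X. (\<forall>i j. X $ i $ j - A $ i $ j \<in> ideal_pow n) \<longrightarrow> X \<in> U"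
  shows "open U"
proof (rule iffD2[OF open_vec_def], rule ballI)
  fix A assume "A \<in> U"
  then obtain n where n: "\<And>X. (\<forall>i j. X $ i $ j - A $ i $ j \<in> ideal_pow n) \<Longrightarrow> X \<in> U"
    using assms by blast
  have "open {x. \<forall>j. x $ j - A $ i $ j \<in> ideal_pow n}" for i
    unfolding open_vec_congruent by (auto intro: ideal_pow_trans)
  then show "\<exists>B. (\<forall>i. open (B i) \<and> A $ i \<in> B i) \<and> (\<forall>Y. (\<forall>i. Y $ i \<in> B i) \<longrightarrow> Y \<in> U)"
    using n by (intro exI[of _ "\<lambda>i. {x. \<forall>j. x $ j - A $ i $ j \<in> ideal_pow n}"]) auto
qed

lemma absval_ord: "x \<noteq> 0 \<Longrightarrow> absval x = res_card TYPE('a) powi (- ord x)"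
  for x :: "'a::nonarch_local_field"
  by (simp add: absval_def dist_ord)

lemma absval_0 [simp]: "absval 0 = 0"
  by (simp add: absval_def)

lemma absval_eq_0_iff [simp]: "absval x = 0 \<longleftrightarrow> x = 0"
  by (simp add: absval_def)

lemma absval_mult: "absval (x * y) = absval x * absval y"
proof (cases "x = 0 \<or> y = 0")
  case False
  then show ?thesis
    using res_card_gt_1[where 'a='a] by (simp add: absval_ord ord_mult power_int_add flip: power_int_add)
qed auto

lemma absval_same_ord: "same_ord n x \<Longrightarrow> absval x = inverse (res_card TYPE('a) ^ n)"
  for x :: "'a::nonarch_local_field"
  by (simp add: same_ord_iff absval_ord power_int_minus)

section \<open>Fixed points of contractions\<close>

text \<open>By the ultrametric inequality it is enough to bound consecutive differences.
  Completeness gives the limit, and as cosets of \<open>ideal_pow m\<close> are open, the limit is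
  congruent to a late term modulo \<open>\<pi> ^ m\<close>.\<close>

lemma ideal_pow_limit:
  fixes s :: "nat \<Rightarrow> 'a::nonarch_local_field"
  assumes s: "\<And>m. s (Suc m) - s m \<in> ideal_pow m"
  obtains l where "\<And>m. l - s m \<in> ideal_pow m"
proof -
  have d: "s k - s m \<in> ideal_pow m" if "m \<le> k" for m k
    using that
  proof (induction rule: dec_induct)
    case base
    then show ?case by simp
  next
    case (step k)
    have "s (Suc k) - s k \<in> ideal_pow m" using ideal_pow_mono[OF s step(1)] .
    then show ?case using step ideal_pow_trans by blast
  qed
  have "Cauchy s" unfolding Cauchy_altdef2
  proof (intro allI impI)
    fix e :: real assume "e > 0"
    then obtain n where "res_card TYPE('a) powi (- int n) < e" using res_card_powi_tendsto by blast
    then show "\<exists>N. \<forall>n\<ge>N. dist (s n) (s N) < e"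
      using d[of n] unfolding ideal_pow_dist by (intro exI[of _ n]) force
  qed
  then obtain l where l: "s \<longlonglongrightarrow> l" using Cauchy_convergent_iff convergent_def by blast
  have "l - s m \<in> ideal_pow m" for m
  proof -
    have "eventually (\<lambda>k. s k \<in> {x. x - l \<in> ideal_pow m}) sequentially"
      by (rule topological_tendstoD[OF l open_coset_ideal_pow]) simp
    then obtain k where k: "k \<ge> m" "s k - l \<in> ideal_pow m"
      unfolding eventually_sequentially by (metis mem_Collect_eq nle_le)
    then show ?thesis using d[of m k] ideal_pow_diff_commute ideal_pow_trans by blast
  qed
  then show thesis using that by blast
qed

text \<open>Banach's fixed point theorem one digit at a time: the iterates of \<open>F\<close> from
  zero stabilise modulo each power of the maximal ideal, and two fixed points agree modulo every
  power. Families indexed by \<open>'i\<close> cover the scalar case (\<open>unit\<close>) as well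
  as the three unknowns of \<open>local_solution\<close>.\<close>

lemma contraction_fixed_point:
  fixes F :: "('i \<Rightarrow> 'a::nonarch_local_field) \<Rightarrow> 'i \<Rightarrow> 'a"
  assumes maps: "\<And>z. (\<And>i. z i \<in> ideal_pow n) \<Longrightarrow> (\<And>i. F z i \<in> ideal_pow n)"
    and contr: "\<And>z z' k. (\<And>i. z i \<in> ideal_pow n) \<Longrightarrow> (\<And>i. z' i \<in> ideal_pow n) \<Longrightarrow>
      (\<And>i. z i - z' i \<in> ideal_pow k) \<Longrightarrow> (\<And>i. F z i - F z' i \<in> ideal_pow (Suc k))"
  shows "\<exists>!z. (\<forall>i. z i \<in> ideal_pow n) \<and> F z = z"
proof -
  define s where "s m = (F ^^ m) (\<lambda>i. 0)" for m
  have s0: "s 0 = (\<lambda>i. 0)" and sS: "s (Suc m) = F (s m)" for m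
    by (auto simp: s_def)
  have mem: "s m i \<in> ideal_pow n" for m i
    by (induction m arbitrary: i) (auto simp: s0 sS intro: maps)
  have d: "s (Suc m) i - s m i \<in> ideal_pow m" for m i
  proof (induction m arbitrary: i)
    case 0
    have "s 1 i \<in> integers" using mem[of 1 i] ideal_pow_integers by blast
    then show ?case by (simp add: s0)
  next
    case (Suc m)
    show ?case unfolding sS[of "Suc m"] sS[of m]
      by (rule contr) (use Suc mem mem[of "Suc m"] sS in auto)
  qed
  have "\<exists>l. \<forall>m. l - s m i \<in> ideal_pow m" for i
    using ideal_pow_limit[of "\<lambda>m. s m i"] d by blast
  then obtain l where l: "\<And>i m. l i - s m i \<in> ideal_pow m" by metis
  have ln: "l i \<in> ideal_pow n" for i
    using l[of i n] mem[of n i] ideal_pow_congruent by blast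
  have "F l i - l i \<in> ideal_pow m" for i m
  proof -
    have "F l i - F (s m) i \<in> ideal_pow (Suc m)" by (rule contr) (use ln mem l in auto)
    then have "F l i - s (Suc m) i \<in> ideal_pow (Suc m)" by (simp add: sS)
    moreover have "s (Suc m) i - l i \<in> ideal_pow (Suc m)"
      using l ideal_pow_diff_commute by blast
    ultimately have "F l i - l i \<in> ideal_pow (Suc m)" using ideal_pow_trans by blast
    then show ?thesis by (rule ideal_pow_mono) simp
  qed
  then have "F l i - l i = 0" for i using ideal_pow_zero_iff by blast
  then have Fl: "F l = l" by (simp add: fun_eq_iff)
  show ?thesis
  proof (rule ex1I[of _ l])
    show "(\<forall>i. l i \<in> ideal_pow n) \<and> F l = l" using ln Fl by blast
    fix z assume z: "(\<forall>i. z i \<in> ideal_pow n) \<and> F z = z"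
    have "z i - l i \<in> ideal_pow k" for i k
    proof (induction k arbitrary: i)
      case 0
      have "z i \<in> integers" "l i \<in> integers" using z ln ideal_pow_integers by blast+
      then show ?case by (rule ideal_pow_diff)
    next
      case (Suc k)
      then have "F z i - F l i \<in> ideal_pow (Suc k)" using z ln contr by blast
      then show ?case using z Fl by simp
    qed
    then have "z i - l i = 0" for i using ideal_pow_zero_iff by blast
    then show "z = l" by (simp add: fun_eq_iff)
  qed
qed

text \<open>A scalar Hensel lemma: the difference quotient of the right-hand side lies in the
  maximal ideal because \<open>a\<close> and \<open>b\<close> do. It yields the roots split off at
  vertices of a Newton polygon and, with \<open>a = 0\<close>, the entry \<open>y13\<close> in the
  last chart.\<close>

lemma cubic_fixed_point:
  fixes a b c :: "'a::nonarch_local_field"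
  assumes a: "a \<in> ideal_pow 1" and b: "b \<in> ideal_pow 1" and c: "c \<in> integers"
  shows "\<exists>!z. z \<in> integers \<and> z = c + b * z ^ 2 + a * z ^ 3"
proof -
  define F :: "(unit \<Rightarrow> 'a) \<Rightarrow> unit \<Rightarrow> 'a" where "F z = (\<lambda>i. c + b * z i ^ 2 + a * z i ^ 3)" for z
  have "\<exists>!z. (\<forall>i. z i \<in> ideal_pow 0) \<and> F z = z"
  proof (rule contraction_fixed_point)
    fix z :: "unit \<Rightarrow> 'a" and i
    assume "\<And>i. z i \<in> integers"
    then show "F z i \<in> integers" using assms ideal_pow_integers[of _ 1]
      unfolding F_def power2_eq_square power3_eq_cube
      by (intro ideal_pow_add integers_mult) auto
  next
    fix z z' :: "unit \<Rightarrow> 'a" and k i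
    assume z: "\<And>i. z i \<in> integers" "\<And>i. z' i \<in> integers" and d: "\<And>i. z i - z' i \<in> ideal_pow k"
    have e: "F z i - F z' i = (z i - z' i) * (b * (z i + z' i) + a * (z i * z i + z i * z' i + z' i * z' i))"
      by (simp add: F_def algebra_simps power2_eq_square power3_eq_cube)
    have "b * (z i + z' i) + a * (z i * z i + z i * z' i + z' i * z' i) \<in> ideal_pow 1"
      using a b z by (intro ideal_pow_add ideal_pow_mult_integer integers_mult) (auto intro: ideal_pow_add integers_mult)
    then have "F z i - F z' i \<in> ideal_pow (k + 1)" unfolding e using d ideal_pow_mult by blast
    then show "F z i - F z' i \<in> ideal_pow (Suc k)" by simp
  qed
  then obtain z where z: "\<forall>i. z i \<in> ideal_pow 0" "F z = z"
    and u: "\<And>y. (\<forall>i. y i \<in> ideal_pow 0) \<Longrightarrow> F y = y \<Longrightarrow> y = z" by blast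
  show ?thesis
  proof (rule ex1I[of _ "z ()"])
    show "z () \<in> integers \<and> z () = c + b * z () ^ 2 + a * z () ^ 3"
      using z(1) fun_cong[OF z(2)[symmetric], of "()"] unfolding F_def by blast
    fix y assume "y \<in> integers \<and> y = c + b * y ^ 2 + a * y ^ 3"
    then have "(\<lambda>_. y) = z" by (intro u) (auto simp: F_def fun_eq_iff)
    then show "y = z ()" by auto
  qed
qed


section \<open>Volumes of boxes\<close>

definition box_shell :: "('n::finite \<Rightarrow> nat) \<Rightarrow> 'n set \<Rightarrow> ('a::discrete_valued_field ^ 'n) set" where
  "box_shell n s = {y. \<forall>i. y $ i \<in> ideal_pow (n i) \<and> (i \<in> s \<longrightarrow> y $ i \<notin> ideal_pow (Suc (n i)))}"

lemma open_box_shell: "open (box_shell n s :: ('a::nonarch_local_field ^ 'n::finite) set)"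
  unfolding open_vec_def
proof
  fix a :: "'a ^ 'n" assume a: "a \<in> box_shell n s"
  define A :: "'n \<Rightarrow> 'a set" where "A i = (if i \<in> s then ideal_pow (n i) \<inter> - ideal_pow (Suc (n i)) else ideal_pow (n i))" for i
  have "open (A i)" for i
    by (auto simp: A_def intro!: open_Int open_ideal_pow closed_ideal_pow open_Compl)
  then show "\<exists>A. (\<forall>i. open (A i) \<and> a $ i \<in> A i) \<and> (\<forall>y. (\<forall>i. y $ i \<in> A i) \<longrightarrow> y \<in> box_shell n s)"
    using a by (intro exI[of _ A]) (auto simp: A_def box_shell_def split: if_splits)
qed

lemma box_shell_borel: "box_shell n s \<in> sets (borel :: ('a::nonarch_local_field ^ 'n::finite) measure)"
  using open_box_shell by (rule borel_open)

text \<open>\<open>std_lattice\<close> is the disjoint union of \<open>q ^ (\<Sum>i. n i)\<close>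
  translates of the box, one for each vector of representatives, and all of them have the same
  volume.\<close>

lemma emeasure_box:
  fixes \<nu> :: "('a::nonarch_local_field ^ 'n::finite) measure"
  assumes \<nu>: "normalized_haar \<nu>"
  shows "emeasure \<nu> (box_shell n {}) = ennreal (inverse (res_card TYPE('a) ^ (\<Sum>i\<in>UNIV. n i)))"
proof -
  let ?q = "res_card TYPE('a)"
  have "\<exists>T. representatives (n i) (T :: 'a set) \<and> card T = CARD('a residue) ^ n i" for i
    by (rule representatives_exist)
  then obtain T :: "'n \<Rightarrow> 'a set" where T: "\<And>i. representatives (n i) (T i)"
    "\<And>i. card (T i) = CARD('a residue) ^ n i" by metis
  define V where "V = (\<lambda>f. \<chi> i. f i) ` (PiE UNIV T)"
  have inj: "inj_on (\<lambda>f. \<chi> i. f i) (PiE UNIV T)" by (rule inj_onI) (auto simp: vec_eq_iff fun_eq_iff)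
  have cV: "card V = CARD('a residue) ^ (\<Sum>i\<in>UNIV. n i)"
    unfolding V_def card_image[OF inj] by (simp add: card_PiE T(2) power_sum)
  have fV: "finite V" unfolding V_def
    by (intro finite_imageI finite_PiE) (auto intro: representativesD(1)[OF T(1)])
  have V: "v \<in> V \<longleftrightarrow> (\<forall>i. v $ i \<in> T i)" for v
  proof
    assume "\<forall>i. v $ i \<in> T i"
    then show "v \<in> V" unfolding V_def by (intro image_eqI[of _ _ "\<lambda>i. v $ i"]) auto
  qed (auto simp: V_def)
  define B where "B = (box_shell n {} :: ('a ^ 'n) set)"
  have B: "y \<in> B \<longleftrightarrow> (\<forall>i. y $ i \<in> ideal_pow (n i))" for y by (simp add: B_def box_shell_def)
  have tr: "y \<in> (\<lambda>z. v + z) ` B \<longleftrightarrow> (\<forall>i. y $ i - v $ i \<in> ideal_pow (n i))" for y v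
  proof
    assume "\<forall>i. y $ i - v $ i \<in> ideal_pow (n i)"
    then show "y \<in> (\<lambda>z. v + z) ` B" by (intro image_eqI[of _ _ "y - v"]) (auto simp: B)
  qed (auto simp: B)
  have sets: "sets \<nu> = sets borel" using \<nu> by (simp add: normalized_haar_def)
  have Bs: "B \<in> sets borel" unfolding B_def by (rule box_shell_borel)
  have op: "open ((\<lambda>z. v + z) ` B)" for v
    unfolding open_vec_congruent
  proof
    fix a assume "a \<in> (\<lambda>z. v + z) ` B"
    then have a: "a $ i - v $ i \<in> ideal_pow (n i)" for i using tr by blast
    have "x \<in> (\<lambda>z. v + z) ` B" if "\<forall>i. x $ i - a $ i \<in> ideal_pow (Max (range n))" for x
      unfolding tr
    proof
      fix i
      have "n i \<le> Max (range n)" by simp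
      then have "x $ i - a $ i \<in> ideal_pow (n i)" using that ideal_pow_mono by blast
      then show "x $ i - v $ i \<in> ideal_pow (n i)" using a ideal_pow_trans by blast
    qed
    then show "\<exists>m. \<forall>x. (\<forall>i. x $ i - a $ i \<in> ideal_pow m) \<longrightarrow> x \<in> (\<lambda>z. v + z) ` B" by blast
  qed
  have un: "std_lattice = (\<Union>v\<in>V. (\<lambda>z. v + z) ` B)"
  proof (intro equalityI subsetI)
    fix x :: "'a ^ 'n" assume "x \<in> std_lattice"
    then have "\<exists>t. t \<in> T i \<and> x $ i - t \<in> ideal_pow (n i)" for i
      using representativesD(3)[OF T(1), of "x $ i" i] by (auto simp: std_lattice_def)
    then obtain t where "\<And>i. t i \<in> T i \<and> x $ i - t i \<in> ideal_pow (n i)" by metis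
    then show "x \<in> (\<Union>v\<in>V. (\<lambda>z. v + z) ` B)"
      by (intro UN_I[of "\<chi> i. t i"]) (auto simp: V tr)
  next
    fix x assume "x \<in> (\<Union>v\<in>V. (\<lambda>z. v + z) ` B)"
    then obtain v where v: "v \<in> V" "\<And>i. x $ i - v $ i \<in> ideal_pow (n i)" using tr by blast
    have "x $ i \<in> integers" for i
    proof -
      have "v $ i \<in> integers" using v(1) representativesD(2)[OF T(1)] V by blast
      moreover have "x $ i - v $ i \<in> integers" using v(2) ideal_pow_integers by blast
      ultimately have "x $ i - v $ i + v $ i \<in> integers" by (metis ideal_pow_add)
      then show ?thesis by simp
    qed
    then show "x \<in> std_lattice" by (simp add: std_lattice_def)
  qed
  have dj: "disjoint_family_on (\<lambda>v. (\<lambda>z. v + z) ` B) V"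
    unfolding disjoint_family_on_def
  proof (intro ballI impI)
    fix v w assume vw: "v \<in> V" "w \<in> V" "v \<noteq> w"
    show "(\<lambda>z. v + z) ` B \<inter> (\<lambda>z. w + z) ` B = {}"
    proof (rule ccontr)
      assume "(\<lambda>z. v + z) ` B \<inter> (\<lambda>z. w + z) ` B \<noteq> {}"
      then obtain x where "x \<in> (\<lambda>z. v + z) ` B" "x \<in> (\<lambda>z. w + z) ` B" by blast
      then have "v $ i - w $ i \<in> ideal_pow (n i)" for i
        using tr[of x v] tr[of x w] ideal_pow_diff_commute[of "x $ i" "v $ i"]
          ideal_pow_trans[of "v $ i" "x $ i" "n i" "w $ i"] by blast
      then have "v $ i = w $ i" for i
        using representativesD(4)[OF T(1)] vw V by blast
      then show False using vw(3) by (simp add: vec_eq_iff)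
    qed
  qed
  have "1 = emeasure \<nu> (\<Union>v\<in>V. (\<lambda>z. v + z) ` B)"
    using \<nu> un by (simp add: normalized_haar_def)
  also have "\<dots> = (\<Sum>v\<in>V. emeasure \<nu> ((\<lambda>z. v + z) ` B))"
    by (rule sum_emeasure[symmetric]) (use sets op fV dj in \<open>auto intro: borel_open\<close>)
  also have "\<dots> = (\<Sum>v\<in>V. emeasure \<nu> B)"
    by (rule sum.cong) (use \<nu> Bs in \<open>auto simp: normalized_haar_def\<close>)
  also have "\<dots> = of_nat (card V) * emeasure \<nu> B" by simp
  also have "of_nat (card V) = ennreal (?q ^ (\<Sum>i\<in>UNIV. n i))"
    unfolding cV by (simp add: ennreal_of_nat_eq_real_of_nat)
  finally have 1: "1 = ennreal (?q ^ (\<Sum>i\<in>UNIV. n i)) * emeasure \<nu> B" .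
  have q: "0 < ?q ^ (\<Sum>i\<in>UNIV. n i)" using res_card_gt_1[where 'a='a] by simp
  have "emeasure \<nu> B = ennreal (inverse (?q ^ (\<Sum>i\<in>UNIV. n i))) * (ennreal (?q ^ (\<Sum>i\<in>UNIV. n i)) * emeasure \<nu> B)"
    using q by (simp add: mult.assoc[symmetric] ennreal_mult[symmetric])
  then show ?thesis using 1 by (simp add: B_def)
qed

text \<open>Induction on \<open>s\<close>: a ball in the coordinate \<open>j\<close> is the disjoint
  union of a shell and of the next smaller ball, whose share is \<open>1 / q\<close>. So each shell
  contributes the factor \<open>1 - 1 / q\<close>.\<close>

lemma emeasure_box_shell:
  fixes \<nu> :: "('a::nonarch_local_field ^ 'n::finite) measure"
  assumes \<nu>: "normalized_haar \<nu>"
  shows "emeasure \<nu> (box_shell n s) =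
    ennreal (inverse (res_card TYPE('a) ^ (\<Sum>i\<in>UNIV. n i)) * (1 - inverse (res_card TYPE('a))) ^ card s)"
proof -
  let ?q = "res_card TYPE('a)"
  have q: "1 < ?q" by (rule res_card_gt_1)
  have fin: "finite s" by simp
  have sets: "sets \<nu> = sets borel" using \<nu> by (simp add: normalized_haar_def)
  from fin show ?thesis
  proof (induction s arbitrary: n rule: finite_induct)
    case empty
    then show ?case using emeasure_box[OF \<nu>, of n] by simp
  next
    case (insert j s)
    define c where "c = inverse (?q ^ (\<Sum>i\<in>UNIV. n i)) * (1 - inverse ?q) ^ card s"
    have c0: "0 \<le> c" using q by (simp add: c_def field_simps)
    have split: "box_shell n s = box_shell n (insert j s) \<union> (box_shell (n(j := Suc (n j))) s :: ('a ^ 'n) set)"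
    proof -
      have "y \<in> box_shell n s \<longleftrightarrow> y \<in> box_shell n (insert j s) \<or> y \<in> box_shell (n(j := Suc (n j))) s"
        for y :: "'a ^ 'n"
        using insert.hyps(2) ideal_pow_mono[of "y $ j" "Suc (n j)" "n j"]
        by (cases "y $ j \<in> ideal_pow (Suc (n j))") (auto simp: box_shell_def split: if_splits)
      then show ?thesis by blast
    qed
    have dj: "box_shell n (insert j s) \<inter> (box_shell (n(j := Suc (n j))) s :: ('a ^ 'n) set) = {}"
      unfolding box_shell_def by (auto split: if_splits)
    have "emeasure \<nu> (box_shell n s) = emeasure \<nu> (box_shell n (insert j s)) + emeasure \<nu> (box_shell (n(j := Suc (n j))) s)"
      unfolding split by (rule plus_emeasure[symmetric]) (use sets dj box_shell_borel in auto)
    moreover have "emeasure \<nu> (box_shell n s) = ennreal c" unfolding c_def by (rule insert.IH)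
    moreover have s: "(\<Sum>i\<in>UNIV. (n(j := Suc (n j))) i) = Suc (\<Sum>i\<in>UNIV. n i)"
    proof -
      have "(\<Sum>i\<in>UNIV. (n(j := Suc (n j))) i) = (\<Sum>i\<in>UNIV. n i + (if i = j then 1 else 0))"
        by (rule sum.cong) auto
      then show ?thesis by (simp add: sum.distrib)
    qed
    have "emeasure \<nu> (box_shell (n(j := Suc (n j))) s) = ennreal (inverse ?q * c)"
      unfolding insert.IH s c_def by (simp add: mult.assoc)
    ultimately have e: "ennreal c = emeasure \<nu> (box_shell n (insert j s)) + ennreal (inverse ?q * c)" by simp
    then have "emeasure \<nu> (box_shell n (insert j s)) = ennreal c - ennreal (inverse ?q * c)"
      by (simp add: ennreal_add_diff_cancel_right)
    also have "\<dots> = ennreal (c - inverse ?q * c)" using c0 q by (intro ennreal_minus) auto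
    also have "c - inverse ?q * c = inverse (?q ^ (\<Sum>i\<in>UNIV. n i)) * (1 - inverse ?q) ^ card (insert j s)"
      using insert.hyps by (simp add: c_def algebra_simps)
    finally show ?case .
  qed
qed

lemma emeasure_coset_box:
  fixes \<nu> :: "('a::nonarch_local_field ^ 'n::finite) measure"
  assumes \<nu>: "normalized_haar \<nu>"
  shows "emeasure \<nu> {y. \<forall>i. y $ i - a $ i \<in> ideal_pow n} = ennreal (inverse (res_card TYPE('a) ^ (CARD('n) * n)))"
proof -
  have bs: "(box_shell (\<lambda>_. n) {} :: ('a ^ 'n) set) \<in> sets borel" by (rule box_shell_borel)
  have "{y. \<forall>i. y $ i - a $ i \<in> ideal_pow n} = (\<lambda>z. a + z) ` box_shell (\<lambda>_. n) {}"
  proof (intro equalityI subsetI)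
    fix y assume "y \<in> {y. \<forall>i. y $ i - a $ i \<in> ideal_pow n}"
    then show "y \<in> (\<lambda>z. a + z) ` box_shell (\<lambda>_. n) {}"
      by (intro image_eqI[of _ _ "y - a"]) (auto simp: box_shell_def)
  qed (auto simp: box_shell_def)
  then show ?thesis
    using \<nu> bs emeasure_box[OF \<nu>, of "\<lambda>_. n"]
    by (simp add: normalized_haar_def)
qed

section \<open>The Newton polygon of an irreducible cubic\<close>

text \<open>If the point of \<open>c2\<close> lies below the chord of the Newton polygon and is a
  vertex, the side of length one next to the constant term splits off a root of valuation
  \<open>ord c3 - ord c2\<close>. The substitution \<open>x = c3 / c2 * z\<close> turns the cubic
  into a fixed point equation whose higher coefficients lie in the maximal ideal.\<close>

lemma cubic_root_vertex_1:
  fixes c1 c2 c3 :: "'a::nonarch_local_field"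
  assumes "c2 \<noteq> 0" "c3 \<noteq> 0" "3 * ord c2 < 2 * ord c3" "c1 = 0 \<or> 2 * ord c2 < ord c1 + ord c3"
  shows "\<exists>x. x ^ 3 + c1 * x ^ 2 + c2 * x + c3 = 0"
proof -
  have b: "- (c1 * c3 / c2 ^ 2) \<in> ideal_pow 1"
    using assms by (cases "c1 = 0") (auto simp: ideal_pow_def ord_mult ord_inverse ord_power divide_inverse)
  have a: "- (c3 ^ 2 / c2 ^ 3) \<in> ideal_pow 1"
    using assms by (auto simp: ideal_pow_def ord_mult ord_inverse ord_power divide_inverse)
  obtain z where z: "z = - 1 + - (c1 * c3 / c2 ^ 2) * z ^ 2 + - (c3 ^ 2 / c2 ^ 3) * z ^ 3"
    using cubic_fixed_point[OF a b, of "-1"] by auto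
  have "(c3 / c2 * z) ^ 3 + c1 * (c3 / c2 * z) ^ 2 + c2 * (c3 / c2 * z) + c3 =
      c3 * (z - (- 1 + - (c1 * c3 / c2 ^ 2) * z ^ 2 + - (c3 ^ 2 / c2 ^ 3) * z ^ 3))"
    using assms(1) by (simp add: field_simps power2_eq_square power3_eq_cube)
  also have "\<dots> = 0" unfolding iffD2[OF right_minus_eq z] by simp
  finally show ?thesis by blast
qed

text \<open>The vertex at \<open>c1\<close>: the side of length one next to the leading term splits
  off a root of the same valuation as \<open>c1\<close>. Here it is the reciprocal variable
  \<open>w = c1 / x\<close> that satisfies the fixed point equation.\<close>

lemma cubic_root_vertex_2:
  fixes c1 c2 c3 :: "'a::nonarch_local_field"
  assumes "c1 \<noteq> 0" "c3 \<noteq> 0" "3 * ord c1 < ord c3" "c2 = 0 \<or> 2 * ord c1 < ord c2"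
  shows "\<exists>x. x ^ 3 + c1 * x ^ 2 + c2 * x + c3 = 0"
proof -
  have b: "- (c2 / c1 ^ 2) \<in> ideal_pow 1"
    using assms by (cases "c2 = 0") (auto simp: ideal_pow_def ord_mult ord_inverse ord_power divide_inverse)
  have a: "- (c3 / c1 ^ 3) \<in> ideal_pow 1"
    using assms by (auto simp: ideal_pow_def ord_mult ord_inverse ord_power divide_inverse)
  obtain w where w: "w = - 1 + - (c2 / c1 ^ 2) * w ^ 2 + - (c3 / c1 ^ 3) * w ^ 3"
    using cubic_fixed_point[OF a b, of "-1"] by auto
  have w0: "w \<noteq> 0"
  proof
    assume "w = 0"
    then show False using w by simp
  qed
  have "(c1 / w) ^ 3 + c1 * (c1 / w) ^ 2 + c2 * (c1 / w) + c3 =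
      (c1 / w) ^ 3 * (w - (- 1 + - (c2 / c1 ^ 2) * w ^ 2 + - (c3 / c1 ^ 3) * w ^ 3))"
    using assms(1) w0 by (simp add: field_simps power2_eq_square power3_eq_cube)
  also have "\<dots> = 0" unfolding iffD2[OF right_minus_eq w] by simp
  finally show ?thesis by blast
qed

text \<open>A point below the chord from \<open>c3\<close> to the leading coefficient cannot be a
  vertex, since that would give a root. So the other point must lie below the chord as well and
  shield it, which two points cannot do to each other.\<close>

lemma newton_cubic:
  fixes c1 c2 c3 :: "'a::nonarch_local_field"
  assumes c3: "c3 \<noteq> 0" and no_root: "\<And>x. x ^ 3 + c1 * x ^ 2 + c2 * x + c3 \<noteq> 0"
  shows "c1 = 0 \<or> ord c3 \<le> 3 * ord c1" "c2 = 0 \<or> 2 * ord c3 \<le> 3 * ord c2"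
proof -
  have v1: "c1 \<noteq> 0 \<and> ord c1 + ord c3 \<le> 2 * ord c2" if "c2 \<noteq> 0" "3 * ord c2 < 2 * ord c3"
    using cubic_root_vertex_1[of c2 c3 c1] that c3 no_root by force
  have v2: "c2 \<noteq> 0 \<and> ord c2 \<le> 2 * ord c1" if "c1 \<noteq> 0" "3 * ord c1 < ord c3"
    using cubic_root_vertex_2[of c1 c3 c2] that c3 no_root by force
  show "c2 = 0 \<or> 2 * ord c3 \<le> 3 * ord c2" using v1 v2 by linarith
  then show "c1 = 0 \<or> ord c3 \<le> 3 * ord c1" using v1 v2 by linarith
qed


section \<open>The characteristic polynomial of a three by three matrix\<close>

lemma charpoly_3:
  "charpoly X = [:- det X, X$1$1 * X$2$2 - X$1$2 * X$2$1 + (X$1$1 * X$3$3 - X$1$3 * X$3$1)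
     + (X$2$2 * X$3$3 - X$2$3 * X$3$2), - (X$1$1 + X$2$2 + X$3$3), 1:]"
  for X :: "'a::comm_ring_1 ^ 3 ^ 3"
  unfolding charpoly_def det_3 by (simp add: algebra_simps)

lemma rho_components:
  fixes X :: "'a::comm_ring_1 ^ 3 ^ 3"
  shows "rho X $ 1 = - (X$1$1 + X$2$2 + X$3$3)"
    "rho X $ 2 = X$1$1 * X$2$2 - X$1$2 * X$2$1 + (X$1$1 * X$3$3 - X$1$3 * X$3$1)
       + (X$2$2 * X$3$3 - X$2$3 * X$3$2)"
    "rho X $ 3 = - det X"
  by (simp_all add: rho_def charpoly_3 numeral_2_eq_2)

lemma charpoly_rho: "charpoly X = [:rho X $ 3, rho X $ 2, rho X $ 1, 1:]"
  for X :: "'a::comm_ring_1 ^ 3 ^ 3"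
  unfolding charpoly_3 rho_components ..

lemma charpoly_eq_iff_rho: "charpoly X = charpoly Y \<longleftrightarrow> rho X = rho Y"
  for X Y :: "'a::comm_ring_1 ^ 3 ^ 3"
  unfolding charpoly_rho by (auto simp: vec_eq_iff forall_3)

lemma drho_components:
  fixes X Y :: "'a::comm_ring_1 ^ 3 ^ 3"
  shows "drho X Y $ 1 = - (Y$1$1 + Y$2$2 + Y$3$3)"
    "drho X Y $ 2 = Y$1$1 * X$2$2 + X$1$1 * Y$2$2 - Y$1$2 * X$2$1 - X$1$2 * Y$2$1
       + Y$1$1 * X$3$3 + X$1$1 * Y$3$3 - Y$1$3 * X$3$1 - X$1$3 * Y$3$1
       + Y$2$2 * X$3$3 + X$2$2 * Y$3$3 - Y$2$3 * X$3$2 - X$2$3 * Y$3$2"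
    "drho X Y $ 3 =
       - (Y$1$1 * (X$2$2 * X$3$3 - X$2$3 * X$3$2) + X$1$1 * (Y$2$2 * X$3$3 + X$2$2 * Y$3$3 - Y$2$3 * X$3$2 - X$2$3 * Y$3$2)
        - Y$1$2 * (X$2$1 * X$3$3 - X$2$3 * X$3$1) - X$1$2 * (Y$2$1 * X$3$3 + X$2$1 * Y$3$3 - Y$2$3 * X$3$1 - X$2$3 * Y$3$1)
        + Y$1$3 * (X$2$1 * X$3$2 - X$2$2 * X$3$1) + X$1$3 * (Y$2$1 * X$3$2 + X$2$1 * Y$3$2 - Y$2$2 * X$3$1 - X$2$2 * Y$3$1))"
  by (simp_all add: drho_def rho_components det_3 algebra_simps)

lemma drho_add: "drho X (Y + Z) = drho X Y + drho X Z"
  for X Y Z :: "'a::comm_ring_1 ^ 3 ^ 3"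
  unfolding vec_eq_iff forall_3 vector_add_component drho_components by (simp add: algebra_simps)

lemma drho_scale: "drho X (mat_scale a Y) = a *s drho X Y"
  for X Y :: "'a::comm_ring_1 ^ 3 ^ 3"
  unfolding vec_eq_iff forall_3 vector_smult_component drho_components by (simp add: algebra_simps mat_scale_def)

section \<open>Three by three determinants of vectors\<close>

text \<open>The determinant with rows \<open>u\<close>, \<open>v\<close>, \<open>w\<close>, as an
  explicit polynomial, so that identities between minors reduce to
  \<open>algebra_simps\<close>.\<close>

definition tri :: "'a::comm_ring_1 ^ 3 \<Rightarrow> 'a ^ 3 \<Rightarrow> 'a ^ 3 \<Rightarrow> 'a" where
  "tri u v w = u$1 * (v$2 * w$3 - v$3 * w$2) - u$2 * (v$1 * w$3 - v$3 * w$1) + u$3 * (v$1 * w$2 - v$2 * w$1)"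

lemma cramer_3:
  fixes u v w r :: "'a::field ^ 3"
  assumes D: "tri u v w \<noteq> 0"
  shows "a *s u + b *s v + c *s w = r \<longleftrightarrow>
    a = tri r v w / tri u v w \<and> b = tri u r w / tri u v w \<and> c = tri u v r / tri u v w"
proof
  assume r: "a *s u + b *s v + c *s w = r"
  have "tri r v w = a * tri u v w" "tri u r w = b * tri u v w" "tri u v r = c * tri u v w"
    unfolding r[symmetric] by (simp_all add: tri_def algebra_simps)
  then show "a = tri r v w / tri u v w \<and> b = tri u r w / tri u v w \<and> c = tri u v r / tri u v w"
    using D by simp
next
  assume abc: "a = tri r v w / tri u v w \<and> b = tri u r w / tri u v w \<and> c = tri u v r / tri u v w"
  have "tri r v w * u $ i + tri u r w * v $ i + tri u v r * w $ i = tri u v w * r $ i" for i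
    using exhaust_3[of i] by (auto simp: tri_def algebra_simps)
  then have "(tri r v w * u $ i + tri u r w * v $ i + tri u v r * w $ i) / tri u v w = r $ i" for i
    using D by simp
  then show "a *s u + b *s v + c *s w = r"
    using abc by (simp add: vec_eq_iff add_divide_distrib)
qed

lemma alternating_form_add_multiple:
  assumes "alternating_form sm \<omega>" "i \<noteq> j"
  shows "\<omega> (f(i := f i + sm a (f j))) = \<omega> f"
proof -
  have "\<omega> (f(i := f i + sm a (f j))) = \<omega> (f(i := f i)) + \<omega> (f(i := sm a (f j)))"
    using assms unfolding alternating_form_def by blast
  also have "\<omega> (f(i := sm a (f j))) = a * \<omega> (f(i := f j))"
    using assms unfolding alternating_form_def by blast
  also have "\<omega> (f(i := f j)) = 0"
    using assms unfolding alternating_form_def by (metis fun_upd_other fun_upd_same)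
  finally show ?thesis by (simp only: fun_upd_triv mult_zero_right add_0_right)
qed

text \<open>Shears do not change an alternating form. They are carried out for one index outside
  \<open>J\<close> after the other; as the vectors indexed by \<open>J\<close> never move, the
  multiples to be added stay the same.\<close>

lemma alternating_form_add_multiples_3:
  fixes f g :: "'i::finite \<Rightarrow> 'v::ab_group_add"
  assumes \<omega>: "alternating_form sm \<omega>" and J: "j1 \<in> J" "j2 \<in> J" "j3 \<in> J"
    and g: "\<And>i. i \<in> J \<Longrightarrow> g i = f i"
    and g': "\<And>i. i \<notin> J \<Longrightarrow> \<exists>a b c. g i = f i + sm a (f j1) + sm b (f j2) + sm c (f j3)"
  shows "\<omega> g = \<omega> f"
proof -
  have "finite S \<Longrightarrow> S \<inter> J = {} \<Longrightarrow> \<omega> (\<lambda>i. if i \<in> S then g i else f i) = \<omega> f" for S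
  proof (induction S rule: finite_induct)
    case (insert i S)
    define h where "h = (\<lambda>i. if i \<in> S then g i else f i)"
    have h: "h i = f i" "h j1 = f j1" "h j2 = f j2" "h j3 = f j3"
      using insert J g by (auto simp: h_def)
    have ij: "i \<noteq> j1" "i \<noteq> j2" "i \<noteq> j3" using insert J by auto
    have "i \<notin> J" using insert by auto
    then obtain a b c where abc: "g i = f i + sm a (f j1) + sm b (f j2) + sm c (f j3)" using g' by blast
    define h1 where "h1 = h(i := h i + sm a (h j1))"
    define h2 where "h2 = h1(i := h1 i + sm b (h1 j2))"
    define h3 where "h3 = h2(i := h2 i + sm c (h2 j3))"
    have "h3 = (\<lambda>k. if k \<in> insert i S then g k else f k)"
      unfolding h3_def h2_def h1_def using ij h abc insert.hyps by (auto simp: fun_eq_iff h_def)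
    moreover have "\<omega> h3 = \<omega> h"
      unfolding h3_def h2_def h1_def
      using alternating_form_add_multiple[OF \<omega> ij(3)] alternating_form_add_multiple[OF \<omega> ij(2)]
        alternating_form_add_multiple[OF \<omega> ij(1)] by metis
    ultimately show ?case using insert h_def by auto
  qed simp
  from this[of "- J"] have "\<omega> (\<lambda>i. if i \<in> - J then g i else f i) = \<omega> f" by simp
  moreover have "(\<lambda>i. if i \<in> - J then g i else f i) = g" using g by auto
  ultimately show ?thesis by simp
qed

text \<open>Top forms on a three-dimensional space are proportional: transpositions reduce all
  values on triples of basis vectors to a single one. Antisymmetry is derived from the vanishing on
  equal arguments, which also covers characteristic two.\<close>

lemma alternating_form_tri:
  fixes \<omega> :: "(3 \<Rightarrow> 'a::field ^ 3) \<Rightarrow> 'a"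
  assumes \<omega>: "alternating_form (*s) \<omega>"
  shows "\<omega> v = tri (v 1) (v 2) (v 3) * \<omega> (\<lambda>i. axis i 1)"
proof -
  define F where "F u v w = \<omega> ((\<lambda>_. 0)(1 := u, 2 := v, 3 := w))" for u v w :: "'a ^ 3"
  have F: "\<omega> v = F (v 1) (v 2) (v 3)" for v
    unfolding F_def by (rule arg_cong[of _ _ \<omega>]) (auto simp: fun_eq_iff forall_3)
  have u1: "((\<lambda>_::3. 0)(1 := u, 2 := v, 3 := w)) = ((\<lambda>_::3. 0)(1 := 0, 2 := v, 3 := w))(1 := u)"
    and u2: "((\<lambda>_::3. 0)(1 := u, 2 := v, 3 := w)) = ((\<lambda>_::3. 0)(1 := u, 2 := 0, 3 := w))(2 := v)"
    and u3: "((\<lambda>_::3. 0)(1 := u, 2 := v, 3 := w)) = ((\<lambda>_::3. 0)(1 := u, 2 := v, 3 := 0))(3 := w)"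
    for u v w :: "'a ^ 3" by (auto simp: fun_eq_iff)
  have ad: "\<And>w i x y. \<omega> (w(i := x + y)) = \<omega> (w(i := x)) + \<omega> (w(i := y))"
    and sc: "\<And>w i a x. \<omega> (w(i := a *s x)) = a * \<omega> (w(i := x))"
    and alt: "\<And>w i j. i \<noteq> j \<Longrightarrow> w i = w j \<Longrightarrow> \<omega> w = 0"
    using \<omega> unfolding alternating_form_def by blast+
  have add: "F (x + y) v w = F x v w + F y v w" "F v (x + y) w = F v x w + F v y w" "F v w (x + y) = F v w x + F v w y"
    for x y v w unfolding F_def using ad u1 u2 u3 by metis+
  have scl: "F (a *s x) v w = a * F x v w" "F v (a *s x) w = a * F v x w" "F v w (a *s x) = a * F v w x"
    for a x v w unfolding F_def using sc u1 u2 u3 by metis+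
  have al: "F x x w = 0" "F x w x = 0" "F w x x = 0" for x w
    unfolding F_def by (rule alt[of 1 2], simp, simp, rule alt[of 1 3], simp, simp, rule alt[of 2 3], simp, simp)
  have sw1: "F x y w = - F y x w" for x y w
  proof -
    have "F (x + y) (x + y) w = 0" by (rule al)
    then show ?thesis unfolding add by (simp only: al add_0_left add_0_right eq_neg_iff_add_eq_0 add.commute)
  qed
  have sw2: "F w x y = - F w y x" for x y w
  proof -
    have "F w (x + y) (x + y) = 0" by (rule al)
    then show ?thesis unfolding add by (simp only: al add_0_left add_0_right eq_neg_iff_add_eq_0 add.commute)
  qed
  define e :: "3 \<Rightarrow> 'a ^ 3" where "e i = axis i 1" for i
  have basis: "x = x$1 *s e 1 + x$2 *s e 2 + x$3 *s e 3" for x :: "'a ^ 3"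
    by (auto simp: vec_eq_iff forall_3 e_def axis_def)
  have p1: "F (e 1) (e 3) (e 2) = - F (e 1) (e 2) (e 3)" by (rule sw2)
  have p2: "F (e 2) (e 1) (e 3) = - F (e 1) (e 2) (e 3)" by (rule sw1)
  have p3: "F (e 2) (e 3) (e 1) = F (e 1) (e 2) (e 3)"
    using trans[OF sw2[of "e 2" "e 3" "e 1"] arg_cong[OF p2, of uminus]] by simp
  have p4: "F (e 3) (e 1) (e 2) = F (e 1) (e 2) (e 3)"
    using trans[OF sw1[of "e 3" "e 1" "e 2"] arg_cong[OF p1, of uminus]] by simp
  have p5: "F (e 3) (e 2) (e 1) = - F (e 1) (e 2) (e 3)"
    using trans[OF sw1[of "e 3" "e 2" "e 1"] arg_cong[OF p3, of uminus]] by simp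
  have "F x y z = tri x y z * F (e 1) (e 2) (e 3)" for x y z
  proof -
    have "F x y z = F (x$1 *s e 1 + x$2 *s e 2 + x$3 *s e 3) (y$1 *s e 1 + y$2 *s e 2 + y$3 *s e 3)
        (z$1 *s e 1 + z$2 *s e 2 + z$3 *s e 3)"
      by (simp only: basis[symmetric])
    also have "\<dots> = tri x y z * F (e 1) (e 2) (e 3)"
      unfolding add scl al p1 p2 p3 p4 p5 by (simp add: tri_def algebra_simps)
    finally show ?thesis .
  qed
  from this[of "v 1" "v 2" "v 3"] show ?thesis
    unfolding F[of v] F[of "\<lambda>i. axis i 1"] e_def .
qed


section \<open>Volumes of coordinate charts\<close>

definition fill :: "(6 \<Rightarrow> 3 \<times> 3) \<Rightarrow> 'a::comm_ring_1 ^ 6 \<Rightarrow> 'a ^ 3 ^ 3" where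
  "fill e y = (\<chi> i j. \<Sum>k\<in>UNIV. if e k = (i, j) then y $ k else 0)"

definition entry :: "'a ^ 3 ^ 3 \<Rightarrow> 3 \<times> 3 \<Rightarrow> 'a" where
  "entry X P = X $ fst P $ snd P"

lemma elem_matrix_component: "elem_matrix P $ i $ j = (if (i, j) = P then 1 else 0)"
  by (simp add: elem_matrix_def)

lemma entry_elem_matrix: "entry (elem_matrix P) Q = (if P = Q then 1 else 0)"
  by (auto simp: entry_def elem_matrix_component)

lemma entry_simps [simp]:
  "entry (X + Y) P = entry X P + entry Y P" "entry (mat_scale a X) P = a * entry X P"
  by (simp_all add: entry_def mat_scale_def)

lemma matrix_eq_iff_entry: "X = Y \<longleftrightarrow> (\<forall>P. entry X P = entry Y P)"
  by (auto simp: entry_def vec_eq_iff)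

lemma entries_entry: "entries e X $ k = entry X (e k)"
  by (simp add: entries_def entry_def)

text \<open>The \<open>3\<close>-minor of the differential of \<open>rho\<close> in the columns
  \<open>p\<close>. The other six positions are the coordinates of the chart in which the entries at
  \<open>p\<close> are dependent.\<close>

definition partial_jacobian :: "(3 \<Rightarrow> 3 \<times> 3) \<Rightarrow> 'a::comm_ring_1 ^ 3 ^ 3 \<Rightarrow> 'a" where
  "partial_jacobian p X = tri (drho X (elem_matrix (p 1))) (drho X (elem_matrix (p 2))) (drho X (elem_matrix (p 3)))"

context
  fixes e :: "6 \<Rightarrow> 3 \<times> 3" and p :: "3 \<Rightarrow> 3 \<times> 3"
  assumes bij: "bij (case_sum e p)"
begin

lemma inj_e: "e k = e l \<longleftrightarrow> k = l"
  using bij_is_inj[OF bij] by (metis injD old.sum.inject(1) old.sum.simps(5))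

lemma inj_p: "p k = p l \<longleftrightarrow> k = l"
  using bij_is_inj[OF bij] by (metis injD old.sum.inject(2) old.sum.simps(6))

lemma e_neq_p: "e k \<noteq> p l"
  using bij_is_inj[OF bij] by (metis injD old.sum.distinct(1) old.sum.simps(5,6))

lemma positions_cases: "(\<exists>k. P = e k) \<or> P = p 1 \<or> P = p 2 \<or> P = p 3"
proof -
  obtain s where s: "P = case_sum e p s" using bij_is_surj[OF bij] by (metis surjD)
  then show ?thesis
    by (cases s) (auto simp: exhaust_3, metis exhaust_3)
qed

lemma entry_fill: "entry (fill e y) (e k) = y $ k" "entry (fill e y) (p l) = 0"
proof -
  have "(\<Sum>i\<in>UNIV. if e i = e k then y $ i else 0) = (\<Sum>i\<in>UNIV. if i = k then y $ i else 0)"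
    by (simp add: inj_e)
  then show "entry (fill e y) (e k) = y $ k" by (simp add: entry_def fill_def)
  show "entry (fill e y) (p l) = 0" by (simp add: entry_def fill_def e_neq_p)
qed

lemma entry_combination:
  fixes y :: "'a::comm_ring_1 ^ 6" and a b c :: 'a
  defines "Y \<equiv> fill e y + mat_scale a (elem_matrix (p 1)) + mat_scale b (elem_matrix (p 2)) + mat_scale c (elem_matrix (p 3))"
  shows "entry Y (e k) = y $ k" "entry Y (p 1) = a" "entry Y (p 2) = b" "entry Y (p 3) = c"
  using e_neq_p[of k, THEN not_sym]
  by (simp_all add: Y_def entry_fill entry_elem_matrix inj_p inj_e)

lemma matrix_decomposition:
  "Y = fill e (entries e Y) + mat_scale (entry Y (p 1)) (elem_matrix (p 1)) +
    mat_scale (entry Y (p 2)) (elem_matrix (p 2)) + mat_scale (entry Y (p 3)) (elem_matrix (p 3))"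
  for Y :: "'a::comm_ring_1 ^ 3 ^ 3"
  unfolding matrix_eq_iff_entry
proof
  fix P
  show "entry Y P = entry (fill e (entries e Y) + mat_scale (entry Y (p 1)) (elem_matrix (p 1)) +
    mat_scale (entry Y (p 2)) (elem_matrix (p 2)) + mat_scale (entry Y (p 3)) (elem_matrix (p 3))) P"
    using positions_cases[of P] by (auto simp only: entry_combination entries_entry)
qed

lemma drho_decomposition:
  "drho X Y = drho X (fill e (entries e Y)) + entry Y (p 1) *s drho X (elem_matrix (p 1)) +
    entry Y (p 2) *s drho X (elem_matrix (p 2)) + entry Y (p 3) *s drho X (elem_matrix (p 3))"
  for X Y :: "'a::comm_ring_1 ^ 3 ^ 3"
  by (subst matrix_decomposition[of Y]) (simp only: drho_add drho_scale)

text \<open>The linear implicit function theorem: once the six coordinates of a tangent vector are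
  prescribed, \<open>drho X Y = 0\<close> is a \<open>3 \<times> 3\<close> system for the remaining
  entries with determinant \<open>partial_jacobian p X\<close>.\<close>

lemma bij_betw_entries_tangent:
  fixes X :: "'a::field ^ 3 ^ 3"
  assumes D: "partial_jacobian p X \<noteq> 0"
  shows "bij_betw (entries e) (tangent X) UNIV"
proof (rule bij_betwI')
  fix Y Z assume Y: "Y \<in> tangent X" and Z: "Z \<in> tangent X"
  show "entries e Y = entries e Z \<longleftrightarrow> Y = Z"
  proof
    assume YZ: "entries e Y = entries e Z"
    have *: "entry W (p 1) *s drho X (elem_matrix (p 1)) + entry W (p 2) *s drho X (elem_matrix (p 2)) +
        entry W (p 3) *s drho X (elem_matrix (p 3)) = - drho X (fill e (entries e W))"
      if "W \<in> tangent X" for W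
    proof -
      have "drho X W = 0" using that by (simp add: tangent_def)
      then show ?thesis unfolding drho_decomposition[of X W]
        by (simp add: eq_neg_iff_add_eq_0 add.commute add.left_commute add.assoc)
    qed
    have "entry Y (p 1) = entry Z (p 1) \<and> entry Y (p 2) = entry Z (p 2) \<and> entry Y (p 3) = entry Z (p 3)"
      using *[OF Y] *[OF Z] cramer_3[OF D[unfolded partial_jacobian_def]] YZ by metis
    then show "Y = Z" using matrix_decomposition[of Y] matrix_decomposition[of Z] YZ by metis
  qed simp
next
  fix y :: "'a ^ 6"
  let ?D = "drho X \<circ> elem_matrix \<circ> p"
  obtain a b c where abc: "a *s ?D 1 + b *s ?D 2 + c *s ?D 3 = - drho X (fill e y)"
    using cramer_3[OF D[unfolded partial_jacobian_def], of _ _ _ "- drho X (fill e y)"] by auto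
  define Y where "Y = fill e y + mat_scale a (elem_matrix (p 1)) + mat_scale b (elem_matrix (p 2)) + mat_scale c (elem_matrix (p 3))"
  have Y: "entries e Y = y"
    by (simp add: vec_eq_iff entries_entry Y_def entry_combination del: entry_simps)
  moreover have "drho X Y = 0"
    using abc unfolding Y_def drho_add drho_scale
    by (simp add: eq_neg_iff_add_eq_0 add.commute add.left_commute add.assoc)
  ultimately show "\<exists>Y\<in>tangent X. y = entries e Y" by (auto simp: tangent_def)
qed auto

text \<open>The density of the quotient form in a chart is the inverse of the complementary minor.
  The frame vectors differ from elementary matrices only by multiples of those at \<open>p\<close>,
  so \<open>\<omega>_gl\<close> has absolute value one on the frame completed by the elementary
  matrices at \<open>p\<close>; on the other side \<open>\<omega>_A\<close> contributes the minor
  times a unit.\<close>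

lemma absval_quotient_form_coord_frame:
  fixes \<gamma> :: "'a::nonarch_local_field ^ 3 ^ 3"
  assumes gl: "normalized_gl_form \<omega>_gl" and A: "normalized_affine_form \<omega>_A"
    and Q: "quotient_form \<gamma> \<omega>_gl \<omega>_A \<omega>" and X: "X \<in> fiber \<gamma>"
    and D: "partial_jacobian p X \<noteq> 0"
  shows "absval (\<omega> X (coord_frame e X)) * absval (partial_jacobian p X) = 1"
proof -
  define w where "w = coord_frame e X"
  define v where "v = (\<lambda>i. elem_matrix (p i) :: 'a ^ 3 ^ 3)"
  note b = bij_betw_entries_tangent[OF D]
  have w: "w i \<in> tangent X" "entries e (w i) = axis i 1" for i
    using b unfolding w_def coord_frame_def bij_betw_def by (auto intro: inv_into_into f_inv_into_f)
  have fill_axis: "fill e (axis i 1) = (elem_matrix (e i) :: 'a ^ 3 ^ 3)" for i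
    unfolding matrix_eq_iff_entry
  proof
    fix P show "entry (fill e (axis i 1)) P = entry (elem_matrix (e i) :: 'a ^ 3 ^ 3) P"
      using positions_cases[of P] by (auto simp: entry_fill entry_elem_matrix inj_e e_neq_p axis_def)
  qed
  have "\<omega>_gl (case_sum w v) = \<omega>_gl (\<lambda>i. elem_matrix (case_sum e p i))"
  proof (rule alternating_form_add_multiples_3[of mat_scale _ "Inr 1" "range Inr" "Inr 2" "Inr 3"])
    show "alternating_form mat_scale \<omega>_gl" using gl by (simp add: normalized_gl_form_def)
    fix i :: "6 + 3" 
    show "case_sum w v i = elem_matrix (case_sum e p i)" if "i \<in> range Inr"
      using that by (auto simp: v_def)
    show "\<exists>a b c. case_sum w v i = elem_matrix (case_sum e p i) + mat_scale a (elem_matrix (case_sum e p (Inr 1)))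
        + mat_scale b (elem_matrix (case_sum e p (Inr 2))) + mat_scale c (elem_matrix (case_sum e p (Inr 3)))"
      if "i \<notin> range Inr"
    proof -
      obtain k where k: "i = Inl k" using \<open>i \<notin> range Inr\<close> by (cases i) auto
      show ?thesis using matrix_decomposition[of "w k"] unfolding w(2) fill_axis k by auto
    qed
  qed auto
  moreover have "absval (\<omega>_gl (\<lambda>i. elem_matrix (case_sum e p i))) = 1"
    by (rule gl[unfolded normalized_gl_form_def, THEN conjunct2, rule_format, OF bij])
  moreover have "\<omega>_gl (case_sum w v) = \<omega> X w * \<omega>_A (\<lambda>i. drho X (v i))"
    by (rule Q[unfolded quotient_form_def, rule_format, OF X]) (use w(1) in auto)
  moreover have "\<omega>_A (\<lambda>i. drho X (v i)) = partial_jacobian p X * \<omega>_A (\<lambda>i. axis i 1)"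
    using alternating_form_tri[of \<omega>_A "\<lambda>i. drho X (v i)"] A unfolding normalized_affine_form_def partial_jacobian_def v_def by blast
  moreover have "absval (\<omega>_A (\<lambda>i. axis i 1)) = 1" using A by (simp add: normalized_affine_form_def)
  ultimately show ?thesis by (simp add: absval_mult w_def)
qed

lemma emeasure_chart:
  fixes \<gamma> :: "'a::nonarch_local_field ^ 3 ^ 3"
  assumes gl: "normalized_gl_form \<omega>_gl" and A: "normalized_affine_form \<omega>_A"
    and Q: "quotient_form \<gamma> \<omega>_gl \<omega>_A \<omega>" and \<nu>: "normalized_haar \<nu>" and \<mu>: "form_measure \<gamma> \<omega> \<nu> \<mu>"
    and U: "openin (top_of_set (fiber \<gamma>)) U" and inj: "inj_on (entries e) U"
    and D: "\<And>X. X \<in> U \<Longrightarrow> same_ord m (partial_jacobian p X)"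
    and E: "entries e ` U \<in> sets borel"
  shows "emeasure \<mu> U = ennreal (res_card TYPE('a) ^ m) * emeasure \<nu> (entries e ` U)"
proof -
  have q: "0 < res_card TYPE('a) ^ m" using res_card_gt_1[where 'a='a] by simp
  have D0: "partial_jacobian p X \<noteq> 0" if "X \<in> U" for X
    using D[OF that] by (simp add: same_ord_iff)
  have UF: "U \<subseteq> fiber \<gamma>" using U openin_imp_subset by blast
  have "coord_chart \<gamma> e U"
    unfolding coord_chart_def using U inj bij_betw_entries_tangent D0 by blast
  then have "emeasure \<mu> U = (\<integral>\<^sup>+ y \<in> entries e ` U.
      (let X = inv_into U (entries e) y in ennreal (absval (\<omega> X (coord_frame e X)))) \<partial>\<nu>)"
    using \<mu> by (simp add: form_measure_def)
  also have "\<dots> = (\<integral>\<^sup>+ y. ennreal (res_card TYPE('a) ^ m) * indicator (entries e ` U) y \<partial>\<nu>)"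
  proof (rule nn_integral_cong)
    fix y
    show "(let X = inv_into U (entries e) y in ennreal (absval (\<omega> X (coord_frame e X)))) * indicator (entries e ` U) y =
      ennreal (res_card TYPE('a) ^ m) * indicator (entries e ` U) y"
    proof (cases "y \<in> entries e ` U")
      case True
      define X where "X = inv_into U (entries e) y"
      have X: "X \<in> U" using True by (simp add: X_def inv_into_into)
      have "absval (\<omega> X (coord_frame e X)) * inverse (res_card TYPE('a) ^ m) = 1"
        using absval_quotient_form_coord_frame[OF gl A Q _ D0[OF X]] X UF absval_same_ord[OF D[OF X]] by auto
      then have "absval (\<omega> X (coord_frame e X)) = res_card TYPE('a) ^ m"
        using q by (simp add: field_simps)
      then show ?thesis using True by (simp add: X_def Let_def)
    qed simp
  qed
  also have "\<dots> = ennreal (res_card TYPE('a) ^ m) * emeasure \<nu> (entries e ` U)"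
    using E \<nu> by (intro nn_integral_cmult_indicator) (simp add: normalized_haar_def)
  finally show ?thesis .
qed

end


section \<open>Volumes of balls in the fiber\<close>

definition cong_matrix :: "nat \<Rightarrow> 'a::discrete_valued_field ^ 'n ^ 'm \<Rightarrow> 'a ^ 'n ^ 'm \<Rightarrow> bool" where
  "cong_matrix n X Y \<longleftrightarrow> (\<forall>i j. X $ i $ j - Y $ i $ j \<in> ideal_pow n)"

lemma cong_matrix_entry: "cong_matrix n X Y \<longleftrightarrow> (\<forall>P. entry X P - entry Y P \<in> ideal_pow n)"
  for X Y :: "'a::discrete_valued_field ^ 3 ^ 3"
  by (auto simp: cong_matrix_def entry_def)

lemma integral_matrices_entry: "X \<in> integral_matrices \<longleftrightarrow> (\<forall>P. entry X P \<in> integers)"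
  for X :: "'a::discrete_valued_field ^ 3 ^ 3"
  by (auto simp: integral_matrices_def entry_def)

lemma open_cong_matrix: "open {X :: 'a::nonarch_local_field ^ 'n::finite ^ 'm::finite. cong_matrix n X X0}"
proof (rule open_matrix_congruent)
  fix A :: "'a ^ 'n ^ 'm" assume A: "A \<in> {X. cong_matrix n X X0}"
  show "\<exists>k. \<forall>X. (\<forall>i j. X $ i $ j - A $ i $ j \<in> ideal_pow k) \<longrightarrow> X \<in> {X. cong_matrix n X X0}"
    using A ideal_pow_trans unfolding cong_matrix_def mem_Collect_eq by (intro exI[of _ n]) blast
qed

lemma matrix_sum_elem:
  "Y = (\<Sum>P\<in>UNIV. mat_scale (entry Y P) (elem_matrix P))" for Y :: "'a::comm_ring_1 ^ 3 ^ 3"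
proof -
  have "entry (sum f A) P = (\<Sum>Q\<in>A. entry (f Q) P)" for f :: "3 \<times> 3 \<Rightarrow> 'a ^ 3 ^ 3" and A P
    by (simp add: entry_def)
  then show ?thesis
    by (simp add: matrix_eq_iff_entry entry_elem_matrix if_distrib[of "\<lambda>x. _ * x"] cong: if_cong)
qed

lemma tri_linear:
  "tri (u + u') v w = tri u v w + tri u' v w" "tri u (v + v') w = tri u v w + tri u v' w"
  "tri u v (w + w') = tri u v w + tri u v w'"
  "tri (a *s u) v w = a * tri u v w" "tri u (a *s v) w = a * tri u v w" "tri u v (a *s w) = a * tri u v w"
  by (simp_all add: tri_def algebra_simps)

lemma tri_zero [simp]: "tri 0 v w = 0" "tri u 0 w = 0" "tri u v 0 = 0"
  by (simp_all add: tri_def)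

lemma drho_0 [simp]: "drho X 0 = 0" for X :: "'a::comm_ring_1 ^ 3 ^ 3"
  using drho_add[of X 0 0] by simp

lemma integral_matrix_induct:
  fixes Y :: "'a::discrete_valued_field ^ 3 ^ 3"
  assumes "Y \<in> integral_matrices" "Q 0" "\<And>Y Z. Q Y \<Longrightarrow> Q Z \<Longrightarrow> Q (Y + Z)"
    "\<And>a P. a \<in> integers \<Longrightarrow> Q (mat_scale a (elem_matrix P))"
  shows "Q Y"
proof -
  have "Q (\<Sum>P\<in>A. mat_scale (entry Y P) (elem_matrix P))" for A
    by (induction A rule: infinite_finite_induct) (use assms in \<open>auto simp: integral_matrices_entry\<close>)
  from this[of UNIV] show ?thesis unfolding matrix_sum_elem[symmetric] .
qed

lemma tri_drho_mem:
  fixes X :: "'a::discrete_valued_field ^ 3 ^ 3"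
  assumes *: "\<And>P1 P2 P3. tri (drho X (elem_matrix P1)) (drho X (elem_matrix P2)) (drho X (elem_matrix P3)) \<in> ideal_pow k"
    and Y: "Y1 \<in> integral_matrices" "Y2 \<in> integral_matrices" "Y3 \<in> integral_matrices"
  shows "tri (drho X Y1) (drho X Y2) (drho X Y3) \<in> ideal_pow k"
proof -
  have 1: "tri (drho X Y1) (drho X (elem_matrix P2)) (drho X (elem_matrix P3)) \<in> ideal_pow k" for P2 P3
    by (rule integral_matrix_induct[OF Y(1)]) (auto simp: drho_add drho_scale tri_linear intro: * ideal_pow_add ideal_pow_mult_integer)
  have 2: "tri (drho X Y1) (drho X Y2) (drho X (elem_matrix P3)) \<in> ideal_pow k" for P3
    by (rule integral_matrix_induct[OF Y(2)]) (auto simp: drho_add drho_scale tri_linear intro: 1 ideal_pow_add ideal_pow_mult_integer)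
  show ?thesis
    by (rule integral_matrix_induct[OF Y(3)]) (auto simp: drho_add drho_scale tri_linear intro: 2 ideal_pow_add ideal_pow_mult_integer)
qed

text \<open>The number \<open>m\<close> is the valuation of the Jacobian of \<open>rho\<close> at \<open>X\<close>: the least valuation of its
  \<open>3\<close>-minors. Phrased with all integral directions it is visibly invariant under conjugation.\<close>

definition jacobian_ord :: "'a::discrete_valued_field ^ 3 ^ 3 \<Rightarrow> nat \<Rightarrow> bool" where
  "jacobian_ord X m \<longleftrightarrow>
    (\<forall>Y1\<in>integral_matrices. \<forall>Y2\<in>integral_matrices. \<forall>Y3\<in>integral_matrices.
       tri (drho X Y1) (drho X Y2) (drho X Y3) \<in> ideal_pow m) \<and>
    (\<exists>Y1\<in>integral_matrices. \<exists>Y2\<in>integral_matrices. \<exists>Y3\<in>integral_matrices.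
       same_ord m (tri (drho X Y1) (drho X Y2) (drho X Y3)))"

lemma elem_matrix_integral [simp]: "elem_matrix P \<in> integral_matrices"
  by (simp add: integral_matrices_def elem_matrix_def)

lemma extend_positions:
  fixes p :: "3 \<Rightarrow> 3 \<times> 3"
  assumes "inj p"
  obtains e :: "6 \<Rightarrow> 3 \<times> 3" where "bij (case_sum e p)"
proof -
  have "card (- range p) = 6"
    using card_image[OF assms] by (simp add: card_Diff_subset Compl_eq_Diff_UNIV)
  then obtain e :: "6 \<Rightarrow> 3 \<times> 3" where e: "bij_betw e UNIV (- range p)"
    using finite_same_card_bij[of "UNIV :: 6 set" "- range p"] by auto
  have "bij (case_sum e p)"
    unfolding bij_def
  proof
    show "inj (case_sum e p)"
      using e assms by (auto simp: inj_def bij_betw_def split: sum.splits) blast+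
    show "surj (case_sum e p)"
      unfolding surj_def
    proof
      fix P
      show "\<exists>s. P = case_sum e p s"
      proof (cases "P \<in> range p")
        case True
        then obtain k where "P = p k" by blast
        then show ?thesis by (intro exI[of _ "Inr k"]) simp
      next
        case False
        then have "P \<in> range e" using e by (simp add: bij_betw_def)
        then obtain k where "P = e k" by blast
        then show ?thesis by (intro exI[of _ "Inl k"]) simp
      qed
    qed
  qed
  then show thesis by (rule that)
qed

lemma tri_same [simp]: "tri u u w = 0" "tri u w u = 0" "tri w u u = 0"
  by (simp_all add: tri_def algebra_simps)

text \<open>By multilinearity it is enough to test elementary matrices: if all their minors were
  divisible by \<open>\<pi> ^ (m + 1)\<close>, so would be the one of valuation \<open>m\<close>.
  The three positions are distinct because \<open>tri\<close> vanishes on repeated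
  arguments.\<close>

lemma jacobian_ord_obtain:
  fixes X :: "'a::discrete_valued_field ^ 3 ^ 3"
  assumes "jacobian_ord X m"
  obtains e :: "6 \<Rightarrow> 3 \<times> 3" and p where "bij (case_sum e p)" "same_ord m (partial_jacobian p X)"
proof -
  have "\<exists>P1 P2 P3. \<not> tri (drho X (elem_matrix P1)) (drho X (elem_matrix P2)) (drho X (elem_matrix P3)) \<in> ideal_pow (Suc m)"
    using assms tri_drho_mem[of X "Suc m"] unfolding jacobian_ord_def same_ord_def by blast
  then obtain P1 P2 P3 where P: "tri (drho X (elem_matrix P1)) (drho X (elem_matrix P2)) (drho X (elem_matrix P3)) \<notin> ideal_pow (Suc m)"
    by blast
  define p :: "3 \<Rightarrow> 3 \<times> 3" where "p k = (if k = 1 then P1 else if k = 2 then P2 else P3)" for k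
  have p: "p 1 = P1" "p 2 = P2" "p 3 = P3" by (auto simp: p_def)
  have "P1 \<noteq> P2" "P1 \<noteq> P3" "P2 \<noteq> P3" using P by auto
  then have "x = y" if "p x = p y" for x y
    using exhaust_3[of x] exhaust_3[of y] p that by metis
  then have "inj p" by (rule injI)
  then obtain e :: "6 \<Rightarrow> 3 \<times> 3" where "bij (case_sum e p)" by (rule extend_positions)
  moreover have "same_ord m (partial_jacobian p X)"
    using P assms unfolding same_ord_def partial_jacobian_def p jacobian_ord_def by simp
  ultimately show thesis by (rule that)
qed

text \<open>The Taylor remainder of \<open>rho\<close> at \<open>X\<close>; all its monomials have
  degree at least two in \<open>H\<close>.\<close>

definition rho_remainder :: "'a::comm_ring_1 ^ 3 ^ 3 \<Rightarrow> 'a ^ 3 ^ 3 \<Rightarrow> 'a ^ 3" where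
  "rho_remainder X H = rho (X + H) - rho X - drho X H"

lemma rho_remainder_components:
  fixes X H :: "'a::comm_ring_1 ^ 3 ^ 3"
  shows "rho_remainder X H $ 1 = 0"
  "rho_remainder X H $ 2 = H$1$1 * H$2$2 - H$1$2 * H$2$1 + (H$1$1 * H$3$3 - H$1$3 * H$3$1)
       + (H$2$2 * H$3$3 - H$2$3 * H$3$2)"
  "rho_remainder X H $ 3 = - (X$1$1 * (H$2$2 * H$3$3 - H$2$3 * H$3$2) + X$2$2 * (H$1$1 * H$3$3 - H$1$3 * H$3$1)
     + X$3$3 * (H$1$1 * H$2$2 - H$1$2 * H$2$1) - X$1$2 * (H$2$1 * H$3$3 - H$2$3 * H$3$1)
     - X$2$1 * (H$1$2 * H$3$3 - H$1$3 * H$3$2) + X$1$3 * (H$2$1 * H$3$2 - H$2$2 * H$3$1)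
     + X$3$1 * (H$1$2 * H$2$3 - H$1$3 * H$2$2) - X$2$3 * (H$1$1 * H$3$2 - H$1$2 * H$3$1)
     - X$3$2 * (H$1$1 * H$2$3 - H$1$3 * H$2$1)
     + H$1$1 * (H$2$2 * H$3$3 - H$2$3 * H$3$2) - H$1$2 * (H$2$1 * H$3$3 - H$2$3 * H$3$1)
     + H$1$3 * (H$2$1 * H$3$2 - H$2$2 * H$3$1))"
  by (simp_all add: rho_remainder_def rho_components drho_components det_3 algebra_simps)

text \<open>A name for congruence that introduction rules can be resolved against, so that
  congruences between large polynomials are proved along their syntax tree.\<close>

definition prod_cong :: "nat \<Rightarrow> 'a::discrete_valued_field \<Rightarrow> 'a \<Rightarrow> bool" where
  "prod_cong k x y \<longleftrightarrow> x - y \<in> ideal_pow k"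

lemma prod_cong_intros:
  "prod_cong k x x" 
  "prod_cong k x y \<Longrightarrow> prod_cong k x' y' \<Longrightarrow> prod_cong k (x + x') (y + y')"
  "prod_cong k x y \<Longrightarrow> prod_cong k x' y' \<Longrightarrow> prod_cong k (x - x') (y - y')"
  "prod_cong k x y \<Longrightarrow> prod_cong k (- x) (- y)"
  "a \<in> integers \<Longrightarrow> prod_cong k x y \<Longrightarrow> prod_cong k (a * x) (a * y)"
proof -
  show "prod_cong k x x" by (simp add: prod_cong_def)
  show "prod_cong k x y \<Longrightarrow> prod_cong k x' y' \<Longrightarrow> prod_cong k (x + x') (y + y')"
    using ideal_pow_add[of "x - y" k "x' - y'"] by (simp add: prod_cong_def add_diff_add)
  show "prod_cong k x y \<Longrightarrow> prod_cong k x' y' \<Longrightarrow> prod_cong k (x - x') (y - y')"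
    using ideal_pow_diff[of "x - y" k "x' - y'"] by (simp add: prod_cong_def algebra_simps)
  show "prod_cong k x y \<Longrightarrow> prod_cong k (- x) (- y)"
    using ideal_pow_uminus[of "x - y" k] by (simp add: prod_cong_def)
  show "a \<in> integers \<Longrightarrow> prod_cong k x y \<Longrightarrow> prod_cong k (a * x) (a * y)"
    using ideal_pow_mult_integer(1)[of a "x - y" k] by (simp add: prod_cong_def algebra_simps)
qed

lemma prod_cong_mult:
  assumes "x \<in> integers" "y' \<in> integers" "prod_cong k x y" "prod_cong k x' y'"
  shows "prod_cong k (x * x') (y * y')"
proof -
  have e: "x * x' - y * y' = x * (x' - y') + (x - y) * y'" by (simp add: algebra_simps)
  show ?thesis unfolding prod_cong_def e using assms
    by (intro ideal_pow_add ideal_pow_mult_integer) (auto simp: prod_cong_def)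
qed

lemma prod_cong_mult_small:
  assumes "x \<in> ideal_pow n" "y' \<in> ideal_pow n" "prod_cong k x y" "prod_cong k x' y'"
  shows "prod_cong (n + k) (x * x') (y * y')"
proof -
  have e: "x * x' - y * y' = x * (x' - y') + y' * (x - y)" by (simp add: algebra_simps)
  show ?thesis unfolding prod_cong_def e using assms
    by (intro ideal_pow_add ideal_pow_mult) (auto simp: prod_cong_def)
qed

text \<open>Every monomial of the remainder has at least two factors from \<open>H\<close>. When
  \<open>H\<close> is replaced by \<open>H'\<close>, one factor supplies the difference, of order
  \<open>k\<close>, and another one the size \<open>n\<close>. This gain is what makes the iteration
  in \<open>local_solution\<close> contract.\<close>

lemma rho_remainder_cong:
  fixes X H H' :: "'a::discrete_valued_field ^ 3 ^ 3"
  assumes X: "\<And>i j. X $ i $ j \<in> integers" and H: "\<And>i j. H $ i $ j \<in> ideal_pow n"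
    and H': "\<And>i j. H' $ i $ j \<in> ideal_pow n" and k: "\<And>i j. H $ i $ j - H' $ i $ j \<in> ideal_pow k"
  shows "rho_remainder X H $ i - rho_remainder X H' $ i \<in> ideal_pow (n + k)"
proof -
  have q: "prod_cong (n + k) (H $ a $ b * H $ c $ d - H $ e $ f * H $ g $ h) (H' $ a $ b * H' $ c $ d - H' $ e $ f * H' $ g $ h)" 
    for a b c d e f g h
    by (intro prod_cong_intros prod_cong_mult_small) (use H H' k in \<open>auto simp: prod_cong_def\<close>)
  have c: "prod_cong (n + k) (H $ r $ s * (H $ a $ b * H $ c $ d - H $ e $ f * H $ g $ h)) (H' $ r $ s * (H' $ a $ b * H' $ c $ d - H' $ e $ f * H' $ g $ h))"
    for a b c d e f g h r s
  proof (rule prod_cong_mult_small)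
    show "H' $ a $ b * H' $ c $ d - H' $ e $ f * H' $ g $ h \<in> ideal_pow n"
      by (intro ideal_pow_diff ideal_pow_mult_integer(1)) (use H' in \<open>auto intro: ideal_pow_integers\<close>)
    show "prod_cong k (H $ a $ b * H $ c $ d - H $ e $ f * H $ g $ h) (H' $ a $ b * H' $ c $ d - H' $ e $ f * H' $ g $ h)"
      using q[of a b c d e f g h] ideal_pow_mono[of _ "n + k" k] by (simp add: prod_cong_def)
  qed (use H k in \<open>auto simp: prod_cong_def\<close>)
  have "prod_cong (n + k) (rho_remainder X H $ 1) (rho_remainder X H' $ 1)"
    "prod_cong (n + k) (rho_remainder X H $ 2) (rho_remainder X H' $ 2)"
    "prod_cong (n + k) (rho_remainder X H $ 3) (rho_remainder X H' $ 3)"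
    unfolding rho_remainder_components
    by (intro q c X prod_cong_intros)+
  then show ?thesis using exhaust_3[of i] by (auto simp: prod_cong_def)
qed

lemma tri_mem:
  assumes "\<And>i. u $ i \<in> ideal_pow k" "\<And>i. v $ i \<in> integers" "\<And>i. w $ i \<in> integers"
  shows "tri u v w \<in> ideal_pow k" "tri v u w \<in> ideal_pow k" "tri v w u \<in> ideal_pow k"
proof -
  have u: "tri u v w \<in> ideal_pow k" if "\<And>i. u $ i \<in> ideal_pow k" "\<And>i. v $ i \<in> integers" "\<And>i. w $ i \<in> integers" for u v w :: "'a ^ 3"
    unfolding tri_def by (intro ideal_pow_add ideal_pow_diff ideal_pow_mult_integer(2) that integers_mult)
  have "tri v u w = - tri u v w" "tri v w u = tri u v w" by (simp_all add: tri_def algebra_simps)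
  then show "tri u v w \<in> ideal_pow k" "tri v u w \<in> ideal_pow k" "tri v w u \<in> ideal_pow k" using u[OF assms] by simp_all
qed

lemma drho_integral:
  fixes X Y :: "'a::discrete_valued_field ^ 3 ^ 3"
  assumes "X \<in> integral_matrices" "Y \<in> integral_matrices"
  shows "drho X Y $ i \<in> integers"
proof -
  have X: "\<And>i j. X $ i $ j \<in> integers" and Y: "\<And>i j. Y $ i $ j \<in> integers"
    using assms by (auto simp: integral_matrices_def)
  have "drho X Y $ 1 \<in> integers" "drho X Y $ 2 \<in> integers" "drho X Y $ 3 \<in> integers"
    unfolding drho_components
    by (intro X Y ideal_pow_add ideal_pow_diff integers_mult iffD2[OF ideal_pow_uminus])+
  then show ?thesis using exhaust_3[of i] by auto
qed

lemma partial_jacobian_cong: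
  fixes X X' :: "'a::discrete_valued_field ^ 3 ^ 3"
  assumes X: "X \<in> integral_matrices" and X': "X' \<in> integral_matrices" and c: "cong_matrix n X X'"
  shows "partial_jacobian p X - partial_jacobian p X' \<in> ideal_pow n"
proof -
  have XX: "X $ i $ j \<in> integers" "X' $ i $ j \<in> integers" "prod_cong n (X $ i $ j) (X' $ i $ j)" for i j
    using assms by (auto simp: integral_matrices_def cong_matrix_def prod_cong_def)
  have "prod_cong n (drho X Y $ 1) (drho X' Y $ 1) \<and> prod_cong n (drho X Y $ 2) (drho X' Y $ 2)
     \<and> prod_cong n (drho X Y $ 3) (drho X' Y $ 3)" if Y: "Y \<in> integral_matrices" for Y
  proof -
    have Y': "Y $ i $ j \<in> integers" for i j using Y by (auto simp: integral_matrices_def)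
    show ?thesis unfolding drho_components
      by (intro conjI prod_cong_intros(2-4) prod_cong_mult prod_cong_intros(1) XX Y' ideal_pow_add ideal_pow_diff integers_mult)
  qed
  then have d: "prod_cong n (drho X Y $ i) (drho X' Y $ i)" if "Y \<in> integral_matrices" for Y i
    using exhaust_3[of i] that by auto
  have "prod_cong n (partial_jacobian p X) (partial_jacobian p X')"
    unfolding partial_jacobian_def tri_def
    by (intro prod_cong_intros(2-4) prod_cong_mult d drho_integral X X' ideal_pow_diff integers_mult elem_matrix_integral)
  then show ?thesis by (simp add: prod_cong_def)
qed


lemma entry_diff [simp]: "entry (X - Y) P = entry X P - entry Y P"
  by (simp add: entry_def)

lemma ld_measureE:
  assumes "ld_measure \<gamma> \<mu>"
  obtains \<omega>_gl \<omega>_A \<omega> \<nu> where "normalized_gl_form \<omega>_gl" "normalized_affine_form \<omega>_A"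
    "quotient_form \<gamma> \<omega>_gl \<omega>_A \<omega>" "normalized_haar \<nu>" "form_measure \<gamma> \<omega> \<nu> \<mu>"
  using assms unfolding ld_measure_def by blast

lemma emeasure_chart_box_shell:
  fixes \<gamma> :: "'a::nonarch_local_field ^ 3 ^ 3" and e :: "6 \<Rightarrow> 3 \<times> 3"
  assumes ld: "ld_measure \<gamma> \<mu>" and bij: "bij (case_sum e p)"
    and U: "openin (top_of_set (fiber \<gamma>)) U" and inj: "inj_on (entries e) U"
    and D: "\<And>X. X \<in> U \<Longrightarrow> same_ord m (partial_jacobian p X)"
    and E: "entries e ` U = box_shell n s"
  shows "emeasure \<mu> U = ennreal (res_card TYPE('a) ^ m * (inverse (res_card TYPE('a) ^ (\<Sum>i\<in>UNIV. n i)) *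
    (1 - inverse (res_card TYPE('a))) ^ card s))"
proof -
  have q: "1 < res_card TYPE('a)" by (rule res_card_gt_1)
  from ld obtain \<omega>_gl \<omega>_A \<omega> \<nu> where *: "normalized_gl_form \<omega>_gl" "normalized_affine_form \<omega>_A"
    "quotient_form \<gamma> \<omega>_gl \<omega>_A \<omega>" "normalized_haar \<nu>" "form_measure \<gamma> \<omega> \<nu> \<mu>" by (rule ld_measureE)
  have "entries e ` U \<in> sets borel" unfolding E by (rule box_shell_borel)
  from emeasure_chart[OF bij * U inj D this] show ?thesis
    unfolding E emeasure_box_shell[OF *(4)] using q
    by (subst ennreal_mult) (auto simp: field_simps)
qed

lemma emeasure_chart_coset:
  fixes \<gamma> :: "'a::nonarch_local_field ^ 3 ^ 3" and e :: "6 \<Rightarrow> 3 \<times> 3"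
  assumes ld: "ld_measure \<gamma> \<mu>" and bij: "bij (case_sum e p)"
    and U: "openin (top_of_set (fiber \<gamma>)) U" and inj: "inj_on (entries e) U"
    and D: "\<And>X. X \<in> U \<Longrightarrow> same_ord m (partial_jacobian p X)"
    and E: "entries e ` U = {y. \<forall>i. y $ i - a $ i \<in> ideal_pow n}"
  shows "emeasure \<mu> U = ennreal (res_card TYPE('a) ^ m * inverse (res_card TYPE('a) ^ (6 * n)))"
proof -
  have q: "1 < res_card TYPE('a)" by (rule res_card_gt_1)
  from ld obtain \<omega>_gl \<omega>_A \<omega> \<nu> where *: "normalized_gl_form \<omega>_gl" "normalized_affine_form \<omega>_A"
    "quotient_form \<gamma> \<omega>_gl \<omega>_A \<omega>" "normalized_haar \<nu>" "form_measure \<gamma> \<omega> \<nu> \<mu>" by (rule ld_measureE)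
  have "open {y :: 'a ^ 6. \<forall>i. y $ i - a $ i \<in> ideal_pow n}"
    unfolding open_vec_congruent using ideal_pow_trans by blast
  then have "entries e ` U \<in> sets borel" unfolding E by (rule borel_open)
  from emeasure_chart[OF bij * U inj D this] show ?thesis
    unfolding E emeasure_coset_box[OF *(4)] using q by (simp add: ennreal_mult)
qed

text \<open>Newton's method with a Jacobian that need not be a unit. Cramer's rule costs a division
  by a minor \<Delta> of valuation \<open>m\<close>. The linear term affords it because all minors
  are divisible by \<open>\<pi> ^ m\<close>, also those with the perturbation as a column; the
  remainder affords it because it has order \<open>2 n\<close> and \<open>m < n\<close>.\<close>

lemma local_solution:
  fixes \<gamma> :: "'a::nonarch_local_field ^ 3 ^ 3" and e :: "6 \<Rightarrow> 3 \<times> 3"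
  assumes bij: "bij (case_sum e p)" and X0: "X0 \<in> fiber \<gamma>" "X0 \<in> integral_matrices"
    and m: "jacobian_ord X0 m" and D: "same_ord m (partial_jacobian p X0)" and mn: "m < n"
    and y: "\<And>k. y $ k - entries e X0 $ k \<in> ideal_pow n"
  shows "\<exists>!X. X \<in> fiber \<gamma> \<and> cong_matrix n X X0 \<and> entries e X = y"
proof -
  obtain \<pi> :: 'a where \<pi>: "uniformizer \<pi>" using exists_uniformizer by blast
  define h where "h = y - entries e X0"
  have h: "h $ k \<in> ideal_pow n" for k using y by (simp add: h_def)
  define \<Delta> where "\<Delta> = partial_jacobian p X0"
  have \<Delta>0: "\<Delta> \<noteq> 0" using D by (simp add: \<Delta>_def same_ord_iff)
  define E where "E k = (elem_matrix (p k) :: 'a ^ 3 ^ 3)" for k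
  define d where "d k = drho X0 (E k)" for k
  have \<Delta>: "\<Delta> = tri (d 1) (d 2) (d 3)" by (simp add: \<Delta>_def partial_jacobian_def d_def E_def)
  have Ei: "E k \<in> integral_matrices" for k by (simp add: E_def)
  have di: "d k $ i \<in> integers" for k i unfolding d_def by (rule drho_integral[OF X0(2) Ei])
  define H where "H z = fill e h + mat_scale (z 1) (E 1) + mat_scale (z 2) (E 2) + mat_scale (z 3) (E 3)" for z :: "3 \<Rightarrow> 'a"
  have He: "entry (H z) (e k) = h $ k" "entry (H z) (p l) = z l" for z k l
  proof -
    show "entry (H z) (e k) = h $ k" unfolding H_def E_def by (rule entry_combination(1)[OF bij])
    show "entry (H z) (p l) = z l"
      using exhaust_3[of l] entry_combination(2-4)[OF bij] unfolding H_def E_def by metis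
  qed
  have Hm: "entry (H z) P \<in> ideal_pow k" if "\<And>i. h $ i \<in> ideal_pow k" "\<And>i. z i \<in> ideal_pow k" for z k P
    using positions_cases[OF bij, of P] He that by auto
  have Hd: "entry (H z) P - entry (H z') P \<in> ideal_pow k" if "\<And>i. z i - z' i \<in> ideal_pow k" for z z' k P
    using positions_cases[OF bij, of P] He[of z] He[of z'] that by auto
  define r where "r z = drho X0 (fill e h) + rho_remainder X0 (H z)" for z
  \<comment> \<open>Cramer's solution of \<open>rho (X0 + H z) = rho X0\<close> with the remainder
    evaluated at the previous iterate; the fixed points of \<open>F\<close> are the exact
    solutions.\<close>
  define F where "F z k = (if k = 1 then - tri (r z) (d 2) (d 3) / \<Delta> else if k = 2 then - tri (d 1) (r z) (d 3) / \<Delta>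
     else - tri (d 1) (d 2) (r z) / \<Delta>)" for z and k :: 3
  have F: "F z 1 = - tri (r z) (d 2) (d 3) / \<Delta>" "F z 2 = - tri (d 1) (r z) (d 3) / \<Delta>"
    "F z 3 = - tri (d 1) (d 2) (r z) / \<Delta>" for z by (auto simp: F_def)
  have rho_H: "rho (X0 + H z) = rho X0 + (r z + (z 1 *s d 1 + z 2 *s d 2 + z 3 *s d 3))" for z
  proof -
    have "rho (X0 + H z) = rho X0 + drho X0 (H z) + rho_remainder X0 (H z)"
      by (simp add: rho_remainder_def)
    also have "drho X0 (H z) = drho X0 (fill e h) + (z 1 *s d 1 + z 2 *s d 2 + z 3 *s d 3)"
      unfolding H_def d_def drho_add drho_scale by (simp add: add.assoc)
    finally show ?thesis by (simp add: r_def algebra_simps)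
  qed
  have fix_iff: "F z = z \<longleftrightarrow> rho (X0 + H z) = rho X0" for z
  proof -
    have "rho (X0 + H z) = rho X0 \<longleftrightarrow> z 1 *s d 1 + z 2 *s d 2 + z 3 *s d 3 = - r z"
      unfolding rho_H by (simp add: eq_neg_iff_add_eq_0 add.commute add.left_commute add.assoc)
    also have "\<dots> \<longleftrightarrow> z 1 = F z 1 \<and> z 2 = F z 2 \<and> z 3 = F z 3"
      unfolding cramer_3[OF \<Delta>0[unfolded \<Delta>]] F \<Delta>
      by (simp add: tri_def algebra_simps)
    also have "\<dots> \<longleftrightarrow> F z = z" by (auto simp: fun_eq_iff forall_3)
    finally show ?thesis by blast
  qed
  have X0i: "X0 $ i $ j \<in> integers" for i j using X0(2) by (simp add: integral_matrices_def)
  have rem_cong: "rho_remainder X0 (H z) $ i - rho_remainder X0 (H z') $ i \<in> ideal_pow (n + k)"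
    if "\<And>i. z i \<in> ideal_pow n" "\<And>i. z' i \<in> ideal_pow n" "\<And>i. z i - z' i \<in> ideal_pow k" for z z' k i
    by (rule rho_remainder_cong[OF X0i]) (use that Hm[OF h] Hd[of z z' k] in \<open>auto simp: entry_def\<close>)
  have rem0: "rho_remainder X0 (H z) $ i \<in> ideal_pow (n + n)" if "\<And>i. z i \<in> ideal_pow n" for z i
  proof -
    have "rho_remainder X0 (H z) $ i - rho_remainder X0 0 $ i \<in> ideal_pow (n + n)"
      by (rule rho_remainder_cong[OF X0i]) (use that Hm[OF h] in \<open>auto simp: entry_def\<close>)
    then show ?thesis by (simp add: rho_remainder_def)
  qed
  \<comment> \<open>Once \<open>\<pi> ^ n\<close> is taken out, an integral direction is left, to
    which the lower bound in \<open>jacobian_ord\<close> applies. This is where the minimality of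
    \<open>m\<close> among all minors enters.\<close>
  have fill_factor: "fill e h = mat_scale (\<pi> ^ n) (fill e (\<chi> k. h $ k / \<pi> ^ n))"
    using \<pi> uniformizer_nonzero[OF \<pi>] by (auto simp: fill_def mat_scale_def vec_eq_iff sum_distrib_left intro!: sum.cong)
  have fill_int: "fill e (\<chi> k. h $ k / \<pi> ^ n) \<in> integral_matrices"
    unfolding integral_matrices_def fill_def
    using ideal_pow_divide_power[OF \<pi>, of _ n 0] h by (auto intro!: ideal_pow_sum)
  have tri_fill: "tri (drho X0 (fill e h)) (d i) (d j) \<in> ideal_pow (n + m)"
    "tri (d i) (drho X0 (fill e h)) (d j) \<in> ideal_pow (n + m)"
    "tri (d i) (d j) (drho X0 (fill e h)) \<in> ideal_pow (n + m)" for i j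
    unfolding fill_factor drho_scale tri_linear d_def uniformizer_power_mult[OF \<pi>]
    using m Ei fill_int unfolding jacobian_ord_def by blast+
  have div: "x / \<Delta> \<in> ideal_pow k" if "x \<in> ideal_pow (m + k)" for x k
    using same_ord_divide[of m \<Delta> x k] D that by (simp add: \<Delta>_def)
  have "\<exists>!z. (\<forall>i. z i \<in> ideal_pow n) \<and> F z = z"
  proof (rule contraction_fixed_point)
    fix z :: "3 \<Rightarrow> 'a" and i assume z: "\<And>i. z i \<in> ideal_pow n"
    have rm: "rho_remainder X0 (H z) $ i \<in> ideal_pow (n + m)" for i
      by (rule ideal_pow_mono[OF rem0]) (use z mn in auto)
    have "F z 1 \<in> ideal_pow n" "F z 2 \<in> ideal_pow n" "F z 3 \<in> ideal_pow n"
      unfolding F r_def tri_linear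
      by (rule div, subst add.commute, subst ideal_pow_uminus, intro ideal_pow_add tri_fill tri_mem rm di)+
    then show "F z i \<in> ideal_pow n" using exhaust_3[of i] by auto
  next
    fix z z' :: "3 \<Rightarrow> 'a" and k i
    assume z: "\<And>i. z i \<in> ideal_pow n" "\<And>i. z' i \<in> ideal_pow n" "\<And>i. z i - z' i \<in> ideal_pow k"
    define u where "u = rho_remainder X0 (H z) - rho_remainder X0 (H z')"
    have u: "u $ i \<in> ideal_pow (m + Suc k)" for i
      unfolding u_def vector_minus_component
      by (rule ideal_pow_mono[OF rem_cong]) (use z mn in auto)
    have "r z = r z' + u" by (simp add: r_def u_def)
    then have "F z 1 - F z' 1 = - tri u (d 2) (d 3) / \<Delta>" "F z 2 - F z' 2 = - tri (d 1) u (d 3) / \<Delta>"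
      "F z 3 - F z' 3 = - tri (d 1) (d 2) u / \<Delta>"
      unfolding F by (simp_all add: tri_linear divide_inverse algebra_simps)
    moreover have "- tri u (d 2) (d 3) / \<Delta> \<in> ideal_pow (Suc k)" "- tri (d 1) u (d 3) / \<Delta> \<in> ideal_pow (Suc k)"
      "- tri (d 1) (d 2) u / \<Delta> \<in> ideal_pow (Suc k)"
      by (rule div, subst ideal_pow_uminus, intro tri_mem u di)+
    ultimately show "F z i - F z' i \<in> ideal_pow (Suc k)" using exhaust_3[of i] by auto
  qed
  then obtain z where z: "\<And>i. z i \<in> ideal_pow n" "F z = z"
    and uniq: "\<And>z'. (\<And>i. z' i \<in> ideal_pow n) \<Longrightarrow> F z' = z' \<Longrightarrow> z' = z" by blast
  show ?thesis
  proof (rule ex1I[of _ "X0 + H z"])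
    have "rho (X0 + H z) = rho X0" using z(2) fix_iff by blast
    moreover have "cong_matrix n (X0 + H z) X0" unfolding cong_matrix_entry using Hm[OF h z(1)] by simp
    moreover have "entries e (X0 + H z) = y"
      by (simp add: vec_eq_iff entries_entry He) (simp add: h_def entries_entry)
    ultimately show "X0 + H z \<in> fiber \<gamma> \<and> cong_matrix n (X0 + H z) X0 \<and> entries e (X0 + H z) = y"
      using X0(1) by (simp add: fiber_def)
  next
    fix X assume X: "X \<in> fiber \<gamma> \<and> cong_matrix n X X0 \<and> entries e X = y"
    define z' where "z' k = entry (X - X0) (p k)" for k
    have he: "entries e (X - X0) = h" using X by (auto simp: h_def vec_eq_iff entries_def)
    have XH: "X - X0 = H z'"
      unfolding H_def z'_def E_def by (rule matrix_decomposition[OF bij, of "X - X0", unfolded he])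
    then have X': "X = X0 + H z'" by (simp add: algebra_simps)
    have "z' i \<in> ideal_pow n" for i using X unfolding cong_matrix_entry z'_def entry_diff by blast
    moreover have "F z' = z'" unfolding fix_iff X'[symmetric] using X X0(1) by (simp add: fiber_def)
    ultimately have "z' = z" by (rule uniq)
    then show "X = X0 + H z" using X' by simp
  qed
qed

lemma integral_cong_matrix: "X \<in> integral_matrices \<Longrightarrow> cong_matrix n X' X \<Longrightarrow> X' \<in> integral_matrices"
  unfolding integral_matrices_def cong_matrix_def
  using ideal_pow_congruent ideal_pow_integers by blast

text \<open>By \<open>local_solution\<close> the entries at \<open>e\<close> map the ball
  bijectively onto a coordinate ball of the same radius, and the minor keeps its valuation
  \<open>m\<close> because it changes only modulo \<open>\<pi> ^ n\<close> with
  \<open>m < n\<close>. The chosen chart leaves no trace in the result.\<close>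

lemma emeasure_ball:
  fixes \<gamma> :: "'a::nonarch_local_field ^ 3 ^ 3"
  assumes ld: "ld_measure \<gamma> \<mu>" and X0: "X0 \<in> fiber \<gamma>" "X0 \<in> integral_matrices"
    and m: "jacobian_ord X0 m" and mn: "m < n"
  shows "emeasure \<mu> (fiber \<gamma> \<inter> {X. cong_matrix n X X0}) =
    ennreal (res_card TYPE('a) ^ m * inverse (res_card TYPE('a) ^ (6 * n)))"
proof -
  from m obtain e :: "6 \<Rightarrow> 3 \<times> 3" and p where bij: "bij (case_sum e p)" and D: "same_ord m (partial_jacobian p X0)"
    by (rule jacobian_ord_obtain)
  note sol = local_solution[OF bij X0 m D mn]
  have c: "entries e X $ k - entries e X0 $ k \<in> ideal_pow n" if "cong_matrix n X X0" for X k
    using that by (auto simp: entries_def cong_matrix_def)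
  show ?thesis
  proof (rule emeasure_chart_coset[OF ld bij])
    show "openin (top_of_set (fiber \<gamma>)) (fiber \<gamma> \<inter> {X. cong_matrix n X X0})"
      using open_cong_matrix by blast
    show "inj_on (entries e) (fiber \<gamma> \<inter> {X. cong_matrix n X X0})"
    proof (rule inj_onI)
      fix X X' assume X: "X \<in> fiber \<gamma> \<inter> {X. cong_matrix n X X0}" "X' \<in> fiber \<gamma> \<inter> {X. cong_matrix n X X0}"
        and e: "entries e X = entries e X'"
      have "\<exists>!Z. Z \<in> fiber \<gamma> \<and> cong_matrix n Z X0 \<and> entries e Z = entries e X'"
        using c X by (intro sol) auto
      then show "X = X'" using X e by (auto elim!: ex1E)
    qed
    show "entries e ` (fiber \<gamma> \<inter> {X. cong_matrix n X X0}) = {y. \<forall>i. y $ i - entries e X0 $ i \<in> ideal_pow n}"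
    proof (intro equalityI subsetI)
      fix y assume "y \<in> {y. \<forall>i. y $ i - entries e X0 $ i \<in> ideal_pow n}"
      then have "\<exists>!Z. Z \<in> fiber \<gamma> \<and> cong_matrix n Z X0 \<and> entries e Z = y" by (intro sol) auto
      then obtain Z where "Z \<in> fiber \<gamma> \<and> cong_matrix n Z X0 \<and> entries e Z = y" by (rule ex1E)
      then show "y \<in> entries e ` (fiber \<gamma> \<inter> {X. cong_matrix n X X0})" by blast
    qed (use c in auto)
    fix X assume X: "X \<in> fiber \<gamma> \<inter> {X. cong_matrix n X X0}"
    have "partial_jacobian p X - partial_jacobian p X0 \<in> ideal_pow n"
      using partial_jacobian_cong[of X X0 n p] X X0(2) integral_cong_matrix by blast
    then have "partial_jacobian p X - partial_jacobian p X0 \<in> ideal_pow (Suc m)"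
      using mn ideal_pow_mono by (metis Suc_leI)
    then show "same_ord m (partial_jacobian p X)" using same_ord_add[OF D] by fastforce
  qed
qed


section \<open>Invariance under conjugation\<close>

definition const_matrix :: "'a::comm_ring_1 ^ 'n ^ 'm \<Rightarrow> 'a poly ^ 'n ^ 'm" where
  "const_matrix A = (\<chi> i j. [:A $ i $ j:])"

lemma const_poly_sum: "[:sum f A:] = (\<Sum>i\<in>A. [:f i:])" for f :: "'i \<Rightarrow> 'b::comm_ring_1"
proof -
  have "[:a + b:] = [:a:] + [:b:]" for a b :: 'b by simp
  note add = this
  show ?thesis
    by (induction A rule: infinite_finite_induct) (simp_all add: add del: add_pCons)
qed

lemma const_matrix_mult: "const_matrix (A ** B) = const_matrix A ** const_matrix B"
  by (simp add: const_matrix_def matrix_matrix_mult_def vec_eq_iff const_poly_sum mult.commute)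

lemma const_matrix_one: "const_matrix (mat 1) = mat 1"
  by (simp add: const_matrix_def mat_def vec_eq_iff one_pCons)

lemma charpoly_conj:
  fixes g h X :: "'a::comm_ring_1 ^ 'n ^ 'n"
  assumes gh: "g ** h = mat 1"
  shows "charpoly (g ** X ** h) = charpoly X"
proof -
  define C where "C A = mat [:0, 1:] - const_matrix A" for A :: "'a ^ 'n ^ 'n"
  have C: "charpoly A = det (C A)" for A
    unfolding charpoly_def C_def by (rule arg_cong[of _ _ det]) (simp add: vec_eq_iff mat_def const_matrix_def)
  have "const_matrix g ** mat [:0, 1:] ** const_matrix h = mat [:0, 1:]"
  proof -
    have "const_matrix g ** mat [:0, 1:] = mat [:0, 1:] ** const_matrix g"
      by (simp add: vec_eq_iff matrix_matrix_mult_def mat_def if_distrib[of "\<lambda>x. _ * x"] if_distrib[of "\<lambda>x. x * _"] cong: if_cong)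
    then have "const_matrix g ** mat [:0, 1:] ** const_matrix h = mat [:0, 1:] ** const_matrix (g ** h)"
      by (simp add: const_matrix_mult matrix_mul_assoc)
    then show ?thesis by (simp add: gh const_matrix_one)
  qed
  then have "C (g ** X ** h) = const_matrix g ** C X ** const_matrix h"
    unfolding C_def const_matrix_mult
    by (simp add: vec_eq_iff matrix_matrix_mult_def algebra_simps sum_subtractf sum_distrib_left sum_distrib_right sum.distrib)
  then have "charpoly (g ** X ** h) = det (const_matrix (g ** h)) * charpoly X"
    by (simp add: C det_mul const_matrix_mult)
  then show ?thesis by (simp add: gh const_matrix_one)
qed

lemma rho_conj: "g ** h = mat 1 \<Longrightarrow> rho (g ** X ** h) = rho X"
  for g h X :: "'a::comm_ring_1 ^ 3 ^ 3"
  using charpoly_conj charpoly_eq_iff_rho by blast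

text \<open>\<open>drho\<close> is the \<epsilon>-coefficient of \<open>rho\<close> over the
  polynomial ring, where constant matrices act on \<open>X + \<epsilon> Y\<close> by conjugation. So
  the invariance of \<open>rho\<close> over every commutative ring contains that of its
  differential.\<close>

lemma drho_conj:
  fixes g h X Y :: "'a::comm_ring_1 ^ 3 ^ 3"
  assumes gh: "g ** h = mat 1"
  shows "drho (g ** X ** h) (g ** Y ** h) = drho X Y"
proof -
  define M where "M X Y = (\<chi> j k. [:X $ j $ k, Y $ j $ k:])" for X Y :: "'a ^ 3 ^ 3"
  have "const_matrix g ** M X Y ** const_matrix h = M (g ** X ** h) (g ** Y ** h)"
    by (simp add: M_def const_matrix_def vec_eq_iff matrix_matrix_mult_def sum_3 algebra_simps)
  moreover have "const_matrix g ** const_matrix h = mat 1"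
    by (simp add: gh const_matrix_one flip: const_matrix_mult)
  ultimately have "rho (M (g ** X ** h) (g ** Y ** h)) = rho (M X Y)"
    using rho_conj by metis
  then show ?thesis unfolding drho_def M_def by simp
qed

lemma integral_matrices_mult: "X \<in> integral_matrices \<Longrightarrow> Y \<in> integral_matrices \<Longrightarrow> X ** Y \<in> integral_matrices"
  unfolding integral_matrices_def matrix_matrix_mult_def by (auto intro!: ideal_pow_sum integers_mult)

lemma cong_matrix_mult:
  assumes "X \<in> integral_matrices" "Y' \<in> integral_matrices" "cong_matrix n X X'" "cong_matrix n Y Y'"
  shows "cong_matrix n (X ** Y) (X' ** Y')"
  unfolding cong_matrix_def
proof (intro allI)
  fix i j
  have "X $ i $ k * Y $ k $ j - X' $ i $ k * Y' $ k $ j \<in> ideal_pow n" for k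
    using prod_cong_mult[of "X $ i $ k" "Y' $ k $ j" n "X' $ i $ k" "Y $ k $ j"] assms
    by (simp add: integral_matrices_def cong_matrix_def prod_cong_def)
  then show "(X ** Y) $ i $ j - (X' ** Y') $ i $ j \<in> ideal_pow n"
    by (simp add: matrix_matrix_mult_def sum_subtractf[symmetric] ideal_pow_sum)
qed

lemma cong_matrix_refl [simp]: "cong_matrix n X X"
  by (simp add: cong_matrix_def)

lemma cong_matrix_sym: "cong_matrix n X Y \<Longrightarrow> cong_matrix n Y X"
  unfolding cong_matrix_def using ideal_pow_diff_commute by blast

lemma cong_matrix_trans: "cong_matrix n X Y \<Longrightarrow> cong_matrix n Y Z \<Longrightarrow> cong_matrix n X Z"
  unfolding cong_matrix_def using ideal_pow_trans by blast

lemma mat_mul_conj_cancel: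
  fixes g h X :: "'a::comm_ring_1 ^ 'n ^ 'n"
  assumes "g ** h = mat 1"
  shows "g ** (h ** X ** g) ** h = X"
proof -
  have "g ** (h ** X ** g) ** h = (g ** h) ** X ** (g ** h)"
    by (simp only: matrix_mul_assoc)
  then show ?thesis by (simp add: assms)
qed

text \<open>Conjugation by \<open>g\<close> permutes the integral directions, and
  \<open>jacobian_ord\<close> quantifies over all of them; elementary matrices alone would not be
  permuted.\<close>

lemma jacobian_ord_conj:
  fixes g h X :: "'a::discrete_valued_field ^ 3 ^ 3"
  assumes gh: "g ** h = mat 1" and i: "g \<in> integral_matrices" "h \<in> integral_matrices"
    and X: "jacobian_ord X m"
  shows "jacobian_ord (g ** X ** h) m"
proof -
  have hg: "h ** g = mat 1" using gh matrix_left_right_inverse by blast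
  have d: "drho (g ** X ** h) Y = drho X (h ** Y ** g)" for Y
    using drho_conj[OF gh, of X "h ** Y ** g"] mat_mul_conj_cancel[OF gh, of Y] by simp
  have i1: "h ** Y ** g \<in> integral_matrices" if "Y \<in> integral_matrices" for Y
    using that i by (intro integral_matrices_mult)
  have i2: "\<exists>Z\<in>integral_matrices. Y = h ** Z ** g" if "Y \<in> integral_matrices" for Y
    using that i by (intro bexI[of _ "g ** Y ** h"] integral_matrices_mult) (auto simp: mat_mul_conj_cancel[OF hg])
  show ?thesis unfolding jacobian_ord_def
  proof (intro conjI ballI)
    fix Y1 Y2 Y3 :: "'a ^ 3 ^ 3"
    assume "Y1 \<in> integral_matrices" "Y2 \<in> integral_matrices" "Y3 \<in> integral_matrices"
    then show "tri (drho (g ** X ** h) Y1) (drho (g ** X ** h) Y2) (drho (g ** X ** h) Y3) \<in> ideal_pow m"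
      using X i1 unfolding d jacobian_ord_def by blast
  next
    obtain Y1 Y2 Y3 where Y: "Y1 \<in> integral_matrices" "Y2 \<in> integral_matrices" "Y3 \<in> integral_matrices"
      "same_ord m (tri (drho X Y1) (drho X Y2) (drho X Y3))" using X unfolding jacobian_ord_def by blast
    obtain Z1 Z2 Z3 where "Z1 \<in> integral_matrices" "Z2 \<in> integral_matrices" "Z3 \<in> integral_matrices"
      "Y1 = h ** Z1 ** g" "Y2 = h ** Z2 ** g" "Y3 = h ** Z3 ** g" using Y(1-3) i2 by meson
    then show "\<exists>Y1\<in>integral_matrices. \<exists>Y2\<in>integral_matrices. \<exists>Y3\<in>integral_matrices.
       same_ord m (tri (drho (g ** X ** h) Y1) (drho (g ** X ** h) Y2) (drho (g ** X ** h) Y3))"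
      unfolding d using Y(4) by blast
  qed
qed

definition conj_by :: "'a::comm_ring_1 ^ 'n ^ 'n \<Rightarrow> 'a ^ 'n ^ 'n \<Rightarrow> 'a ^ 'n ^ 'n \<Rightarrow> 'a ^ 'n ^ 'n" where
  "conj_by g h X = g ** X ** h"

text \<open>Compactness of the integral matrices in the form of a finite number of classes modulo
  \<open>\<pi> ^ n\<close>.\<close>

lemma finite_classes:
  fixes \<gamma> :: "'a::nonarch_local_field ^ 3 ^ 3"
  assumes W: "W \<subseteq> integral_matrices"
  shows "finite ((\<lambda>X. fiber \<gamma> \<inter> {X'. cong_matrix n X' X}) ` W)"
proof -
  obtain T :: "'a set" where T: "representatives n T" using representatives_exist by blast
  define R where "R = (\<lambda>f. \<chi> i j. f (i, j)) ` (PiE (UNIV :: (3 \<times> 3) set) (\<lambda>_. T))"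
  have "finite R" unfolding R_def using representativesD(1)[OF T] by (intro finite_imageI finite_PiE) auto
  moreover have "(\<lambda>X. fiber \<gamma> \<inter> {X'. cong_matrix n X' X}) ` W \<subseteq> (\<lambda>X. fiber \<gamma> \<inter> {X'. cong_matrix n X' X}) ` R"
  proof
    fix V assume "V \<in> (\<lambda>X. fiber \<gamma> \<inter> {X'. cong_matrix n X' X}) ` W"
    then obtain X where X: "X \<in> W" "V = fiber \<gamma> \<inter> {X'. cong_matrix n X' X}" by blast
    have "\<exists>t. t \<in> T \<and> entry X P - t \<in> ideal_pow n" for P
      using representativesD(3)[OF T, of "entry X P"] W X(1) integral_matrices_entry by blast
    then obtain t where t: "\<And>P. t P \<in> T \<and> entry X P - t P \<in> ideal_pow n" by metis
    define Y where "Y = (\<chi> i j. t (i, j))"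
    have "Y \<in> R" unfolding R_def Y_def using t by (intro image_eqI[of _ _ t]) auto
    moreover have "cong_matrix n X Y" using t by (auto simp: cong_matrix_def Y_def entry_def)
    then have "V = fiber \<gamma> \<inter> {X'. cong_matrix n X' Y}"
      unfolding X(2) using cong_matrix_sym cong_matrix_trans by blast
    ultimately show "V \<in> (\<lambda>X. fiber \<gamma> \<inter> {X'. cong_matrix n X' X}) ` R" by blast
  qed
  ultimately show ?thesis by (meson finite_imageI finite_subset)
qed

text \<open>\<open>W\<close> is a finite disjoint union of balls of radius \<open>n\<close> in the
  fiber. A conjugation that is integral in both directions carries balls to balls of the same
  radius, and their volumes agree because \<open>jacobian_ord\<close> is preserved.\<close>

lemma emeasure_conj:
  fixes \<gamma> g h :: "'a::nonarch_local_field ^ 3 ^ 3"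
  assumes ld: "ld_measure \<gamma> \<mu>" and gh: "g ** h = mat 1" and i: "g \<in> integral_matrices" "h \<in> integral_matrices"
    and W: "W \<subseteq> fiber \<gamma>" "W \<subseteq> integral_matrices"
    and jac: "\<And>X. X \<in> W \<Longrightarrow> \<exists>m<n. jacobian_ord X m"
    and closed: "\<And>X X'. X \<in> W \<Longrightarrow> X' \<in> fiber \<gamma> \<Longrightarrow> cong_matrix n X' X \<Longrightarrow> X' \<in> W"
  shows "emeasure \<mu> (conj_by g h ` W) = emeasure \<mu> W"
proof -
  define V where "V X = fiber \<gamma> \<inter> {X'. cong_matrix n X' X}" for X
  define K where "K = V ` W"
  let ?\<phi> = "conj_by g h"
  have hg: "h ** g = mat 1" using gh matrix_left_right_inverse by blast
  have inv: "conj_by h g (conj_by g h X) = X" "conj_by g h (conj_by h g X) = X" for X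
    using mat_mul_conj_cancel[OF gh] mat_mul_conj_cancel[OF hg] by (simp_all add: conj_by_def)
  then have inj: "inj ?\<phi>" by (metis injI)
  have fib: "conj_by g h X \<in> fiber \<gamma> \<longleftrightarrow> X \<in> fiber \<gamma>" for X
    using rho_conj[OF gh, of X] by (simp add: fiber_def conj_by_def)
  have cong1: "cong_matrix n (conj_by g' h' X) (conj_by g' h' Y)"
    if "cong_matrix n X Y" "X \<in> integral_matrices" "Y \<in> integral_matrices" "g' \<in> integral_matrices" "h' \<in> integral_matrices" 
    for g' h' X Y
    using that unfolding conj_by_def by (intro cong_matrix_mult integral_matrices_mult) auto
  have \<phi>i: "?\<phi> X \<in> integral_matrices" if "X \<in> integral_matrices" for X
    using that i unfolding conj_by_def by (intro integral_matrices_mult)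
  have img: "?\<phi> ` V X = V (?\<phi> X)" if X: "X \<in> integral_matrices" for X
  proof (intro equalityI subsetI)
    fix Z assume "Z \<in> ?\<phi> ` V X"
    then obtain X' where "X' \<in> fiber \<gamma>" "cong_matrix n X' X" "Z = ?\<phi> X'" by (auto simp: V_def)
    then show "Z \<in> V (?\<phi> X)" unfolding V_def
      using fib cong1[of X' X g h] X i integral_cong_matrix by blast
  next
    fix Z assume Z: "Z \<in> V (?\<phi> X)"
    then have c: "cong_matrix n Z (?\<phi> X)" by (simp add: V_def)
    have "Z \<in> integral_matrices" using c \<phi>i[OF X] integral_cong_matrix by blast
    then have "cong_matrix n (conj_by h g Z) X"
      using cong1[OF c _ \<phi>i[OF X] i(2,1)] inv by simp
    moreover have "conj_by h g Z \<in> fiber \<gamma>" using Z fib[of "conj_by h g Z"] inv by (simp add: V_def)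
    ultimately have "conj_by h g Z \<in> V X" by (simp add: V_def)
    then show "Z \<in> ?\<phi> ` V X" using inv by (metis image_eqI)
  qed
  have V: "emeasure \<mu> (?\<phi> ` V X) = emeasure \<mu> (V X)" if X: "X \<in> W" for X
  proof -
    obtain m where m: "m < n" "jacobian_ord X m" using jac X by blast
    have XX: "X \<in> fiber \<gamma>" "X \<in> integral_matrices" using X W by auto
    have "emeasure \<mu> (V X) = ennreal (res_card TYPE('a) ^ m * inverse (res_card TYPE('a) ^ (6 * n)))"
      unfolding V_def by (rule emeasure_ball[OF ld XX m(2,1)])
    moreover have "emeasure \<mu> (V (?\<phi> X)) = ennreal (res_card TYPE('a) ^ m * inverse (res_card TYPE('a) ^ (6 * n)))"
      unfolding V_def
      by (rule emeasure_ball[OF ld _ \<phi>i[OF XX(2)] _ m(1)])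
        (use XX fib jacobian_ord_conj[OF gh i m(2)] in \<open>auto simp: conj_by_def\<close>)
    ultimately show ?thesis using img[OF XX(2)] by simp
  qed
  have sets: "sets \<mu> = sets (restrict_space borel (fiber \<gamma>))"
    using ld by (auto simp: ld_measure_def form_measure_def)
  have Vs: "V X \<in> sets \<mu>" for X
    unfolding sets sets_restrict_space V_def using open_cong_matrix[of n X] by (auto intro: borel_open)
  have OK: "W = (\<Union>C\<in>K. C)" unfolding K_def V_def using W(1) closed by auto
  have fin: "finite K" unfolding K_def V_def by (rule finite_classes[OF W(2)])
  have dj: "disjoint_family_on (\<lambda>C. C) K"
    unfolding disjoint_family_on_def
  proof (intro ballI impI)
    fix C D assume "C \<in> K" "D \<in> K" "C \<noteq> D"
    then obtain X Y where *: "C = V X" "D = V Y" by (auto simp: K_def)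
    show "C \<inter> D = {}"
    proof (rule ccontr)
      assume "C \<inter> D \<noteq> {}"
      then obtain Z where "cong_matrix n Z X" "cong_matrix n Z Y" using * by (auto simp: V_def)
      then have "cong_matrix n X Y" "cong_matrix n Y X" using cong_matrix_sym cong_matrix_trans by blast+
      then have "V X = V Y" unfolding V_def using cong_matrix_trans by blast
      then show False using * \<open>C \<noteq> D\<close> by simp
    qed
  qed
  have dj': "disjoint_family_on (\<lambda>C. ?\<phi> ` C) K"
    using dj unfolding disjoint_family_on_def by (metis image_Int[OF inj] image_empty)
  have Ks: "C \<in> sets \<mu>" "?\<phi> ` C \<in> sets \<mu>" if C: "C \<in> K" for C
  proof -
    obtain X where X: "X \<in> W" "C = V X" using C by (auto simp: K_def)
    then have "X \<in> integral_matrices" using W(2) by blast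
    then show "C \<in> sets \<mu>" "?\<phi> ` C \<in> sets \<mu>" using X(2) Vs img by auto
  qed
  have "emeasure \<mu> (?\<phi> ` W) = emeasure \<mu> (\<Union>C\<in>K. ?\<phi> ` C)" by (simp only: image_UN[symmetric] OK[symmetric])
  also have "\<dots> = (\<Sum>C\<in>K. emeasure \<mu> (?\<phi> ` C))"
    by (rule sum_emeasure[symmetric]) (use Ks dj' fin in auto)
  also have "\<dots> = (\<Sum>C\<in>K. emeasure \<mu> C)"
    by (rule sum.cong) (use V in \<open>auto simp: K_def\<close>)
  also have "\<dots> = emeasure \<mu> (\<Union>C\<in>K. C)"
    by (rule sum_emeasure) (use Ks dj fin in auto)
  also have "\<dots> = emeasure \<mu> W" by (simp only: OK[symmetric])
  finally show ?thesis .
qed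


section \<open>The orbit of a diagonal lattice\<close>

definition row_exp :: "nat \<Rightarrow> nat \<Rightarrow> 3 \<Rightarrow> nat" where
  "row_exp k1 k2 i = (if i = 1 then 0 else if i = 2 then k1 else k2)"

lemma row_exp_simps [simp]: "row_exp k1 k2 1 = 0" "row_exp k1 k2 2 = k1" "row_exp k1 k2 3 = k2"
  by (simp_all add: row_exp_def)

text \<open>Divisibility of the rows says that \<open>X\<close> factors as \<open>D Y\<close> with
  \<open>Y\<close> integral, so the image of \<open>X\<close> lies in that of \<open>D\<close>.
  Equality of the two images is not demanded: it will follow from \<open>k1 + k2\<close> being the
  valuation of the determinant.\<close>

definition diag_orbit :: "'a::discrete_valued_field ^ 3 ^ 3 \<Rightarrow> nat \<Rightarrow> nat \<Rightarrow> ('a ^ 3 ^ 3) set" where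
  "diag_orbit \<gamma> k1 k2 = {X \<in> fiber \<gamma>. \<forall>i j. X $ i $ j \<in> ideal_pow (row_exp k1 k2 i)}"

lemma diag_orbit_integral: "diag_orbit \<gamma> k1 k2 \<subseteq> integral_matrices"
  using ideal_pow_integers by (auto simp: diag_orbit_def integral_matrices_def)

lemma diag_orbit_cong:
  assumes "X \<in> diag_orbit \<gamma> k1 k2" "X' \<in> fiber \<gamma>" "cong_matrix n X' X" "k1 \<le> n" "k2 \<le> n"
  shows "X' \<in> diag_orbit \<gamma> k1 k2"
proof -
  have "X' $ i $ j \<in> ideal_pow (row_exp k1 k2 i)" for i j
  proof -
    have "X' $ i $ j - X $ i $ j \<in> ideal_pow (row_exp k1 k2 i)"
      by (rule ideal_pow_mono[of _ n]) (use assms in \<open>auto simp: cong_matrix_def row_exp_def\<close>)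
    moreover have "X $ i $ j \<in> ideal_pow (row_exp k1 k2 i)" using assms(1) by (simp add: diag_orbit_def)
    ultimately show ?thesis using ideal_pow_congruent by blast
  qed
  then show ?thesis using assms(2) by (simp add: diag_orbit_def)
qed

lemma openin_cong_matrix:
  fixes U :: "('a::nonarch_local_field ^ 3 ^ 3) set"
  assumes "U \<subseteq> fiber \<gamma>" "\<And>X X'. X \<in> U \<Longrightarrow> X' \<in> fiber \<gamma> \<Longrightarrow> cong_matrix n X' X \<Longrightarrow> X' \<in> U"
  shows "openin (top_of_set (fiber \<gamma>)) U"
proof -
  have "U = fiber \<gamma> \<inter> (\<Union>X\<in>U. {X'. cong_matrix n X' X})" using assms by force
  moreover have "open (\<Union>X\<in>U. {X'. cong_matrix n X' X})" using open_cong_matrix by blast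
  ultimately show ?thesis by (metis openin_open)
qed

lemma ex1_unique: "\<exists>!x. Q x \<Longrightarrow> Q a \<Longrightarrow> Q b \<Longrightarrow> a = b"
  by blast

text \<open>What is kept of the hypotheses on the characteristic polynomial. The bounds make
  \<open>y11\<close> and \<open>b2\<close> nonunits, and the exact valuation of the last coefficient
  makes \<open>u\<close>, the determinant of \<open>Y\<close>, a unit.\<close>

locale orbit_equations =
  fixes \<gamma> :: "'a::nonarch_local_field ^ 3 ^ 3" and \<pi> :: 'a and k1 k2 :: nat
  assumes uniformizer: "uniformizer \<pi>" and k1: "1 \<le> k1" and k12: "k1 \<le> k2"
    and c1: "rho \<gamma> $ 1 \<in> ideal_pow 1" and c2: "rho \<gamma> $ 2 \<in> ideal_pow (Suc k1)"
    and c3: "same_ord (k1 + k2) (rho \<gamma> $ 3)"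
begin

abbreviation "p \<equiv> \<pi> ^ k1"
abbreviation "r \<equiv> \<pi> ^ k2"
abbreviation "P \<equiv> \<pi> ^ (k2 - k1)"

definition "b2 = rho \<gamma> $ 2 / p"
definition "u = - rho \<gamma> $ 3 / (p * r)"

lemma pi_nonzero [simp]: "\<pi> \<noteq> 0" using uniformizer by (rule uniformizer_nonzero)

lemma r_eq: "r = p * P" using k12 by (simp flip: power_add)

lemma p_mem: "p \<in> ideal_pow 1" using uniformizer_power_mem'[OF uniformizer k1] .

lemma r_mem: "r \<in> ideal_pow 1" using uniformizer_power_mem'[OF uniformizer] k1 k12 by simp

lemma P_integer: "P \<in> integers" using uniformizer_power_mem'[OF uniformizer] by simp

lemma b2_mem: "b2 \<in> ideal_pow 1"
  unfolding b2_def using ideal_pow_divide_power[OF uniformizer, of _ k1 1] c2 by simp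

lemma u_unit: "ounit u"
proof -
  have "same_ord (k1 + k2) (p * r)"
    using same_ord_mult same_ord_uniformizer_power[OF uniformizer] by blast
  then show ?thesis using c3 by (auto simp: u_def same_ord_iff ounit_iff divide_inverse ord_mult ord_inverse)
qed

text \<open>Left multiplication by the diagonal matrix \<open>D\<close>.\<close>

definition dm :: "'a ^ 3 ^ 3 \<Rightarrow> 'a ^ 3 ^ 3" where
  "dm Y = (\<chi> i j. \<pi> ^ row_exp k1 k2 i * Y $ i $ j)"

lemma dm_components [simp]: "dm Y $ 1 $ j = Y $ 1 $ j" "dm Y $ 2 $ j = p * Y $ 2 $ j" "dm Y $ 3 $ j = r * Y $ 3 $ j"
  by (simp_all add: dm_def)

lemma entry_dm: "entry (dm Y) Q = \<pi> ^ row_exp k1 k2 (fst Q) * entry Y Q"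
  by (simp add: entry_def dm_def)

lemma dm_inj: "dm Y = dm Z \<longleftrightarrow> Y = Z"
  by (auto simp: matrix_eq_iff_entry entry_dm)

text \<open>With \<open>X = dm Y\<close>, the three equations fix the trace, the second coefficient divided by \<open>\<pi>^k\<^sub>1\<close>, and
  \<open>det Y\<close>.\<close>

definition sol :: "'a ^ 3 ^ 3 \<Rightarrow> bool" where
  "sol Y \<longleftrightarrow> Y \<in> integral_matrices \<and>
     Y$1$1 + p * Y$2$2 + r * Y$3$3 = - rho \<gamma> $ 1 \<and>
     Y$1$1 * Y$2$2 - Y$1$2 * Y$2$1 + P * (Y$1$1 * Y$3$3 - Y$1$3 * Y$3$1) + r * (Y$2$2 * Y$3$3 - Y$2$3 * Y$3$2) = b2 \<and>
     Y$1$1 * (Y$2$2 * Y$3$3 - Y$2$3 * Y$3$2) - Y$1$2 * (Y$2$1 * Y$3$3 - Y$2$3 * Y$3$1)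
       + Y$1$3 * (Y$2$1 * Y$3$2 - Y$2$2 * Y$3$1) = u"

lemma fiber_dm: "dm Y \<in> fiber \<gamma> \<longleftrightarrow>
     Y$1$1 + p * Y$2$2 + r * Y$3$3 = - rho \<gamma> $ 1 \<and>
     Y$1$1 * Y$2$2 - Y$1$2 * Y$2$1 + P * (Y$1$1 * Y$3$3 - Y$1$3 * Y$3$1) + r * (Y$2$2 * Y$3$3 - Y$2$3 * Y$3$2) = b2 \<and>
     Y$1$1 * (Y$2$2 * Y$3$3 - Y$2$3 * Y$3$2) - Y$1$2 * (Y$2$1 * Y$3$3 - Y$2$3 * Y$3$1)
       + Y$1$3 * (Y$2$1 * Y$3$2 - Y$2$2 * Y$3$1) = u" (is "_ \<longleftrightarrow> ?T \<and> ?C \<and> ?D")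
proof -
  have 1: "rho (dm Y) $ 1 = rho \<gamma> $ 1 \<longleftrightarrow> ?T"
    unfolding rho_components(1)[of "dm Y"] dm_components by (metis minus_minus)
  have "rho (dm Y) $ 2 = p * (Y$1$1 * Y$2$2 - Y$1$2 * Y$2$1 + P * (Y$1$1 * Y$3$3 - Y$1$3 * Y$3$1)
      + r * (Y$2$2 * Y$3$3 - Y$2$3 * Y$3$2))"
    unfolding rho_components dm_components by (simp add: algebra_simps r_eq)
  then have 2: "rho (dm Y) $ 2 = rho \<gamma> $ 2 \<longleftrightarrow> ?C" by (auto simp: b2_def field_simps)
  have "rho (dm Y) $ 3 = - (p * r) * (Y$1$1 * (Y$2$2 * Y$3$3 - Y$2$3 * Y$3$2)
      - Y$1$2 * (Y$2$1 * Y$3$3 - Y$2$3 * Y$3$1) + Y$1$3 * (Y$2$1 * Y$3$2 - Y$2$2 * Y$3$1))"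
    unfolding rho_components dm_components det_3 by (simp add: algebra_simps)
  moreover have "rho \<gamma> $ 3 = - (p * r) * u" by (simp add: u_def)
  ultimately have "rho (dm Y) $ 3 = rho \<gamma> $ 3 \<longleftrightarrow> ?D" by (simp only: mult_cancel_left) simp
  with 1 2 show ?thesis by (auto simp: fiber_def vec_eq_iff forall_3)
qed

lemma diag_orbit_dm: "dm Y \<in> diag_orbit \<gamma> k1 k2 \<longleftrightarrow> sol Y"
proof -
  have "(\<forall>i j. dm Y $ i $ j \<in> ideal_pow (row_exp k1 k2 i)) \<longleftrightarrow> Y \<in> integral_matrices"
    unfolding dm_def integral_matrices_def
    using uniformizer_power_mult[OF uniformizer, of _ _ 0] by simp
  then show ?thesis unfolding diag_orbit_def sol_def using fiber_dm[of Y] by blast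
qed

lemma diag_orbit_eq: "diag_orbit \<gamma> k1 k2 = dm ` {Y. sol Y}"
proof (intro equalityI subsetI)
  fix X assume X: "X \<in> diag_orbit \<gamma> k1 k2"
  define Y where "Y = (\<chi> i j. X $ i $ j / \<pi> ^ row_exp k1 k2 i)"
  have "X = dm Y" by (simp add: dm_def Y_def vec_eq_iff)
  then show "X \<in> dm ` {Y. sol Y}" using X diag_orbit_dm by blast
qed (use diag_orbit_dm in auto)

text \<open>A chart: the entries at \<open>P1\<close>, \<open>P2\<close>, \<open>P3\<close> are solved for in terms of the other six, of which the one
  at \<open>Q\<close> has valuation at least \<open>N Q\<close>, with equality for \<open>Q\<close> in \<open>S\<close>.\<close>

lemma emeasure_piece:
  assumes ld: "ld_measure \<gamma> \<mu>" and dist: "P1 \<noteq> P2" "P1 \<noteq> P3" "P2 \<noteq> P3"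
    and S: "S \<inter> {P1, P2, P3} = {}"
    and bx: "\<And>Y. bx Y \<longleftrightarrow> (\<forall>Q. Q \<notin> {P1, P2, P3} \<longrightarrow>
      entry Y Q \<in> ideal_pow (N Q) \<and> (Q \<in> S \<longrightarrow> entry Y Q \<notin> ideal_pow (Suc (N Q))))"
    and solve: "\<And>W. W \<in> integral_matrices \<Longrightarrow> bx W \<Longrightarrow>
      \<exists>!Y. sol Y \<and> (\<forall>Q. Q \<notin> {P1, P2, P3} \<longrightarrow> entry Y Q = entry W Q)"
    and jac: "\<And>Y. sol Y \<Longrightarrow> bx Y \<Longrightarrow> same_ord m (tri (drho (dm Y) (elem_matrix P1))
      (drho (dm Y) (elem_matrix P2)) (drho (dm Y) (elem_matrix P3)))"
  shows "emeasure \<mu> (dm ` {Y. sol Y \<and> bx Y}) =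
    ennreal (res_card TYPE('a) ^ m * (inverse (res_card TYPE('a) ^ (\<Sum>Q\<in>- {P1, P2, P3}. row_exp k1 k2 (fst Q) + N Q)) *
      (1 - inverse (res_card TYPE('a))) ^ card S))"
proof -
  define pos :: "3 \<Rightarrow> 3 \<times> 3" where "pos k = (if k = 1 then P1 else if k = 2 then P2 else P3)" for k
  have pos: "pos 1 = P1" "pos 2 = P2" "pos 3 = P3" by (auto simp: pos_def)
  have rpos: "range pos = {P1, P2, P3}" using pos by (auto simp: UNIV_3)
  have "x = y" if "pos x = pos y" for x y
    using exhaust_3[of x] exhaust_3[of y] pos dist that by metis
  then have "inj pos" by (rule injI)
  then obtain e :: "6 \<Rightarrow> 3 \<times> 3" where bij: "bij (case_sum e pos)" by (rule extend_positions)
  have re: "range e = - {P1, P2, P3}"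
  proof -
    have "e k \<noteq> P1" "e k \<noteq> P2" "e k \<noteq> P3" for k using e_neq_p[OF bij, of k] pos by metis+
    moreover have "(\<exists>k. Q = e k) \<or> Q = P1 \<or> Q = P2 \<or> Q = P3" for Q
      using positions_cases[OF bij, of Q] pos by simp
    ultimately show ?thesis by blast
  qed
  have inje: "inj e" using inj_e[OF bij] by (simp add: inj_def)
  \<comment> \<open>The entry of \<open>dm Y\<close> at \<open>Q\<close> is that of \<open>Y\<close>
    times a power of \<pi> given by the row, so the conditions on \<open>Y\<close> become a box in
    the entries of \<open>X\<close> with radii shifted accordingly.\<close>
  define n where "n k = row_exp k1 k2 (fst (e k)) + N (e k)" for k
  define s where "s = e -` S"
  define U where "U = dm ` {Y. sol Y \<and> bx Y}"
  have cs: "card s = card S"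
    unfolding s_def by (rule card_vimage_inj[OF inje]) (use S re in auto)
  have sn: "(\<Sum>k\<in>UNIV. n k) = (\<Sum>Q\<in>- {P1, P2, P3}. row_exp k1 k2 (fst Q) + N Q)"
    unfolding n_def re[symmetric] by (simp add: sum.reindex[OF inje] o_def)
  have shell: "entries e (dm Y) \<in> box_shell n s \<longleftrightarrow> bx Y" for Y
  proof -
    have "entries e (dm Y) \<in> box_shell n s \<longleftrightarrow> (\<forall>k. entry Y (e k) \<in> ideal_pow (N (e k)) \<and>
        (e k \<in> S \<longrightarrow> entry Y (e k) \<notin> ideal_pow (Suc (N (e k)))))"
      unfolding box_shell_def n_def s_def mem_Collect_eq entries_entry entry_dm
        add_Suc_right[symmetric] uniformizer_power_mult[OF uniformizer] by simp
    also have "\<dots> \<longleftrightarrow> (\<forall>Q\<in>range e. entry Y Q \<in> ideal_pow (N Q) \<and>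
        (Q \<in> S \<longrightarrow> entry Y Q \<notin> ideal_pow (Suc (N Q))))" by blast
    also have "\<dots> \<longleftrightarrow> bx Y" unfolding re bx by blast
    finally show ?thesis .
  qed
  have ent: "entries e (dm Y) = entries e (dm W) \<longleftrightarrow> (\<forall>Q. Q \<notin> {P1, P2, P3} \<longrightarrow> entry Y Q = entry W Q)" for Y W
  proof -
    have "entries e (dm Y) = entries e (dm W) \<longleftrightarrow> (\<forall>k. entry Y (e k) = entry W (e k))"
      by (simp add: vec_eq_iff entries_entry entry_dm)
    also have "\<dots> \<longleftrightarrow> (\<forall>Q\<in>range e. entry Y Q = entry W Q)" by blast
    finally show ?thesis unfolding re by blast
  qed
  have boxW: "bx Y \<longleftrightarrow> bx W" if "\<forall>Q. Q \<notin> {P1, P2, P3} \<longrightarrow> entry Y Q = entry W Q" for Y W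
    unfolding bx using that by auto
  have si: "Y \<in> integral_matrices" if "sol Y" for Y using that by (simp add: sol_def)
  have "emeasure \<mu> U = ennreal (res_card TYPE('a) ^ m * (inverse (res_card TYPE('a) ^ (\<Sum>i\<in>UNIV. n i)) *
      (1 - inverse (res_card TYPE('a))) ^ card s))"
  proof (rule emeasure_chart_box_shell[OF ld bij])
    show "openin (top_of_set (fiber \<gamma>)) U"
    proof (rule openin_cong_matrix)
      show "U \<subseteq> fiber \<gamma>" unfolding U_def using diag_orbit_eq by (auto simp: diag_orbit_def)
      fix X X'
      define M where "M = Suc (k1 + k2 + (\<Sum>k\<in>UNIV. n k))"
      assume X: "X \<in> U" and X': "X' \<in> fiber \<gamma>" and c: "cong_matrix (Suc (k1 + k2 + (\<Sum>k\<in>UNIV. n k))) X' X"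
      obtain Y where Y: "X = dm Y" "sol Y" "bx Y" using X by (auto simp: U_def)
      have "X' \<in> diag_orbit \<gamma> k1 k2"
        by (rule diag_orbit_cong[OF _ X' c]) (use Y diag_orbit_dm in auto)
      then obtain Y' where Y': "X' = dm Y'" "sol Y'" unfolding diag_orbit_eq by blast
      have nk: "n k \<le> (\<Sum>k\<in>UNIV. n k)" for k by (rule member_le_sum) auto
      \<comment> \<open>Agreement one digit beyond the radius is needed, because both the ball
        condition and the shell condition have to survive the perturbation.\<close>
      have "entries e X' $ k - entries e X $ k \<in> ideal_pow (Suc (n k))" for k
        by (rule ideal_pow_mono[of _ "Suc (k1 + k2 + (\<Sum>k\<in>UNIV. n k))"])
          (use c nk[of k] in \<open>auto simp: cong_matrix_def entries_def\<close>)
      then have "entries e X' $ k \<in> ideal_pow (n k) \<longleftrightarrow> entries e X $ k \<in> ideal_pow (n k)"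
        "entries e X' $ k \<in> ideal_pow (Suc (n k)) \<longleftrightarrow> entries e X $ k \<in> ideal_pow (Suc (n k))" for k
        using ideal_pow_congruent ideal_pow_mono[of _ "Suc (n k)" "n k"] by (blast intro: le_SucI order_refl)+
      then have "entries e X' \<in> box_shell n s \<longleftrightarrow> entries e X \<in> box_shell n s"
        unfolding box_shell_def by blast
      then have "bx Y'" using shell Y Y' by blast
      then show "X' \<in> U" unfolding U_def using Y' by blast
    qed
    show "inj_on (entries e) U"
    proof (rule inj_onI)
      fix X X' assume "X \<in> U" "X' \<in> U" and ee: "entries e X = entries e X'"
      then obtain Y Y' where Y: "X = dm Y" "sol Y" "bx Y" "X' = dm Y'" "sol Y'" "bx Y'"
        unfolding U_def by blast
      have "\<exists>!Z. sol Z \<and> (\<forall>Q. Q \<notin> {P1, P2, P3} \<longrightarrow> entry Z Q = entry Y Q)"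
        using solve si Y by blast
      moreover have "sol Y' \<and> (\<forall>Q. Q \<notin> {P1, P2, P3} \<longrightarrow> entry Y' Q = entry Y Q)"
        using ee ent[of Y' Y] Y by simp
      moreover have "sol Y \<and> (\<forall>Q. Q \<notin> {P1, P2, P3} \<longrightarrow> entry Y Q = entry Y Q)"
        using Y by simp
      ultimately have "Y' = Y" by (rule ex1_unique)
      then show "X = X'" using Y by simp
    qed
    show "entries e ` U = box_shell n s"
    proof (intro equalityI subsetI)
      fix y assume "y \<in> entries e ` U" then show "y \<in> box_shell n s" using shell by (auto simp: U_def)
    next
      fix y :: "'a ^ 6" assume y: "y \<in> box_shell n s"
      \<comment> \<open>The free entries are read off from \<open>y\<close>; the three dependent
        positions are filled with zeros, and \<open>solve\<close> replaces them by the right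
        values.\<close>
      define W where "W = fill e (\<chi> k. y $ k / \<pi> ^ row_exp k1 k2 (fst (e k)))"
      have Wy: "entries e (dm W) = y"
        by (simp add: vec_eq_iff entries_entry entry_dm W_def entry_fill(1)[OF bij])
      then have bW: "bx W" using shell[of W] y by simp
      have Wi: "W \<in> integral_matrices" unfolding integral_matrices_entry
      proof
        fix Q show "entry W Q \<in> integers"
        proof (cases "Q \<in> {P1, P2, P3}")
          case True
          then obtain l where "Q = pos l" using rpos by blast
          then show ?thesis by (simp add: W_def entry_fill(2)[OF bij])
        next
          case False
          then show ?thesis using bW unfolding bx using ideal_pow_integers by blast
        qed
      qed
      obtain Y where Y: "sol Y" "\<forall>Q. Q \<notin> {P1, P2, P3} \<longrightarrow> entry Y Q = entry W Q"
        using solve[OF Wi bW] by blast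
      have "entries e (dm Y) = y" using ent[of Y W] Y(2) Wy by simp
      moreover have "bx Y" using boxW[OF Y(2)] bW by simp
      ultimately show "y \<in> entries e ` U" unfolding U_def using Y(1) by blast
    qed
    fix X assume "X \<in> U"
    then obtain Y where "X = dm Y" "sol Y" "bx Y" unfolding U_def by blast
    then show "same_ord m (partial_jacobian pos X)" using jac unfolding partial_jacobian_def pos by blast
  qed
  then show ?thesis unfolding U_def sn cs .
qed

end


section \<open>Three charts for the orbit\<close>

lemma linear_system_2:
  fixes a b c d x y A B :: "'a::field"
  assumes "a * d - b * c \<noteq> 0"
  shows "a * x + b * y = A \<and> c * x + d * y = B \<longleftrightarrow>
    x = (A * d - b * B) / (a * d - b * c) \<and> y = (a * B - c * A) / (a * d - b * c)"
proof
  assume *: "a * x + b * y = A \<and> c * x + d * y = B"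
  then have "A * d - b * B = x * (a * d - b * c)" "a * B - c * A = y * (a * d - b * c)"
    by (auto simp: algebra_simps)
  then show "x = (A * d - b * B) / (a * d - b * c) \<and> y = (a * B - c * A) / (a * d - b * c)"
    using assms by simp
next
  assume *: "x = (A * d - b * B) / (a * d - b * c) \<and> y = (a * B - c * A) / (a * d - b * c)"
  have "a * x + b * y = (a * (A * d - b * B) + b * (a * B - c * A)) / (a * d - b * c)"
    "c * x + d * y = (c * (A * d - b * B) + d * (a * B - c * A)) / (a * d - b * c)"
    using * by (simp_all add: add_divide_distrib)
  moreover have "a * (A * d - b * B) + b * (a * B - c * A) = A * (a * d - b * c)"
    "c * (A * d - b * B) + d * (a * B - c * A) = B * (a * d - b * c)" by (auto simp: algebra_simps)
  ultimately show "a * x + b * y = A \<and> c * x + d * y = B" using assms by simp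
qed

lemma UNIV_positions: "(UNIV :: (3 \<times> 3) set) = {(1,1),(1,2),(1,3),(2,1),(2,2),(2,3),(3,1),(3,2),(3,3)}"
  by (auto simp: UNIV_3 simp flip: UNIV_Times_UNIV)

lemma all_positions: "(\<forall>Q :: 3 \<times> 3. F Q) \<longleftrightarrow> F (1,1) \<and> F (1,2) \<and> F (1,3) \<and> F (2,1) \<and> F (2,2) \<and> F (2,3) \<and> F (3,1) \<and> F (3,2) \<and> F (3,3)"
  by (simp add: split_paired_All forall_3)

definition mat3 :: "'a \<Rightarrow> 'a \<Rightarrow> 'a \<Rightarrow> 'a \<Rightarrow> 'a \<Rightarrow> 'a \<Rightarrow> 'a \<Rightarrow> 'a \<Rightarrow> 'a \<Rightarrow> 'a::zero ^ 3 ^ 3" where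
  "mat3 a b c d e f g h i = vector [vector [a, b, c], vector [d, e, f], vector [g, h, i]]"

lemma mat3_components [simp]:
  "mat3 a b c d e f g h i $ 1 $ 1 = a" "mat3 a b c d e f g h i $ 1 $ 2 = b" "mat3 a b c d e f g h i $ 1 $ 3 = c"
  "mat3 a b c d e f g h i $ 2 $ 1 = d" "mat3 a b c d e f g h i $ 2 $ 2 = e" "mat3 a b c d e f g h i $ 2 $ 3 = f"
  "mat3 a b c d e f g h i $ 3 $ 1 = g" "mat3 a b c d e f g h i $ 3 $ 2 = h" "mat3 a b c d e f g h i $ 3 $ 3 = i"
  by (simp_all add: mat3_def)

lemma entry_pair: "entry X (i, j) = X $ i $ j"
  by (simp add: entry_def)

text \<open>In every chart \<open>y11\<close> is eliminated by the trace. This minor and the two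
  after it belong to the remaining pairs of dependent entries: \<open>y21, y23\<close> when
  \<open>y12\<close> is a unit, \<open>y12, y32\<close> when \<open>y21\<close> is, and
  \<open>y21, y13\<close> when neither is.\<close>

lemma jacobian_11_21_23:
  "tri (drho X (elem_matrix (1,1))) (drho X (elem_matrix (2,1))) (drho X (elem_matrix (2,3))) =
    X$1$2 * (X$1$1 * X$3$2 - X$1$2 * X$3$1) - X$3$2 * (X$1$2 * X$3$3 - X$1$3 * X$3$2)"
  by (simp add: tri_def drho_components elem_matrix_component algebra_simps)

lemma jacobian_11_12_32:
  "tri (drho X (elem_matrix (1,1))) (drho X (elem_matrix (1,2))) (drho X (elem_matrix (3,2))) =
    X$2$1 * (X$1$1 * X$2$3 - X$1$3 * X$2$1) - X$2$3 * (X$2$1 * X$3$3 - X$2$3 * X$3$1)"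
  by (simp add: tri_def drho_components elem_matrix_component algebra_simps)

lemma jacobian_11_21_13:
  "tri (drho X (elem_matrix (1,1))) (drho X (elem_matrix (2,1))) (drho X (elem_matrix (1,3))) =
    - X$1$2 * (X$2$1 * X$3$2 - X$2$2 * X$3$1) - X$3$1 * (X$1$2 * X$3$3 - X$1$3 * X$3$2)"
  by (simp add: tri_def drho_components elem_matrix_component algebra_simps)

lemmas mem_intros = ideal_pow_add ideal_pow_diff integers_mult iffD2[OF ideal_pow_uminus]

context orbit_equations
begin

lemma sol_integral: "sol Y \<Longrightarrow> Y $ i $ j \<in> integers"
  by (simp add: sol_def integral_matrices_def)

lemma r_integer: "r \<in> integers" and b2_integer: "b2 \<in> integers" and u_integer: "u \<in> integers"
  using r_mem b2_mem u_unit ideal_pow_integers ounit_integer by blast+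

lemma trace_solution_mem:
  assumes "x \<in> integers" "y \<in> integers"
  shows "- rho \<gamma> $ 1 - p * x - r * y \<in> ideal_pow 1"
  using assms c1 p_mem r_mem by (intro ideal_pow_diff ideal_pow_mult_integer(2)) auto

lemma sol_11: "sol Y \<Longrightarrow> Y$1$1 = - rho \<gamma> $ 1 - p * Y$2$2 - r * Y$3$3"
  unfolding sol_def by (auto simp: algebra_simps)

lemma sol_11_mem: "sol Y \<Longrightarrow> Y$1$1 \<in> ideal_pow 1"
  using sol_11 trace_solution_mem sol_integral by metis

lemma jacobian_piece_1:
  assumes Y: "sol Y" and Y12: "ounit (Y$1$2)" and Y31: "ounit (Y$3$1)"
  shows "same_ord (k2) (tri (drho (dm Y) (elem_matrix (1,1))) (drho (dm Y) (elem_matrix (2,1))) (drho (dm Y) (elem_matrix (2,3))))"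
proof -
  have "ounit (- (Y$1$2 * Y$1$2 * Y$3$1) + (Y$1$2 * (Y$1$1 * Y$3$2) - r * (Y$3$2 * (Y$1$2 * Y$3$3 - Y$1$3 * Y$3$2))))"
  proof (rule ounit_add)
    show "ounit (- (Y$1$2 * Y$1$2 * Y$3$1))" using Y12 Y31 by (simp add: ounit_mult)
    show "Y$1$2 * (Y$1$1 * Y$3$2) - r * (Y$3$2 * (Y$1$2 * Y$3$3 - Y$1$3 * Y$3$2)) \<in> ideal_pow 1"
      using sol_11_mem[OF Y] r_mem sol_integral[OF Y]
      by (intro ideal_pow_diff ideal_pow_mult_integer(1)[OF sol_integral[OF Y]] ideal_pow_mult_integer(2) integers_mult) auto
  qed
  moreover have "tri (drho (dm Y) (elem_matrix (1,1))) (drho (dm Y) (elem_matrix (2,1))) (drho (dm Y) (elem_matrix (2,3))) =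
    r * (- (Y$1$2 * Y$1$2 * Y$3$1) + (Y$1$2 * (Y$1$1 * Y$3$2) - r * (Y$3$2 * (Y$1$2 * Y$3$3 - Y$1$3 * Y$3$2))))"
    unfolding jacobian_11_21_23 dm_components by (simp add: algebra_simps)
  ultimately show ?thesis
    using same_ord_mult[OF same_ord_uniformizer_power[OF uniformizer, of k2], of 0] by (simp add: same_ord_0)
qed

text \<open>After \<open>y11\<close> is fixed by the trace, the other equations are linear in
  \<open>y21\<close> and \<open>y23\<close>, since these lie in one row. Their determinant is
  \<open>- y12^2 y31\<close> up to nonunits, so the solution is integral whenever the six free
  entries are.\<close>

lemma emeasure_piece_1:
  assumes ld: "ld_measure \<gamma> \<mu>"
  shows "emeasure \<mu> (dm ` {Y. sol Y \<and> ounit (Y$1$2) \<and> ounit (Y$3$1)}) =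
    ennreal (res_card TYPE('a) ^ k2 * (inverse (res_card TYPE('a) ^ (k1 + 3 * k2)) * (1 - inverse (res_card TYPE('a))) ^ 2))"
    (is "emeasure \<mu> ?U = _")
proof -
  let ?P = "{(1,1), (2,1), (2,3)} :: (3 \<times> 3) set"
  let ?S = "{(1,2), (3,1)} :: (3 \<times> 3) set"
  define bx :: "'a ^ 3 ^ 3 \<Rightarrow> bool" where
    "bx Y \<longleftrightarrow> (\<forall>Q. Q \<notin> ?P \<longrightarrow> entry Y Q \<in> ideal_pow 0 \<and> (Q \<in> ?S \<longrightarrow> entry Y Q \<notin> ideal_pow (Suc 0)))" for Y
  have bx: "bx Y \<longleftrightarrow> ounit (Y$1$2) \<and> ounit (Y$3$1)" if "Y \<in> integral_matrices" for Y
    using that unfolding bx_def all_positions by (auto simp: entry_pair ounit_def integral_matrices_def)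
  have "?U = dm ` {Y. sol Y \<and> bx Y}" using bx by (intro arg_cong[of _ _ "image dm"]) (auto simp: sol_def)
  moreover have "emeasure \<mu> (dm ` {Y. sol Y \<and> bx Y}) =
    ennreal (res_card TYPE('a) ^ k2 * (inverse (res_card TYPE('a) ^ (\<Sum>Q\<in>- ?P. row_exp k1 k2 (fst Q) + 0)) *
      (1 - inverse (res_card TYPE('a))) ^ card ?S))"
  proof (rule emeasure_piece[OF ld])
    show "bx Y \<longleftrightarrow> (\<forall>Q. Q \<notin> ?P \<longrightarrow> entry Y Q \<in> ideal_pow 0 \<and> (Q \<in> ?S \<longrightarrow> entry Y Q \<notin> ideal_pow (Suc 0)))" for Y
      by (rule bx_def)
    fix W :: "'a ^ 3 ^ 3" assume Wi: "W \<in> integral_matrices" and "bx W"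
    then have W12: "ounit (W$1$2)" and W31: "ounit (W$3$1)" using bx by auto
    have W: "W $ i $ j \<in> integers" for i j using Wi by (simp add: integral_matrices_def)
    define a where "a = - rho \<gamma> $ 1 - p * W$2$2 - r * W$3$3"
    have a1: "a \<in> ideal_pow 1" unfolding a_def by (intro trace_solution_mem W)
    then have a: "a \<in> integers" by (rule ideal_pow_integers)
    define A where "A = b2 - a * W$2$2 - P * (a * W$3$3 - W$1$3 * W$3$1) - r * (W$2$2 * W$3$3)"
    define B where "B = u - a * (W$2$2 * W$3$3) + W$1$3 * (W$2$2 * W$3$1)"
    define c where "c = - (W$1$2 * W$3$3) + W$1$3 * W$3$2"
    define d where "d = W$1$2 * W$3$1 - a * W$3$2"
    define \<delta> where "\<delta> = - W$1$2 * d - (- r * W$3$2) * c"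
    have c: "c \<in> integers" and d: "d \<in> integers" and A: "A \<in> integers" and B: "B \<in> integers"
      unfolding A_def B_def c_def d_def
      by (intro mem_intros W a b2_integer u_integer P_integer r_integer)+
    have "ounit (- (W$1$2 * W$1$2 * W$3$1) + (W$1$2 * (a * W$3$2) + r * (W$3$2 * c)))"
    proof (rule ounit_add)
      show "ounit (- (W$1$2 * W$1$2 * W$3$1))" using W12 W31 by (simp add: ounit_mult)
      show "W$1$2 * (a * W$3$2) + r * (W$3$2 * c) \<in> ideal_pow 1"
        using a1 r_mem W c by (intro ideal_pow_add ideal_pow_mult_integer(1)[OF W] ideal_pow_mult_integer(2) integers_mult)
    qed
    then have \<delta>: "ounit \<delta>" by (simp add: \<delta>_def d_def algebra_simps)
    have \<delta>0: "- W$1$2 * d - (- r * W$3$2) * c \<noteq> 0" using ounit_nonzero[OF \<delta>] by (simp add: \<delta>_def)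
    define x where "x = (A * d - (- r * W$3$2) * B) / \<delta>"
    define y where "y = (- W$1$2 * B - c * A) / \<delta>"
    have x: "x \<in> integers" and y: "y \<in> integers" unfolding x_def y_def
      by (rule ounit_divide[OF \<delta>], intro mem_intros W a A B c d r_integer)+
    have key: "sol Y \<longleftrightarrow> Y \<in> integral_matrices \<and> Y$1$1 = a \<and> Y$2$1 = x \<and> Y$2$3 = y"
      if Y: "Y$1$2 = W$1$2" "Y$1$3 = W$1$3" "Y$2$2 = W$2$2" "Y$3$1 = W$3$1" "Y$3$2 = W$3$2" "Y$3$3 = W$3$3" for Y
    proof -
      have T: "Y$1$1 + p * W$2$2 + r * W$3$3 = - rho \<gamma> $ 1 \<longleftrightarrow> Y$1$1 = a"
        by (auto simp: a_def algebra_simps)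
      have C: "a * W$2$2 - W$1$2 * Y$2$1 + P * (a * W$3$3 - W$1$3 * W$3$1) + r * (W$2$2 * W$3$3 - Y$2$3 * W$3$2) = b2
          \<longleftrightarrow> - W$1$2 * Y$2$1 + (- r * W$3$2) * Y$2$3 = A"
        by (auto simp: A_def algebra_simps)
      have D: "a * (W$2$2 * W$3$3 - Y$2$3 * W$3$2) - W$1$2 * (Y$2$1 * W$3$3 - Y$2$3 * W$3$1) + W$1$3 * (Y$2$1 * W$3$2 - W$2$2 * W$3$1) = u
          \<longleftrightarrow> c * Y$2$1 + d * Y$2$3 = B"
        by (auto simp: B_def c_def d_def algebra_simps)
      have "sol Y \<longleftrightarrow> Y \<in> integral_matrices \<and> Y$1$1 = a \<and> (- W$1$2 * Y$2$1 + (- r * W$3$2) * Y$2$3 = A \<and> c * Y$2$1 + d * Y$2$3 = B)"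
        unfolding sol_def Y using T C D by auto
      then show ?thesis unfolding linear_system_2[OF \<delta>0] x_def y_def \<delta>_def .
    qed
    have "\<exists>!Y. sol Y \<and> Y$1$2 = W$1$2 \<and> Y$1$3 = W$1$3 \<and> Y$2$2 = W$2$2 \<and> Y$3$1 = W$3$1 \<and> Y$3$2 = W$3$2 \<and> Y$3$3 = W$3$3"
    proof (rule ex1I[of _ "mat3 a (W$1$2) (W$1$3) x (W$2$2) y (W$3$1) (W$3$2) (W$3$3)"], goal_cases)
      case 1
      have "mat3 a (W$1$2) (W$1$3) x (W$2$2) y (W$3$1) (W$3$2) (W$3$3) \<in> integral_matrices"
        using a x y W by (simp add: integral_matrices_def forall_3)
      then show ?case by (subst key) simp_all
    next
      case (2 Y)
      then show ?case using key[of Y] by (simp add: vec_eq_iff forall_3)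
    qed
    then show "\<exists>!Y. sol Y \<and> (\<forall>Q. Q \<notin> ?P \<longrightarrow> entry Y Q = entry W Q)"
      unfolding all_positions by (simp add: entry_pair)
  next
    fix Y assume Y: "sol Y" "bx Y"
    show "same_ord (k2) (tri (drho (dm Y) (elem_matrix (1,1))) (drho (dm Y) (elem_matrix (2,1))) (drho (dm Y) (elem_matrix (2,3))))"
      by (rule jacobian_piece_1) (use Y bx in \<open>auto simp: sol_def\<close>)
  qed auto
  \<comment> \<open>Radii of the free entries: none in the first row, \<open>k1\<close> for
    \<open>y22\<close>, and \<open>k2\<close> for each of the three entries in the last row.\<close>
  moreover have "(\<Sum>Q\<in>- ?P. row_exp k1 k2 (fst Q) + 0) = k1 + 3 * k2"
    unfolding Compl_eq_Diff_UNIV UNIV_positions by (simp add: insert_Diff_if)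
  moreover have "card ?S = 2" by simp
  ultimately show ?thesis by simp
qed

lemma jacobian_piece_2:
  assumes Y: "sol Y" and Y21: "ounit (Y$2$1)" and Y13: "ounit (Y$1$3)"
  shows "same_ord (k1 + k1) (tri (drho (dm Y) (elem_matrix (1,1))) (drho (dm Y) (elem_matrix (1,2))) (drho (dm Y) (elem_matrix (3,2))))"
proof -
  have "ounit (- (Y$2$1 * Y$1$3 * Y$2$1) + (Y$2$1 * (Y$1$1 * Y$2$3) - r * (Y$2$3 * (Y$2$1 * Y$3$3 - Y$2$3 * Y$3$1))))"
  proof (rule ounit_add)
    show "ounit (- (Y$2$1 * Y$1$3 * Y$2$1))" using Y21 Y13 by (simp add: ounit_mult)
    show "Y$2$1 * (Y$1$1 * Y$2$3) - r * (Y$2$3 * (Y$2$1 * Y$3$3 - Y$2$3 * Y$3$1)) \<in> ideal_pow 1"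
      using sol_11_mem[OF Y] r_mem sol_integral[OF Y]
      by (intro ideal_pow_diff ideal_pow_mult_integer(1)[OF sol_integral[OF Y]] ideal_pow_mult_integer(2) integers_mult) auto
  qed
  moreover have "tri (drho (dm Y) (elem_matrix (1,1))) (drho (dm Y) (elem_matrix (1,2))) (drho (dm Y) (elem_matrix (3,2))) =
    (p * p) * (- (Y$2$1 * Y$1$3 * Y$2$1) + (Y$2$1 * (Y$1$1 * Y$2$3) - r * (Y$2$3 * (Y$2$1 * Y$3$3 - Y$2$3 * Y$3$1))))"
    unfolding jacobian_11_12_32 dm_components by (simp add: algebra_simps)
  moreover have "same_ord (k1 + k1) (p * p)"
    by (intro same_ord_mult same_ord_uniformizer_power[OF uniformizer])
  ultimately show ?thesis
    using same_ord_mult[of "k1 + k1" "p * p" 0] by (simp add: same_ord_0)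
qed

text \<open>The mirror image: linear in \<open>y12\<close> and \<open>y32\<close>, which share a
  column, with determinant \<open>- y21^2 y13\<close> up to nonunits. The parameter \<open>l\<close>
  allows \<open>y31\<close> to be restricted: on this piece it is a nonunit if
  \<open>k1 = k2\<close> and arbitrary if \<open>k1 < k2\<close>.\<close>

lemma emeasure_piece_2:
  assumes ld: "ld_measure \<gamma> \<mu>"
  shows "emeasure \<mu> (dm ` {Y. sol Y \<and> ounit (Y$2$1) \<and> ounit (Y$1$3) \<and> Y$3$1 \<in> ideal_pow l}) =
    ennreal (res_card TYPE('a) ^ (k1 + k1) * (inverse (res_card TYPE('a) ^ (3 * k1 + 2 * k2 + l)) * (1 - inverse (res_card TYPE('a))) ^ 2))"
    (is "emeasure \<mu> ?U = _")
proof -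
  let ?P = "{(1,1), (1,2), (3,2)} :: (3 \<times> 3) set"
  let ?S = "{(2,1), (1,3)} :: (3 \<times> 3) set"
  define N :: "3 \<times> 3 \<Rightarrow> nat" where "N Q = (if Q = (3,1) then l else 0)" for Q
  define bx :: "'a ^ 3 ^ 3 \<Rightarrow> bool" where
    "bx Y \<longleftrightarrow> (\<forall>Q. Q \<notin> ?P \<longrightarrow> entry Y Q \<in> ideal_pow (N Q) \<and> (Q \<in> ?S \<longrightarrow> entry Y Q \<notin> ideal_pow (Suc (N Q))))" for Y
  have bx: "bx Y \<longleftrightarrow> ounit (Y$2$1) \<and> ounit (Y$1$3) \<and> Y$3$1 \<in> ideal_pow l" if "Y \<in> integral_matrices" for Y
    using that unfolding bx_def all_positions by (auto simp: entry_pair ounit_def integral_matrices_def N_def)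
  have "?U = dm ` {Y. sol Y \<and> bx Y}" using bx by (intro arg_cong[of _ _ "image dm"]) (auto simp: sol_def)
  moreover have "emeasure \<mu> (dm ` {Y. sol Y \<and> bx Y}) =
    ennreal (res_card TYPE('a) ^ (k1 + k1) * (inverse (res_card TYPE('a) ^ (\<Sum>Q\<in>- ?P. row_exp k1 k2 (fst Q) + N Q)) *
      (1 - inverse (res_card TYPE('a))) ^ card ?S))"
  proof (rule emeasure_piece[OF ld])
    show "bx Y \<longleftrightarrow> (\<forall>Q. Q \<notin> ?P \<longrightarrow> entry Y Q \<in> ideal_pow (N Q) \<and> (Q \<in> ?S \<longrightarrow> entry Y Q \<notin> ideal_pow (Suc (N Q))))" for Y
      by (rule bx_def)
    fix W :: "'a ^ 3 ^ 3" assume Wi: "W \<in> integral_matrices" and "bx W"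
    then have W21: "ounit (W$2$1)" and W13: "ounit (W$1$3)" using bx by auto
    have W: "W $ i $ j \<in> integers" for i j using Wi by (simp add: integral_matrices_def)
    define a where "a = - rho \<gamma> $ 1 - p * W$2$2 - r * W$3$3"
    have a1: "a \<in> ideal_pow 1" unfolding a_def by (intro trace_solution_mem W)
    then have a: "a \<in> integers" by (rule ideal_pow_integers)
    define A where "A = b2 - a * W$2$2 - P * (a * W$3$3 - W$1$3 * W$3$1) - r * (W$2$2 * W$3$3)"
    define B where "B = u - a * (W$2$2 * W$3$3) + W$1$3 * (W$2$2 * W$3$1)"
    define c where "c = - (W$2$1 * W$3$3) + W$2$3 * W$3$1"
    define d where "d = W$1$3 * W$2$1 - a * W$2$3"
    define \<delta> where "\<delta> = - W$2$1 * d - (- r * W$2$3) * c"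
    have c: "c \<in> integers" and d: "d \<in> integers" and A: "A \<in> integers" and B: "B \<in> integers"
      unfolding A_def B_def c_def d_def
      by (intro mem_intros W a b2_integer u_integer P_integer r_integer)+
    have "ounit (- (W$2$1 * W$1$3 * W$2$1) + (W$2$1 * (a * W$2$3) + r * (W$2$3 * c)))"
    proof (rule ounit_add)
      show "ounit (- (W$2$1 * W$1$3 * W$2$1))" using W21 W13 by (simp add: ounit_mult)
      show "W$2$1 * (a * W$2$3) + r * (W$2$3 * c) \<in> ideal_pow 1"
        using a1 r_mem W c by (intro ideal_pow_add ideal_pow_mult_integer(1)[OF W] ideal_pow_mult_integer(2) integers_mult)
    qed
    then have \<delta>: "ounit \<delta>" by (simp add: \<delta>_def d_def algebra_simps)
    have \<delta>0: "- W$2$1 * d - (- r * W$2$3) * c \<noteq> 0" using ounit_nonzero[OF \<delta>] by (simp add: \<delta>_def)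
    define x where "x = (A * d - (- r * W$2$3) * B) / \<delta>"
    define y where "y = (- W$2$1 * B - c * A) / \<delta>"
    have x: "x \<in> integers" and y: "y \<in> integers" unfolding x_def y_def
      by (rule ounit_divide[OF \<delta>], intro mem_intros W a A B c d r_integer)+
    have key: "sol Y \<longleftrightarrow> Y \<in> integral_matrices \<and> Y$1$1 = a \<and> Y$1$2 = x \<and> Y$3$2 = y"
      if Y: "Y$2$1 = W$2$1" "Y$1$3 = W$1$3" "Y$2$2 = W$2$2" "Y$3$1 = W$3$1" "Y$2$3 = W$2$3" "Y$3$3 = W$3$3" for Y
    proof -
      have T: "Y$1$1 + p * W$2$2 + r * W$3$3 = - rho \<gamma> $ 1 \<longleftrightarrow> Y$1$1 = a"
        by (auto simp: a_def algebra_simps)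
      have C: "a * W$2$2 - Y$1$2 * W$2$1 + P * (a * W$3$3 - W$1$3 * W$3$1) + r * (W$2$2 * W$3$3 - W$2$3 * Y$3$2) = b2
          \<longleftrightarrow> - W$2$1 * Y$1$2 + (- r * W$2$3) * Y$3$2 = A"
        by (auto simp: A_def algebra_simps)
      have D: "a * (W$2$2 * W$3$3 - W$2$3 * Y$3$2) - Y$1$2 * (W$2$1 * W$3$3 - W$2$3 * W$3$1) + W$1$3 * (W$2$1 * Y$3$2 - W$2$2 * W$3$1) = u
          \<longleftrightarrow> c * Y$1$2 + d * Y$3$2 = B"
        by (auto simp: B_def c_def d_def algebra_simps)
      have "sol Y \<longleftrightarrow> Y \<in> integral_matrices \<and> Y$1$1 = a \<and> (- W$2$1 * Y$1$2 + (- r * W$2$3) * Y$3$2 = A \<and> c * Y$1$2 + d * Y$3$2 = B)"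
        unfolding sol_def Y using T C D by auto
      then show ?thesis unfolding linear_system_2[OF \<delta>0] x_def y_def \<delta>_def .
    qed
    have "\<exists>!Y. sol Y \<and> Y$1$3 = W$1$3 \<and> Y$2$1 = W$2$1 \<and> Y$2$2 = W$2$2 \<and> Y$2$3 = W$2$3 \<and> Y$3$1 = W$3$1 \<and> Y$3$3 = W$3$3"
    proof (rule ex1I[of _ "mat3 a x (W$1$3) (W$2$1) (W$2$2) (W$2$3) (W$3$1) y (W$3$3)"], goal_cases)
      case 1
      have "mat3 a x (W$1$3) (W$2$1) (W$2$2) (W$2$3) (W$3$1) y (W$3$3) \<in> integral_matrices"
        using a x y W by (simp add: integral_matrices_def forall_3)
      then show ?case by (subst key) simp_all
    next
      case (2 Y)
      then show ?case using key[of Y] by (simp add: vec_eq_iff forall_3)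
    qed
    then show "\<exists>!Y. sol Y \<and> (\<forall>Q. Q \<notin> ?P \<longrightarrow> entry Y Q = entry W Q)"
      unfolding all_positions by (simp add: entry_pair)
  next
    fix Y assume Y: "sol Y" "bx Y"
    show "same_ord (k1 + k1) (tri (drho (dm Y) (elem_matrix (1,1))) (drho (dm Y) (elem_matrix (1,2))) (drho (dm Y) (elem_matrix (3,2))))"
      by (rule jacobian_piece_2) (use Y bx in \<open>auto simp: sol_def\<close>)
  qed auto
  moreover have "(\<Sum>Q\<in>- ?P. row_exp k1 k2 (fst Q) + N Q) = 3 * k1 + 2 * k2 + l"
    unfolding Compl_eq_Diff_UNIV UNIV_positions by (simp add: insert_Diff_if N_def)
  moreover have "card ?S = 2" by simp
  ultimately show ?thesis by simp
qed

lemma sol_12_21: "sol Y \<Longrightarrow> Y$1$2 * Y$2$1 =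
    Y$1$1 * Y$2$2 - b2 + P * (Y$1$1 * Y$3$3 - Y$1$3 * Y$3$1) + r * (Y$2$2 * Y$3$3 - Y$2$3 * Y$3$2)"
  unfolding sol_def by (auto simp: algebra_simps)

context
  fixes K :: nat
  assumes K1: "K \<le> k1" and K2: "K \<le> k2 - k1" and Kc1: "rho \<gamma> $ 1 \<in> ideal_pow K"
    and Kc2: "rho \<gamma> $ 2 \<in> ideal_pow (k1 + K)"
begin

lemma p_mem_K: "p \<in> ideal_pow K" and P_mem_K: "P \<in> ideal_pow K" and r_mem_K: "r \<in> ideal_pow K"
  and b2_mem_K: "b2 \<in> ideal_pow K"
  using uniformizer_power_mem'[OF uniformizer] K1 K2 k12 ideal_pow_divide_power[OF uniformizer Kc2]
  by (auto simp: b2_def)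

lemma trace_solution_mem_K:
  assumes "x \<in> integers" "y \<in> integers"
  shows "- rho \<gamma> $ 1 - p * x - r * y \<in> ideal_pow K"
  using assms Kc1 p_mem_K r_mem_K by (intro ideal_pow_diff ideal_pow_mult_integer(2)) auto

lemma product_mem_K:
  assumes "a \<in> ideal_pow K" "x \<in> integers" "y \<in> integers" "z \<in> integers"
  shows "a * x - b2 + P * y + r * z \<in> ideal_pow K"
  using assms P_mem_K r_mem_K b2_mem_K by (intro ideal_pow_add ideal_pow_diff ideal_pow_mult_integer(2)) auto

text \<open>The assumptions on \<open>K\<close> make every term on the right of
  \<open>sol_12_21\<close> divisible by \<open>\<pi> ^ K\<close>. Hence so is the product
  \<open>y12 y21\<close>, and \<open>y12\<close> accounts for only \<open>i < K\<close> of its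
  valuation.\<close>

lemma sol_21_mem:
  assumes Y: "sol Y" and i: "same_ord i (Y$1$2)" "i < K"
  shows "Y$2$1 \<in> ideal_pow 1"
proof -
  note Yi = sol_integral[OF Y]
  have "Y$1$1 \<in> ideal_pow K" using sol_11[OF Y] trace_solution_mem_K Yi by metis
  then have "Y$1$2 * Y$2$1 \<in> ideal_pow K"
    unfolding sol_12_21[OF Y] by (intro product_mem_K mem_intros Yi)
  then have "Y$1$2 * Y$2$1 \<in> ideal_pow (i + 1)" using i(2) ideal_pow_mono by fastforce
  then show ?thesis using same_ord_mult_ideal_pow[OF i(1)] by blast
qed

text \<open>Apart from the factor \<open>p * r\<close> the leading term is
  \<open>y12 y22 y31\<close>, of valuation \<open>i\<close>: \<open>y21\<close> is a nonunit, and
  the other summand carries the factor \<open>P\<close>, divisible by \<open>\<pi> ^ K\<close> with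
  \<open>i < K\<close>.\<close>

lemma jacobian_piece_3:
  assumes Y: "sol Y" and Y12: "same_ord i (Y$1$2)" and Y22: "ounit (Y$2$2)" and Y31: "ounit (Y$3$1)" and iK: "i < K"
  shows "same_ord (k1 + k2 + i) (tri (drho (dm Y) (elem_matrix (1,1))) (drho (dm Y) (elem_matrix (2,1))) (drho (dm Y) (elem_matrix (1,3))))"
proof -
  note Yi = sol_integral[OF Y]
  have "ounit (Y$2$2 * Y$3$1 + - (Y$2$1 * Y$3$2))"
    using sol_21_mem[OF Y Y12 iK]
    by (intro ounit_add ounit_mult Y22 Y31 iffD2[OF ideal_pow_uminus] ideal_pow_mult_integer(2) Yi)
  then have "same_ord (i + 0) (Y$1$2 * (Y$2$2 * Y$3$1 + - (Y$2$1 * Y$3$2)))"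
    by (intro same_ord_mult Y12) (simp add: same_ord_0)
  moreover have "- (P * (Y$3$1 * (Y$1$2 * Y$3$3 - Y$1$3 * Y$3$2))) \<in> ideal_pow (Suc i)"
    using P_mem_K iK ideal_pow_mono[of P K "Suc i"]
    by (intro iffD2[OF ideal_pow_uminus] ideal_pow_mult_integer(2) mem_intros Yi) auto
  ultimately have "same_ord i (Y$1$2 * (Y$2$2 * Y$3$1 + - (Y$2$1 * Y$3$2)) + - (P * (Y$3$1 * (Y$1$2 * Y$3$3 - Y$1$3 * Y$3$2))))"
    unfolding add_0_right by (rule same_ord_add)
  moreover have "tri (drho (dm Y) (elem_matrix (1,1))) (drho (dm Y) (elem_matrix (2,1))) (drho (dm Y) (elem_matrix (1,3))) =
    (p * r) * (Y$1$2 * (Y$2$2 * Y$3$1 + - (Y$2$1 * Y$3$2)) + - (P * (Y$3$1 * (Y$1$2 * Y$3$3 - Y$1$3 * Y$3$2))))"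
    unfolding jacobian_11_21_13 dm_components by (simp add: algebra_simps r_eq)
  moreover have "same_ord (k1 + k2) (p * r)"
    by (intro same_ord_mult same_ord_uniformizer_power[OF uniformizer])
  ultimately show ?thesis
    by (simp only: same_ord_mult)
qed

text \<open>Here the equations are linear in \<open>y\<^sub>1\<^sub>1\<close> and \<open>y\<^sub>2\<^sub>1\<close>; eliminating these leaves a quadratic fixed-point
  equation for \<open>y\<^sub>1\<^sub>3\<close> with small leading coefficient.\<close>

lemma emeasure_piece_3:
  assumes ld: "ld_measure \<gamma> \<mu>" and iK: "i < K"
  shows "emeasure \<mu> (dm ` {Y. sol Y \<and> same_ord i (Y$1$2) \<and> ounit (Y$2$2) \<and> ounit (Y$3$1)}) =
    ennreal (res_card TYPE('a) ^ (k1 + k2 + i) * (inverse (res_card TYPE('a) ^ (i + 2 * k1 + 3 * k2)) * (1 - inverse (res_card TYPE('a))) ^ 3))"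
    (is "emeasure \<mu> ?U = _")
proof -
  let ?P = "{(1,1), (2,1), (1,3)} :: (3 \<times> 3) set"
  let ?S = "{(1,2), (2,2), (3,1)} :: (3 \<times> 3) set"
  define N :: "3 \<times> 3 \<Rightarrow> nat" where "N Q = (if Q = (1,2) then i else 0)" for Q
  define bx :: "'a ^ 3 ^ 3 \<Rightarrow> bool" where
    "bx Y \<longleftrightarrow> (\<forall>Q. Q \<notin> ?P \<longrightarrow> entry Y Q \<in> ideal_pow (N Q) \<and> (Q \<in> ?S \<longrightarrow> entry Y Q \<notin> ideal_pow (Suc (N Q))))" for Y
  have bx: "bx Y \<longleftrightarrow> same_ord i (Y$1$2) \<and> ounit (Y$2$2) \<and> ounit (Y$3$1)" if "Y \<in> integral_matrices" for Y
    using that unfolding bx_def all_positions by (auto simp: entry_pair ounit_def same_ord_def integral_matrices_def N_def)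
  have "?U = dm ` {Y. sol Y \<and> bx Y}" using bx by (intro arg_cong[of _ _ "image dm"]) (auto simp: sol_def)
  moreover have "emeasure \<mu> (dm ` {Y. sol Y \<and> bx Y}) =
    ennreal (res_card TYPE('a) ^ (k1 + k2 + i) * (inverse (res_card TYPE('a) ^ (\<Sum>Q\<in>- ?P. row_exp k1 k2 (fst Q) + N Q)) *
      (1 - inverse (res_card TYPE('a))) ^ card ?S))"
  proof (rule emeasure_piece[OF ld])
    show "bx Y \<longleftrightarrow> (\<forall>Q. Q \<notin> ?P \<longrightarrow> entry Y Q \<in> ideal_pow (N Q) \<and> (Q \<in> ?S \<longrightarrow> entry Y Q \<notin> ideal_pow (Suc (N Q))))" for Y
      by (rule bx_def)
    fix W :: "'a ^ 3 ^ 3" assume Wi: "W \<in> integral_matrices" and "bx W"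
    then have W12: "same_ord i (W$1$2)" and W22: "ounit (W$2$2)" and W31: "ounit (W$3$1)" using bx by auto
    have W: "W $ i $ j \<in> integers" for i j using Wi by (simp add: integral_matrices_def)
    have W120: "W$1$2 \<noteq> 0" using W12 by (simp add: same_ord_iff)
    define a where "a = - rho \<gamma> $ 1 - p * W$2$2 - r * W$3$3"
    have aK: "a \<in> ideal_pow K" unfolding a_def by (intro trace_solution_mem_K W)
    then have a: "a \<in> integers" by (rule ideal_pow_integers)
    have divK: "x / W$1$2 \<in> ideal_pow 1" if "x \<in> ideal_pow K" for x
    proof -
      have "x \<in> ideal_pow (i + 1)" by (rule ideal_pow_mono[OF that]) (use iK in simp)
      then show ?thesis using same_ord_divide[OF W12] by blast
    qed
    \<comment> \<open>The second equation divided by \<open>y12\<close>: it reads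
      \<open>y21 = \<alpha> + \<beta> y13\<close>. The numerators are divisible by
      \<open>\<pi> ^ K\<close> and \<open>i < K\<close>, so \<alpha> and \<beta> are still
      nonunits.\<close>
    define \<alpha> where "\<alpha> = (a * W$2$2 - b2 + P * (a * W$3$3) + r * (W$2$2 * W$3$3 - W$2$3 * W$3$2)) / W$1$2"
    define \<beta> where "\<beta> = - (P * W$3$1) / W$1$2"
    have \<alpha>: "\<alpha> \<in> ideal_pow 1" unfolding \<alpha>_def by (intro divK product_mem_K mem_intros W a aK)
    have \<beta>: "\<beta> \<in> ideal_pow 1" unfolding \<beta>_def
      by (intro divK iffD2[OF ideal_pow_uminus] ideal_pow_mult_integer(2) W P_mem_K)
    note \<alpha>\<beta> = ideal_pow_integers[OF \<alpha>] ideal_pow_integers[OF \<beta>]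
    define g where "g = a * (W$2$2 * W$3$3 - W$2$3 * W$3$2) - W$1$2 * (\<alpha> * W$3$3 - W$2$3 * W$3$1) - u"
    define w where "w = W$2$2 * W$3$1 + (\<beta> * (W$1$2 * W$3$3) - \<alpha> * W$3$2)"
    have g: "g \<in> integers" unfolding g_def by (intro mem_intros W a \<alpha>\<beta> u_integer)
    have w: "ounit w" unfolding w_def
      by (intro ounit_add ounit_mult W22 W31 ideal_pow_diff ideal_pow_mult_integer(2) integers_mult W \<alpha> \<beta>)
    \<comment> \<open>The determinant equation after this substitution, divided by the unit
      \<open>w\<close>. Its quadratic coefficient is a nonunit because of \<beta>; the vanishing
      cubic term is written out to match \<open>cubic_fixed_point\<close>.\<close>
    define root where "root z \<longleftrightarrow> z = g / w + (\<beta> * W$3$2 / w) * z ^ 2 + 0 * z ^ 3" for z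
    have root_eq: "root z \<longleftrightarrow> z * w = g + \<beta> * W$3$2 * z ^ 2" for z
      unfolding root_def using ounit_nonzero[OF w] by (simp add: field_simps)
    have ex1: "\<exists>!z. z \<in> integers \<and> root z"
      unfolding root_def
      by (rule cubic_fixed_point, simp, intro ounit_divide[OF w] ideal_pow_mult_integer(2) W \<beta>, rule ounit_divide[OF w g])
    obtain z where z: "z \<in> integers" "root z" using ex1 by blast
    have key: "sol Y \<longleftrightarrow> Y \<in> integral_matrices \<and> Y$1$1 = a \<and> Y$2$1 = \<alpha> + \<beta> * Y$1$3 \<and> root (Y$1$3)"
      if Y: "Y$1$2 = W$1$2" "Y$2$2 = W$2$2" "Y$2$3 = W$2$3" "Y$3$1 = W$3$1" "Y$3$2 = W$3$2" "Y$3$3 = W$3$3" for Y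
    proof -
      have T: "Y$1$1 + p * W$2$2 + r * W$3$3 = - rho \<gamma> $ 1 \<longleftrightarrow> Y$1$1 = a"
        by (auto simp: a_def algebra_simps)
      have ab: "W$1$2 * (\<alpha> + \<beta> * t) = a * W$2$2 - b2 + P * (a * W$3$3) + r * (W$2$2 * W$3$3 - W$2$3 * W$3$2) - P * W$3$1 * t" for t
        unfolding \<alpha>_def \<beta>_def using W120 by (simp add: field_simps)
      have "Y$2$1 = \<alpha> + \<beta> * Y$1$3 \<longleftrightarrow> W$1$2 * Y$2$1 = W$1$2 * (\<alpha> + \<beta> * Y$1$3)"
        using W120 by simp
      then have C: "a * W$2$2 - W$1$2 * Y$2$1 + P * (a * W$3$3 - Y$1$3 * W$3$1) + r * (W$2$2 * W$3$3 - W$2$3 * W$3$2) = b2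
          \<longleftrightarrow> Y$2$1 = \<alpha> + \<beta> * Y$1$3"
        unfolding ab by (auto simp: algebra_simps)
      have D: "a * (W$2$2 * W$3$3 - W$2$3 * W$3$2) - W$1$2 * ((\<alpha> + \<beta> * t) * W$3$3 - W$2$3 * W$3$1) + t * ((\<alpha> + \<beta> * t) * W$3$2 - W$2$2 * W$3$1) = u
          \<longleftrightarrow> root t" for t
        unfolding root_eq g_def w_def by (auto simp: algebra_simps power2_eq_square)
      show ?thesis
        unfolding sol_def Y using T C D[of "Y$1$3"] by metis
    qed
    have "\<exists>!Y. sol Y \<and> Y$1$2 = W$1$2 \<and> Y$2$2 = W$2$2 \<and> Y$2$3 = W$2$3 \<and> Y$3$1 = W$3$1 \<and> Y$3$2 = W$3$2 \<and> Y$3$3 = W$3$3"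
    proof (rule ex1I[of _ "mat3 a (W$1$2) z (\<alpha> + \<beta> * z) (W$2$2) (W$2$3) (W$3$1) (W$3$2) (W$3$3)"], goal_cases)
      case 1
      have "mat3 a (W$1$2) z (\<alpha> + \<beta> * z) (W$2$2) (W$2$3) (W$3$1) (W$3$2) (W$3$3) \<in> integral_matrices"
        using a z(1) W \<alpha>\<beta> by (simp add: integral_matrices_def forall_3 ideal_pow_add integers_mult)
      then show ?case using z(2) by (subst key) simp_all
    next
      case (2 Y)
      have "Y$1$3 \<in> integers \<and> root (Y$1$3)" using 2 key[of Y] sol_integral by blast
      then have "Y$1$3 = z" using ex1_unique[OF ex1] z by blast
      then show ?case using 2 key[of Y] by (simp add: vec_eq_iff forall_3)
    qed
    then show "\<exists>!Y. sol Y \<and> (\<forall>Q. Q \<notin> ?P \<longrightarrow> entry Y Q = entry W Q)"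
      unfolding all_positions by (simp add: entry_pair)
  next
    fix Y assume Y: "sol Y" "bx Y"
    show "same_ord (k1 + k2 + i) (tri (drho (dm Y) (elem_matrix (1,1))) (drho (dm Y) (elem_matrix (2,1))) (drho (dm Y) (elem_matrix (1,3))))"
      by (rule jacobian_piece_3) (use Y bx iK in \<open>auto simp: sol_def\<close>)
  qed auto
  \<comment> \<open>The summand \<open>i\<close>, the radius of \<open>y12\<close>, cancels against
    the \<open>i\<close> in the Jacobian exponent. This is why all values of \<open>i\<close>
    contribute the same volume.\<close>
  moreover have "(\<Sum>Q\<in>- ?P. row_exp k1 k2 (fst Q) + N Q) = i + 2 * k1 + 3 * k2"
    unfolding Compl_eq_Diff_UNIV UNIV_positions by (simp add: insert_Diff_if N_def)
  moreover have "card ?S = 3" by simp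
  ultimately show ?thesis by simp
qed

end

end


section \<open>The volume of the orbit\<close>

text \<open>Minors are integral, so a least valuation exists, and any minor at hand bounds it from
  above.\<close>

lemma jacobian_ord_exists:
  fixes X :: "'a::discrete_valued_field ^ 3 ^ 3"
  assumes X: "X \<in> integral_matrices"
    and Y: "Y1 \<in> integral_matrices" "Y2 \<in> integral_matrices" "Y3 \<in> integral_matrices"
      "same_ord m (tri (drho X Y1) (drho X Y2) (drho X Y3))"
  shows "\<exists>m'\<le>m. jacobian_ord X m'"
proof -
  define A where "A m \<longleftrightarrow> (\<exists>Y1\<in>integral_matrices. \<exists>Y2\<in>integral_matrices. \<exists>Y3\<in>integral_matrices.
       same_ord m (tri (drho X Y1) (drho X Y2) (drho X Y3)))" for m
  have Am: "A m" using Y unfolding A_def by blast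
  define m' where "m' = (LEAST m. A m)"
  have m': "A m'" "m' \<le> m" unfolding m'_def using Am by (rule LeastI, rule Least_le)
  have "tri (drho X Z1) (drho X Z2) (drho X Z3) \<in> ideal_pow m'"
    if Z: "Z1 \<in> integral_matrices" "Z2 \<in> integral_matrices" "Z3 \<in> integral_matrices" for Z1 Z2 Z3
  proof (rule ccontr)
    assume n: "tri (drho X Z1) (drho X Z2) (drho X Z3) \<notin> ideal_pow m'"
    let ?t = "tri (drho X Z1) (drho X Z2) (drho X Z3)"
    have t0: "?t \<noteq> 0" using n by auto
    moreover have "?t \<in> integers" by (intro tri_mem drho_integral X Z)
    ultimately have o: "0 \<le> ord ?t" by (simp add: ideal_pow_def)
    then have "same_ord (nat (ord ?t)) ?t" using t0 by (simp add: same_ord_iff)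
    then have "A (nat (ord ?t))" unfolding A_def using Z by blast
    then have "m' \<le> nat (ord ?t)" unfolding m'_def by (rule Least_le)
    then show False using n o t0 by (simp add: ideal_pow_def)
  qed
  then have "jacobian_ord X m'" using m'(1) unfolding jacobian_ord_def A_def by blast
  then show ?thesis using m'(2) by blast
qed

context orbit_equations
begin

lemma sol_product_mem: "sol Y \<Longrightarrow> Y$1$2 * Y$2$1 + P * (Y$1$3 * Y$3$1) \<in> ideal_pow 1"
proof -
  assume Y: "sol Y"
  have e: "Y$1$2 * Y$2$1 + P * (Y$1$3 * Y$3$1) =
      Y$1$1 * Y$2$2 - b2 + Y$1$1 * (P * Y$3$3) + r * (Y$2$2 * Y$3$3 - Y$2$3 * Y$3$2)"
    unfolding sol_12_21[OF Y] by (simp add: algebra_simps)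
  show ?thesis unfolding e using sol_11_mem[OF Y] b2_mem r_mem
    by (intro ideal_pow_add ideal_pow_diff ideal_pow_mult_integer(2) integers_mult sol_integral[OF Y] P_integer)
qed

lemma sol_det_unit: "sol Y \<Longrightarrow> ounit (Y$1$3 * (Y$2$1 * Y$3$2 - Y$2$2 * Y$3$1) - Y$1$2 * (Y$2$1 * Y$3$3 - Y$2$3 * Y$3$1))"
proof -
  assume Y: "sol Y"
  have e: "Y$1$3 * (Y$2$1 * Y$3$2 - Y$2$2 * Y$3$1) - Y$1$2 * (Y$2$1 * Y$3$3 - Y$2$3 * Y$3$1) =
      u + - (Y$1$1 * (Y$2$2 * Y$3$3 - Y$2$3 * Y$3$2))"
    using Y unfolding sol_def by (auto simp: algebra_simps)
  show ?thesis unfolding e using sol_11_mem[OF Y]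
    by (intro ounit_add u_unit iffD2[OF ideal_pow_uminus] ideal_pow_mult_integer(2) mem_intros sol_integral[OF Y])
qed

text \<open>Each claim holds because its failure would put a nonunit into every product of the
  expression that \<open>sol_det_unit\<close> shows to be a unit. When \<open>y12\<close> is a unit,
  \<open>sol_product_mem\<close> first transfers the defect from \<open>y31\<close> to
  \<open>y21\<close>.\<close>

lemma sol_units:
  assumes Y: "sol Y"
  shows "ounit (Y$1$2) \<Longrightarrow> ounit (Y$3$1)"
    and "Y$1$2 \<in> ideal_pow 1 \<Longrightarrow> ounit (Y$1$3)"
    and "Y$1$2 \<in> ideal_pow 1 \<Longrightarrow> Y$2$1 \<in> ideal_pow 1 \<Longrightarrow> ounit (Y$2$2) \<and> ounit (Y$3$1)"
    and "Y$1$2 \<in> ideal_pow 1 \<Longrightarrow> Y$3$1 \<in> ideal_pow 1 \<Longrightarrow> ounit (Y$2$1)"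
proof -
  note Yi = sol_integral[OF Y]
  let ?E = "Y$1$3 * (Y$2$1 * Y$3$2 - Y$2$2 * Y$3$1) - Y$1$2 * (Y$2$1 * Y$3$3 - Y$2$3 * Y$3$1)"
  have E: "?E \<notin> ideal_pow 1" using sol_det_unit[OF Y] by (simp add: ounit_def)
  have nonunit: "x \<in> ideal_pow 1" if "\<not> ounit x" "x \<in> integers" for x :: 'a using that by (simp add: ounit_def)
  have m: "x * y \<in> ideal_pow 1" if "x \<in> ideal_pow 1" "y \<in> integers" for x y :: 'a
    using that by (rule ideal_pow_mult_integer(2)[rotated])
  have m': "y * x \<in> ideal_pow 1" if "x \<in> ideal_pow 1" "y \<in> integers" for x y :: 'a
    using m[OF that] by (simp add: mult.commute)
  show "ounit (Y$3$1)" if Y12: "ounit (Y$1$2)"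
  proof (rule ccontr)
    assume "\<not> ounit (Y$3$1)"
    then have 31: "Y$3$1 \<in> ideal_pow 1" using nonunit Yi by blast
    have "P * (Y$1$3 * Y$3$1) \<in> ideal_pow 1" by (intro m' 31 P_integer Yi)
    then have "Y$1$2 * Y$2$1 \<in> ideal_pow 1"
      using sol_product_mem[OF Y] ideal_pow_add_cancel[of "P * (Y$1$3 * Y$3$1)" 1 "Y$1$2 * Y$2$1"] by (simp add: add.commute)
    then have 21: "Y$2$1 \<in> ideal_pow 1" using ounit_mult_ideal_pow[OF Y12] by blast
    have "?E \<in> ideal_pow 1"
      by (intro ideal_pow_diff m'[of "_ - _"] m[OF 21] m'[OF 31] Yi)
    then show False using E by blast
  qed
  show "ounit (Y$1$3)" if 12: "Y$1$2 \<in> ideal_pow 1"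
  proof (rule ccontr)
    assume "\<not> ounit (Y$1$3)"
    then have 13: "Y$1$3 \<in> ideal_pow 1" using nonunit Yi by blast
    have "?E \<in> ideal_pow 1" by (intro ideal_pow_diff m[OF 13] m[OF 12] mem_intros Yi)
    then show False using E by blast
  qed
  show "ounit (Y$2$2) \<and> ounit (Y$3$1)" if 12: "Y$1$2 \<in> ideal_pow 1" and 21: "Y$2$1 \<in> ideal_pow 1"
  proof (rule ccontr)
    assume "\<not> (ounit (Y$2$2) \<and> ounit (Y$3$1))"
    then have "Y$2$2 * Y$3$1 \<in> ideal_pow 1" using nonunit Yi m m' by blast
    then have "?E \<in> ideal_pow 1" by (intro ideal_pow_diff[OF m'[of "_ - _"]] ideal_pow_diff m[OF 12] m[OF 21] mem_intros Yi)
    then show False using E by blast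
  qed
  show "ounit (Y$2$1)" if 12: "Y$1$2 \<in> ideal_pow 1" and 31: "Y$3$1 \<in> ideal_pow 1"
  proof (rule ccontr)
    assume "\<not> ounit (Y$2$1)"
    then have 21: "Y$2$1 \<in> ideal_pow 1" using nonunit Yi by blast
    have "?E \<in> ideal_pow 1" by (intro ideal_pow_diff[OF m'[of "_ - _"]] ideal_pow_diff m[OF 12] m[OF 21] m'[OF 31] mem_intros Yi)
    then show False using E by blast
  qed
qed

section \<open>Assembling the pieces of the orbit\<close>

lemma disjoint_images: "A \<inter> B = {} \<Longrightarrow> dm ` A \<inter> dm ` B = {}"
  by (simp add: dm_inj inj_def flip: image_Int[of dm])

lemma P_mem_1: "k1 < k2 \<Longrightarrow> P \<in> ideal_pow 1"
  using uniformizer_power_mem'[OF uniformizer, of 1 "k2 - k1"] by simp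

lemma sol_12_21_mem:
  assumes Y: "sol Y" and k: "k1 < k2"
  shows "Y$1$2 * Y$2$1 \<in> ideal_pow 1"
proof -
  have "P * (Y$1$3 * Y$3$1) \<in> ideal_pow 1"
    by (intro ideal_pow_mult_integer(2) P_mem_1 k integers_mult sol_integral[OF Y])
  then show ?thesis
    using sol_product_mem[OF Y] ideal_pow_add_cancel[of "P * (Y$1$3 * Y$3$1)" 1 "Y$1$2 * Y$2$1"] by (simp add: add.commute)
qed

text \<open>A condition that is stable under congruence modulo \<open>\<pi> ^ n\<close> is open.
  Multiplication by \<open>D\<close> costs at most \<open>k2\<close> digits, hence the finer modulus
  \<open>k1 + k2 + n\<close> for \<open>X\<close>.\<close>

lemma sets_piece:
  assumes ld: "ld_measure \<gamma> \<mu>"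
    and \<Phi>: "\<And>Y Y'. \<Phi> Y \<Longrightarrow> cong_matrix n Y' Y \<Longrightarrow> \<Phi> Y'"
  shows "dm ` {Y. sol Y \<and> \<Phi> Y} \<in> sets \<mu>"
proof -
  have "openin (top_of_set (fiber \<gamma>)) (dm ` {Y. sol Y \<and> \<Phi> Y})"
  proof (rule openin_cong_matrix)
    show "dm ` {Y. sol Y \<and> \<Phi> Y} \<subseteq> fiber \<gamma>" using diag_orbit_eq by (auto simp: diag_orbit_def)
    fix X X' assume X: "X \<in> dm ` {Y. sol Y \<and> \<Phi> Y}" "X' \<in> fiber \<gamma>" and c: "cong_matrix (k1 + k2 + n) X' X"
    then obtain Y where Y: "X = dm Y" "sol Y" "\<Phi> Y" by blast
    have "X' \<in> diag_orbit \<gamma> k1 k2" by (rule diag_orbit_cong[OF _ X(2) c]) (use Y diag_orbit_dm in auto)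
    then obtain Y' where Y': "X' = dm Y'" "sol Y'" unfolding diag_orbit_eq by blast
    have "cong_matrix n Y' Y" unfolding cong_matrix_def
    proof (intro allI)
      fix i j
      have "\<pi> ^ row_exp k1 k2 i * (Y' $ i $ j - Y $ i $ j) \<in> ideal_pow (row_exp k1 k2 i + n)"
        by (rule ideal_pow_mono[of _ "k1 + k2 + n"])
          (use c Y(1) Y'(1) in \<open>auto simp: cong_matrix_def dm_def algebra_simps row_exp_def\<close>)
      then show "Y' $ i $ j - Y $ i $ j \<in> ideal_pow n" using uniformizer_power_mult[OF uniformizer] by blast
    qed
    then show "X' \<in> dm ` {Y. sol Y \<and> \<Phi> Y}" using \<Phi> Y Y' by blast
  qed
  moreover have "sets \<mu> = sets (restrict_space borel (fiber \<gamma>))"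
    using ld by (auto simp: ld_measure_def form_measure_def)
  ultimately show ?thesis by (auto simp: sets_restrict_space openin_open intro: borel_open)
qed

lemma ounit_cong: "ounit x \<Longrightarrow> y - x \<in> ideal_pow n \<Longrightarrow> 1 \<le> n \<Longrightarrow> ounit y"
  using ounit_congruent[of y x] ideal_pow_mono[of "y - x" n 1] by blast

lemma same_ord_cong: "same_ord i x \<Longrightarrow> y - x \<in> ideal_pow n \<Longrightarrow> Suc i \<le> n \<Longrightarrow> same_ord i y"
  using same_ord_add[of i x "y - x"] ideal_pow_mono[of "y - x" n "Suc i"] by simp

lemma sets_piece_1: "ld_measure \<gamma> \<mu> \<Longrightarrow> dm ` {Y. sol Y \<and> ounit (Y$1$2) \<and> ounit (Y$3$1)} \<in> sets \<mu>"
proof (erule sets_piece[of _ _ 1], elim conjE, intro conjI)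
  fix Y Y' :: "'a ^ 3 ^ 3"
  assume *: "cong_matrix 1 Y' Y" and u: "ounit (Y$1$2)" "ounit (Y$3$1)"
  have c: "Y' $ i $ j - Y $ i $ j \<in> ideal_pow 1" for i j using * by (simp add: cong_matrix_def)
  show "ounit (Y' $ 1 $ 2)" "ounit (Y' $ 3 $ 1)" using ounit_cong[OF _ c] u by auto
qed

lemma sets_piece_2: "ld_measure \<gamma> \<mu> \<Longrightarrow> dm ` {Y. sol Y \<and> ounit (Y$2$1) \<and> ounit (Y$1$3) \<and> Y$3$1 \<in> ideal_pow l} \<in> sets \<mu>"
proof (erule sets_piece[of _ _ "Suc l"], elim conjE, intro conjI)
  fix Y Y' :: "'a ^ 3 ^ 3"
  assume *: "cong_matrix (Suc l) Y' Y" and u: "ounit (Y$2$1)" "ounit (Y$1$3)" and 31: "Y$3$1 \<in> ideal_pow l"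
  have c: "Y' $ i $ j - Y $ i $ j \<in> ideal_pow (Suc l)" for i j using * by (simp add: cong_matrix_def)
  show "ounit (Y' $ 2 $ 1)" "ounit (Y' $ 1 $ 3)" using ounit_cong[OF _ c] u by auto
  show "Y' $ 3 $ 1 \<in> ideal_pow l" using ideal_pow_mono[OF c, of l 3 1] 31 ideal_pow_congruent by (metis le_SucI order_refl)
qed

lemma sets_piece_3: "ld_measure \<gamma> \<mu> \<Longrightarrow> dm ` {Y. sol Y \<and> same_ord i (Y$1$2) \<and> ounit (Y$2$2) \<and> ounit (Y$3$1)} \<in> sets \<mu>"
proof (erule sets_piece[of _ _ "Suc i"], elim conjE, intro conjI)
  fix Y Y' :: "'a ^ 3 ^ 3"
  assume *: "cong_matrix (Suc i) Y' Y" and u: "same_ord i (Y$1$2)" "ounit (Y$2$2)" "ounit (Y$3$1)"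
  have c: "Y' $ k $ j - Y $ k $ j \<in> ideal_pow (Suc i)" for k j using * by (simp add: cong_matrix_def)
  show "same_ord i (Y' $ 1 $ 2)" using same_ord_cong[OF _ c] u by auto
  show "ounit (Y' $ 2 $ 2)" "ounit (Y' $ 3 $ 1)" using ounit_cong[OF _ c] u by auto
qed

lemma res_card_cancel:
  "res_card TYPE('a) ^ m * (inverse (res_card TYPE('a) ^ (m + n)) * t) = inverse (res_card TYPE('a) ^ n) * t"
  using res_card_gt_1[where 'a='a] by (simp add: power_add)

text \<open>For \<open>k1 = k2\<close> the factor \<open>P\<close> is one, so
  \<open>y12 y21 + y13 y31\<close> is a nonunit. If \<open>y12\<close> is a nonunit, then
  \<open>y13\<close> is a unit, hence \<open>y31\<close> is a nonunit, and the determinant forces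
  \<open>y21\<close> to be a unit. So the second piece occurs with \<open>l = 1\<close>, which
  produces the factor \<open>1 + 1 / q\<close>.\<close>

lemma emeasure_orbit_equal:
  assumes ld: "ld_measure \<gamma> \<mu>" and k: "k1 = k2"
  shows "emeasure \<mu> (diag_orbit \<gamma> k1 k2) =
    ennreal (inverse (res_card TYPE('a) ^ (k1 + 2 * k2)) * (1 - inverse (res_card TYPE('a))) ^ 2 * (1 + inverse (res_card TYPE('a))))"
proof -
  let ?q = "res_card TYPE('a)"
  have q: "1 < ?q" by (rule res_card_gt_1)
  let ?A = "{Y. sol Y \<and> ounit (Y$1$2) \<and> ounit (Y$3$1)}"
  let ?B = "{Y. sol Y \<and> ounit (Y$2$1) \<and> ounit (Y$1$3) \<and> Y$3$1 \<in> ideal_pow 1}"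
  have 31: "Y$3$1 \<in> ideal_pow 1" if "sol Y" "Y$1$2 \<in> ideal_pow 1" for Y
  proof -
    note Yi = sol_integral[OF that(1)]
    have "Y$1$2 * Y$2$1 \<in> ideal_pow 1" by (intro ideal_pow_mult_integer(2) that Yi)
    then have "Y$1$3 * Y$3$1 \<in> ideal_pow 1"
      using sol_product_mem[OF that(1)] ideal_pow_add_cancel[of "Y$1$2 * Y$2$1" 1 "Y$1$3 * Y$3$1"] k by simp
    then show ?thesis using ounit_mult_ideal_pow[OF sol_units(2)[OF that]] by blast
  qed
  have "sol Y \<longleftrightarrow> Y \<in> ?A \<or> Y \<in> ?B" for Y
    using sol_units[of Y] 31[of Y] integer_cases[OF sol_integral[of Y 1 2]] by auto
  then have un: "{Y. sol Y} = ?A \<union> ?B" by blast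
  have dj: "?A \<inter> ?B = {}" by (auto simp: ounit_def)
  have "diag_orbit \<gamma> k1 k2 = dm ` ?A \<union> dm ` ?B"
    by (rule trans[OF diag_orbit_eq trans[OF arg_cong[of _ _ "image dm", OF un] image_Un]])
  then have "emeasure \<mu> (diag_orbit \<gamma> k1 k2) = emeasure \<mu> (dm ` ?A \<union> dm ` ?B)"
    by (rule arg_cong)
  also have "\<dots> = emeasure \<mu> (dm ` ?A) + emeasure \<mu> (dm ` ?B)"
    by (rule plus_emeasure[symmetric, OF sets_piece_1[OF ld] sets_piece_2[OF ld]]) (rule disjoint_images[OF dj])
  also have "emeasure \<mu> (dm ` ?A) = ennreal (inverse (?q ^ (k1 + 2 * k2)) * (1 - inverse ?q) ^ 2)"
    unfolding emeasure_piece_1[OF ld] res_card_cancel[of k2 "k1 + 2 * k2", symmetric] by (simp add: algebra_simps)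
  also have "emeasure \<mu> (dm ` ?B) = ennreal (inverse (?q ^ (k1 + 2 * k2 + 1)) * (1 - inverse ?q) ^ 2)"
    unfolding emeasure_piece_2[OF ld] res_card_cancel[of "k1 + k1" "k1 + 2 * k2 + 1", symmetric] by (simp add: k algebra_simps)
  finally show ?thesis using q by (simp add: ennreal_plus[symmetric] algebra_simps power_add del: ennreal_plus)
qed

text \<open>For \<open>k1 < k2\<close> at most one of \<open>y12\<close>, \<open>y21\<close> is a
  unit. The two pieces where one of them is have equal volume. Elsewhere the valuation of
  \<open>y12\<close> runs from \<open>1\<close> to \<open>K - 1\<close>, and each value gives a
  piece smaller by the factor \<open>1 - 1 / q\<close>, since three coordinates instead of two are
  confined to shells.\<close>

lemma emeasure_orbit_less:
  assumes ld: "ld_measure \<gamma> \<mu>" and k: "k1 < k2"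
    and K: "1 \<le> K" "K \<le> k1" "K \<le> k2 - k1" "rho \<gamma> $ 1 \<in> ideal_pow K" "rho \<gamma> $ 2 \<in> ideal_pow (k1 + K)"
    and G: "\<And>Y. sol Y \<Longrightarrow> Y$1$2 \<in> ideal_pow 1 \<Longrightarrow> Y$2$1 \<in> ideal_pow 1 \<Longrightarrow> same_ord K (Y$1$2 * Y$2$1)"
  shows "emeasure \<mu> (diag_orbit \<gamma> k1 k2) =
    ennreal (inverse (res_card TYPE('a) ^ (k1 + 2 * k2)) * (1 - inverse (res_card TYPE('a))) ^ 2 *
      (2 + (real K - 1) * (1 - inverse (res_card TYPE('a)))))"
proof -
  let ?q = "res_card TYPE('a)"
  have q: "1 < ?q" by (rule res_card_gt_1)
  let ?A = "{Y. sol Y \<and> ounit (Y$1$2) \<and> ounit (Y$3$1)}"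
  let ?B = "{Y. sol Y \<and> ounit (Y$2$1) \<and> ounit (Y$1$3) \<and> Y$3$1 \<in> ideal_pow 0}"
  let ?C = "\<lambda>i. {Y. sol Y \<and> same_ord i (Y$1$2) \<and> ounit (Y$2$2) \<and> ounit (Y$3$1)}"
  have C: "Y \<in> ?C (nat (ord (Y$1$2))) \<and> 1 \<le> nat (ord (Y$1$2)) \<and> nat (ord (Y$1$2)) < K"
    if Y: "sol Y" "Y$1$2 \<in> ideal_pow 1" "Y$2$1 \<in> ideal_pow 1" for Y
  proof -
    have g: "same_ord K (Y$1$2 * Y$2$1)" by (rule G[OF Y])
    then have nz: "Y$1$2 \<noteq> 0" "Y$2$1 \<noteq> 0" by (auto simp: same_ord_iff)
    then have o: "1 \<le> ord (Y$1$2)" "1 \<le> ord (Y$2$1)" using Y by (auto simp: ideal_pow_def)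
    then have "ord (Y$1$2) + ord (Y$2$1) = int K" using g nz by (simp add: same_ord_iff ord_mult)
    then show ?thesis using o nz Y(1) sol_units(3)[OF Y] by (auto simp: same_ord_iff)
  qed
  have AB: "Y \<in> ?A \<or> Y \<in> ?B \<or> (Y$1$2 \<in> ideal_pow 1 \<and> Y$2$1 \<in> ideal_pow 1)" if Y: "sol Y" for Y
    using sol_units(1,2)[OF Y] integer_cases[OF sol_integral[OF Y]] Y sol_integral[OF Y] by blast
  have un: "{Y. sol Y} = (?A \<union> ?B) \<union> (\<Union>i\<in>{1..<K}. ?C i)"
  proof (intro equalityI subsetI)
    fix Y assume "Y \<in> {Y. sol Y}"
    then have Y: "sol Y" by simp
    show "Y \<in> (?A \<union> ?B) \<union> (\<Union>i\<in>{1..<K}. ?C i)"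
    proof (cases "Y$1$2 \<in> ideal_pow 1 \<and> Y$2$1 \<in> ideal_pow 1")
      case True
      then have "Y \<in> (\<Union>i\<in>{1..<K}. ?C i)" using C[OF Y] by (intro UN_I[of "nat (ord (Y$1$2))"]) auto
      then show ?thesis by blast
    qed (use AB[OF Y] in blast)
  qed auto
  \<comment> \<open>For the disjointness from the first two pieces: \<open>1 \<le> i\<close> makes
    \<open>y12\<close> a nonunit, and \<open>i < K\<close> does the same for
    \<open>y21\<close>.\<close>
  have C12: "Y$1$2 \<in> ideal_pow 1" "Y$2$1 \<in> ideal_pow 1" if "Y \<in> ?C i" "i \<in> {1..<K}" for Y i
    using that sol_21_mem[OF K(2-5), of Y i] ideal_pow_mono[of "Y$1$2" i 1] by (auto simp: same_ord_def)
  have B12: "Y$1$2 \<in> ideal_pow 1" if "Y \<in> ?B" for Y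
    using sol_12_21_mem[of Y] k that ounit_mult_ideal_pow[of "Y$2$1" "Y$1$2" 1] by (simp add: mult.commute)
  have dj1: "?A \<inter> ?B = {}" using B12 unfolding ounit_def by blast
  have dj2: "(?A \<union> ?B) \<inter> (\<Union>i\<in>{1..<K}. ?C i) = {}" using C12 unfolding ounit_def by blast
  have dj3: "disjoint_family_on (\<lambda>i. dm ` ?C i) {1..<K}"
    unfolding disjoint_family_on_def using dm_inj by (auto simp: same_ord_iff)
  have sC: "(\<Union>i\<in>{1..<K}. dm ` ?C i) \<in> sets \<mu>" using sets_piece_3[OF ld] by blast
  have iC: "(\<Union>i\<in>{1..<K}. dm ` ?C i) = dm ` (\<Union>i\<in>{1..<K}. ?C i)" by (rule image_UN[symmetric])
  have "diag_orbit \<gamma> k1 k2 = dm ` (?A \<union> ?B) \<union> dm ` (\<Union>i\<in>{1..<K}. ?C i)"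
    by (rule trans[OF diag_orbit_eq trans[OF arg_cong[of _ _ "image dm", OF un] image_Un]])
  then have "diag_orbit \<gamma> k1 k2 = (dm ` ?A \<union> dm ` ?B) \<union> (\<Union>i\<in>{1..<K}. dm ` ?C i)"
    unfolding iC image_Un[of dm ?A ?B] .
  then have "emeasure \<mu> (diag_orbit \<gamma> k1 k2) = emeasure \<mu> ((dm ` ?A \<union> dm ` ?B) \<union> (\<Union>i\<in>{1..<K}. dm ` ?C i))"
    by (rule arg_cong)
  also have "\<dots> = emeasure \<mu> (dm ` ?A \<union> dm ` ?B) + emeasure \<mu> (\<Union>i\<in>{1..<K}. dm ` ?C i)"
  proof (rule plus_emeasure[symmetric])
    show "dm ` ?A \<union> dm ` ?B \<in> sets \<mu>" using sets_piece_1[OF ld] sets_piece_2[OF ld] by blast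
    show "(dm ` ?A \<union> dm ` ?B) \<inter> (\<Union>i\<in>{1..<K}. dm ` ?C i) = {}"
      unfolding iC image_Un[symmetric] by (rule disjoint_images[OF dj2])
  qed (rule sC)
  also have "emeasure \<mu> (dm ` ?A \<union> dm ` ?B) = emeasure \<mu> (dm ` ?A) + emeasure \<mu> (dm ` ?B)"
    by (rule plus_emeasure[symmetric, OF sets_piece_1[OF ld] sets_piece_2[OF ld]]) (rule disjoint_images[OF dj1])
  also have "emeasure \<mu> (\<Union>i\<in>{1..<K}. dm ` ?C i) = (\<Sum>i\<in>{1..<K}. emeasure \<mu> (dm ` ?C i))"
    by (rule sum_emeasure[symmetric]) (use sets_piece_3[OF ld] dj3 in auto)
  also have "\<dots> = (\<Sum>i\<in>{1..<K}. ennreal (inverse (?q ^ (k1 + 2 * k2)) * (1 - inverse ?q) ^ 3))"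
  proof (rule sum.cong[OF refl])
    fix i assume "i \<in> {1..<K}"
    then show "emeasure \<mu> (dm ` ?C i) = ennreal (inverse (?q ^ (k1 + 2 * k2)) * (1 - inverse ?q) ^ 3)"
      using emeasure_piece_3[OF K(2-5) ld, of i]
      unfolding res_card_cancel[of "k1 + k2 + i" "k1 + 2 * k2", symmetric] by (simp add: algebra_simps)
  qed
  also have "\<dots> = ennreal ((real K - 1) * (inverse (?q ^ (k1 + 2 * k2)) * (1 - inverse ?q) ^ 3))"
  proof -
    have "0 \<le> inverse (?q ^ (k1 + 2 * k2)) * (1 - inverse ?q) ^ 3" using q by (simp add: inverse_le_1_iff)
    then show ?thesis using K(1) by (subst ennreal_mult) (auto simp: ennreal_of_nat_eq_real_of_nat of_nat_diff)
  qed
  also have "emeasure \<mu> (dm ` ?A) = ennreal (inverse (?q ^ (k1 + 2 * k2)) * (1 - inverse ?q) ^ 2)"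
    unfolding emeasure_piece_1[OF ld] res_card_cancel[of k2 "k1 + 2 * k2", symmetric] by (simp add: algebra_simps)
  also have "emeasure \<mu> (dm ` ?B) = ennreal (inverse (?q ^ (k1 + 2 * k2)) * (1 - inverse ?q) ^ 2)"
    unfolding emeasure_piece_2[OF ld] res_card_cancel[of "k1 + k1" "k1 + 2 * k2", symmetric] by (simp add: algebra_simps)
  also have "ennreal (inverse (?q ^ (k1 + 2 * k2)) * (1 - inverse ?q) ^ 2) + ennreal (inverse (?q ^ (k1 + 2 * k2)) * (1 - inverse ?q) ^ 2)
     + ennreal ((real K - 1) * (inverse (?q ^ (k1 + 2 * k2)) * (1 - inverse ?q) ^ 3)) =
     ennreal (inverse (?q ^ (k1 + 2 * k2)) * (1 - inverse ?q) ^ 2 + inverse (?q ^ (k1 + 2 * k2)) * (1 - inverse ?q) ^ 2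
     + (real K - 1) * (inverse (?q ^ (k1 + 2 * k2)) * (1 - inverse ?q) ^ 3))"
  proof -
    have x: "0 \<le> inverse (?q ^ (k1 + 2 * k2)) * (1 - inverse ?q) ^ 2" using q by simp
    have y: "0 \<le> (real K - 1) * (inverse (?q ^ (k1 + 2 * k2)) * (1 - inverse ?q) ^ 3)"
      using q K(1) by (simp add: inverse_le_1_iff)
    show ?thesis
      by (subst ennreal_plus[OF x x, symmetric], subst ennreal_plus[OF add_nonneg_nonneg[OF x x] y, symmetric]) (rule refl)
  qed
  also have "inverse (?q ^ (k1 + 2 * k2)) * (1 - inverse ?q) ^ 2 + inverse (?q ^ (k1 + 2 * k2)) * (1 - inverse ?q) ^ 2
     + (real K - 1) * (inverse (?q ^ (k1 + 2 * k2)) * (1 - inverse ?q) ^ 3) =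
     inverse (?q ^ (k1 + 2 * k2)) * (1 - inverse ?q) ^ 2 * (2 + (real K - 1) * (1 - inverse ?q))"
    unfolding power2_eq_square power3_eq_cube by (simp only: algebra_simps)
  finally show ?thesis .
qed

end


section \<open>From the diagonal lattice to its translates under integral base change\<close>

definition adjugate_3 :: "'a::comm_ring_1 ^ 3 ^ 3 \<Rightarrow> 'a ^ 3 ^ 3" where
  "adjugate_3 Y = mat3
    (Y$2$2 * Y$3$3 - Y$2$3 * Y$3$2) (Y$1$3 * Y$3$2 - Y$1$2 * Y$3$3) (Y$1$2 * Y$2$3 - Y$1$3 * Y$2$2)
    (Y$2$3 * Y$3$1 - Y$2$1 * Y$3$3) (Y$1$1 * Y$3$3 - Y$1$3 * Y$3$1) (Y$1$3 * Y$2$1 - Y$1$1 * Y$2$3)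
    (Y$2$1 * Y$3$2 - Y$2$2 * Y$3$1) (Y$1$2 * Y$3$1 - Y$1$1 * Y$3$2) (Y$1$1 * Y$2$2 - Y$1$2 * Y$2$1)"

text \<open>Cramer's rule: the adjugate has integral entries, and division by a unit determinant
  keeps them integral.\<close>

lemma integral_inverse_obtain:
  fixes Y :: "'a::discrete_valued_field ^ 3 ^ 3"
  assumes Y: "Y \<in> integral_matrices" and u: "ounit (det Y)"
  obtains Z where "Z \<in> integral_matrices" "Y ** Z = mat 1" "Z ** Y = mat 1"
proof -
  define Z where "Z = mat_scale (inverse (det Y)) (adjugate_3 Y)"
  have Yi: "Y $ i $ j \<in> integers" for i j using Y by (simp add: integral_matrices_def)
  have "adjugate_3 Y \<in> integral_matrices"
    unfolding integral_matrices_def mem_Collect_eq forall_3 adjugate_3_def mat3_components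
    by (intro conjI mem_intros Yi)
  then have "Z \<in> integral_matrices"
    unfolding Z_def integral_matrices_def mat_scale_def
    using ounit_integer[OF ounit_inverse[OF u]] by (auto intro: integers_mult)
  moreover have "Y ** adjugate_3 Y = mat_scale (det Y) (mat 1)"
    unfolding vec_eq_iff forall_3 mat_scale_def
    by (simp add: matrix_matrix_mult_def sum_3 adjugate_3_def mat_def det_3 algebra_simps)
  then have "Y ** Z = mat 1"
    using ounit_nonzero[OF u]
    unfolding vec_eq_iff Z_def
    by (simp add: matrix_matrix_mult_def mat_scale_def mult.left_commute sum_distrib_left[symmetric])
  ultimately show thesis using that matrix_left_right_inverse by blast
qed

lemma integral_matrix_std_lattice:
  assumes "X \<in> integral_matrices" "x \<in> std_lattice"
  shows "X *v x \<in> std_lattice"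
  using assms unfolding integral_matrices_def std_lattice_def matrix_vector_mult_def
  by (auto intro!: ideal_pow_sum integers_mult)

lemma std_lattice_axis: "axis j 1 \<in> std_lattice"
  by (simp add: std_lattice_def axis_def)

lemma matrix_axis: "(X *v axis j 1) $ i = X $ i $ j"
  by (simp add: matrix_vector_mult_def axis_def if_distrib[of "\<lambda>x. _ * x"] cong: if_cong)

text \<open>For \<open>h\<close> invertible over the integers with inverse \<open>g\<close> this is
  \<open>g D L\<close>: the condition says that \<open>h x\<close> lies in the image of
  \<open>D\<close>.\<close>

definition standard_sublattice :: "'a::discrete_valued_field ^ 3 ^ 3 \<Rightarrow> nat \<Rightarrow> nat \<Rightarrow> ('a ^ 3) set" where
  "standard_sublattice h k1 k2 = {x \<in> std_lattice. \<forall>i. (h *v x) $ i \<in> ideal_pow (row_exp k1 k2 i)}"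

context orbit_equations
begin

text \<open>\<open>emeasure_conj\<close> needs one radius beyond the Jacobian valuations of all
  points of the orbit. On the pieces these are at most \<open>k2\<close>, \<open>2 k1\<close> and
  \<open>k1 + k2 + i\<close> with \<open>i < K\<close>, so \<open>2 k1 + 2 k2\<close> bounds them
  all.\<close>

lemma jacobian_ord_orbit:
  assumes X: "X \<in> diag_orbit \<gamma> k1 k2"
    and K: "k1 < k2 \<Longrightarrow> K \<le> k1 \<and> K \<le> k2 - k1 \<and> rho \<gamma> $ 1 \<in> ideal_pow K \<and> rho \<gamma> $ 2 \<in> ideal_pow (k1 + K)"
    and G: "\<And>Y. k1 < k2 \<Longrightarrow> sol Y \<Longrightarrow> Y$1$2 \<in> ideal_pow 1 \<Longrightarrow> Y$2$1 \<in> ideal_pow 1 \<Longrightarrow> same_ord K (Y$1$2 * Y$2$1)"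
  shows "\<exists>m<Suc (2 * k1 + 2 * k2). jacobian_ord X m"
proof -
  obtain Y where Y: "X = dm Y" "sol Y" using X unfolding diag_orbit_eq by blast
  have Xi: "X \<in> integral_matrices" using X diag_orbit_integral by blast
  have *: "\<exists>m<Suc (2 * k1 + 2 * k2). jacobian_ord X m"
    if "same_ord m (tri (drho (dm Y) (elem_matrix P1)) (drho (dm Y) (elem_matrix P2)) (drho (dm Y) (elem_matrix P3)))"
      "m \<le> 2 * k1 + 2 * k2" for m P1 P2 P3
    using jacobian_ord_exists[OF Xi elem_matrix_integral elem_matrix_integral elem_matrix_integral that(1)[folded Y(1)]] that(2)
    by (meson le_trans less_Suc_eq_le)
  show ?thesis
  proof (cases "ounit (Y$1$2)")
    case True
    show ?thesis by (rule *[OF jacobian_piece_1[OF Y(2) True sol_units(1)[OF Y(2) True]]]) simp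
  next
    case False
    then have 12: "Y$1$2 \<in> ideal_pow 1" using sol_integral[OF Y(2)] by (simp add: ounit_def)
    show ?thesis
    proof (cases "ounit (Y$2$1)")
      case True
      show ?thesis by (rule *[OF jacobian_piece_2[OF Y(2) True sol_units(2)[OF Y(2) 12]]]) simp
    next
      case False
      then have 21: "Y$2$1 \<in> ideal_pow 1" using sol_integral[OF Y(2)] by (simp add: ounit_def)
      have k: "k1 < k2"
      proof (rule ccontr)
        assume "\<not> k1 < k2"
        then have "k1 = k2" using k12 by simp
        then have "Y$1$3 * Y$3$1 \<in> ideal_pow 1"
          using sol_product_mem[OF Y(2)] ideal_pow_add_cancel[of "Y$1$2 * Y$2$1" 1 "Y$1$3 * Y$3$1"]
            ideal_pow_mult_integer(2)[OF sol_integral[OF Y(2)] 12] by simp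
        then have "Y$3$1 \<in> ideal_pow 1" using ounit_mult_ideal_pow[OF sol_units(2)[OF Y(2) 12]] by blast
        then have "ounit (Y$2$1)" by (rule sol_units(4)[OF Y(2) 12])
        then show False using False by blast
      qed
      have g: "same_ord K (Y$1$2 * Y$2$1)" by (rule G[OF k Y(2) 12 21])
      then have nz: "Y$1$2 \<noteq> 0" "Y$2$1 \<noteq> 0" by (auto simp: same_ord_iff)
      then have o: "1 \<le> ord (Y$1$2)" "1 \<le> ord (Y$2$1)" using 12 21 by (auto simp: ideal_pow_def)
      then have s: "ord (Y$1$2) + ord (Y$2$1) = int K" using g nz by (simp add: same_ord_iff ord_mult)
      define i where "i = nat (ord (Y$1$2))"
      have i: "same_ord i (Y$1$2)" "i < K" using o s nz by (auto simp: i_def same_ord_iff)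
      have K': "K \<le> k1" "K \<le> k2 - k1" "rho \<gamma> $ 1 \<in> ideal_pow K" "rho \<gamma> $ 2 \<in> ideal_pow (k1 + K)" using K[OF k] by auto
      have u: "ounit (Y$2$2)" "ounit (Y$3$1)" using sol_units(3)[OF Y(2) 12 21] by auto
      show ?thesis by (rule *[OF jacobian_piece_3[OF K' Y(2) i(1) u i(2)]]) (use i(2) K' in simp)
    qed
  qed
qed

text \<open>In \<open>X = D Y\<close> the determinant of \<open>Y\<close> is the unit
  \<open>u\<close>, so \<open>Y\<close> is invertible over the integers and \<open>X\<close> maps
  \<open>L\<close> onto the image of \<open>D\<close>, not merely into it.\<close>

lemma diag_orbit_image:
  assumes X: "X \<in> diag_orbit \<gamma> k1 k2"
  shows "y \<in> std_lattice \<Longrightarrow> (X *v y) $ i \<in> ideal_pow (row_exp k1 k2 i)"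
    and "(\<And>i. y $ i \<in> ideal_pow (row_exp k1 k2 i)) \<Longrightarrow> \<exists>z\<in>std_lattice. X *v z = y"
proof -
  show "(X *v y) $ i \<in> ideal_pow (row_exp k1 k2 i)" if "y \<in> std_lattice"
    using that X unfolding matrix_vector_mult_def diag_orbit_def std_lattice_def
    by (auto intro!: ideal_pow_sum ideal_pow_mult_integer(2))
  assume y: "\<And>i. y $ i \<in> ideal_pow (row_exp k1 k2 i)"
  obtain Y where Y: "X = dm Y" "sol Y" using X unfolding diag_orbit_eq by blast
  have "det Y = u" using Y(2) unfolding sol_def det_3 by (auto simp: algebra_simps)
  then obtain Z where Z: "Z \<in> integral_matrices" "Y ** Z = mat 1"
    using integral_inverse_obtain[of Y] Y(2) u_unit unfolding sol_def by metis
  define w where "w = (\<chi> i. y $ i / \<pi> ^ row_exp k1 k2 i)"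
  have w: "w \<in> std_lattice"
    unfolding std_lattice_def w_def using ideal_pow_divide_power[OF uniformizer, of _ _ 0] y by simp
  have "X *v (Z *v w) = y"
  proof -
    have "Y *v (Z *v w) = w" using Z(2) by (simp add: matrix_vector_mul_assoc)
    then have "\<pi> ^ row_exp k1 k2 i * (Y *v (Z *v w)) $ i = y $ i" for i by (simp add: w_def)
    moreover have "(dm Y *v (Z *v w)) $ i = \<pi> ^ row_exp k1 k2 i * (Y *v (Z *v w)) $ i" for i
      by (simp add: matrix_vector_mult_def dm_def sum_distrib_left mult.assoc)
    ultimately show ?thesis by (simp add: vec_eq_iff Y(1))
  qed
  moreover have "Z *v w \<in> std_lattice" by (rule integral_matrix_std_lattice[OF Z(1) w])
  ultimately show "\<exists>z\<in>std_lattice. X *v z = y" by blast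
qed

lemma image_orbit_conj:
  assumes gh: "g ** h = mat 1" and i: "g \<in> integral_matrices" "h \<in> integral_matrices"
  shows "image_orbit \<gamma> (standard_sublattice h k1 k2) = conj_by g h ` diag_orbit \<gamma> k1 k2"
proof (intro equalityI subsetI)
  have hg: "h ** g = mat 1" using gh matrix_left_right_inverse by blast
  have gh': "g *v (h *v x) = x" "h *v (g *v x) = x" for x
    using gh hg by (simp_all add: matrix_vector_mul_assoc)
  {
    fix X assume "X \<in> image_orbit \<gamma> (standard_sublattice h k1 k2)"
    then have X: "X \<in> integral_matrices" "charpoly X = charpoly \<gamma>"
      "(\<lambda>x. X *v x) ` std_lattice = standard_sublattice h k1 k2" by (auto simp: image_orbit_def)
    define X' where "X' = conj_by h g X"
    have "X' \<in> fiber \<gamma>" using X(2) rho_conj[OF hg, of X] by (simp add: X'_def conj_by_def fiber_def charpoly_eq_iff_rho)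
    moreover have "X' $ i $ j \<in> ideal_pow (row_exp k1 k2 i)" for i j
    proof -
      have "X *v (g *v axis j 1) \<in> standard_sublattice h k1 k2"
        using X(3) integral_matrix_std_lattice[OF i(1) std_lattice_axis] by blast
      then have "(h *v (X *v (g *v axis j 1))) $ i \<in> ideal_pow (row_exp k1 k2 i)"
        by (simp add: standard_sublattice_def)
      then show ?thesis
        by (simp add: matrix_vector_mul_assoc matrix_axis X'_def conj_by_def matrix_mul_assoc)
    qed
    ultimately have "X' \<in> diag_orbit \<gamma> k1 k2" by (simp add: diag_orbit_def)
    moreover have "X = conj_by g h X'" using mat_mul_conj_cancel[OF gh, of X] by (simp add: X'_def conj_by_def)
    ultimately show "X \<in> conj_by g h ` diag_orbit \<gamma> k1 k2" by blast
  next
    fix X assume "X \<in> conj_by g h ` diag_orbit \<gamma> k1 k2"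
    then obtain X' where X': "X' \<in> diag_orbit \<gamma> k1 k2" "X = g ** X' ** h" by (auto simp: conj_by_def)
    have Xi: "X \<in> integral_matrices" unfolding X'(2)
      using X'(1) diag_orbit_integral i by (intro integral_matrices_mult) auto
    have "rho X = rho \<gamma>" using X' rho_conj[OF gh, of X'] by (simp add: diag_orbit_def fiber_def)
    then have c: "charpoly X = charpoly \<gamma>" by (simp add: charpoly_eq_iff_rho)
    have hX: "h *v (X *v z) = X' *v (h *v z)" for z
    proof -
      have "X *v z = g *v (X' *v (h *v z))" by (simp add: X'(2) matrix_vector_mul_assoc matrix_mul_assoc)
      then show ?thesis using gh'(2) by simp
    qed
    have "(\<lambda>x. X *v x) ` std_lattice = standard_sublattice h k1 k2"
    proof (intro equalityI subsetI)
      fix x assume "x \<in> (\<lambda>x. X *v x) ` std_lattice"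
      then obtain z where z: "z \<in> std_lattice" "x = X *v z" by blast
      have "(h *v x) $ i \<in> ideal_pow (row_exp k1 k2 i)" for i
        unfolding z(2) hX by (rule diag_orbit_image(1)[OF X'(1) integral_matrix_std_lattice[OF i(2) z(1)]])
      moreover have "x \<in> std_lattice" unfolding z(2) by (rule integral_matrix_std_lattice[OF Xi z(1)])
      ultimately show "x \<in> standard_sublattice h k1 k2" by (simp add: standard_sublattice_def)
    next
      fix x assume "x \<in> standard_sublattice h k1 k2"
      then have "\<exists>z\<in>std_lattice. X' *v z = h *v x"
        by (intro diag_orbit_image(2)[OF X'(1)]) (simp add: standard_sublattice_def)
      then obtain z where z: "z \<in> std_lattice" "X' *v z = h *v x" by blast
      have "h *v (X *v (g *v z)) = h *v x" unfolding hX gh' z(2) ..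
      then have "X *v (g *v z) = x" using gh'(1) by metis
      moreover have "g *v z \<in> std_lattice" by (rule integral_matrix_std_lattice[OF i(1) z(1)])
      ultimately show "x \<in> (\<lambda>x. X *v x) ` std_lattice" by blast
    qed
    then show "X \<in> image_orbit \<gamma> (standard_sublattice h k1 k2)" using Xi c by (simp add: image_orbit_def)
  }
qed

lemma emeasure_image_orbit:
  assumes ld: "ld_measure \<gamma> \<mu>" and gh: "g ** h = mat 1" and i: "g \<in> integral_matrices" "h \<in> integral_matrices"
    and K: "k1 < k2 \<Longrightarrow> K \<le> k1 \<and> K \<le> k2 - k1 \<and> rho \<gamma> $ 1 \<in> ideal_pow K \<and> rho \<gamma> $ 2 \<in> ideal_pow (k1 + K)"
    and G: "\<And>Y. k1 < k2 \<Longrightarrow> sol Y \<Longrightarrow> Y$1$2 \<in> ideal_pow 1 \<Longrightarrow> Y$2$1 \<in> ideal_pow 1 \<Longrightarrow> same_ord K (Y$1$2 * Y$2$1)"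
  shows "emeasure \<mu> (image_orbit \<gamma> (standard_sublattice h k1 k2)) = emeasure \<mu> (diag_orbit \<gamma> k1 k2)"
  unfolding image_orbit_conj[OF gh i]
proof (rule emeasure_conj[OF ld gh i _ diag_orbit_integral])
  show "diag_orbit \<gamma> k1 k2 \<subseteq> fiber \<gamma>" by (auto simp: diag_orbit_def)
  show "\<exists>m<Suc (2 * k1 + 2 * k2). jacobian_ord X m" if "X \<in> diag_orbit \<gamma> k1 k2" for X
    using jacobian_ord_orbit[OF that K G] by blast
  show "X' \<in> diag_orbit \<gamma> k1 k2"
    if "X \<in> diag_orbit \<gamma> k1 k2" "X' \<in> fiber \<gamma>" "cong_matrix (Suc (2 * k1 + 2 * k2)) X' X" for X X'
    by (rule diag_orbit_cong[OF that]) auto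
qed

end


section \<open>Sublattices of a given type\<close>

definition pairing :: "'a::comm_ring_1 ^ 3 \<Rightarrow> 'a ^ 3 \<Rightarrow> 'a" where
  "pairing f x = f$1 * x$1 + f$2 * x$2 + f$3 * x$3"

lemma pairing_linear:
  "pairing f (x + y) = pairing f x + pairing f y" "pairing f (a *s x) = a * pairing f x"
  "pairing f (x - y) = pairing f x - pairing f y" "pairing f 0 = 0"
  "pairing (f + g) x = pairing f x + pairing g x" "pairing (a *s f) x = a * pairing f x"
  "pairing (f - g) x = pairing f x - pairing g x"
  by (simp_all add: pairing_def algebra_simps)

lemma pairing_mem:
  assumes "\<And>i. f $ i \<in> ideal_pow k" "x \<in> std_lattice"
  shows "pairing f x \<in> ideal_pow k"
  using assms unfolding pairing_def std_lattice_def by (auto intro!: ideal_pow_add ideal_pow_mult_integer(2))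

lemma pairing_integer: "f \<in> std_lattice \<Longrightarrow> x \<in> std_lattice \<Longrightarrow> pairing f x \<in> integers"
  by (rule pairing_mem) (auto simp: std_lattice_def)

text \<open>The cross product of \<open>f\<close> and \<open>g\<close>; two integral forms are
  independent modulo \<pi> when one of its coordinates is a unit.\<close>

definition minor :: "'a::comm_ring_1 ^ 3 \<Rightarrow> 'a ^ 3 \<Rightarrow> 3 \<Rightarrow> 'a" where
  "minor f g i = (if i = 1 then f$2 * g$3 - f$3 * g$2 else if i = 2 then f$3 * g$1 - f$1 * g$3 else f$1 * g$2 - f$2 * g$1)"

lemma minor_components:
  "minor f g 1 = f$2 * g$3 - f$3 * g$2" "minor f g 2 = f$3 * g$1 - f$1 * g$3" "minor f g 3 = f$1 * g$2 - f$2 * g$1"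
  by (simp_all add: minor_def)

definition independent_mod :: "'a::discrete_valued_field ^ 3 \<Rightarrow> 'a ^ 3 \<Rightarrow> bool" where
  "independent_mod f g \<longleftrightarrow> f \<in> std_lattice \<and> g \<in> std_lattice \<and> (\<exists>i. ounit (minor f g i))"

definition sublattice :: "nat \<Rightarrow> nat \<Rightarrow> 'a::discrete_valued_field ^ 3 \<Rightarrow> 'a ^ 3 \<Rightarrow> ('a ^ 3) set" where
  "sublattice k1 k2 f1 f2 = {x \<in> std_lattice. pairing f1 x \<in> ideal_pow k1 \<and> pairing f2 x \<in> ideal_pow k2}"

text \<open>The pair is completed by the coordinate form \<open>axis i 1\<close>, where
  \<open>i\<close> is the index of a unit minor; that minor is then the determinant of
  \<open>h\<close>.\<close>

lemma independent_mod_basis: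
  fixes f1 f2 :: "'a::discrete_valued_field ^ 3"
  assumes "independent_mod f1 f2"
  obtains g h :: "'a ^ 3 ^ 3" where "g \<in> integral_matrices" "h \<in> integral_matrices" "g ** h = mat 1" "h ** g = mat 1"
    "h $ 2 = f1" "h $ 3 = f2"
proof -
  obtain i where u: "ounit (minor f1 f2 i)" and f: "f1 \<in> std_lattice" "f2 \<in> std_lattice"
    using assms by (auto simp: independent_mod_def)
  define h where "h = (vector [axis i 1, f1, f2] :: 'a ^ 3 ^ 3)"
  have h: "h $ 1 = axis i 1" "h $ 2 = f1" "h $ 3 = f2" by (simp_all add: h_def)
  have hi: "h \<in> integral_matrices"
    using f unfolding integral_matrices_def mem_Collect_eq forall_3[of "\<lambda>i. \<forall>j. h $ i $ j \<in> integers"] h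
    by (auto simp: std_lattice_def axis_def)
  have "det h = minor f1 f2 i"
    unfolding det_3 h using exhaust_3[of i] by (auto simp: minor_components axis_def algebra_simps)
  then obtain g where "g \<in> integral_matrices" "h ** g = mat 1" "g ** h = mat 1"
    using integral_inverse_obtain[OF hi] u by metis
  then show thesis using that hi h by blast
qed

lemma matrix_vector_pairing: "(h *v x) $ i = pairing (h $ i) x" for h :: "'a::comm_ring_1 ^ 3 ^ 3"
  by (simp add: matrix_vector_mult_def pairing_def sum_3)

lemma sublattice_standard:
  assumes "h \<in> integral_matrices"
  shows "standard_sublattice h k1 k2 = sublattice k1 k2 (h $ 2) (h $ 3)"
proof -
  have "h $ 1 \<in> std_lattice" using assms by (simp add: integral_matrices_def std_lattice_def)
  then show ?thesis
    by (auto simp: standard_sublattice_def sublattice_def forall_3 matrix_vector_pairing pairing_integer)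
qed

lemma coset_eq_iff:
  fixes S :: "'b::ab_group_add set"
  assumes "0 \<in> S" "\<And>x y. x \<in> S \<Longrightarrow> y \<in> S \<Longrightarrow> x - y \<in> S"
  shows "coset x S = coset y S \<longleftrightarrow> x - y \<in> S"
proof
  have neg: "- s \<in> S" if "s \<in> S" for s using assms(2)[OF assms(1) that] by simp
  have add: "s + s' \<in> S" if "s \<in> S" "s' \<in> S" for s s' using assms(2)[OF that(1) neg[OF that(2)]] by simp
  assume "coset x S = coset y S"
  moreover have "x \<in> coset x S" using assms(1) by (force simp: coset_def)
  ultimately obtain s where "s \<in> S" "x = y + s" by (auto simp: coset_def)
  then show "x - y \<in> S" by simp
next
  have neg: "- s \<in> S" if "s \<in> S" for s using assms(2)[OF assms(1) that] by simp
  have add: "s + s' \<in> S" if "s \<in> S" "s' \<in> S" for s s' using assms(2)[OF that(1) neg[OF that(2)]] by simp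
  have sub: "coset x S \<subseteq> coset y S" if "x - y \<in> S" for x y
  proof
    fix z assume "z \<in> coset x S"
    then obtain s where "s \<in> S" "z = x + s" by (auto simp: coset_def)
    then show "z \<in> coset y S" using add[OF that] by (auto simp: coset_def intro!: image_eqI[of _ _ "x - y + s"])
  qed
  assume "x - y \<in> S"
  then show "coset x S = coset y S" using sub[of x y] sub[of y x] neg[of "x - y"] by auto
qed

lemma coset_ideal_pow_eq_iff: "coset x (ideal_pow k) = coset y (ideal_pow k) \<longleftrightarrow> x - y \<in> ideal_pow k"
  by (rule coset_eq_iff) (auto intro: ideal_pow_diff)

lemma coset_ideal_pow_mem: "u \<in> coset x (ideal_pow k) \<longleftrightarrow> u - x \<in> ideal_pow k"
  by (auto simp: coset_def image_iff algebra_simps intro: bexI[of _ "u - x"])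

lemma coset_ideal_pow_add:
  "coset (a + b) (ideal_pow k) = {u + v | u v. u \<in> coset a (ideal_pow k) \<and> v \<in> coset b (ideal_pow k)}"
proof (intro equalityI subsetI)
  fix z assume "z \<in> coset (a + b) (ideal_pow k)"
  then have z: "(z - b) - a \<in> ideal_pow k" by (simp add: coset_ideal_pow_mem algebra_simps)
  have "z = (z - b) + b" "z - b \<in> coset a (ideal_pow k)" "b \<in> coset b (ideal_pow k)"
    using z by (simp_all add: coset_ideal_pow_mem)
  then show "z \<in> {u + v | u v. u \<in> coset a (ideal_pow k) \<and> v \<in> coset b (ideal_pow k)}" by blast
next
  fix z assume "z \<in> {u + v | u v. u \<in> coset a (ideal_pow k) \<and> v \<in> coset b (ideal_pow k)}"
  then obtain u v where z: "z = u + v" "u - a \<in> ideal_pow k" "v - b \<in> ideal_pow k" by (auto simp: coset_ideal_pow_mem)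
  show "z \<in> coset (a + b) (ideal_pow k)"
    using ideal_pow_add[OF z(2,3)] z(1) by (simp add: coset_ideal_pow_mem algebra_simps)
qed

lemma coset_ideal_pow_scale:
  assumes a: "a \<in> integers"
  shows "coset (a * b) (ideal_pow k) = {a * u + z | u z. u \<in> coset b (ideal_pow k) \<and> z \<in> ideal_pow k}"
proof (intro equalityI subsetI)
  fix x assume "x \<in> coset (a * b) (ideal_pow k)"
  then have x: "x - a * b \<in> ideal_pow k" by (simp add: coset_ideal_pow_mem)
  moreover have "x = a * b + (x - a * b)" "b \<in> coset b (ideal_pow k)" by (simp_all add: coset_ideal_pow_mem)
  ultimately show "x \<in> {a * u + z | u z. u \<in> coset b (ideal_pow k) \<and> z \<in> ideal_pow k}" by blast
next
  fix x assume "x \<in> {a * u + z | u z. u \<in> coset b (ideal_pow k) \<and> z \<in> ideal_pow k}"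
  then obtain u z where x: "x = a * u + z" "u - b \<in> ideal_pow k" "z \<in> ideal_pow k" by (auto simp: coset_ideal_pow_mem)
  have "a * (u - b) + z \<in> ideal_pow k" using ideal_pow_mult_integer(1)[OF a x(2)] x(3) by (rule ideal_pow_add)
  then show "x \<in> coset (a * b) (ideal_pow k)" by (simp add: coset_ideal_pow_mem x(1) algebra_simps)
qed

lemma std_lattice_closed:
  "0 \<in> std_lattice" "x \<in> std_lattice \<Longrightarrow> y \<in> std_lattice \<Longrightarrow> x + y \<in> std_lattice"
  "x \<in> std_lattice \<Longrightarrow> y \<in> std_lattice \<Longrightarrow> x - y \<in> std_lattice"
  "a \<in> integers \<Longrightarrow> x \<in> std_lattice \<Longrightarrow> a *s x \<in> std_lattice"
  by (auto simp: std_lattice_def intro: ideal_pow_add ideal_pow_diff integers_mult)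

lemma o_submodule_diff:
  assumes "o_submodule M" "x \<in> M" "y \<in> M"
  shows "x - y \<in> M"
proof -
  have "(- 1) *s y \<in> M" using assms unfolding o_submodule_def by (metis ideal_pow_uminus one_in_integers)
  then have "x + (- 1) *s y \<in> M" using assms unfolding o_submodule_def by blast
  then show ?thesis by simp
qed

lemma coset_submodule_eq_iff: "o_submodule M \<Longrightarrow> coset x M = coset y M \<longleftrightarrow> x - y \<in> M"
  by (rule coset_eq_iff) (auto intro: o_submodule_diff simp: o_submodule_def)

lemma less_length_2: "i < length [k1, k2] \<longleftrightarrow> i = 0 \<or> i = Suc 0"
  by auto

lemma sublattice_submodule: "o_submodule (sublattice k1 k2 f1 f2)"
  unfolding o_submodule_def sublattice_def
  by (auto simp: std_lattice_closed pairing_linear intro: ideal_pow_add ideal_pow_mult_integer)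

lemma sublattice_full:
  fixes f1 f2 :: "'a::discrete_valued_field ^ 3"
  assumes f: "f1 \<in> std_lattice" "f2 \<in> std_lattice" and k: "k1 \<le> k2"
  shows "full_sublattice (sublattice k1 k2 f1 f2)"
proof -
  obtain \<pi> :: 'a where \<pi>: "uniformizer \<pi>" using exists_uniformizer by blast
  have "x \<in> vec.span (sublattice k1 k2 f1 f2)" for x
  proof -
    define N where "N = Max ((\<lambda>i. nat (- ord (x $ i))) ` UNIV)"
    have N: "nat (- ord (x $ i)) \<le> N" for i unfolding N_def by simp
    have "\<pi> ^ N * x $ i \<in> integers" for i
      using N[of i] \<pi> by (cases "x $ i = 0") (auto simp: ideal_pow_def ord_mult ord_uniformizer_power uniformizer_nonzero)
    then have 1: "\<pi> ^ N *s x \<in> std_lattice" by (simp add: std_lattice_def)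
    define y where "y = \<pi> ^ k2 *s (\<pi> ^ N *s x)"
    have p: "\<pi> ^ k2 \<in> ideal_pow k1" "\<pi> ^ k2 \<in> ideal_pow k2" "\<pi> ^ k2 \<in> integers"
      using uniformizer_power_mem'[OF \<pi>] k by auto
    have "pairing f1 y \<in> ideal_pow k1" "pairing f2 y \<in> ideal_pow k2"
      unfolding y_def pairing_linear(2)[of _ "\<pi> ^ k2"]
      by (intro ideal_pow_mult_integer(2) pairing_integer f 1 p)+
    moreover have "y \<in> std_lattice" unfolding y_def by (rule std_lattice_closed(4)[OF p(3) 1])
    ultimately have "y \<in> sublattice k1 k2 f1 f2" by (simp add: sublattice_def)
    then have "inverse (\<pi> ^ k2 * \<pi> ^ N) *s y \<in> vec.span (sublattice k1 k2 f1 f2)"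
      by (intro vec.span_scale vec.span_base)
    moreover have "inverse (\<pi> ^ k2 * \<pi> ^ N) *s y = x"
      using uniformizer_nonzero[OF \<pi>] by (simp add: y_def vec_eq_iff field_simps)
    ultimately show ?thesis by simp
  qed
  then show ?thesis unfolding full_sublattice_def using sublattice_submodule by (auto simp: sublattice_def)
qed

text \<open>The isomorphism sends \<open>x\<close> to the classes of \<open>pairing f1 x\<close>
  modulo \<open>\<pi> ^ k1\<close> and of \<open>pairing f2 x\<close> modulo
  \<open>\<pi> ^ k2\<close>. Its kernel is the sublattice by construction, and it is onto because
  the pair extends to a basis of forms.\<close>

lemma sublattice_has_type:
  fixes f1 f2 :: "'a::discrete_valued_field ^ 3"
  assumes f: "independent_mod f1 f2" and k: "1 \<le> k1" "k1 \<le> k2"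
  shows "has_type (sublattice k1 k2 f1 f2) [k1, k2]"
proof -
  let ?M = "sublattice k1 k2 f1 f2" and ?ks = "[k1, k2]"
  have fi: "f1 \<in> std_lattice" "f2 \<in> std_lattice" using f by (auto simp: independent_mod_def)
  define F where "F i = [f1, f2] ! i" for i
  define \<phi> where "\<phi> x = (\<lambda>i\<in>{..<length ?ks}. coset (pairing (F i) x) (ideal_pow (?ks ! i)))" for x
  have \<phi>: "\<phi> x i = coset (pairing (F i) x) (ideal_pow (?ks ! i))" if "i < length ?ks" for x i
    using that by (simp add: \<phi>_def)
  have \<phi>_eq: "\<phi> x = \<phi> y \<longleftrightarrow> coset x ?M = coset y ?M" if xy: "x \<in> std_lattice" "y \<in> std_lattice" for x y
  proof -
    have "\<phi> x = \<phi> y \<longleftrightarrow> (\<forall>i<length ?ks. pairing (F i) x - pairing (F i) y \<in> ideal_pow (?ks ! i))"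
      unfolding \<phi>_def fun_eq_iff restrict_def using coset_ideal_pow_eq_iff by (auto 4 3)
    also have "\<dots> \<longleftrightarrow> x - y \<in> ?M"
      unfolding less_length_2 sublattice_def using std_lattice_closed(3)[OF xy]
      by (auto simp: F_def pairing_linear)
    finally show ?thesis using coset_submodule_eq_iff[OF sublattice_submodule] by blast
  qed
  have \<phi>_mem: "\<phi> x \<in> (\<Pi>\<^sub>E i\<in>{..<length ?ks}. (\<lambda>a. coset a (ideal_pow (?ks ! i))) ` integers)"
    if x: "x \<in> std_lattice" for x
  proof -
    have "pairing (F i) x \<in> integers" if "i < length ?ks" for i
      using that fi x unfolding less_length_2 by (auto simp: F_def pairing_integer)
    then show ?thesis unfolding \<phi>_def by (intro restrict_PiE_iff[THEN iffD2]) auto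
  qed
  define \<Phi> where "\<Phi> C = \<phi> (SOME x. x \<in> std_lattice \<and> C = coset x ?M)" for C
  have \<Phi>: "\<Phi> (coset x ?M) = \<phi> x" if "x \<in> std_lattice" for x
  proof -
    let ?y = "SOME y. y \<in> std_lattice \<and> coset x ?M = coset y ?M"
    have "?y \<in> std_lattice \<and> coset x ?M = coset ?y ?M" by (rule someI[of _ x]) (use that in simp)
    then have "\<phi> x = \<phi> ?y" using \<phi>_eq[OF that] by blast
    then show ?thesis by (simp add: \<Phi>_def)
  qed
  have "bij_betw \<Phi> ((\<lambda>x. coset x ?M) ` std_lattice)
       (\<Pi>\<^sub>E i\<in>{..<length ?ks}. (\<lambda>a. coset a (ideal_pow (?ks ! i))) ` integers)"
    unfolding bij_betw_def
  proof
    show "inj_on \<Phi> ((\<lambda>x. coset x ?M) ` std_lattice)"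
    proof (rule inj_onI)
      fix C D assume "C \<in> (\<lambda>x. coset x ?M) ` std_lattice" "D \<in> (\<lambda>x. coset x ?M) ` std_lattice" "\<Phi> C = \<Phi> D"
      then obtain x y where "x \<in> std_lattice" "y \<in> std_lattice" "C = coset x ?M" "D = coset y ?M" by blast
      then show "C = D" using \<open>\<Phi> C = \<Phi> D\<close> \<Phi> \<phi>_eq by simp
    qed
    show "\<Phi> ` ((\<lambda>x. coset x ?M) ` std_lattice) = (\<Pi>\<^sub>E i\<in>{..<length ?ks}. (\<lambda>a. coset a (ideal_pow (?ks ! i))) ` integers)"
    proof (intro equalityI subsetI)
      fix c assume "c \<in> \<Phi> ` ((\<lambda>x. coset x ?M) ` std_lattice)"
      then obtain x where x: "x \<in> std_lattice" "c = \<phi> x" using \<Phi> by auto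
      show "c \<in> (\<Pi>\<^sub>E i\<in>{..<length ?ks}. (\<lambda>a. coset a (ideal_pow (?ks ! i))) ` integers)"
        unfolding x(2) by (rule \<phi>_mem[OF x(1)])
    next
      fix c :: "nat \<Rightarrow> 'a set" assume c: "c \<in> (\<Pi>\<^sub>E i\<in>{..<length ?ks}. (\<lambda>a. coset a (ideal_pow (?ks ! i))) ` integers)"
      have "c 0 \<in> (\<lambda>a. coset a (ideal_pow k1)) ` integers" "c 1 \<in> (\<lambda>a. coset a (ideal_pow k2)) ` integers"
        using PiE_mem[OF c, of 0] PiE_mem[OF c, of 1] by auto
      then obtain a b where ab: "a \<in> integers" "b \<in> integers" "c 0 = coset a (ideal_pow k1)" "c 1 = coset b (ideal_pow k2)"
        by auto
      obtain g h :: "'a ^ 3 ^ 3" where gh: "g \<in> integral_matrices" "h \<in> integral_matrices" "g ** h = mat 1" "h ** g = mat 1"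
        "h $ 2 = f1" "h $ 3 = f2" using independent_mod_basis[OF f] .
      \<comment> \<open>The columns of \<open>g\<close> are dual to the rows of \<open>h\<close>,
        the last two of which are \<open>f1\<close> and \<open>f2\<close>; so this vector has the
        prescribed pairings.\<close>
      define x where "x = g *v vector [0, a, b]"
      have x: "x \<in> std_lattice" unfolding x_def
        by (rule integral_matrix_std_lattice[OF gh(1)]) (use ab in \<open>simp add: std_lattice_def forall_3\<close>)
      have hx: "h *v x = vector [0, a, b]" unfolding x_def by (simp add: matrix_vector_mul_assoc gh(4))
      have pa: "pairing f1 x = a"
        using hx[THEN arg_cong, of "\<lambda>v. v $ 2"] unfolding matrix_vector_pairing gh(5) vector_3 .
      have pb: "pairing f2 x = b"
        using hx[THEN arg_cong, of "\<lambda>v. v $ 3"] unfolding matrix_vector_pairing gh(6) vector_3 .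
      have "\<phi> x = c"
      proof (rule PiE_ext[OF \<phi>_mem[OF x] c])
        fix i assume "i \<in> {..<length ?ks}"
        then have i: "i < length ?ks" "i = 0 \<or> i = 1" by auto
        show "\<phi> x i = c i" unfolding \<phi>[OF i(1)] using i(2) pa pb ab(3,4) by (elim disjE) (simp_all add: F_def)
      qed
      then show "c \<in> \<Phi> ` ((\<lambda>x. coset x ?M) ` std_lattice)" using \<Phi>[OF x] x by force
    qed
  qed
  then have "quotient_iso ?ks ?M \<Phi>"
    unfolding quotient_iso_def
    by (simp only: \<Phi> \<phi> std_lattice_closed coset_ideal_pow_add[symmetric] coset_ideal_pow_scale[symmetric]
      pairing_linear(1,2) simp_thms ball_simps) (simp add: \<Phi> \<phi> std_lattice_closed coset_ideal_pow_scale pairing_linear flip: coset_ideal_pow_add)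
  then show ?thesis unfolding has_type_def using sublattice_full[OF fi k(2)] k by auto
qed

text \<open>The components of the isomorphism are linear, hence determined by their values on the
  standard basis. Lifts of these values form \<open>F 0\<close> and \<open>F 1\<close>; injectivity
  makes \<open>M\<close> their sublattice, and surjectivity makes them independent modulo
  \<pi>.\<close>

lemma has_type_sublattice:
  fixes M :: "('a::discrete_valued_field ^ 3) set"
  assumes "has_type M [k1, k2]"
  shows "\<exists>f1 f2. independent_mod f1 f2 \<and> M = sublattice k1 k2 f1 f2"
proof -
  let ?ks = "[k1, k2]"
  from assms obtain \<Phi> where full: "full_sublattice M" and k: "1 \<le> k1" "k1 \<le> k2" and q: "quotient_iso ?ks M \<Phi>"
    by (auto simp: has_type_def)
  have M: "o_submodule M" "M \<subseteq> std_lattice" using full by (auto simp: full_sublattice_def)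
  have bij: "bij_betw \<Phi> ((\<lambda>x. coset x M) ` std_lattice)
       (\<Pi>\<^sub>E i\<in>{..<length ?ks}. (\<lambda>a. coset a (ideal_pow (?ks ! i))) ` integers)"
    and add: "\<And>x y i. x \<in> std_lattice \<Longrightarrow> y \<in> std_lattice \<Longrightarrow> i < length ?ks \<Longrightarrow>
        \<Phi> (coset (x + y) M) i = {u + v | u v. u \<in> \<Phi> (coset x M) i \<and> v \<in> \<Phi> (coset y M) i}"
    and scale: "\<And>a x i. a \<in> integers \<Longrightarrow> x \<in> std_lattice \<Longrightarrow> i < length ?ks \<Longrightarrow>
        \<Phi> (coset (a *s x) M) i = {a * u + z | u z. u \<in> \<Phi> (coset x M) i \<and> z \<in> ideal_pow (?ks ! i)}"
    subgoal by (rule q[unfolded quotient_iso_def, THEN conjunct1])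
    subgoal by (rule q[unfolded quotient_iso_def, THEN conjunct2, THEN conjunct1, rule_format])
    subgoal by (rule q[unfolded quotient_iso_def, THEN conjunct2, THEN conjunct2, rule_format])
    done
  have PiE: "\<Phi> (coset x M) \<in> (\<Pi>\<^sub>E i\<in>{..<length ?ks}. (\<lambda>a. coset a (ideal_pow (?ks ! i))) ` integers)" if "x \<in> std_lattice" for x
    by (rule bspec[OF bij_betwE[OF bij]]) (use that in \<open>rule imageI\<close>)
  have "\<exists>c. c \<in> integers \<and> \<Phi> (coset (axis j 1) M) i = coset c (ideal_pow (?ks ! i))" if "i < length ?ks" for i j
    using PiE_mem[OF PiE[OF std_lattice_axis[of j]], of i] that by auto
  then obtain c where c: "\<And>i j. i < length ?ks \<Longrightarrow> c i j \<in> integers \<and> \<Phi> (coset (axis j 1) M) i = coset (c i j) (ideal_pow (?ks ! i))"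
    by metis
  define F where "F i = (\<chi> j. c i j)" for i
  have Fi: "F i \<in> std_lattice" if "i < length ?ks" for i using c[OF that] by (simp add: F_def std_lattice_def)
  have \<Phi>: "\<Phi> (coset x M) i = coset (pairing (F i) x) (ideal_pow (?ks ! i))" if x: "x \<in> std_lattice" and i: "i < length ?ks" for x i
  proof -
    have sc: "\<Phi> (coset (x $ j *s axis j 1) M) i = coset (x $ j * c i j) (ideal_pow (?ks ! i))"
      and xj: "x $ j *s axis j 1 \<in> std_lattice" for j
    proof -
      have xi: "x $ j \<in> integers" using x by (simp add: std_lattice_def)
      show "\<Phi> (coset (x $ j *s axis j 1) M) i = coset (x $ j * c i j) (ideal_pow (?ks ! i))"
        unfolding scale[OF xi std_lattice_axis i] coset_ideal_pow_scale[OF xi] using c[OF i, of j] by auto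
      show "x $ j *s axis j 1 \<in> std_lattice" by (rule std_lattice_closed(4)[OF xi std_lattice_axis])
    qed
    have e: "x = x $ 1 *s axis 1 1 + x $ 2 *s axis 2 1 + x $ 3 *s axis 3 1"
      by (auto simp: vec_eq_iff forall_3 axis_def)
    have "\<Phi> (coset (x $ 1 *s axis 1 1 + x $ 2 *s axis 2 1 + x $ 3 *s axis 3 1) M) i =
        coset (x $ 1 * c i 1 + x $ 2 * c i 2 + x $ 3 * c i 3) (ideal_pow (?ks ! i))"
      unfolding add[OF std_lattice_closed(2)[OF xj xj] xj i] add[OF xj xj i] sc coset_ideal_pow_add[symmetric] ..
    moreover have "x $ 1 * c i 1 + x $ 2 * c i 2 + x $ 3 * c i 3 = pairing (F i) x"
      by (simp add: pairing_def F_def mult.commute)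
    ultimately show ?thesis using e by simp
  qed
  have "x \<in> M \<longleftrightarrow> x \<in> sublattice k1 k2 (F 0) (F 1)" for x
  proof (cases "x \<in> std_lattice")
    case True
    have "x \<in> M \<longleftrightarrow> coset x M = coset 0 M" using coset_submodule_eq_iff[OF M(1), of x 0] by simp
    also have "\<dots> \<longleftrightarrow> \<Phi> (coset x M) = \<Phi> (coset 0 M)"
      using bij_betw_imp_inj_on[OF bij] True std_lattice_closed(1) by (auto dest: inj_onD)
    also have "\<dots> \<longleftrightarrow> (\<forall>i<length ?ks. \<Phi> (coset x M) i = \<Phi> (coset 0 M) i)"
      using PiE_eq_iff_not_empty PiE_ext[OF PiE[OF True] PiE[OF std_lattice_closed(1)]] by auto
    also have "\<dots> \<longleftrightarrow> (\<forall>i<length ?ks. pairing (F i) x \<in> ideal_pow (?ks ! i))"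
    proof -
      have "\<Phi> (coset x M) i = \<Phi> (coset 0 M) i \<longleftrightarrow> pairing (F i) x \<in> ideal_pow (?ks ! i)" if i: "i < length ?ks" for i
        unfolding \<Phi>[OF True i] \<Phi>[OF std_lattice_closed(1) i] coset_ideal_pow_eq_iff pairing_linear(4) diff_0_right ..
      then show ?thesis by simp
    qed
    also have "\<dots> \<longleftrightarrow> x \<in> sublattice k1 k2 (F 0) (F 1)"
      unfolding less_length_2 sublattice_def using True by auto
    finally show ?thesis .
  next
    case False
    then show ?thesis using M(2) by (auto simp: sublattice_def)
  qed
  then have MF: "M = sublattice k1 k2 (F 0) (F 1)" by blast
  have solve: "\<exists>x\<in>std_lattice. pairing (F 0) x - a \<in> ideal_pow k1 \<and> pairing (F 1) x - b \<in> ideal_pow k2"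
    if ab: "a \<in> integers" "b \<in> integers" for a b
  proof -
    define t where "t = (\<lambda>i\<in>{..<length ?ks}. coset ([a, b] ! i) (ideal_pow (?ks ! i)))"
    have "t \<in> (\<Pi>\<^sub>E i\<in>{..<length ?ks}. (\<lambda>a. coset a (ideal_pow (?ks ! i))) ` integers)"
      unfolding t_def by (intro restrict_PiE_iff[THEN iffD2] ballI) (use ab in \<open>auto simp: less_Suc_eq\<close>)
    note tm = this
    have t0: "t 0 = coset a (ideal_pow k1)" and t1: "t 1 = coset b (ideal_pow k2)" by (simp_all add: t_def)
    have "t \<in> \<Phi> ` ((\<lambda>x. coset x M) ` std_lattice)" unfolding bij_betw_imp_surj_on[OF bij] by (rule tm)
    then obtain x where x: "x \<in> std_lattice" "\<Phi> (coset x M) = t" by (elim imageE) simp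
    have z: "\<Phi> (coset x M) 0 = coset (pairing (F 0) x) (ideal_pow k1)" using \<Phi>[OF x(1), of 0] by simp
    have o: "\<Phi> (coset x M) 1 = coset (pairing (F 1) x) (ideal_pow k2)" using \<Phi>[OF x(1), of 1] by simp
    have "pairing (F 0) x - a \<in> ideal_pow k1" using z[symmetric] unfolding x(2) t0 coset_ideal_pow_eq_iff .
    moreover have "pairing (F 1) x - b \<in> ideal_pow k2" using o[symmetric] unfolding x(2) t1 coset_ideal_pow_eq_iff .
    ultimately show ?thesis using x(1) by blast
  qed
  obtain x where x: "x \<in> std_lattice" "pairing (F 0) x - 1 \<in> ideal_pow k1" "pairing (F 1) x - 0 \<in> ideal_pow k2"
    using solve[of 1 0] by auto
  obtain y where y: "y \<in> std_lattice" "pairing (F 0) y - 0 \<in> ideal_pow k1" "pairing (F 1) y - 1 \<in> ideal_pow k2"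
    using solve[of 0 1] by auto
  have 1: "pairing (F 0) x - 1 \<in> ideal_pow 1" "pairing (F 1) x \<in> ideal_pow 1" "pairing (F 1) y - 1 \<in> ideal_pow 1"
    using x y k ideal_pow_mono[of _ k1 1] ideal_pow_mono[of _ k2 1] by auto
  have F01: "F 0 \<in> std_lattice" "F 1 \<in> std_lattice" using Fi by auto
  have "ounit (pairing (F 0) x)" "ounit (pairing (F 1) y)" using ounit_congruent 1 ounit_one by blast+
  then have "ounit (pairing (F 0) x * pairing (F 1) y + - (pairing (F 0) y * pairing (F 1) x))"
    by (intro ounit_add ounit_mult iffD2[OF ideal_pow_uminus] ideal_pow_mult_integer(1) 1 pairing_integer F01 y)
  \<comment> \<open>The Cauchy-Binet identity: vectors whose pairings are congruent to
    \<open>(1, 0)\<close> and \<open>(0, 1)\<close> exhibit a unit as an integral combination of the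
    minors of the forms, so some minor is a unit.\<close>
  moreover have "pairing (F 0) x * pairing (F 1) y + - (pairing (F 0) y * pairing (F 1) x) =
      minor (F 0) (F 1) 1 * minor x y 1 + minor (F 0) (F 1) 2 * minor x y 2 + minor (F 0) (F 1) 3 * minor x y 3"
    unfolding minor_components pairing_def by (simp add: algebra_simps)
  ultimately have u: "ounit (minor (F 0) (F 1) 1 * minor x y 1 + minor (F 0) (F 1) 2 * minor x y 2 + minor (F 0) (F 1) 3 * minor x y 3)"
    by simp
  have mi: "minor v w i \<in> integers" if "v \<in> std_lattice" "w \<in> std_lattice" for v w :: "'a ^ 3" and i
    using that exhaust_3[of i] by (auto simp: minor_components std_lattice_def intro!: ideal_pow_diff integers_mult)
  have "\<exists>i. ounit (minor (F 0) (F 1) i)"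
  proof (rule ccontr)
    assume "\<nexists>i. ounit (minor (F 0) (F 1) i)"
    then have "minor (F 0) (F 1) i \<in> ideal_pow 1" for i using integer_cases[OF mi[OF F01]] by blast
    then have "minor (F 0) (F 1) 1 * minor x y 1 + minor (F 0) (F 1) 2 * minor x y 2 + minor (F 0) (F 1) 3 * minor x y 3 \<in> ideal_pow 1"
      by (intro ideal_pow_add ideal_pow_mult_integer(2) mi x(1) y(1))
    then show False using u by (simp add: ounit_def)
  qed
  then have "independent_mod (F 0) (F 1)" using F01 by (simp add: independent_mod_def)
  then show ?thesis using MF by blast
qed


section \<open>The number of sublattices of a given type\<close>

lemma reduce_hom:
  assumes "x \<in> integers" "y \<in> integers"
  shows "reduce (x * y) = reduce x * reduce y" "reduce (x - y) = reduce x - reduce y"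
  using assms times_residue.abs_eq[of x y] minus_residue.abs_eq[of x y]
  by (auto simp: reduce_def eq_onp_def residue_eq_def)

lemma reduce_eq_0_iff: "x \<in> integers \<Longrightarrow> reduce x = 0 \<longleftrightarrow> x \<in> ideal_pow 1"
  using residue_eq_iff[of x 0] by (simp add: reduce_def zero_residue_def)

lemma ounit_reduce: "x \<in> integers \<Longrightarrow> ounit x \<longleftrightarrow> reduce x \<noteq> 0"
  by (simp add: reduce_eq_0_iff ounit_def)

lemma representativesE:
  assumes "representatives n T"
  obtains rep where "\<And>x. x \<in> integers \<Longrightarrow> rep x \<in> T" "\<And>x. x \<in> integers \<Longrightarrow> x - rep x \<in> ideal_pow n"
proof -
  have "\<forall>x. \<exists>t. x \<in> integers \<longrightarrow> t \<in> T \<and> x - t \<in> ideal_pow n"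
    using representativesD(3)[OF assms] by blast
  then obtain rep where "\<forall>x. x \<in> integers \<longrightarrow> rep x \<in> T \<and> x - rep x \<in> ideal_pow n" by metis
  then show thesis using that by blast
qed

text \<open>The residue class of \<open>s\<close> consists of the elements
  \<open>s + \<pi> y\<close>, and modulo \<open>\<pi> ^ n\<close> only \<open>y\<close> modulo
  \<open>\<pi> ^ (n - 1)\<close> matters.\<close>

lemma card_representatives_reduce:
  fixes T :: "'a::nonarch_local_field set"
  assumes T: "representatives n T" and n: "1 \<le> n"
  shows "card {t \<in> T. reduce t = \<rho>} = CARD('a residue) ^ (n - 1)"
proof -
  obtain s :: 'a where s: "s \<in> integers" "reduce s = \<rho>" using reduce_surj .
  obtain \<pi> :: 'a where \<pi>: "uniformizer \<pi>" using exists_uniformizer by blast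
  obtain S :: "'a set" where S: "representatives (n - 1) S" "card S = CARD('a residue) ^ (n - 1)"
    using representatives_exist by blast
  obtain rep where rep: "\<And>x. x \<in> integers \<Longrightarrow> rep x \<in> T" "\<And>x. x \<in> integers \<Longrightarrow> x - rep x \<in> ideal_pow n"
    using representativesE[OF T] by blast
  have Ti: "T \<subseteq> integers" using T by (simp add: representatives_def)
  have Si: "S \<subseteq> integers" using S by (simp add: representatives_def)
  have int: "s + \<pi> * y \<in> integers" if "y \<in> S" for y
    using s(1) Si that uniformizer_power_mem'[OF \<pi>, of 0 1] by (auto intro: ideal_pow_add integers_mult)
  have mul: "\<pi> * y \<in> ideal_pow n \<longleftrightarrow> y \<in> ideal_pow (n - 1)" for y
    using uniformizer_power_mult'[OF \<pi>, of 1 n y] n by simp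
  have "bij_betw (\<lambda>y. rep (s + \<pi> * y)) S {t \<in> T. reduce t = \<rho>}"
  proof (rule bij_betwI')
    fix y y' assume y: "y \<in> S" "y' \<in> S"
    show "rep (s + \<pi> * y) = rep (s + \<pi> * y') \<longleftrightarrow> y = y'"
    proof
      assume e: "rep (s + \<pi> * y) = rep (s + \<pi> * y')"
      have "(s + \<pi> * y) - rep (s + \<pi> * y) - ((s + \<pi> * y') - rep (s + \<pi> * y')) \<in> ideal_pow n"
        using rep(2)[OF int[OF y(1)]] rep(2)[OF int[OF y(2)]] by (rule ideal_pow_diff)
      then have "\<pi> * (y - y') \<in> ideal_pow n" unfolding e by (simp add: algebra_simps)
      then show "y = y'" using mul representativesD(4)[OF S(1) y] by blast
    qed simp
  next
    fix y assume y: "y \<in> S"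
    let ?t = "rep (s + \<pi> * y)"
    have t: "?t \<in> T" "?t \<in> integers" using rep(1)[OF int[OF y]] Ti by auto
    have "s + \<pi> * y - ?t \<in> ideal_pow 1" using rep(2)[OF int[OF y]] n ideal_pow_mono by blast
    moreover have "\<pi> * y \<in> ideal_pow 1"
      using uniformizer_power_mem[OF \<pi>, of 1] y Si by (auto intro: ideal_pow_mult_integer(2))
    ultimately have "(s + \<pi> * y - ?t) - \<pi> * y \<in> ideal_pow 1" by (rule ideal_pow_diff)
    then have "reduce s = reduce ?t" using residue_eq_iff[OF s(1) t(2)] by simp
    then show "?t \<in> {t \<in> T. reduce t = \<rho>}" using t s by simp
  next
    fix t assume t: "t \<in> {t \<in> T. reduce t = \<rho>}"
    then have ti: "t \<in> integers" using Ti by auto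
    have "t - s \<in> ideal_pow 1" using residue_eq_iff[OF ti s(1)] t s by simp
    then obtain y where y: "y \<in> integers" "t - s = \<pi> ^ 1 * y" using ideal_pow_obtain[OF \<pi>] by blast
    obtain y' where y': "y' \<in> S" "y - y' \<in> ideal_pow (n - 1)" using representativesD(3)[OF S(1) y(1)] by blast
    have "t - (s + \<pi> * y') = \<pi> * (y - y')" using y(2) by (simp add: algebra_simps)
    then have "t - (s + \<pi> * y') \<in> ideal_pow n" using mul y'(2) by simp
    then have "t - rep (s + \<pi> * y') \<in> ideal_pow n" using rep(2)[OF int[OF y'(1)]] ideal_pow_trans by blast
    then have "t = rep (s + \<pi> * y')" using representativesD(4)[OF T _ rep(1)[OF int[OF y'(1)]]] t by blast
    then show "\<exists>y\<in>S. t = rep (s + \<pi> * y)" using y'(1) by blast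
  qed
  then show ?thesis using bij_betw_same_card S(2) by fastforce
qed

lemma finite_residue_functions: "finite (UNIV :: ('i::finite \<Rightarrow> 'a::nonarch_local_field residue) set)"
proof -
  have "finite (PiE (UNIV :: 'i set) (\<lambda>_. UNIV :: 'a residue set))" by (intro finite_PiE finite_residue) simp
  then show ?thesis by (simp add: PiE_UNIV_domain)
qed

lemma card_functions_PiE:
  fixes S :: "'i::finite \<Rightarrow> 'b set"
  shows "card {g. \<forall>i. g i \<in> S i} = (\<Prod>i\<in>UNIV. card (S i))"
proof -
  have "{g. \<forall>i. g i \<in> S i} = PiE UNIV S" by (auto simp: PiE_UNIV_domain)
  then show ?thesis by (simp add: card_PiE)
qed

lemma card_residue_functions: "card (UNIV :: ('i::finite \<Rightarrow> 'a::nonarch_local_field residue) set) = CARD('a residue) ^ CARD('i)"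
  using card_functions_PiE[of "\<lambda>_ :: 'i. UNIV :: 'a residue set"] by simp

text \<open>\<open>Q\<close> looks only at residues, and over every family of residues lie equally
  many families of representatives.\<close>

lemma card_representatives_functions:
  fixes T :: "'i::finite \<Rightarrow> 'a::nonarch_local_field set"
  assumes T: "\<And>i. representatives (n i) (T i)" and n: "\<And>i. 1 \<le> n i"
  shows "card {f. (\<forall>i. f i \<in> T i) \<and> Q (\<lambda>i. reduce (f i))} =
    CARD('a residue) ^ (\<Sum>i\<in>UNIV. n i - 1) * card {g :: 'i \<Rightarrow> 'a residue. Q g}"
proof -
  define B where "B g = {f. \<forall>i. f i \<in> {t \<in> T i. reduce t = g i}}" for g
  have B: "B g = PiE UNIV (\<lambda>i. {t \<in> T i. reduce t = g i})" for g by (auto simp: B_def PiE_UNIV_domain)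
  have fB: "finite (B g)" for g unfolding B using representativesD(1)[OF T] by (intro finite_PiE) auto
  have cB: "card (B g) = CARD('a residue) ^ (\<Sum>i\<in>UNIV. n i - 1)" for g
    unfolding B by (simp add: card_PiE card_representatives_reduce[OF T n] power_sum)
  have "{f. (\<forall>i. f i \<in> T i) \<and> Q (\<lambda>i. reduce (f i))} = (\<Union>g\<in>{g. Q g}. B g)"
  proof (intro equalityI subsetI)
    fix f assume "f \<in> {f. (\<forall>i. f i \<in> T i) \<and> Q (\<lambda>i. reduce (f i))}"
    then show "f \<in> (\<Union>g\<in>{g. Q g}. B g)" by (intro UN_I[of "\<lambda>i. reduce (f i)"]) (auto simp: B_def)
  next
    fix f assume "f \<in> (\<Union>g\<in>{g. Q g}. B g)"
    then obtain g where g: "Q g" "f \<in> B g" by blast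
    then have "(\<lambda>i. reduce (f i)) = g" by (auto simp: B_def)
    then show "f \<in> {f. (\<forall>i. f i \<in> T i) \<and> Q (\<lambda>i. reduce (f i))}" using g by (auto simp: B_def)
  qed
  moreover have "card (\<Union>g\<in>{g. Q g}. B g) = (\<Sum>g\<in>{g. Q g}. card (B g))"
  proof (rule card_UN_disjoint)
    show "finite {g. Q g}" using finite_residue_functions by (rule finite_subset[rotated]) simp
    show "\<forall>i\<in>{g. Q g}. \<forall>j\<in>{g. Q g}. i \<noteq> j \<longrightarrow> B i \<inter> B j = {}"
      by (auto simp: B_def fun_eq_iff)
  qed (use fB in auto)
  ultimately show ?thesis by (simp add: cB)
qed

text \<open>Linear independence of two vectors, phrased in the order of choice that makes it easy to
  count: \<open>w\<close> nonzero, then \<open>v\<close> outside the line of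
  \<open>w\<close>.\<close>

definition lin_indep :: "('i \<Rightarrow> 'k::field) \<Rightarrow> ('i \<Rightarrow> 'k) \<Rightarrow> bool" where
  "lin_indep v w \<longleftrightarrow> (\<exists>i. w i \<noteq> 0) \<and> (\<forall>c. v \<noteq> (\<lambda>i. c * w i))"

lemma card_lin_indep:
  "card {g :: bool \<times> 'i::finite \<Rightarrow> 'a::nonarch_local_field residue. lin_indep (\<lambda>i. g (False, i)) (\<lambda>i. g (True, i))} =
    (CARD('a residue) ^ CARD('i) - 1) * (CARD('a residue) ^ CARD('i) - CARD('a residue))"
proof -
  let ?N = "{w :: 'i \<Rightarrow> 'a residue. \<exists>i. w i \<noteq> 0}"
  let ?R = "\<lambda>w :: 'i \<Rightarrow> 'a residue. UNIV - range (\<lambda>c i. c * w i)"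
  have N: "?N = UNIV - {\<lambda>_. 0}" by (auto simp: fun_eq_iff)
  have cN: "card ?N = CARD('a residue) ^ CARD('i) - 1"
    unfolding N by (simp add: card_Diff_subset card_residue_functions)
  have cR: "card (?R w) = CARD('a residue) ^ CARD('i) - CARD('a residue)" if w: "w \<in> ?N" for w
  proof -
    obtain i where "w i \<noteq> 0" using w by blast
    then have "inj (\<lambda>c i. c * w i)" by (auto simp: inj_def fun_eq_iff)
    then have "card (range (\<lambda>c i. c * w i)) = CARD('a residue)" by (rule card_image)
    then show ?thesis
      by (subst card_Diff_subset) (auto simp: card_residue_functions intro!: finite_imageI finite_residue)
  qed
  have "bij_betw (\<lambda>g. (\<lambda>i. g (True, i), \<lambda>i. g (False, i)))
      {g :: bool \<times> 'i \<Rightarrow> 'a residue. lin_indep (\<lambda>i. g (False, i)) (\<lambda>i. g (True, i))} (SIGMA w:?N. ?R w)"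
  proof (rule bij_betwI')
    fix g h :: "bool \<times> 'i \<Rightarrow> 'a residue"
    show "((\<lambda>i. g (True, i), \<lambda>i. g (False, i)) = (\<lambda>i. h (True, i), \<lambda>i. h (False, i))) = (g = h)"
      by (auto simp: fun_eq_iff split_paired_All all_bool_eq)
  next
    fix g :: "bool \<times> 'i \<Rightarrow> 'a residue"
    assume "g \<in> {g. lin_indep (\<lambda>i. g (False, i)) (\<lambda>i. g (True, i))}"
    then show "(\<lambda>i. g (True, i), \<lambda>i. g (False, i)) \<in> (SIGMA w:?N. ?R w)" by (auto simp: lin_indep_def)
  next
    fix y assume "y \<in> (SIGMA w:?N. ?R w)"
    then obtain w v where y: "y = (w, v)" "\<exists>i. w i \<noteq> 0" "v \<notin> range (\<lambda>c i. c * w i)" by blast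
    then have "lin_indep v w" by (auto simp: lin_indep_def)
    then show "\<exists>g\<in>{g. lin_indep (\<lambda>i. g (False, i)) (\<lambda>i. g (True, i))}. y = (\<lambda>i. g (True, i), \<lambda>i. g (False, i))"
      by (intro bexI[of _ "\<lambda>(b, i). if b then w i else v i"]) (auto simp: y(1))
  qed
  then have "card {g :: bool \<times> 'i \<Rightarrow> 'a residue. lin_indep (\<lambda>i. g (False, i)) (\<lambda>i. g (True, i))} = card (SIGMA w:?N. ?R w)"
    by (rule bij_betw_same_card)
  also have "\<dots> = (\<Sum>w\<in>?N. card (?R w))"
  proof (rule card_SigmaI)
    show "finite ?N" unfolding N using finite_residue_functions[where 'i='i and 'a='a] by simp
    show "\<forall>w\<in>?N. finite (?R w)" using finite_residue_functions[where 'i='i and 'a='a] by simp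
  qed
  also have "\<dots> = (\<Sum>w\<in>?N. CARD('a residue) ^ CARD('i) - CARD('a residue))" by (rule sum.cong) (use cR in auto)
  finally show ?thesis by (simp add: cN)
qed

lemma lin_indep_3:
  fixes v w :: "3 \<Rightarrow> 'k::field"
  shows "lin_indep v w \<longleftrightarrow> v 2 * w 3 - v 3 * w 2 \<noteq> 0 \<or> v 3 * w 1 - v 1 * w 3 \<noteq> 0 \<or> v 1 * w 2 - v 2 * w 1 \<noteq> 0"
proof
  assume l: "lin_indep v w"
  show "v 2 * w 3 - v 3 * w 2 \<noteq> 0 \<or> v 3 * w 1 - v 1 * w 3 \<noteq> 0 \<or> v 1 * w 2 - v 2 * w 1 \<noteq> 0"
  proof (rule ccontr)
    assume "\<not> ?thesis"
    then have m: "v 2 * w 3 = v 3 * w 2" "v 3 * w 1 = v 1 * w 3" "v 1 * w 2 = v 2 * w 1" by auto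
    obtain i where i: "w i \<noteq> 0" using l by (auto simp: lin_indep_def)
    have "v j * w i = v i * w j" for j
      using m exhaust_3[of i] exhaust_3[of j] by (auto simp: mult.commute)
    then have "v j = v i / w i * w j" for j using i by (simp add: field_simps)
    then have "v = (\<lambda>j. v i / w i * w j)" by blast
    then show False using l unfolding lin_indep_def by blast
  qed
next
  assume m: "v 2 * w 3 - v 3 * w 2 \<noteq> 0 \<or> v 3 * w 1 - v 1 * w 3 \<noteq> 0 \<or> v 1 * w 2 - v 2 * w 1 \<noteq> 0"
  show "lin_indep v w" unfolding lin_indep_def
  proof (intro conjI allI notI)
    show "\<exists>i. w i \<noteq> 0" using m by (metis mult_zero_right diff_0_right)
    fix c assume "v = (\<lambda>i. c * w i)"
    then show False using m by (simp add: mult.commute mult.left_commute)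
  qed
qed

lemma lin_indep_2:
  fixes v w :: "bool \<Rightarrow> 'k::field"
  shows "lin_indep v w \<longleftrightarrow> v False * w True - v True * w False \<noteq> 0"
proof
  assume l: "lin_indep v w"
  show "v False * w True - v True * w False \<noteq> 0"
  proof
    assume m: "v False * w True - v True * w False = 0"
    obtain i where i: "w i \<noteq> 0" using l by (auto simp: lin_indep_def)
    have "v j * w i = v i * w j" for j using m by (cases i; cases j) (auto simp: mult.commute)
    then have "v j = v i / w i * w j" for j using i by (simp add: field_simps)
    then have "v = (\<lambda>j. v i / w i * w j)" by blast
    then show False using l unfolding lin_indep_def by blast
  qed
next
  assume m: "v False * w True - v True * w False \<noteq> 0"
  show "lin_indep v w" unfolding lin_indep_def
  proof (intro conjI allI notI)
    show "\<exists>i. w i \<noteq> 0" using m by (metis mult_zero_right diff_0_right)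
    fix c assume "v = (\<lambda>i. c * w i)"
    then show False using m by (simp add: mult.commute mult.left_commute)
  qed
qed

lemma independent_mod_lin_indep:
  assumes f: "f \<in> std_lattice" "g \<in> std_lattice"
  shows "independent_mod f g \<longleftrightarrow> lin_indep (\<lambda>i. reduce (f $ i)) (\<lambda>i. reduce (g $ i))"
proof -
  have fi: "f $ i \<in> integers" "g $ i \<in> integers" for i using f by (auto simp: std_lattice_def)
  have m: "ounit (f $ i * g $ j - f $ j * g $ i) \<longleftrightarrow> reduce (f $ i) * reduce (g $ j) - reduce (f $ j) * reduce (g $ i) \<noteq> 0" for i j
    by (subst ounit_reduce) (simp_all add: reduce_hom fi ideal_pow_diff integers_mult)
  have "independent_mod f g \<longleftrightarrow> ounit (minor f g 1) \<or> ounit (minor f g 2) \<or> ounit (minor f g 3)"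
    unfolding independent_mod_def using f exhaust_3 by metis
  then show ?thesis unfolding minor_components m lin_indep_3 .
qed

lemma card_diagonal_nonzero:
  "card {g :: bool \<times> bool \<Rightarrow> 'a::nonarch_local_field residue. g (False, False) \<noteq> 0 \<and> g (True, True) \<noteq> 0} =
    CARD('a residue) ^ 2 * (CARD('a residue) - 1) ^ 2"
proof -
  define S :: "bool \<times> bool \<Rightarrow> 'a residue set" where "S i = (if fst i = snd i then UNIV - {0} else UNIV)" for i
  have "{g. g (False, False) \<noteq> 0 \<and> g (True, True) \<noteq> 0} = {g. \<forall>i. g i \<in> S i}"
    by (auto simp: S_def all_bool_eq split_paired_All)
  then have "card {g :: bool \<times> bool \<Rightarrow> 'a residue. g (False, False) \<noteq> 0 \<and> g (True, True) \<noteq> 0} = (\<Prod>i\<in>UNIV. card (S i))"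
    by (simp only: card_functions_PiE)
  also have "\<dots> = card (S (False, False)) * card (S (False, True)) * card (S (True, False)) * card (S (True, True))"
    by (simp add: UNIV_Times_UNIV[symmetric] UNIV_bool insert_Times_insert del: UNIV_Times_UNIV)
  finally show ?thesis by (simp add: S_def card_Diff_subset power2_eq_square algebra_simps)
qed


text \<open>The rows of \<open>h\<close> and the columns of \<open>g\<close> are dual bases;
  \<open>e0\<close>, \<open>e1\<close>, \<open>e2\<close> serve as test vectors that read off the
  coordinates of a form.\<close>

lemma independent_mod_dual_basis:
  fixes f1 f2 :: "'a::discrete_valued_field ^ 3"
  assumes "independent_mod f1 f2"
  obtains e0 e1 e2 f0 :: "'a ^ 3" where "e0 \<in> std_lattice" "e1 \<in> std_lattice" "e2 \<in> std_lattice" "f0 \<in> std_lattice"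
    "pairing f1 e0 = 0" "pairing f1 e1 = 1" "pairing f1 e2 = 0"
    "pairing f2 e0 = 0" "pairing f2 e1 = 0" "pairing f2 e2 = 1"
    "\<forall>f. f = pairing f e0 *s f0 + pairing f e1 *s f1 + pairing f e2 *s f2"
proof -
  from assms obtain g h :: "'a ^ 3 ^ 3" where gh: "g \<in> integral_matrices" "h \<in> integral_matrices" "g ** h = mat 1" "h ** g = mat 1"
    "h $ 2 = f1" "h $ 3 = f2" by (rule independent_mod_basis)
  define e where "e j = (\<chi> i. g $ i $ j)" for j :: 3
  have ei: "e j \<in> std_lattice" for j using gh(1) by (simp add: e_def std_lattice_def integral_matrices_def)
  have h1: "h $ 1 \<in> std_lattice" using gh(2) by (simp add: std_lattice_def integral_matrices_def)
  have he: "pairing (h $ i) (e j) = (if i = j then 1 else 0)" for i j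
  proof -
    have "pairing (h $ i) (e j) = (h ** g) $ i $ j" by (simp add: pairing_def e_def matrix_matrix_mult_def sum_3)
    then show ?thesis unfolding gh(4) by (simp add: mat_def)
  qed
  have g: "g $ i $ 1 * h $ 1 $ k + g $ i $ 2 * h $ 2 $ k + g $ i $ 3 * h $ 3 $ k = (if i = k then 1 else 0)" for i k
  proof -
    have "g $ i $ 1 * h $ 1 $ k + g $ i $ 2 * h $ 2 $ k + g $ i $ 3 * h $ 3 $ k = (g ** h) $ i $ k"
      by (simp add: matrix_matrix_mult_def sum_3)
    then show ?thesis unfolding gh(3) by (simp add: mat_def)
  qed
  have dec: "f = pairing f (e 1) *s h $ 1 + pairing f (e 2) *s f1 + pairing f (e 3) *s f2" for f
  proof -
    have "(pairing f (e 1) *s h $ 1 + pairing f (e 2) *s h $ 2 + pairing f (e 3) *s h $ 3) $ k = f $ k" for k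
    proof -
      have "(pairing f (e 1) *s h $ 1 + pairing f (e 2) *s h $ 2 + pairing f (e 3) *s h $ 3) $ k =
        f $ 1 * (g $ 1 $ 1 * h $ 1 $ k + g $ 1 $ 2 * h $ 2 $ k + g $ 1 $ 3 * h $ 3 $ k) +
        f $ 2 * (g $ 2 $ 1 * h $ 1 $ k + g $ 2 $ 2 * h $ 2 $ k + g $ 2 $ 3 * h $ 3 $ k) +
        f $ 3 * (g $ 3 $ 1 * h $ 1 $ k + g $ 3 $ 2 * h $ 2 $ k + g $ 3 $ 3 * h $ 3 $ k)"
        by (simp add: pairing_def e_def algebra_simps)
      then show ?thesis unfolding g using exhaust_3[of k] by auto
    qed
    then show ?thesis unfolding gh(5,6) by (simp add: vec_eq_iff)
  qed
  show thesis
    by (rule that[OF ei[of 1] ei[of 2] ei[of 3] h1 _ _ _ _ _ _ allI[OF dec]]) (use he[of 2] he[of 3] gh(5,6) in simp_all)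
qed

section \<open>Pairs of forms that define the same sublattice\<close>

definition cong_vec :: "nat \<Rightarrow> 'a::discrete_valued_field ^ 3 \<Rightarrow> 'a ^ 3 \<Rightarrow> bool" where
  "cong_vec k v w \<longleftrightarrow> (\<forall>i. v $ i - w $ i \<in> ideal_pow k)"

lemma cong_vec_sym: "cong_vec k v w \<Longrightarrow> cong_vec k w v"
  unfolding cong_vec_def using ideal_pow_diff_commute by blast

lemma cong_vec_trans: "cong_vec k u v \<Longrightarrow> cong_vec k v w \<Longrightarrow> cong_vec k u w"
  unfolding cong_vec_def using ideal_pow_trans by blast

lemma cong_vec_mono: "cong_vec k v w \<Longrightarrow> l \<le> k \<Longrightarrow> cong_vec l v w"
  unfolding cong_vec_def using ideal_pow_mono by blast

lemma pairing_cong_vec: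
  assumes "cong_vec k f g" "x \<in> std_lattice"
  shows "pairing f x \<in> ideal_pow k \<longleftrightarrow> pairing g x \<in> ideal_pow k"
proof -
  have "pairing (f - g) x \<in> ideal_pow k"
    by (rule pairing_mem) (use assms in \<open>auto simp: cong_vec_def\<close>)
  then have "pairing f x - pairing g x \<in> ideal_pow k" by (simp add: pairing_linear)
  then show ?thesis by (rule ideal_pow_congruent)
qed

lemma sublattice_cong_vec:
  "cong_vec k1 f1 g1 \<Longrightarrow> cong_vec k2 f2 g2 \<Longrightarrow> sublattice k1 k2 f1 f2 = sublattice k1 k2 g1 g2"
  using pairing_cong_vec unfolding sublattice_def by blast

lemma std_lattice_cong_vec: "cong_vec k f g \<Longrightarrow> g \<in> std_lattice \<Longrightarrow> f \<in> std_lattice"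
  unfolding cong_vec_def std_lattice_def using ideal_pow_congruent ideal_pow_integers by blast

lemma independent_mod_cong_vec:
  assumes "independent_mod f1 f2" "cong_vec 1 g1 f1" "cong_vec 1 g2 f2"
  shows "independent_mod g1 g2"
proof -
  have f: "f1 \<in> std_lattice" "f2 \<in> std_lattice" using assms(1) by (auto simp: independent_mod_def)
  then have g: "g1 \<in> std_lattice" "g2 \<in> std_lattice" using assms(2,3) std_lattice_cong_vec by blast+
  have "reduce (g1 $ i) = reduce (f1 $ i)" "reduce (g2 $ i) = reduce (f2 $ i)" for i
    using f g assms(2,3) residue_eq_iff[of "g1 $ i" "f1 $ i"] residue_eq_iff[of "g2 $ i" "f2 $ i"]
    by (simp_all add: std_lattice_def cong_vec_def)
  then show ?thesis using assms(1) by (simp add: independent_mod_lin_indep[OF f] independent_mod_lin_indep[OF g])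
qed

text \<open>\<open>f1\<close> matters only modulo \<open>\<pi> ^ k1\<close>, so it may enter the
  second condition only with a factor divisible by \<open>\<pi> ^ (k2 - k1)\<close>; the first
  condition tolerates every integral multiple of \<open>f2\<close> because
  \<open>k1 \<le> k2\<close>. The converse direction uses the adjugate of the coefficient
  matrix.\<close>

lemma sublattice_transform:
  assumes k: "k1 \<le> k2" and abc: "a \<in> integers" "b \<in> integers" "c \<in> integers" "e \<in> integers"
    and P: "P \<in> ideal_pow (k2 - k1)" and u: "ounit (a * e - P * b * c)"
  shows "sublattice k1 k2 (a *s f1 + b *s f2) ((P * c) *s f1 + e *s f2) = sublattice k1 k2 f1 f2"
proof -
  have P1: "P * y \<in> ideal_pow k2" if "y \<in> ideal_pow k1" for y
    using ideal_pow_mult[OF P that] k by simp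
  have "a * y1 + b * y2 \<in> ideal_pow k1 \<and> P * c * y1 + e * y2 \<in> ideal_pow k2 \<longleftrightarrow> y1 \<in> ideal_pow k1 \<and> y2 \<in> ideal_pow k2"
    for y1 y2
  proof
    assume y: "y1 \<in> ideal_pow k1 \<and> y2 \<in> ideal_pow k2"
    then have "y2 \<in> ideal_pow k1" using k ideal_pow_mono by blast
    then have "a * y1 + b * y2 \<in> ideal_pow k1" using y abc by (intro ideal_pow_add ideal_pow_mult_integer(1)) auto
    moreover have "c * (P * y1) + e * y2 \<in> ideal_pow k2"
      by (rule ideal_pow_add[OF ideal_pow_mult_integer(1)[OF abc(3) P1] ideal_pow_mult_integer(1)[OF abc(4)]]) (use y in auto)
    moreover have "c * (P * y1) = P * c * y1" by (simp only: ac_simps)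
    ultimately show "a * y1 + b * y2 \<in> ideal_pow k1 \<and> P * c * y1 + e * y2 \<in> ideal_pow k2" by simp
  next
    assume y: "a * y1 + b * y2 \<in> ideal_pow k1 \<and> P * c * y1 + e * y2 \<in> ideal_pow k2"
    then have y2: "P * c * y1 + e * y2 \<in> ideal_pow k1" using k ideal_pow_mono by blast
    have "e * (a * y1 + b * y2) - b * (P * c * y1 + e * y2) \<in> ideal_pow k1"
      by (rule ideal_pow_diff[OF ideal_pow_mult_integer(1)[OF abc(4)] ideal_pow_mult_integer(1)[OF abc(2)]]) (use y y2 in auto)
    then have "(a * e - P * b * c) * y1 \<in> ideal_pow k1" by (simp add: algebra_simps)
    moreover have "a * (P * c * y1 + e * y2) - c * (P * (a * y1 + b * y2)) \<in> ideal_pow k2"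
      by (rule ideal_pow_diff[OF ideal_pow_mult_integer(1)[OF abc(1)] ideal_pow_mult_integer(1)[OF abc(3) P1]]) (use y in auto)
    then have "(a * e - P * b * c) * y2 \<in> ideal_pow k2" by (simp add: algebra_simps)
    ultimately show "y1 \<in> ideal_pow k1 \<and> y2 \<in> ideal_pow k2" using ounit_mult_ideal_pow[OF u] by blast
  qed
  then show ?thesis unfolding sublattice_def pairing_linear by blast
qed

lemma independent_mod_transform:
  assumes f: "independent_mod f1 f2" and abc: "a \<in> integers" "b \<in> integers" "c \<in> integers" "e \<in> integers"
  shows "independent_mod (a *s f1 + b *s f2) (c *s f1 + e *s f2) \<longleftrightarrow> ounit (a * e - b * c)"
proof -
  have fi: "f1 \<in> std_lattice" "f2 \<in> std_lattice" using f by (auto simp: independent_mod_def)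
  have fij: "f1 $ i \<in> integers" "f2 $ i \<in> integers" for i using fi by (auto simp: std_lattice_def)
  have m: "minor (a *s f1 + b *s f2) (c *s f1 + e *s f2) i = (a * e - b * c) * minor f1 f2 i" for i
    by (simp add: minor_def algebra_simps)
  have D: "a * e - b * c \<in> integers" using abc by (intro ideal_pow_diff integers_mult)
  have mi: "minor f1 f2 i \<in> integers" for i
    unfolding minor_def using fij by (auto intro!: ideal_pow_diff integers_mult)
  have "a *s f1 + b *s f2 \<in> std_lattice" "c *s f1 + e *s f2 \<in> std_lattice"
    using abc fi by (auto intro!: std_lattice_closed)
  then show ?thesis using f unfolding independent_mod_def m ounit_mult_iff[OF D mi] by blast
qed

lemma independent_mod_unique:
  fixes f1 f2 :: "'a::discrete_valued_field ^ 3"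
  assumes f: "independent_mod f1 f2" and c: "cong_vec k (a *s f1 + b *s f2) (a' *s f1 + b' *s f2)"
  shows "a - a' \<in> ideal_pow k" "b - b' \<in> ideal_pow k"
proof -
  from f obtain e0 e1 e2 f0 :: "'a ^ 3" where e: "e0 \<in> std_lattice" "e1 \<in> std_lattice" "e2 \<in> std_lattice" "f0 \<in> std_lattice"
    "pairing f1 e0 = 0" "pairing f1 e1 = 1" "pairing f1 e2 = 0"
    "pairing f2 e0 = 0" "pairing f2 e1 = 0" "pairing f2 e2 = 1"
    "\<forall>f. f = pairing f e0 *s f0 + pairing f e1 *s f1 + pairing f e2 *s f2"
    by (rule independent_mod_dual_basis)
  have "pairing ((a *s f1 + b *s f2) - (a' *s f1 + b' *s f2)) x \<in> ideal_pow k" if "x \<in> std_lattice" for x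
    by (rule pairing_mem[OF _ that]) (use c in \<open>auto simp: cong_vec_def\<close>)
  from this[OF e(2)] this[OF e(3)] show "a - a' \<in> ideal_pow k" "b - b' \<in> ideal_pow k"
    unfolding pairing_linear e(5-10) by simp_all
qed

text \<open>The vectors \<open>e0\<close> and \<open>\<pi> ^ k1 e1\<close> lie in the sublattice of
  \<open>f1, f2\<close>, hence in that of \<open>g1, g2\<close>. The first makes the components
  along \<open>f0\<close> negligible, the second makes the \<open>f1\<close>-component of
  \<open>g2\<close> divisible by \<open>\<pi> ^ (k2 - k1)\<close>.\<close>

lemma sublattice_eq_transform:
  fixes f1 f2 g1 g2 :: "'a::discrete_valued_field ^ 3"
  assumes f: "independent_mod f1 f2" and g: "g1 \<in> std_lattice" "g2 \<in> std_lattice" and k: "k1 \<le> k2"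
    and \<pi>: "uniformizer \<pi>" and eq: "sublattice k1 k2 f1 f2 = sublattice k1 k2 g1 g2"
  shows "\<exists>a b c e. a \<in> integers \<and> b \<in> integers \<and> c \<in> integers \<and> e \<in> integers \<and>
    cong_vec k1 g1 (a *s f1 + b *s f2) \<and> cong_vec k2 g2 ((\<pi> ^ (k2 - k1) * c) *s f1 + e *s f2)"
proof -
  from f obtain e0 e1 e2 f0 :: "'a ^ 3" where e: "e0 \<in> std_lattice" "e1 \<in> std_lattice" "e2 \<in> std_lattice" "f0 \<in> std_lattice"
    "pairing f1 e0 = 0" "pairing f1 e1 = 1" "pairing f1 e2 = 0"
    "pairing f2 e0 = 0" "pairing f2 e1 = 0" "pairing f2 e2 = 1"
    and dec: "\<forall>f. f = pairing f e0 *s f0 + pairing f e1 *s f1 + pairing f e2 *s f2"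
    by (rule independent_mod_dual_basis)
  have pk: "\<pi> ^ k1 \<in> integers" "\<pi> ^ k1 \<in> ideal_pow k1" using uniformizer_power_mem'[OF \<pi>] by auto
  have "e0 \<in> sublattice k1 k2 f1 f2" "\<pi> ^ k1 *s e1 \<in> sublattice k1 k2 f1 f2"
    unfolding sublattice_def using e pk by (auto simp: pairing_linear std_lattice_closed)
  then have g0: "pairing g1 e0 \<in> ideal_pow k1" "pairing g2 e0 \<in> ideal_pow k2" "\<pi> ^ k1 * pairing g2 e1 \<in> ideal_pow k2"
    unfolding eq by (auto simp: sublattice_def pairing_linear)
  have "pairing g2 e1 \<in> ideal_pow (k2 - k1)" using uniformizer_power_mult'[OF \<pi> k] g0(3) by blast
  then obtain c where c: "c \<in> integers" "pairing g2 e1 = \<pi> ^ (k2 - k1) * c" by (rule ideal_pow_obtain[OF \<pi>])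
  have f0: "f0 $ i \<in> integers" for i using e(4) by (simp add: std_lattice_def)
  have *: "cong_vec l v (pairing v e1 *s f1 + pairing v e2 *s f2)" if "pairing v e0 \<in> ideal_pow l" for l v
  proof -
    have "v - (pairing v e1 *s f1 + pairing v e2 *s f2) = pairing v e0 *s f0"
    proof -
      have "x - (y + z) = w" if "x = w + y + z" for w x y z :: "'a ^ 3" using that by simp
      from this[OF spec[OF dec]] show ?thesis .
    qed
    then have "(v - (pairing v e1 *s f1 + pairing v e2 *s f2)) $ i \<in> ideal_pow l" for i
      using that f0 by (simp add: ideal_pow_mult_integer(2))
    then show ?thesis by (simp add: cong_vec_def)
  qed
  have "cong_vec k1 g1 (pairing g1 e1 *s f1 + pairing g1 e2 *s f2)"
    "cong_vec k2 g2 ((\<pi> ^ (k2 - k1) * c) *s f1 + pairing g2 e2 *s f2)"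
    using *[OF g0(1)] *[OF g0(2)] c(2) by simp_all
  moreover have "pairing g1 e1 \<in> integers" "pairing g1 e2 \<in> integers" "pairing g2 e2 \<in> integers"
    using e g by (auto simp: pairing_integer)
  ultimately show ?thesis using c(1) by blast
qed

text \<open>Invertibility of a base change, read modulo \<pi>: because of the factor
  \<open>\<pi> ^ (k2 - k1)\<close> the matrix is triangular there if \<open>k1 < k2\<close>, while
  it is arbitrary if \<open>k1 = k2\<close>. This split is the source of the two different lattice
  counts.\<close>

definition unit_condition :: "nat \<Rightarrow> nat \<Rightarrow> (bool \<times> bool \<Rightarrow> 'k::field) \<Rightarrow> bool" where
  "unit_condition k1 k2 g \<longleftrightarrow> (if k1 < k2 then g (False, False) \<noteq> 0 \<and> g (True, True) \<noteq> 0
     else lin_indep (\<lambda>i. g (False, i)) (\<lambda>i. g (True, i)))"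

lemma unit_condition_iff:
  assumes \<pi>: "uniformizer \<pi>" and m: "\<And>i. m i \<in> integers" and k: "k1 \<le> k2"
  shows "unit_condition k1 k2 (\<lambda>i. reduce (m i)) \<longleftrightarrow>
    ounit (m (False, False) * m (True, True) - m (False, True) * (\<pi> ^ (k2 - k1) * m (True, False)))"
proof (cases "k1 < k2")
  case True
  then have P: "\<pi> ^ (k2 - k1) \<in> ideal_pow 1" using uniformizer_power_mem'[OF \<pi>, of 1 "k2 - k1"] by simp
  have "- (m (False, True) * (\<pi> ^ (k2 - k1) * m (True, False))) \<in> ideal_pow 1"
    by (intro iffD2[OF ideal_pow_uminus] ideal_pow_mult_integer(1)[OF m] ideal_pow_mult_integer(2)[OF m] P)
  then have "ounit (m (False, False) * m (True, True) + - (m (False, True) * (\<pi> ^ (k2 - k1) * m (True, False)))) \<longleftrightarrow>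
     ounit (m (False, False) * m (True, True))"
    by (intro ounit_congruent) simp
  then show ?thesis using True by (simp add: unit_condition_def ounit_mult_iff m ounit_reduce)
next
  case False
  then have "k1 = k2" using k by simp
  moreover have "ounit (m (False, False) * m (True, True) - m (False, True) * m (True, False)) \<longleftrightarrow>
      reduce (m (False, False)) * reduce (m (True, True)) - reduce (m (False, True)) * reduce (m (True, False)) \<noteq> 0"
    by (subst ounit_reduce) (simp_all add: reduce_hom m ideal_pow_diff integers_mult)
  ultimately show ?thesis by (simp add: unit_condition_def lin_indep_2)
qed

text \<open>Both sides count the pairs of forms, encoded as functions on \<open>bool \<times> 3\<close> with the first form at
  \<open>False\<close>. The second factor on the left is the number of base changes; its \<open>2 \<times> 2\<close> matrices have
  lower left entry divisible by \<open>\<pi>^(k\<^sub>2 - k\<^sub>1)\<close>, and only the quotient is recorded.\<close>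

lemma num_sublattices_mult:
  assumes k: "1 \<le> k1" "k1 \<le> k2"
  defines "q \<equiv> CARD('a::nonarch_local_field residue)"
  shows "num_sublattices TYPE('a) TYPE(3) [k1, k2] *
      (q ^ (3 * (k1 - 1) + (k2 - 1)) * card {g :: bool \<times> bool \<Rightarrow> 'a residue. unit_condition k1 k2 g}) =
    q ^ (3 * (k1 - 1) + 3 * (k2 - 1)) * ((q ^ 3 - 1) * (q ^ 3 - q))"
proof -
  obtain \<pi> :: 'a where \<pi>: "uniformizer \<pi>" using exists_uniformizer by blast
  let ?P = "\<pi> ^ (k2 - k1)"
  have P: "?P \<in> ideal_pow (k2 - k1)" "?P \<in> integers" using uniformizer_power_mem'[OF \<pi>] by auto
  obtain T1 T2 :: "'a set" where T: "representatives k1 T1" "representatives k2 T2" using representatives_exist by blast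
  have Ti: "T1 \<subseteq> integers" "T2 \<subseteq> integers" using T by (auto simp: representatives_def)
  obtain r1 where r1: "\<And>x. x \<in> integers \<Longrightarrow> r1 x \<in> T1" "\<And>x. x \<in> integers \<Longrightarrow> x - r1 x \<in> ideal_pow k1"
    using representativesE[OF T(1)] by blast
  obtain r2 where r2: "\<And>x. x \<in> integers \<Longrightarrow> r2 x \<in> T2" "\<And>x. x \<in> integers \<Longrightarrow> x - r2 x \<in> ideal_pow k2"
    using representativesE[OF T(2)] by blast
  define V where "V b f = (\<chi> i. f (b, i))" for b :: bool and f :: "bool \<times> 3 \<Rightarrow> 'a"
  define TA where "TA i = (if fst i then T2 else T1)" for i :: "bool \<times> 3"
  \<comment> \<open>The lower left quotient enters only through its product with \<open>?P\<close>
    modulo \<open>\<pi> ^ k2\<close>, that is, modulo \<open>\<pi> ^ k1\<close>. So only the last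
    diagonal entry has to be known modulo \<open>\<pi> ^ k2\<close>.\<close>
  define TG where "TG i = (if i = (True, True) then T2 else T1)" for i :: "bool \<times> bool"
  define A where "A = {f. (\<forall>i. f i \<in> TA i) \<and> lin_indep (\<lambda>i. reduce (f (False, i))) (\<lambda>i. reduce (f (True, i)))}"
  define G where "G = {m. (\<forall>i. m i \<in> TG i) \<and> unit_condition k1 k2 (\<lambda>i. reduce (m i))}"
  define lat where "lat f = sublattice k1 k2 (V False f) (V True f)" for f
  have TA: "representatives (if fst i then k2 else k1) (TA i)" for i using T by (simp add: TA_def)
  have TG: "representatives (if i = (True, True) then k2 else k1) (TG i)" for i using T by (simp add: TG_def)
  have sA: "(\<Sum>i\<in>(UNIV :: (bool \<times> 3) set). (if fst i then k2 else k1) - 1) = 3 * (k1 - 1) + 3 * (k2 - 1)"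
    unfolding UNIV_Times_UNIV[symmetric] sum.cartesian_product' by (simp add: UNIV_bool)
  have cA: "card A = q ^ (3 * (k1 - 1) + 3 * (k2 - 1)) * ((q ^ 3 - 1) * (q ^ 3 - q))"
    unfolding A_def
    using card_representatives_functions[of "\<lambda>i. if fst i then k2 else k1" TA "\<lambda>g. lin_indep (\<lambda>i. g (False, i)) (\<lambda>i. g (True, i))", OF TA]
      k card_lin_indep[where 'i=3 and 'a='a] unfolding sA q_def by simp
  have sG: "(\<Sum>i\<in>(UNIV :: (bool \<times> bool) set). (if i = (True, True) then k2 else k1) - 1) = 3 * (k1 - 1) + (k2 - 1)"
    by (simp add: UNIV_Times_UNIV[symmetric] UNIV_bool insert_Times_insert del: UNIV_Times_UNIV)
  have cG: "card G = q ^ (3 * (k1 - 1) + (k2 - 1)) * card {g :: bool \<times> bool \<Rightarrow> 'a residue. unit_condition k1 k2 g}"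
    unfolding G_def
    using card_representatives_functions[of "\<lambda>i. if i = (True, True) then k2 else k1" TG "unit_condition k1 k2", OF TG] k
    unfolding sG q_def by simp
  have "finite (PiE UNIV TA)" by (intro finite_PiE representativesD(1)[OF TA]) simp
  moreover have "A \<subseteq> PiE UNIV TA" unfolding A_def PiE_UNIV_domain by blast
  ultimately have fA: "finite A" by (rule finite_subset[rotated])
  have TAi: "TA i \<subseteq> integers" and TGi: "TG j \<subseteq> integers" for i j using Ti by (simp_all add: TA_def TG_def)
  have Ai: "f i \<in> integers" if "f \<in> A" for f i using that TAi[of i] unfolding A_def by blast
  have AT: "f (False, i) \<in> T1" "f (True, i) \<in> T2" if "f \<in> A" for f i
  proof -
    have "f (b, i) \<in> TA (b, i)" for b using that unfolding A_def by blast
    from this[of False] this[of True] show "f (False, i) \<in> T1" "f (True, i) \<in> T2" by (simp_all add: TA_def)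
  qed
  have Vi: "V b f \<in> std_lattice" if "f \<in> A" for b f using Ai[OF that] by (simp add: V_def std_lattice_def)
  have Aind: "independent_mod (V False f) (V True f)" if "f \<in> A" for f
    unfolding independent_mod_lin_indep[OF Vi[OF that] Vi[OF that]] using that by (simp add: V_def A_def)
  \<comment> \<open>\<open>enc\<close> moves an independent pair to its representatives, which
    changes neither the sublattice nor the independence.\<close>
  define enc where "enc v w = (\<lambda>(b, i). if b then r2 (w $ i) else r1 (v $ i))" for v w :: "'a ^ 3"
  have enc: "enc v w \<in> A" "cong_vec k1 (V False (enc v w)) v" "cong_vec k2 (V True (enc v w)) w"
    if ind: "independent_mod v w" for v w
  proof -
    have vw: "v \<in> std_lattice" "w \<in> std_lattice" using ind by (auto simp: independent_mod_def)
    have vi: "v $ i \<in> integers" "w $ i \<in> integers" for i using vw by (auto simp: std_lattice_def)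
    show c: "cong_vec k1 (V False (enc v w)) v" "cong_vec k2 (V True (enc v w)) w"
      by (rule cong_vec_sym, simp add: cong_vec_def V_def enc_def r1(2) r2(2) vi)+
    have i: "independent_mod (V False (enc v w)) (V True (enc v w))"
      by (rule independent_mod_cong_vec[OF ind cong_vec_mono[OF c(1) k(1)] cong_vec_mono[OF c(2)]]) (use k in simp)
    then have "V False (enc v w) \<in> std_lattice" "V True (enc v w) \<in> std_lattice" by (auto simp: independent_mod_def)
    from i[unfolded independent_mod_lin_indep[OF this]]
    show "enc v w \<in> A" unfolding A_def using r1(1)[OF vi(1)] r2(1)[OF vi(2)] by (auto simp: V_def enc_def TA_def)
  qed
  have img: "lat ` A = {M :: ('a ^ 3) set. has_type M [k1, k2]}"
  proof (intro equalityI subsetI)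
    fix M assume "M \<in> lat ` A"
    then show "M \<in> {M. has_type M [k1, k2]}" using sublattice_has_type[OF Aind k] by (auto simp: lat_def)
  next
    fix M :: "('a ^ 3) set" assume "M \<in> {M. has_type M [k1, k2]}"
    then obtain v w where M: "independent_mod v w" "M = sublattice k1 k2 v w" using has_type_sublattice by blast
    have "lat (enc v w) = M" unfolding lat_def M(2) by (rule sublattice_cong_vec[OF enc(2,3)[OF M(1)]])
    then show "M \<in> lat ` A" using enc(1)[OF M(1)] by blast
  qed
  \<comment> \<open>Up to congruence the base changes in \<open>G\<close> act simply transitively on
    the pairs that define a given sublattice, so all fibers of \<open>lat\<close> have the same
    size.\<close>
  have fiber: "card {f \<in> A. lat f = M} = card G" if M: "M \<in> lat ` A" for M
  proof -
    obtain f0 where f0: "f0 \<in> A" "M = lat f0" using M by blast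
    define f1 where "f1 = V False f0"
    define f2 where "f2 = V True f0"
    have ind: "independent_mod f1 f2" unfolding f1_def f2_def by (rule Aind[OF f0(1)])
    have M': "M = sublattice k1 k2 f1 f2" by (simp add: f0(2) lat_def f1_def f2_def)
    define v where "v m = m (False, False) *s f1 + m (False, True) *s f2" for m :: "bool \<times> bool \<Rightarrow> 'a"
    define w where "w m = (?P * m (True, False)) *s f1 + m (True, True) *s f2" for m :: "bool \<times> bool \<Rightarrow> 'a"
    have Gi: "m i \<in> integers" if "m \<in> G" for m i using that TGi[of i] unfolding G_def by blast
    have Gu: "ounit (m (False, False) * m (True, True) - m (False, True) * (?P * m (True, False)))" if "m \<in> G" for m
      using unit_condition_iff[OF \<pi> Gi[OF that] k(2)] that by (simp add: G_def)
    have vw: "independent_mod (v m) (w m)" if "m \<in> G" for m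
      unfolding v_def w_def
      by (subst independent_mod_transform[OF ind]) (use Gi[OF that] Gu[OF that] P in \<open>auto intro: integers_mult\<close>)
    have "bij_betw (\<lambda>m. enc (v m) (w m)) G {f \<in> A. lat f = M}"
    proof (rule bij_betwI')
      fix m m' assume m: "m \<in> G" "m' \<in> G"
      show "enc (v m) (w m) = enc (v m') (w m') \<longleftrightarrow> m = m'"
      proof
        assume e: "enc (v m) (w m) = enc (v m') (w m')"
        have c: "cong_vec k1 (v m) (v m')" "cong_vec k2 (w m) (w m')"
          using enc(2,3)[OF vw[OF m(1)]] enc(2,3)[OF vw[OF m(2)]] unfolding e
          using cong_vec_sym cong_vec_trans by blast+
        have 1: "m (False, False) - m' (False, False) \<in> ideal_pow k1" "m (False, True) - m' (False, True) \<in> ideal_pow k1"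
          using independent_mod_unique[OF ind c(1)[unfolded v_def]] by blast+
        have 2: "?P * m (True, False) - ?P * m' (True, False) \<in> ideal_pow k2" "m (True, True) - m' (True, True) \<in> ideal_pow k2"
          using independent_mod_unique[OF ind c(2)[unfolded w_def]] by blast+
        have "?P * (m (True, False) - m' (True, False)) \<in> ideal_pow k2" using 2(1) by (simp add: algebra_simps)
        then have 3: "m (True, False) - m' (True, False) \<in> ideal_pow k1"
          using uniformizer_power_mult'[OF \<pi>, of "k2 - k1" k2] k(2) by simp
        have t: "m i \<in> TG i" "m' i \<in> TG i" for i using m unfolding G_def by blast+
        have "m (False, False) = m' (False, False)" "m (False, True) = m' (False, True)"
          "m (True, False) = m' (True, False)" "m (True, True) = m' (True, True)"
          using representativesD(4)[OF T(1) _ _ 1(1)] representativesD(4)[OF T(1) _ _ 1(2)]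
            representativesD(4)[OF T(1) _ _ 3] representativesD(4)[OF T(2) _ _ 2(2)]
            t[of "(False, False)"] t[of "(False, True)"] t[of "(True, False)"] t[of "(True, True)"]
          unfolding TG_def by simp_all
        then have "m (i, j) = m' (i, j)" for i j by (cases i; cases j) simp_all
        then have "m i = m' i" for i by (cases i) simp
        then show "m = m'" by blast
      qed simp
    next
      fix m assume m: "m \<in> G"
      have "lat (enc (v m) (w m)) = sublattice k1 k2 (v m) (w m)"
        unfolding lat_def by (rule sublattice_cong_vec[OF enc(2,3)[OF vw[OF m]]])
      also have "\<dots> = M" unfolding v_def w_def M'
        by (rule sublattice_transform[OF k(2) Gi[OF m] Gi[OF m] Gi[OF m] Gi[OF m] P(1)])
          (use Gu[OF m] in \<open>simp add: mult.assoc mult.left_commute\<close>)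
      finally show "enc (v m) (w m) \<in> {f \<in> A. lat f = M}" using enc(1)[OF vw[OF m]] by blast
    next
      fix f assume f: "f \<in> {f \<in> A. lat f = M}"
      then have fA: "f \<in> A" by blast
      have "sublattice k1 k2 f1 f2 = sublattice k1 k2 (V False f) (V True f)" using f M' by (simp add: lat_def)
      from sublattice_eq_transform[OF ind Vi[OF fA] Vi[OF fA] k(2) \<pi> this]
      obtain a b c e where abc: "a \<in> integers" "b \<in> integers" "c \<in> integers" "e \<in> integers"
        and cv: "cong_vec k1 (V False f) (a *s f1 + b *s f2)" "cong_vec k2 (V True f) ((?P * c) *s f1 + e *s f2)" by blast
      define m where "m = (\<lambda>(i, j). if i then (if j then r2 e else r1 c) else (if j then r1 b else r1 a))"
      have m: "m (False, False) = r1 a" "m (False, True) = r1 b" "m (True, False) = r1 c" "m (True, True) = r2 e"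
        by (simp_all add: m_def)
      have mT: "m i \<in> TG i" for i using abc r1(1) r2(1) by (cases i) (auto simp: m_def TG_def)
      have mi: "m i \<in> integers" for i using mT[of i] TGi[of i] by blast
      have f12: "f1 $ i \<in> integers" "f2 $ i \<in> integers" for i
        using ind by (auto simp: independent_mod_def std_lattice_def)
      have cv1: "cong_vec k1 (a *s f1 + b *s f2) (v m)"
      proof -
        have "(a *s f1 + b *s f2) $ i - v m $ i = (a - r1 a) * f1 $ i + (b - r1 b) * f2 $ i" for i
          by (simp add: v_def m algebra_simps)
        then show ?thesis unfolding cong_vec_def
          using r1(2) abc f12 by (auto intro!: ideal_pow_add ideal_pow_mult_integer(2))
      qed
      have cv2: "cong_vec k2 ((?P * c) *s f1 + e *s f2) (w m)"
      proof -
        have e: "((?P * c) *s f1 + e *s f2) $ i - w m $ i = (?P * (c - r1 c)) * f1 $ i + (e - r2 e) * f2 $ i" for i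
          by (simp add: w_def m algebra_simps)
        have "?P * (c - r1 c) \<in> ideal_pow k2" using ideal_pow_mult[OF P(1) r1(2)[OF abc(3)]] k(2) by simp
        then show ?thesis unfolding cong_vec_def e
          using r2(2) abc f12 by (auto intro!: ideal_pow_add ideal_pow_mult_integer(2))
      qed
      have c1: "cong_vec k1 (V False f) (v m)" and c2: "cong_vec k2 (V True f) (w m)"
        using cv cv1 cv2 cong_vec_trans by blast+
      have "independent_mod (v m) (w m)"
        by (rule independent_mod_cong_vec[OF Aind[OF fA] cong_vec_mono[OF cong_vec_sym[OF c1] k(1)]
          cong_vec_mono[OF cong_vec_sym[OF c2]]]) (use k in simp)
      then have "ounit (m (False, False) * m (True, True) - m (False, True) * (?P * m (True, False)))"
        unfolding v_def w_def by (subst (asm) independent_mod_transform[OF ind]) (use mi P in \<open>auto intro: integers_mult\<close>)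
      then have mG: "m \<in> G" using unit_condition_iff[OF \<pi> mi k(2)] mT by (simp add: G_def)
      have cc: "cong_vec k1 (V False (enc (v m) (w m))) (V False f)" "cong_vec k2 (V True (enc (v m) (w m))) (V True f)"
        using enc(2,3)[OF vw[OF mG]] c1 c2 cong_vec_sym cong_vec_trans by blast+
      have "enc (v m) (w m) (False, i) - f (False, i) \<in> ideal_pow k1"
        "enc (v m) (w m) (True, i) - f (True, i) \<in> ideal_pow k2" for i
        using cc by (simp_all add: cong_vec_def V_def)
      then have "enc (v m) (w m) (False, i) = f (False, i)" "enc (v m) (w m) (True, i) = f (True, i)" for i
        using representativesD(4)[OF T(1) AT(1)[OF enc(1)[OF vw[OF mG]]] AT(1)[OF fA]]
          representativesD(4)[OF T(2) AT(2)[OF enc(1)[OF vw[OF mG]]] AT(2)[OF fA]] by simp_all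
      then have "enc (v m) (w m) (b', i) = f (b', i)" for b' i by (cases b') simp_all
      then have "f = enc (v m) (w m)" by (auto simp: fun_eq_iff)
      then show "\<exists>m\<in>G. f = enc (v m) (w m)" using mG by blast
    qed
    then show ?thesis using bij_betw_same_card by fastforce
  qed
  have "card A = (\<Sum>M\<in>lat ` A. card {f \<in> A. lat f = M})"
    using sum.image_gen[OF fA, of "\<lambda>_. 1 :: nat" lat] by simp
  also have "\<dots> = card (lat ` A) * card G" using fiber by simp
  finally show ?thesis unfolding cA cG img num_sublattices_def by simp
qed


section \<open>Evaluation of the orbital integrals\<close>

lemma irreducible_cubic_no_root:
  fixes a b c x :: "'k::field"
  assumes "irreducible [:c, b, a, 1:]"
  shows "x ^ 3 + a * x ^ 2 + b * x + c \<noteq> 0"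
proof
  assume "x ^ 3 + a * x ^ 2 + b * x + c = 0"
  then have "poly [:c, b, a, 1:] x = 0" by (simp add: algebra_simps power2_eq_square power3_eq_cube)
  then have "[:- x, 1:] dvd [:c, b, a, 1:]" by (rule poly_eq_0_iff_dvd[THEN iffD1])
  then consider "[:c, b, a, 1:] dvd [:- x, 1:]" | "[:- x, 1:] dvd 1"
    using irreducibleD'[OF assms] by blast
  then show False
  proof cases
    case 1
    then have "degree [:c, b, a, 1:] \<le> degree [:- x, 1:]" by (rule dvd_imp_degree_le) simp
    then show False by simp
  next
    case 2
    then have "degree [:- x, 1:] \<le> degree (1 :: 'k poly)" by (rule dvd_imp_degree_le) simp
    then show False by simp
  qed
qed

lemma reduce_add:
  assumes "x \<in> integers" "y \<in> integers"
  shows "reduce (x + y) = reduce x + reduce y"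
  using assms plus_residue.abs_eq[of x y] by (auto simp: reduce_def eq_onp_def residue_eq_def)

lemma has_type_standard_sublattice:
  assumes "has_type M [k1, k2]"
  obtains g h :: "'a::discrete_valued_field ^ 3 ^ 3" where "g \<in> integral_matrices" "h \<in> integral_matrices" "g ** h = mat 1"
    "M = standard_sublattice h k1 k2"
proof -
  obtain f1 f2 where f: "independent_mod f1 f2" "M = sublattice k1 k2 f1 f2" using has_type_sublattice[OF assms] by blast
  from f(1) obtain g h :: "'a ^ 3 ^ 3" where gh: "g \<in> integral_matrices" "h \<in> integral_matrices" "g ** h = mat 1" "h ** g = mat 1"
    "h $ 2 = f1" "h $ 3 = f2" by (rule independent_mod_basis)
  have "M = standard_sublattice h k1 k2" unfolding sublattice_standard[OF gh(2)] gh(5,6) by (rule f(2))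
  then show thesis by (rule that[OF gh(1-3)])
qed

text \<open>All lattices of the type give the volume \<open>v\<close>. The sublattice cut out by the
  last two coordinate forms shows that the type occurs, which is what lets the definite description
  single out \<open>v\<close>.\<close>

lemma (in orbit_equations) orbital_integral_eq:
  assumes ld: "ld_measure \<gamma> \<mu>"
    and K: "k1 < k2 \<Longrightarrow> K \<le> k1 \<and> K \<le> k2 - k1 \<and> rho \<gamma> $ 1 \<in> ideal_pow K \<and> rho \<gamma> $ 2 \<in> ideal_pow (k1 + K)"
    and G: "\<And>Y. k1 < k2 \<Longrightarrow> sol Y \<Longrightarrow> Y$1$2 \<in> ideal_pow 1 \<Longrightarrow> Y$2$1 \<in> ideal_pow 1 \<Longrightarrow> same_ord K (Y$1$2 * Y$2$1)"
    and v: "emeasure \<mu> (diag_orbit \<gamma> k1 k2) = ennreal v" "0 \<le> v"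
  shows "orbital_integral \<mu> \<gamma> [k1, k2] = v"
proof -
  have m: "measure \<mu> (image_orbit \<gamma> M) = v" if M: "has_type M [k1, k2]" for M :: "('a ^ 3) set"
  proof -
    from M obtain g h :: "'a ^ 3 ^ 3" where gh: "g \<in> integral_matrices" "h \<in> integral_matrices" "g ** h = mat 1"
      "M = standard_sublattice h k1 k2" by (rule has_type_standard_sublattice)
    have "emeasure \<mu> (image_orbit \<gamma> M) = ennreal v"
      unfolding gh(4) v(1)[symmetric] by (rule emeasure_image_orbit[OF ld gh(3,1,2) K G])
    then show ?thesis using v(2) by (simp add: measure_def)
  qed
  have "independent_mod (axis 2 1) (axis 3 1 :: 'a ^ 3)"
    unfolding independent_mod_def using std_lattice_axis
    by (auto simp: minor_components axis_def intro!: exI[of _ 1])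
  then have t: "has_type (sublattice k1 k2 (axis 2 1) (axis 3 1 :: 'a ^ 3)) [k1, k2]"
    by (rule sublattice_has_type[OF _ k1 k12])
  show ?thesis unfolding orbital_integral_def
  proof (rule the_equality)
    show "\<forall>M. has_type M [k1, k2] \<longrightarrow> measure \<mu> (image_orbit \<gamma> M) = v" using m by blast
    fix w assume "\<forall>M. has_type M [k1, k2] \<longrightarrow> measure \<mu> (image_orbit \<gamma> M) = w"
    then show "w = v" using m[OF t] t by blast
  qed
qed

lemma num_sublattices_less:
  assumes k: "1 \<le> k1" "k1 < k2" and q: "q = res_card TYPE('a::nonarch_local_field)"
  shows "real (num_sublattices TYPE('a) TYPE(3) [k1, k2]) * (q ^ 4 * (q - 1) ^ 2) = q ^ (2 * k2) * ((q ^ 3 - 1) * (q ^ 3 - q))"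
proof -
  define Q where "Q = CARD('a residue)"
  have Q: "2 \<le> Q" "q = real Q" unfolding Q_def q by (rule residue_card_ge_2) simp
  have r: "real (Q ^ 3 - 1) = q ^ 3 - 1" "real (Q ^ 3 - Q) = q ^ 3 - q" "real (Q - 1) = q - 1"
    using Q self_le_power[of Q 3] by (simp_all add: of_nat_diff Q(2))
  have "{g :: bool \<times> bool \<Rightarrow> 'a residue. unit_condition k1 k2 g} = {g. g (False, False) \<noteq> 0 \<and> g (True, True) \<noteq> 0}"
    using k by (simp add: unit_condition_def)
  then have "card {g :: bool \<times> bool \<Rightarrow> 'a residue. unit_condition k1 k2 g} = Q ^ 2 * (Q - 1) ^ 2"
    unfolding Q_def by (simp only: card_diagonal_nonzero)
  then have "num_sublattices TYPE('a) TYPE(3) [k1, k2] * (Q ^ (3 * (k1 - 1) + (k2 - 1)) * (Q ^ 2 * (Q - 1) ^ 2)) =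
    Q ^ (3 * (k1 - 1) + 3 * (k2 - 1)) * ((Q ^ 3 - 1) * (Q ^ 3 - Q))"
    using num_sublattices_mult[of k1 k2, where 'a='a] k unfolding Q_def by simp
  from this[THEN arg_cong, of real] have "real (num_sublattices TYPE('a) TYPE(3) [k1, k2]) * (q ^ (3 * (k1 - 1) + (k2 - 1)) * (q ^ 2 * (q - 1) ^ 2)) =
    q ^ (3 * (k1 - 1) + 3 * (k2 - 1)) * ((q ^ 3 - 1) * (q ^ 3 - q))"
    by (simp only: of_nat_mult of_nat_power r Q(2)[symmetric])
  moreover have "q ^ (3 * (k1 - 1) + 3 * (k2 - 1)) = q ^ (3 * (k1 - 1) + (k2 - 1)) * q ^ (2 * (k2 - 1))"
    by (simp add: power_add[symmetric] add.commute)
  ultimately have "q ^ (3 * (k1 - 1) + (k2 - 1)) * (real (num_sublattices TYPE('a) TYPE(3) [k1, k2]) * (q ^ 2 * (q - 1) ^ 2)) =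
      q ^ (3 * (k1 - 1) + (k2 - 1)) * (q ^ (2 * (k2 - 1)) * ((q ^ 3 - 1) * (q ^ 3 - q)))" by (simp only: ac_simps)
  then have e: "real (num_sublattices TYPE('a) TYPE(3) [k1, k2]) * (q ^ 2 * (q - 1) ^ 2) = q ^ (2 * (k2 - 1)) * ((q ^ 3 - 1) * (q ^ 3 - q))"
    using Q by simp
  \<comment> \<open>The extra factor \<open>q ^ 2\<close> absorbs the truncated subtraction in the
    exponent \<open>2 * (k2 - 1)\<close>.\<close>
  have "real (num_sublattices TYPE('a) TYPE(3) [k1, k2]) * (q ^ 4 * (q - 1) ^ 2) =
      q ^ 2 * (real (num_sublattices TYPE('a) TYPE(3) [k1, k2]) * (q ^ 2 * (q - 1) ^ 2))"
    by (simp add: power_add[of q 2 2, simplified])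
  also have "\<dots> = (q ^ 2 * q ^ (2 * (k2 - 1))) * ((q ^ 3 - 1) * (q ^ 3 - q))" unfolding e by (simp only: ac_simps)
  also have "q ^ 2 * q ^ (2 * (k2 - 1)) = q ^ (2 * k2)" using k by (subst power_add[symmetric]) (rule arg_cong[of _ _ "power q"], simp)
  finally show ?thesis .
qed

lemma num_sublattices_equal:
  assumes k: "1 \<le> k" and q: "q = res_card TYPE('a::nonarch_local_field)"
  shows "real (num_sublattices TYPE('a) TYPE(3) [k, k]) * (q ^ 2 * (q - 1)) = q ^ (2 * k) * (q ^ 3 - 1)"
proof -
  define Q where "Q = CARD('a residue)"
  have Q: "2 \<le> Q" "q = real Q" unfolding Q_def q by (rule residue_card_ge_2) simp
  have r: "real (Q ^ 3 - 1) = q ^ 3 - 1" "real (Q ^ 3 - Q) = q ^ 3 - q" "real (Q ^ 2 - 1) = q ^ 2 - 1" "real (Q ^ 2 - Q) = q ^ 2 - q"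
    using Q self_le_power[of Q 3] self_le_power[of Q 2] by (simp_all add: of_nat_diff Q(2))
  have "{g :: bool \<times> bool \<Rightarrow> 'a residue. unit_condition k k g} = {g. lin_indep (\<lambda>i. g (False, i)) (\<lambda>i. g (True, i))}"
    by (simp add: unit_condition_def)
  then have "card {g :: bool \<times> bool \<Rightarrow> 'a residue. unit_condition k k g} = (Q ^ 2 - 1) * (Q ^ 2 - Q)"
    unfolding Q_def using card_lin_indep[where 'i=bool and 'a='a] by simp
  then have "num_sublattices TYPE('a) TYPE(3) [k, k] * (Q ^ (3 * (k - 1) + (k - 1)) * ((Q ^ 2 - 1) * (Q ^ 2 - Q))) =
    Q ^ (3 * (k - 1) + 3 * (k - 1)) * ((Q ^ 3 - 1) * (Q ^ 3 - Q))"
    using num_sublattices_mult[of k k, where 'a='a] k unfolding Q_def by simp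
  from this[THEN arg_cong, of real] have "real (num_sublattices TYPE('a) TYPE(3) [k, k]) * (q ^ (3 * (k - 1) + (k - 1)) * ((q ^ 2 - 1) * (q ^ 2 - q))) =
    q ^ (3 * (k - 1) + 3 * (k - 1)) * ((q ^ 3 - 1) * (q ^ 3 - q))"
    by (simp only: of_nat_mult of_nat_power r Q(2)[symmetric])
  moreover have "q ^ (3 * (k - 1) + 3 * (k - 1)) = q ^ (3 * (k - 1) + (k - 1)) * q ^ (2 * (k - 1))"
    by (simp add: power_add[symmetric])
  moreover have "q ^ 2 - q = q * (q - 1)" "q ^ 3 - q = q * (q ^ 2 - 1)"
    by (simp_all add: power2_eq_square power3_eq_cube algebra_simps)
  ultimately have "(q ^ (3 * (k - 1) + (k - 1)) * q * (q ^ 2 - 1)) * (real (num_sublattices TYPE('a) TYPE(3) [k, k]) * (q - 1)) =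
      (q ^ (3 * (k - 1) + (k - 1)) * q * (q ^ 2 - 1)) * (q ^ (2 * (k - 1)) * (q ^ 3 - 1))" by (simp only: ac_simps)
  moreover have "q ^ 2 - 1 \<noteq> 0" using Q by (simp add: power2_eq_1_iff)
  ultimately have e: "real (num_sublattices TYPE('a) TYPE(3) [k, k]) * (q - 1) = q ^ (2 * (k - 1)) * (q ^ 3 - 1)"
    using Q by simp
  have "real (num_sublattices TYPE('a) TYPE(3) [k, k]) * (q ^ 2 * (q - 1)) =
      q ^ 2 * (real (num_sublattices TYPE('a) TYPE(3) [k, k]) * (q - 1))" by (simp only: ac_simps)
  also have "\<dots> = (q ^ 2 * q ^ (2 * (k - 1))) * (q ^ 3 - 1)" unfolding e by (simp only: ac_simps)
  also have "q ^ 2 * q ^ (2 * (k - 1)) = q ^ (2 * k)" using k by (subst power_add[symmetric]) (rule arg_cong[of _ _ "power q"], simp)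
  finally show ?thesis .
qed

text \<open>The origin of the numerator: \<open>2 + (x - 1) * (1 - 1 / q)\<close> equals
  \<open>((x + 1) * q - (x - 1)) / q\<close>, where \<open>x\<close> will be the valuation
  \<open>K\<close>. The two factors \<open>(q - 1) ^ 2\<close> from the count and from the volume
  cancel.\<close>

lemma product_formula_less:
  fixes q c :: real
  assumes q: "1 < q" and c: "c * (q ^ 4 * (q - 1) ^ 2) = q ^ (2 * k2) * ((q ^ 3 - 1) * (q ^ 3 - q))"
  shows "c * (inverse (q ^ (k1 + 2 * k2)) * (1 - inverse q) ^ 2 * (2 + (x - 1) * (1 - inverse q))) =
    (q ^ 3 - 1) * (q ^ 2 - 1) * q ^ k2 * (((x + 1) * q - (x - 1)) / q ^ (6 + (k1 + k2)))"
proof -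
  have q0: "q \<noteq> 0" "q - 1 \<noteq> 0" using q by auto
  have "c * (inverse (q ^ (k1 + 2 * k2)) * (1 - inverse q) ^ 2 * (2 + (x - 1) * (1 - inverse q))) =
      (c * (q ^ 4 * (q - 1) ^ 2)) * ((x + 1) * q - (x - 1)) / (q ^ 7 * q ^ (k1 + 2 * k2))"
  proof -
    have "1 - inverse q = (q - 1) / q" "2 + (x - 1) * ((q - 1) / q) = ((x + 1) * q - (x - 1)) / q"
      using q0 by (simp_all add: field_simps)
    then have e: "inverse (q ^ (k1 + 2 * k2)) * (1 - inverse q) ^ 2 * (2 + (x - 1) * (1 - inverse q)) =
        (q - 1) ^ 2 * ((x + 1) * q - (x - 1)) / (q ^ 3 * q ^ (k1 + 2 * k2))"
      by (simp add: divide_inverse power_mult_distrib power2_eq_square power3_eq_cube)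
    have "q ^ 7 = q ^ 4 * q ^ 3" by (simp add: power_add[symmetric])
    then show ?thesis unfolding e using q0 by (simp add: field_simps)
  qed
  also have "\<dots> = q ^ (2 * k2) * ((q ^ 3 - 1) * (q ^ 3 - q)) * ((x + 1) * q - (x - 1)) / (q ^ 7 * q ^ (k1 + 2 * k2))"
    unfolding c ..
  also have "\<dots> = (q ^ 3 - 1) * (q ^ 2 - 1) * q ^ k2 * (((x + 1) * q - (x - 1)) / q ^ (6 + (k1 + k2)))"
  proof -
    have "q ^ 3 - q = q * (q ^ 2 - 1)" by (simp add: power2_eq_square power3_eq_cube algebra_simps)
    moreover have "q ^ (2 * k2) * q * q ^ (6 + (k1 + k2)) = q ^ 7 * q ^ (k1 + 2 * k2) * q ^ k2"
    proof -
      have "2 * k2 + 1 + (6 + (k1 + k2)) = 7 + (k1 + 2 * k2) + k2" by simp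
      from arg_cong[OF this, of "power q"] show ?thesis by (simp only: power_add power_one_right)
    qed
    then have "q ^ (2 * k2) * q / (q ^ 7 * q ^ (k1 + 2 * k2)) = q ^ k2 / q ^ (6 + (k1 + k2))"
      using q0 by (simp add: frac_eq_eq mult.commute)
    then have "(q ^ 3 - 1) * (q ^ 2 - 1) * ((x + 1) * q - (x - 1)) * (q ^ (2 * k2) * q / (q ^ 7 * q ^ (k1 + 2 * k2))) =
       (q ^ 3 - 1) * (q ^ 2 - 1) * ((x + 1) * q - (x - 1)) * (q ^ k2 / q ^ (6 + (k1 + k2)))" by (rule arg_cong)
    ultimately show ?thesis by (simp only: times_divide_eq_right times_divide_eq_left ac_simps)
  qed
  finally show ?thesis .
qed

lemma product_formula_equal:
  fixes q c :: real
  assumes q: "1 < q" and c: "c * (q ^ 2 * (q - 1)) = q ^ (2 * k) * (q ^ 3 - 1)"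
  shows "c * (inverse (q ^ (k + 2 * k)) * (1 - inverse q) ^ 2 * (1 + inverse q)) =
    (q ^ 3 - 1) * (q ^ 2 - 1) / q ^ (5 + (k + k)) * q ^ k"
proof -
  have q0: "q \<noteq> 0" "q - 1 \<noteq> 0" using q by auto
  have i: "1 - inverse q = (q - 1) / q" "1 + inverse q = (q + 1) / q" using q0 by (simp_all add: field_simps)
  have "inverse N * ((q - 1) / q) ^ 2 * ((q + 1) / q) = (q - 1) * (q ^ 2 - 1) / (q ^ 3 * N)" if "N \<noteq> 0" for N
    using q0 that by (simp add: field_simps power2_eq_square power3_eq_cube)
  then have e: "inverse (q ^ (k + 2 * k)) * (1 - inverse q) ^ 2 * (1 + inverse q) =
      (q - 1) * (q ^ 2 - 1) / (q ^ 3 * q ^ (k + 2 * k))"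
    unfolding i using q0 by simp
  have q5: "q ^ 5 = q ^ 2 * q ^ 3" by (simp add: power_add[symmetric])
  have "c * (inverse (q ^ (k + 2 * k)) * (1 - inverse q) ^ 2 * (1 + inverse q)) =
      (c * (q ^ 2 * (q - 1))) * (q ^ 2 - 1) / (q ^ 5 * q ^ (k + 2 * k))"
    unfolding e q5 using q0 by (simp add: field_simps)
  also have "\<dots> = (q ^ 3 - 1) * (q ^ 2 - 1) * (q ^ (2 * k) / (q ^ 5 * q ^ (k + 2 * k)))"
    unfolding c by (simp only: times_divide_eq_right ac_simps)
  also have "q ^ (2 * k) / (q ^ 5 * q ^ (k + 2 * k)) = q ^ k / q ^ (5 + (k + k))"
  proof -
    have "q ^ (2 * k) * q ^ (5 + (k + k)) = q ^ k * (q ^ 5 * q ^ (k + 2 * k))" by (simp add: power_add[symmetric])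
    then show ?thesis using q0 by (simp add: frac_eq_eq)
  qed
  finally show ?thesis by simp
qed

section \<open>The valuation of \<open>y12 y21\<close> in Cases 1, 2 and 4\<close>

context orbit_equations
begin

text \<open>Of the terms in \<open>sol_12_21\<close> only \<open>y11 y22\<close> has valuation as
  small as \<open>k1\<close>, and there only through the part \<open>- \<pi>^k1 y22\<close> of
  \<open>y11\<close>, \<open>y22\<close> being a unit. As \<open>2 k1 < k2\<close>, both
  \<open>P\<close> and \<open>r\<close> are divisible by a higher power.\<close>

lemma sol_product_order_less:
  assumes Y: "sol Y" "Y$1$2 \<in> ideal_pow 1" "Y$2$1 \<in> ideal_pow 1"
    and k: "2 * k1 < k2" and c1: "rho \<gamma> $ 1 \<in> ideal_pow (Suc k1)" and c2: "rho \<gamma> $ 2 \<in> ideal_pow (k1 + Suc k1)"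
  shows "same_ord k1 (Y$1$2 * Y$2$1)"
proof -
  note Yi = sol_integral[OF Y(1)]
  have u: "ounit (Y$2$2)" using sol_units(3)[OF Y] by blast
  have m: "r \<in> ideal_pow (Suc k1)" "P \<in> ideal_pow (Suc k1)" "b2 \<in> ideal_pow (Suc k1)"
    using uniformizer_power_mem'[OF uniformizer] k ideal_pow_divide_power[OF uniformizer c2] by (auto simp: b2_def)
  have "same_ord (k1 + 0) (p * Y$2$2)"
    using u by (intro same_ord_mult same_ord_uniformizer_power[OF uniformizer]) (simp add: same_ord_0)
  then have "same_ord k1 (- (p * Y$2$2) + (- rho \<gamma> $ 1 - r * Y$3$3))"
    by (intro same_ord_add ideal_pow_diff iffD2[OF ideal_pow_uminus] c1 ideal_pow_mult_integer(2)[OF Yi] m) simp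
  then have "same_ord (k1 + 0) (Y$1$1 * Y$2$2)"
    unfolding sol_11[OF Y(1)] using u by (intro same_ord_mult) (simp_all add: same_ord_0 algebra_simps)
  then have "same_ord k1 (Y$1$1 * Y$2$2 + (- b2 + P * (Y$1$1 * Y$3$3 - Y$1$3 * Y$3$1) + r * (Y$2$2 * Y$3$3 - Y$2$3 * Y$3$2)))"
    unfolding add_0_right
    by (rule same_ord_add) (intro ideal_pow_add iffD2[OF ideal_pow_uminus] ideal_pow_mult_integer(2)[of "_ - _"] m mem_intros Yi)
  then show ?thesis unfolding sol_12_21[OF Y(1)] by (simp add: algebra_simps)
qed

text \<open>Here \<open>P y13 y31\<close> alone has valuation \<open>k2 - k1\<close>, both entries
  being units. All of \<open>y11\<close> is divisible by a higher power, since
  \<open>k2 < 2 k1\<close> gives this for \<open>\<pi>^k1\<close>.\<close>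

lemma sol_product_order_greater:
  assumes Y: "sol Y" "Y$1$2 \<in> ideal_pow 1" "Y$2$1 \<in> ideal_pow 1"
    and k: "k2 < 2 * k1" and c1: "rho \<gamma> $ 1 \<in> ideal_pow (Suc (k2 - k1))" and c2: "rho \<gamma> $ 2 \<in> ideal_pow (k1 + Suc (k2 - k1))"
  shows "same_ord (k2 - k1) (Y$1$2 * Y$2$1)"
proof -
  let ?K = "k2 - k1"
  note Yi = sol_integral[OF Y(1)]
  have u: "ounit (Y$1$3)" "ounit (Y$3$1)" using sol_units(2,3)[OF Y(1)] Y by blast+
  have m: "p \<in> ideal_pow (Suc ?K)" "r \<in> ideal_pow (Suc ?K)" "b2 \<in> ideal_pow (Suc ?K)"
    using uniformizer_power_mem'[OF uniformizer] k k12 k1 ideal_pow_divide_power[OF uniformizer c2] by (auto simp: b2_def)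
  have 11: "Y$1$1 \<in> ideal_pow (Suc ?K)"
    unfolding sol_11[OF Y(1)] by (intro ideal_pow_diff iffD2[OF ideal_pow_uminus] c1 ideal_pow_mult_integer(2)[OF Yi] m)
  have "same_ord (?K + 0) (P * (Y$1$3 * Y$3$1))"
    by (intro same_ord_mult same_ord_uniformizer_power[OF uniformizer]) (simp add: same_ord_0 ounit_mult u)
  then have "same_ord ?K (- (P * (Y$1$3 * Y$3$1)) + (Y$1$1 * Y$2$2 + - b2 + Y$1$1 * (P * Y$3$3) + r * (Y$2$2 * Y$3$3 - Y$2$3 * Y$3$2)))"
    unfolding add_0_right
    by (intro same_ord_add ideal_pow_add iffD2[OF same_ord_uminus] iffD2[OF ideal_pow_uminus] ideal_pow_mult_integer(2) 11 m mem_intros Yi P_integer)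
  then show ?thesis unfolding sol_12_21[OF Y(1)] by (simp add: algebra_simps)
qed

text \<open>Now \<open>y11 y22\<close>, \<open>b2\<close> and \<open>P y13 y31\<close> are all of
  order at least \<open>k1\<close> and might cancel. With \<open>w = y22\<close> and
  \<open>z = y13 y31\<close> they combine to \<open>- \<pi>^k1 (w^2 + a1 w + a2 + z)\<close> modulo
  \<open>\<pi>^(k1 + 1)\<close>, while the determinant gives \<open>z w = a3\<close> modulo \<pi>.
  So \<open>w\<close> times the bracket is congruent to the value of the cubic at \<open>w\<close>,
  a unit by \<open>unit\<close>.\<close>

lemma sol_product_order_irreducible:
  assumes Y: "sol Y" "Y$1$2 \<in> ideal_pow 1" "Y$2$1 \<in> ideal_pow 1"
    and k: "k2 = 2 * k1" and c1: "rho \<gamma> $ 1 = p * a1" and c2: "rho \<gamma> $ 2 = p ^ 2 * a2" and c3: "rho \<gamma> $ 3 = p ^ 3 * a3"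
    and a: "a1 \<in> integers" "a2 \<in> integers" "a3 \<in> integers"
    and unit: "\<And>y. y \<in> integers \<Longrightarrow> ounit (y ^ 3 + a1 * y ^ 2 + a2 * y + a3)"
  shows "same_ord k1 (Y$1$2 * Y$2$1)"
proof -
  note Yi = sol_integral[OF Y(1)]
  have P: "P = p" "r = p * p" using k by (simp_all add: mult_2 power_add)
  have u: "u = - a3" and b2: "b2 = p * a2"
    unfolding u_def b2_def c2 c3 P using pi_nonzero by (simp_all add: power2_eq_square power3_eq_cube)
  define w where "w = Y$2$2"
  define z where "z = Y$1$3 * Y$3$1"
  have w: "w \<in> integers" using Yi by (simp add: w_def)
  have z: "z \<in> integers" unfolding z_def by (intro integers_mult Yi)
  have "z * w - a3 = Y$1$1 * (Y$2$2 * Y$3$3 - Y$2$3 * Y$3$2) - Y$1$2 * (Y$2$1 * Y$3$3 - Y$2$3 * Y$3$1) + Y$2$1 * (Y$1$3 * Y$3$2)"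
    using Y(1) unfolding sol_def u z_def w_def by (auto simp: algebra_simps)
  moreover have "\<dots> \<in> ideal_pow 1"
    by (intro ideal_pow_add ideal_pow_diff[of "_ * _" 1] ideal_pow_mult_integer(2) sol_11_mem[OF Y(1)] Y(2,3) mem_intros Yi)
  ultimately have zw: "z * w - a3 \<in> ideal_pow 1" by simp
  have "ounit ((w ^ 3 + a1 * w ^ 2 + a2 * w + a3) + (z * w - a3))" by (rule ounit_add[OF unit[OF w] zw])
  then have "ounit (w * ((a1 + w) * w + a2 + z))" by (simp add: algebra_simps power2_eq_square power3_eq_cube)
  moreover have "(a1 + w) * w + a2 + z \<in> integers" by (intro mem_intros a w z)
  ultimately have v: "ounit ((a1 + w) * w + a2 + z)" using ounit_mult_iff[OF w] by blast
  have "same_ord (k1 + 0) (p * ((a1 + w) * w + a2 + z))"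
    using v by (intro same_ord_mult same_ord_uniformizer_power[OF uniformizer]) (simp add: same_ord_0)
  moreover have "p * (- (p * (Y$3$3 * w)) + Y$1$1 * Y$3$3 + p * (Y$2$2 * Y$3$3 - Y$2$3 * Y$3$2)) \<in> ideal_pow (k1 + 1)"
    unfolding uniformizer_power_mult[OF uniformizer]
    by (intro ideal_pow_add iffD2[OF ideal_pow_uminus] ideal_pow_mult_integer(2) p_mem sol_11_mem[OF Y(1)] mem_intros Yi w)
  ultimately have "same_ord k1 (- (p * ((a1 + w) * w + a2 + z)) + p * (- (p * (Y$3$3 * w)) + Y$1$1 * Y$3$3 + p * (Y$2$2 * Y$3$3 - Y$2$3 * Y$3$2)))"
    by (intro same_ord_add) simp_all
  moreover have "Y$1$2 * Y$2$1 = - (p * ((a1 + w) * w + a2 + z)) + p * (- (p * (Y$3$3 * w)) + Y$1$1 * Y$3$3 + p * (Y$2$2 * Y$3$3 - Y$2$3 * Y$3$2))"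
  proof -
    have "Y$1$1 * Y$2$2 = (- (p * a1) - p * w - p * p * Y$3$3) * w"
      using sol_11[OF Y(1)] unfolding c1 P w_def by simp
    then show ?thesis unfolding sol_12_21[OF Y(1)] b2 P z_def by (simp add: algebra_simps)
  qed
  ultimately show ?thesis by simp
qed

end

theorem theorem6p1:
  fixes \<gamma> :: "'a::nonarch_local_field ^ 3 ^ 3"
    and \<mu> :: "('a ^ 3 ^ 3) measure"
    and \<pi> :: 'a and q :: real and d k1 k2 s t :: nat
  assumes "\<gamma> \<in> integral_matrices"
    and "irreducible (charpoly \<gamma>)"
    and "separable (charpoly \<gamma>)"
    and "reduce_poly (charpoly \<gamma>) = monom 1 3"
    and "ld_measure \<gamma> \<mu>"
    and "uniformizer \<pi>"
    and "q = real CARD('a residue)"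
    and "int d = ord (coeff (charpoly \<gamma>) 0)"
    and "1 \<le> k1" and "k1 \<le> k2" and "k1 + k2 = d"
    and "t = nat \<lceil>real d / 3\<rceil>" and "s = nat \<lfloor>real d / 3\<rfloor>"
  shows "(k1 < k2 \<and> k1 < t \<longrightarrow>
           real (num_sublattices TYPE('a) TYPE(3) [k1, k2]) * orbital_integral \<mu> \<gamma> [k1, k2] =
             (q ^ 3 - 1) * (q ^ 2 - 1) * q ^ k2 *
               (((real k1 + 1) * q - (real k1 - 1)) / q ^ (6 + d))) \<and>
         (k1 < k2 \<and> s < k1 \<longrightarrow>
           real (num_sublattices TYPE('a) TYPE(3) [k1, k2]) * orbital_integral \<mu> \<gamma> [k1, k2] =
             (q ^ 3 - 1) * (q ^ 2 - 1) * q ^ k2 *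
               (((real k2 - real k1 + 1) * q - (real k2 - real k1 - 1)) / q ^ (6 + d))) \<and>
         (k1 = k2 \<longrightarrow>
           real (num_sublattices TYPE('a) TYPE(3) [k1, k2]) * orbital_integral \<mu> \<gamma> [k1, k2] =
             (q ^ 3 - 1) * (q ^ 2 - 1) / q ^ (5 + d) * q ^ k1) \<and>
         (k1 = t \<and> d = 3 * t \<and>
          irreducible (reduce_poly
            (smult (inverse (\<pi> ^ (3 * t))) (pcompose (charpoly \<gamma>) [:0, \<pi> ^ t:]))) \<longrightarrow>
           real (num_sublattices TYPE('a) TYPE(3) [k1, k2]) * orbital_integral \<mu> \<gamma> [k1, k2] =
             (q ^ 3 - 1) * (q ^ 2 - 1) * q ^ k2 *
               (((real t + 1) * q - (real t - 1)) / q ^ (6 + d)))"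
proof -
  have q: "q = res_card TYPE('a)" and q1: "1 < q" using assms(7) res_card_gt_1[where 'a='a] by simp_all
  define c1 c2 c3 where "c1 = rho \<gamma> $ 1" and "c2 = rho \<gamma> $ 2" and "c3 = rho \<gamma> $ 3"
  have cp: "charpoly \<gamma> = [:c3, c2, c1, 1:]" unfolding c1_def c2_def c3_def by (rule charpoly_rho)
  have \<gamma>i: "\<gamma> $ i $ j \<in> integers" for i j using assms(1) by (simp add: integral_matrices_def)
  have ci: "c1 \<in> integers" "c2 \<in> integers" "c3 \<in> integers"
    unfolding c1_def c2_def c3_def rho_components det_3 by (intro mem_intros \<gamma>i)+
  have r0: "reduce (0 :: 'a) = 0" using reduce_eq_0_iff[of "0 :: 'a"] by simp
  have rc: "coeff (reduce_poly p) i = reduce (coeff p i)" for p :: "'a poly" and i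
    unfolding reduce_poly_def by (rule coeff_map_poly[of reduce, OF r0])
  have "reduce (coeff (charpoly \<gamma>) 2) = 0" unfolding rc[symmetric] assms(4) by simp
  then have "reduce c1 = 0" unfolding cp by (simp add: numeral_2_eq_2)
  then have c1: "c1 \<in> ideal_pow 1" using reduce_eq_0_iff[OF ci(1)] by blast
  have no_root: "x ^ 3 + c1 * x ^ 2 + c2 * x + c3 \<noteq> 0" for x
    using irreducible_cubic_no_root assms(2) unfolding cp by blast
  have c30: "c3 \<noteq> 0" using no_root[of 0] by simp
  have d: "int d = ord c3" using assms(8) unfolding cp by simp
  \<comment> \<open>In integers \<open>3 * n \<le> d + 2\<close> is
    \<open>n \<le> \<lceil>d / 3\<rceil>\<close>: the Newton bound is \<open>d / 3\<close>, and
    integrality of valuations rounds it up. The same happens below with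
    \<open>2 * d / 3\<close>.\<close>
  have c1n: "c1 \<in> ideal_pow n" if "3 * n \<le> d + 2" for n
    using newton_cubic(1)[OF c30 no_root] that d by (auto simp: ideal_pow_def)
  have c2n: "c2 \<in> ideal_pow n" if "3 * n \<le> 2 * d + 2" for n
    using newton_cubic(2)[OF c30 no_root] that d by (auto simp: ideal_pow_def)
  note k = assms(9-11)
  interpret orbit_equations \<gamma> \<pi> k1 k2
  proof
    show "uniformizer \<pi>" "1 \<le> k1" "k1 \<le> k2" using assms by auto
    show "rho \<gamma> $ 1 \<in> ideal_pow 1" using c1 by (simp add: c1_def)
    show "rho \<gamma> $ 2 \<in> ideal_pow (Suc k1)" using c2n[of "Suc k1"] k by (simp add: c2_def)
    show "same_ord (k1 + k2) (rho \<gamma> $ 3)" using c30 d k(3) by (simp add: c3_def same_ord_iff)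
  qed
  let ?c = "real (num_sublattices TYPE('a) TYPE(3) [k1, k2])"
  \<comment> \<open>The cases with \<open>k1 < k2\<close> differ only in the value of
    \<open>K\<close> and in the reason \<open>G\<close> for the valuation of \<open>y12 y21\<close>.
    The last two numerical conditions are the Newton bounds for the first two coefficients.\<close>
  have main: "?c * orbital_integral \<mu> \<gamma> [k1, k2] =
      (q ^ 3 - 1) * (q ^ 2 - 1) * q ^ k2 * (((real K + 1) * q - (real K - 1)) / q ^ (6 + d))"
    if less: "k1 < k2" and K: "1 \<le> K" "K \<le> k1" "K \<le> k2 - k1" "3 * K \<le> d + 2" "3 * (k1 + K) \<le> 2 * d + 2"
      and G: "\<And>Y. sol Y \<Longrightarrow> Y$1$2 \<in> ideal_pow 1 \<Longrightarrow> Y$2$1 \<in> ideal_pow 1 \<Longrightarrow> same_ord K (Y$1$2 * Y$2$1)" for K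
  proof -
    have KC: "rho \<gamma> $ 1 \<in> ideal_pow K" "rho \<gamma> $ 2 \<in> ideal_pow (k1 + K)"
      using c1n[OF K(4)] c2n[OF K(5)] by (simp_all add: c1_def c2_def)
    have "orbital_integral \<mu> \<gamma> [k1, k2] =
      inverse (q ^ (k1 + 2 * k2)) * (1 - inverse q) ^ 2 * (2 + (real K - 1) * (1 - inverse q))"
    proof (rule orbital_integral_eq[OF assms(5), of K])
      show "emeasure \<mu> (diag_orbit \<gamma> k1 k2) =
          ennreal (inverse (q ^ (k1 + 2 * k2)) * (1 - inverse q) ^ 2 * (2 + (real K - 1) * (1 - inverse q)))"
        unfolding q by (rule emeasure_orbit_less[OF assms(5) less K(1-3) KC G])
      have "0 \<le> (real K - 1) * (1 - inverse q)" using K(1) q1 by (simp add: inverse_le_1_iff)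
      then show "0 \<le> inverse (q ^ (k1 + 2 * k2)) * (1 - inverse q) ^ 2 * (2 + (real K - 1) * (1 - inverse q))"
        using q1 by (intro mult_nonneg_nonneg) auto
    qed (use K KC G in auto)
    then show ?thesis
      using product_formula_less[OF q1 num_sublattices_less[OF k(1) less q], of k1 "real K"] k(3) by simp
  qed
  have case1: "?c * orbital_integral \<mu> \<gamma> [k1, k2] =
      (q ^ 3 - 1) * (q ^ 2 - 1) * q ^ k2 * (((real k1 + 1) * q - (real k1 - 1)) / q ^ (6 + d))"
    if "k1 < k2" "k1 < t"
  proof (rule main[OF that(1)])
    \<comment> \<open>Being below the rounded-up quotient means being strictly below
      \<open>d / 3\<close>, also when \<open>d\<close> is divisible by three.\<close>
    have "3 * k1 < d" using that(2) unfolding assms(12) by linarith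
    then have kk: "2 * k1 < k2" using k(3) by simp
    then show "k1 \<le> k2 - k1" "3 * k1 \<le> d + 2" "3 * (k1 + k1) \<le> 2 * d + 2" using k(3) by auto
    have "rho \<gamma> $ 1 \<in> ideal_pow (Suc k1)" "rho \<gamma> $ 2 \<in> ideal_pow (k1 + Suc k1)"
      using c1n[of "Suc k1"] c2n[of "k1 + Suc k1"] kk k(3) by (auto simp: c1_def c2_def)
    then show "same_ord k1 (Y$1$2 * Y$2$1)" if "sol Y" "Y$1$2 \<in> ideal_pow 1" "Y$2$1 \<in> ideal_pow 1" for Y
      using sol_product_order_less[OF that kk] by blast
  qed (use k in auto)
  have case2: "?c * orbital_integral \<mu> \<gamma> [k1, k2] =
      (q ^ 3 - 1) * (q ^ 2 - 1) * q ^ k2 * (((real k2 - real k1 + 1) * q - (real k2 - real k1 - 1)) / q ^ (6 + d))"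
    if "k1 < k2" "s < k1"
  proof -
    have "d < 3 * k1" using that(2) unfolding assms(13) by linarith
    then have kk: "k2 < 2 * k1" using k(3) by simp
    have cc: "rho \<gamma> $ 1 \<in> ideal_pow (Suc (k2 - k1))" "rho \<gamma> $ 2 \<in> ideal_pow (k1 + Suc (k2 - k1))"
      using c1n[of "Suc (k2 - k1)"] c2n[of "k1 + Suc (k2 - k1)"] kk k by (auto simp: c1_def c2_def)
    have "?c * orbital_integral \<mu> \<gamma> [k1, k2] =
      (q ^ 3 - 1) * (q ^ 2 - 1) * q ^ k2 * (((real (k2 - k1) + 1) * q - (real (k2 - k1) - 1)) / q ^ (6 + d))"
    proof (rule main[OF that(1)])
      show "same_ord (k2 - k1) (Y$1$2 * Y$2$1)" if "sol Y" "Y$1$2 \<in> ideal_pow 1" "Y$2$1 \<in> ideal_pow 1" for Y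
        using sol_product_order_greater[OF that kk cc] .
    qed (use k kk that in auto)
    then show ?thesis using k by (simp add: of_nat_diff)
  qed
  have case3: "?c * orbital_integral \<mu> \<gamma> [k1, k2] = (q ^ 3 - 1) * (q ^ 2 - 1) / q ^ (5 + d) * q ^ k1"
    if eq: "k1 = k2"
  proof -
    have "orbital_integral \<mu> \<gamma> [k1, k2] = inverse (q ^ (k1 + 2 * k2)) * (1 - inverse q) ^ 2 * (1 + inverse q)"
    \<comment> \<open>The assumptions about \<open>K\<close> are conditional on
      \<open>k1 < k2\<close>, so \<open>0\<close> serves as a placeholder.\<close>
    proof (rule orbital_integral_eq[OF assms(5), of 0])
      show "emeasure \<mu> (diag_orbit \<gamma> k1 k2) = ennreal (inverse (q ^ (k1 + 2 * k2)) * (1 - inverse q) ^ 2 * (1 + inverse q))"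
        unfolding q by (rule emeasure_orbit_equal[OF assms(5) eq])
    qed (use eq q1 in auto)
    moreover have "d = k1 + k1" using k(3) eq by simp
    ultimately show ?thesis
      using product_formula_equal[OF q1 num_sublattices_equal[OF k(1) q]] unfolding eq[symmetric] by simp
  qed
  have case4: "?c * orbital_integral \<mu> \<gamma> [k1, k2] =
      (q ^ 3 - 1) * (q ^ 2 - 1) * q ^ k2 * (((real t + 1) * q - (real t - 1)) / q ^ (6 + d))"
    if t: "k1 = t" "d = 3 * t" and irr: "irreducible (reduce_poly
            (smult (inverse (\<pi> ^ (3 * t))) (pcompose (charpoly \<gamma>) [:0, \<pi> ^ t:])))"
  proof -
    have k2: "k2 = 2 * k1" using t k(3) by simp
    define a1 a2 a3 where "a1 = c1 / \<pi> ^ k1" and "a2 = c2 / \<pi> ^ (2 * k1)" and "a3 = c3 / \<pi> ^ (3 * k1)"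
    have "c1 \<in> ideal_pow k1" "c2 \<in> ideal_pow (2 * k1)" "c3 \<in> ideal_pow (3 * k1)"
      using c1n[of k1] c2n[of "2 * k1"] c30 d t by (auto simp: ideal_pow_def)
    then have a: "a1 \<in> integers" "a2 \<in> integers" "a3 \<in> integers"
      unfolding a1_def a2_def a3_def
      using ideal_pow_divide_power[OF assms(6), of c1 k1 0] ideal_pow_divide_power[OF assms(6), of c2 "2 * k1" 0]
        ideal_pow_divide_power[OF assms(6), of c3 "3 * k1" 0] by simp_all
    have p3: "\<pi> ^ (2 * k1) = (\<pi> ^ k1) ^ 2" "\<pi> ^ (3 * k1) = (\<pi> ^ k1) ^ 3" by (simp_all add: power_mult[symmetric] mult.commute)
    have ca: "rho \<gamma> $ 1 = \<pi> ^ k1 * a1" "rho \<gamma> $ 2 = (\<pi> ^ k1) ^ 2 * a2" "rho \<gamma> $ 3 = (\<pi> ^ k1) ^ 3 * a3"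
      unfolding a1_def a2_def a3_def p3 c1_def c2_def c3_def using pi_nonzero by simp_all
    \<comment> \<open>\<open>a1\<close>, \<open>a2\<close>, \<open>a3\<close> are the coefficients
      of the rescaled polynomial; they are integral because for \<open>d = 3 * t\<close> the Newton
      bounds are exactly \<open>t\<close>, \<open>2 * t\<close> and \<open>3 * t\<close>.\<close>
    have "smult (inverse (\<pi> ^ (3 * t))) (pcompose (charpoly \<gamma>) [:0, \<pi> ^ t:]) = [:a3, a2, a1, 1:]"
    proof -
      have "pcompose (charpoly \<gamma>) [:0, \<pi> ^ t:] = [:c3, c2 * \<pi> ^ k1, c1 * (\<pi> ^ k1) ^ 2, (\<pi> ^ k1) ^ 3:]"
        unfolding cp t(1)[symmetric] by (simp add: pcompose_pCons power2_eq_square power3_eq_cube algebra_simps)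
      then show ?thesis unfolding a1_def a2_def a3_def t(1)[symmetric] p3 using pi_nonzero
        by (simp add: power2_eq_square power3_eq_cube field_simps)
    qed
    moreover have "reduce_poly [:a3, a2, a1, 1:] = [:reduce a3, reduce a2, reduce a1, 1:]"
    proof -
      have "reduce (1 :: 'a) = 1" by (simp add: reduce_def one_residue_def)
      then show ?thesis by (intro poly_eqI) (simp add: rc r0 coeff_pCons split: nat.split)
    qed
    ultimately have irr': "irreducible [:reduce a3, reduce a2, reduce a1, 1:]" using irr by simp
    have unit: "ounit (y ^ 3 + a1 * y ^ 2 + a2 * y + a3)" if y: "y \<in> integers" for y
    proof -
      have "reduce (y ^ 3 + a1 * y ^ 2 + a2 * y + a3) = reduce y ^ 3 + reduce a1 * reduce y ^ 2 + reduce a2 * reduce y + reduce a3"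
        using a y by (simp add: reduce_hom(1) reduce_add integers_mult ideal_pow_add power2_eq_square power3_eq_cube)
      also have "\<dots> \<noteq> 0" by (rule irreducible_cubic_no_root[OF irr'])
      finally show ?thesis
        using a y by (subst ounit_reduce) (auto simp: power2_eq_square power3_eq_cube intro!: ideal_pow_add integers_mult)
    qed
    have "?c * orbital_integral \<mu> \<gamma> [k1, k2] =
      (q ^ 3 - 1) * (q ^ 2 - 1) * q ^ k2 * (((real k1 + 1) * q - (real k1 - 1)) / q ^ (6 + d))"
    proof (rule main)
      show "same_ord k1 (Y$1$2 * Y$2$1)" if "sol Y" "Y$1$2 \<in> ideal_pow 1" "Y$2$1 \<in> ideal_pow 1" for Y
        by (rule sol_product_order_irreducible[OF that k2 ca a unit])
    qed (use k k2 t in auto)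
    then show ?thesis using t(1) by simp
  qed
  show ?thesis using case1 case2 case3 case4 by blast
qed

end
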